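(* Let $b:\mathbb{D}\to\mathbb{D}$ be analytic with zero sequence $(a_n)_n$ (with multiplicity) and singular inner factor $S_\nu$, let $\Omega$ be an approach region at $1$ and $m\ge 0$ an integer, and assume that \[\sup_{z\in\Omega}\ \sum_n\frac{1-|a_n|^2}{|1-\overline{a_n}z|^{2m+2}}+\int_{\mathbb{T}}\frac{d\nu(\zeta)}{|1-\overline{\zeta}z|^{2m+2}}+\int_{\mathbb{T}}\frac{-\log|b(\zeta)|}{|1-\overline{\zeta}z|^{2m+2}}\,dm(\zeta)<\infty\] (equivalently, $\sup_{z\in\Omega}\|\overline{\partial_z}^m k^b_z\|_b<\infty$, equivalently every $f\in\mathcal{H}(b)$ has $f^{(m)}(z)$ convergent as $z\to1$ in $\Omega$). Then the following are equivalent: (i) $\overline{\partial_z}^m k^b_z\to\overline{\partial_z}^m k^b_1$ in the norm of $\mathcal{H}(b)$ as $z\to 1$ in $\Omega$; (ii) \[\lim_{\substack{z\to1\\ z\in\Omega}}\ \sum_{n:\,a_n\in S_z}\frac{1-|a_n|^2}{|1-\overline{a_n}z|^{2m+2}}+\int_{E_z}\frac{d\nu(\zeta)}{|1-\overline{\zeta}z|^{2m+2}}+\int_{E_z}\frac{-\log|b(\zeta)|}{|1-\overline{\zeta}z|^{2m+2}}\,dm(\zeta)=0.\]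
   Context: $\mathbb{D}$ is the unit disk, $\mathbb{T}$ the unit circle, $m$ (as measure) normalized Lebesgue measure on $\mathbb{T}$; $S_\nu(z)=\exp(-\int_{\mathbb{T}}\frac{\zeta+z}{\zeta-z}d\nu(\zeta))$ with $\nu\ge0$ singular. $\mathcal{H}(b)$ is the reproducing kernel Hilbert space with kernel $k^b_z(w)=\frac{1-\overline{b(z)}b(w)}{1-\overline{z}w}$; $\overline{\partial_z}^m k^b_z\in\mathcal{H}(b)$ is the $m$-th $\bar z$-derivative of $z\mapsto k^b_z$ and satisfies $\langle f,\overline{\partial_z}^m k^b_z\rangle_b=f^{(m)}(z)$. The boundary kernel $\overline{\partial_z}^m k^b_1$ is the weak limit in $\mathcal{H}(b)$ of $\overline{\partial_z}^m k^b_{z}$ as $z\to1$ in $\Omega$ (which exists under the hypothesis). An approach region at $1$ is an open simply connected $\Omega\subset\mathbb{D}$ with $\partial\Omega\cap\mathbb{T}=\{1\}$ such that for $z\in\Omega$ close enough to $1$ the segment $[z,1]$ lies in $\Omega$. For $z\in\mathbb{D}$ with $\arg z\in(0,\pi)$ (arguments in $(-\pi,\pi]$), $E_z=\{e^{it}:\arg z/2<t<2\arg z\}$; for $\arg z<0$, $E_z$ is the reflection of $E_{\bar z}$ in the real axis; $E_z=\varnothing$ for $z\in(0,1)$. $S_z=\{re^{it}\in\mathbb{D}: e^{it}\in E_z\}$. *)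

theory Defs
  imports "HOL-Complex_Analysis.Complex_Analysis"
begin

definition mT :: "complex measure" where
  "mT = distr (density lborel (\<lambda>t::real. ennreal (indicator {-pi<..pi} t / (2*pi)))) borel cis"

definition sing_inner :: "complex measure \<Rightarrow> complex \<Rightarrow> complex" where
  "sing_inner \<nu> z = exp (- integral\<^sup>L \<nu> (\<lambda>\<zeta>. (\<zeta> + z) / (\<zeta> - z)))"

definition bdry :: "(complex \<Rightarrow> complex) \<Rightarrow> complex \<Rightarrow> complex" where
  "bdry b \<zeta> = Lim (at_left (1::real)) (\<lambda>r. b (of_real r * \<zeta>))"

text \<open>Zero set of b in the disc; multiplicities are given by zorder.\<close>
definition zeros_of :: "(complex \<Rightarrow> complex) \<Rightarrow> complex set" where
  "zeros_of b = {w \<in> ball 0 1. b w = 0}"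

definition blaschke_abs :: "(complex \<Rightarrow> complex) \<Rightarrow> complex \<Rightarrow> real" where
  "blaschke_abs b z = exp (infsum (\<lambda>w. real (nat (zorder b w)) *
       ln (cmod ((w - z) / (1 - cnj w * z)))) (zeros_of b))"

definition outer_abs :: "(complex \<Rightarrow> complex) \<Rightarrow> complex \<Rightarrow> real" where
  "outer_abs b z = exp (integral\<^sup>L mT (\<lambda>\<zeta>. Re ((\<zeta> + z) / (\<zeta> - z)) * ln (cmod (bdry b \<zeta>))))"

definition singular_measure_on_T :: "complex measure \<Rightarrow> bool" where
  "singular_measure_on_T \<nu> \<longleftrightarrow> sets \<nu> = sets borel \<and> finite_measure \<nu> \<and>
     emeasure \<nu> (UNIV - sphere 0 1) = 0 \<and>
     (\<exists>A \<in> sets borel. emeasure mT A = 0 \<and> emeasure \<nu> (UNIV - A) = 0)"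

text \<open>b has zero sequence (zeros counted with zorder) and singular inner factor S_nu, i.e.
  b = gamma * B * S_nu * O_b (canonical factorization), expressed through moduli.\<close>
definition has_singular_factor :: "(complex \<Rightarrow> complex) \<Rightarrow> complex measure \<Rightarrow> bool" where
  "has_singular_factor b \<nu> \<longleftrightarrow> singular_measure_on_T \<nu> \<and>
     (\<forall>z \<in> ball 0 1. b z \<noteq> 0 \<longrightarrow>
        cmod (b z) = blaschke_abs b z * cmod (sing_inner \<nu> z) * outer_abs b z)"

definition approach_region :: "complex set \<Rightarrow> bool" where
  "approach_region \<Omega> \<longleftrightarrow> open \<Omega> \<and> simply_connected \<Omega> \<and> \<Omega> \<subseteq> ball 0 1 \<and>
     frontier \<Omega> \<inter> sphere 0 1 = {1} \<and>
     (\<exists>\<delta>>0. \<forall>z\<in>\<Omega>. dist z 1 < \<delta> \<longrightarrow> closed_segment z 1 - {1} \<subseteq> \<Omega>)"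

definition Eset :: "complex \<Rightarrow> complex set" where
  "Eset z = (if 0 < Arg z \<and> Arg z < pi then {cis t | t. Arg z / 2 < t \<and> t < 2 * Arg z}
             else if Arg z < 0 then {cis t | t. 2 * Arg z < t \<and> t < Arg z / 2}
             else {})"

definition Sset :: "complex \<Rightarrow> complex set" where
  "Sset z = {of_real r * \<zeta> | r \<zeta>. 0 < r \<and> r < 1 \<and> \<zeta> \<in> Eset z}"

definition Qsum :: "(complex \<Rightarrow> complex) \<Rightarrow> complex measure \<Rightarrow> nat \<Rightarrow> complex set \<Rightarrow> complex set
                     \<Rightarrow> complex \<Rightarrow> ennreal" where
  "Qsum b \<nu> m F G z =
     (\<integral>\<^sup>+ w. ennreal (real (nat (zorder b w)) * (1 - (cmod w)\<^sup>2) / cmod (1 - cnj w * z) ^ (2*m+2))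
        \<partial>count_space (zeros_of b \<inter> F))
   + (\<integral>\<^sup>+ \<zeta>. indicator G \<zeta> * ennreal (1 / cmod (1 - cnj \<zeta> * z) ^ (2*m+2)) \<partial>\<nu>)
   + (\<integral>\<^sup>+ \<zeta>. indicator G \<zeta> * ennreal (- ln (cmod (bdry b \<zeta>)) / cmod (1 - cnj \<zeta> * z) ^ (2*m+2)) \<partial>mT)"

definition kb :: "(complex \<Rightarrow> complex) \<Rightarrow> complex \<Rightarrow> complex \<Rightarrow> complex" where
  "kb b z w = (1 - cnj (b z) * b w) / (1 - cnj z * w)"

definition psd_kernel :: "('a \<Rightarrow> 'a \<Rightarrow> complex) \<Rightarrow> 'a set \<Rightarrow> bool" where
  "psd_kernel K X \<longleftrightarrow> (\<forall>F c. finite F \<longrightarrow> F \<subseteq> X \<longrightarrow>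
      (let s = (\<Sum>x\<in>F. \<Sum>y\<in>F. c x * cnj (c y) * K x y) in Im s = 0 \<and> Re s \<ge> 0))"

text \<open>Norm in the RKHS with kernel K (K x y = k_y(x)); Aronszajn: f in H(K) with norm at most c
  iff c^2 K(x,y) - f(x) conj(f(y)) is positive semidefinite.\<close>
definition rkhs_norm :: "('a \<Rightarrow> 'a \<Rightarrow> complex) \<Rightarrow> 'a set \<Rightarrow> ('a \<Rightarrow> complex) \<Rightarrow> real" where
  "rkhs_norm K X f = Inf {c. c \<ge> 0 \<and>
      psd_kernel (\<lambda>x y. complex_of_real (c\<^sup>2) * K x y - f x * cnj (f y)) X}"

definition Hb_norm :: "(complex \<Rightarrow> complex) \<Rightarrow> (complex \<Rightarrow> complex) \<Rightarrow> real" where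
  "Hb_norm b f = rkhs_norm (\<lambda>x y. kb b y x) (ball 0 1) f"

text \<open>m-th conj(z)-derivative of z |-> k^b_z, evaluated at w.\<close>
definition dkb :: "(complex \<Rightarrow> complex) \<Rightarrow> nat \<Rightarrow> complex \<Rightarrow> complex \<Rightarrow> complex" where
  "dkb b m z w = cnj ((deriv ^^ m) (\<lambda>\<zeta>. (1 - b \<zeta> * cnj (b w)) / (1 - \<zeta> * cnj w)) z)"

text \<open>Boundary kernel at 1: the (weak, hence pointwise) limit of dkb b m z as z -> 1 in Omega.\<close>
definition dkb1 :: "(complex \<Rightarrow> complex) \<Rightarrow> nat \<Rightarrow> complex set \<Rightarrow> complex \<Rightarrow> complex" where
  "dkb1 b m \<Omega> w = Lim (at 1 within \<Omega>) (\<lambda>z. dkb b m z w)"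

end

theory Submission
  imports Defs
begin

text \<open>
  Write \<open>b = \<gamma> B exp (- p)\<close> with a Blaschke product \<open>B\<close> and \<open>p\<close> the Herglotz integral of the measure
  \<open>\<mu> = \<nu> - log \<bar>b\<bar> dm\<close> on the circle. Filtering the identity divisor down to \<open>b\<close>, first through the partial
  products of \<open>B\<close> and then through \<open>s \<mapsto> B exp (- s p)\<close>, writes the kernel as an integral
  \<open>k\<^sub>z(w) = \<integral> f\<^sub>x(w) / (1 - cnj (e x) w) * cnj (f\<^sub>x(z) / (1 - cnj (e x) z)) dM(x)\<close> over a measure \<open>M\<close> whose image under
  the node map \<open>e\<close> is \<open>2 \<mu>\<close> plus point masses \<open>1 - \<bar>a\<^sub>n\<bar>\<^sup>2\<close> at the zeros \<open>a\<^sub>n\<close>. Norms in \<open>H(b)\<close> thereby become \<open>L\<^sup>2(M)\<close> norms of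
  \<open>m\<close>-th derivatives of these integrands, whose size is governed by \<open>1 / \<bar>1 - cnj (e x) z\<bar>\<^sup>m\<^sup>+\<^sup>1\<close>. They converge
  pointwise as \<open>z\<close> tends to 1; outside \<open>S\<^sub>z \<union> E\<^sub>z\<close> they are dominated by their boundary values, and \<open>S\<^sub>z \<union> E\<^sub>z\<close>
  shrinks to a null set, so norm convergence holds exactly if no mass concentrates there.

  Since \<^const>\<open>bdry\<close> is a junk value where the radial limit does not exist, Fatou's theorem is needed to
  replace \<open>log \<bar>b\<bar>\<close> by a Borel function almost everywhere.
\<close>

section \<open>Kernel models\<close>

text \<open>\<open>Hb_norm\<close> is an infimum over positive semidefinite kernels, so the L2 model
  has to be shown isometric to it: any representing function bounds the infimum from above, but only
  a function in the closed span of the \<open>G x z\<close> bounds it from below. Derivatives of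
  divisors are controlled only where b is bounded away from 0. Near 1 this comes for free:
  \<open>1 - |b(z)|^2 = (1 - |z|^2) * k_z(z)\<close>, and k_z(z) is bounded wherever Q(z), the
  integral of \<open>1 / |1 - cnj (e x) * z|^(2*m+2)\<close>, is bounded. There every divisor f has
  modulus between 1/2 and 1, and f' = f L with the derivatives of L controlled by Q. The Leibniz
  rule then yields the leading term of size \<open>1 / |1 - cnj (e x) * z|^(m+1)\<close> and terms
  of lower order. The latter hurt only in the direction from norm convergence to vanishing mass. Two
  points of \<open>\<Omega>\<close> close to 1 need not be joined by a short path in
  \<open>\<Omega>\<close>, so the existence of limits along \<open>\<Omega>\<close> is a separate
  argument. Norm convergence is rephrased as a Cauchy condition, so that no representing function of
  the boundary kernel is required.\<close>

lemma norm_integral_le: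
  fixes f :: "'x \<Rightarrow> 'b::{banach, second_countable_topology}"
  assumes "integrable M f" "integrable M g" "AE x in M. norm (f x) \<le> g x"
  shows "norm (\<integral>x. f x \<partial>M) \<le> (\<integral>x. g x \<partial>M)"
  by (rule order_trans[OF integral_norm_bound integral_mono_AE]) (use assms in auto)

section \<open>Holomorphic families under the integral sign\<close>

definition locally_bounded_family :: "('x \<Rightarrow> complex \<Rightarrow> complex) \<Rightarrow> bool" where
  "locally_bounded_family F \<longleftrightarrow> (\<forall>x. F x holomorphic_on ball 0 1) \<and>
     (\<forall>r<1. \<exists>B. \<forall>x. \<forall>z\<in>cball 0 r. cmod (F x z) \<le> B)"

lemma locally_bounded_familyD:
  assumes "locally_bounded_family F" "r < 1"
  obtains B where "B > 0" "\<And>x z. cmod z \<le> r \<Longrightarrow> cmod (F x z) \<le> B"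
proof -
  obtain B where B: "\<forall>x. \<forall>z\<in>cball 0 r. cmod (F x z) \<le> B"
    using assms unfolding locally_bounded_family_def by blast
  show ?thesis
    by (rule that[of "max B 1"]) (use B in \<open>auto simp: le_max_iff_disj\<close>)
qed

lemma locally_bounded_family_holomorphic:
  "locally_bounded_family F \<Longrightarrow> F x holomorphic_on ball 0 1"
  by (auto simp: locally_bounded_family_def)

lemma locally_bounded_family_deriv:
  assumes "locally_bounded_family F"
  shows "locally_bounded_family (\<lambda>x. deriv (F x))"
  unfolding locally_bounded_family_def
proof (intro conjI allI impI)
  show "deriv (F x) holomorphic_on ball 0 1" for x
    using locally_bounded_family_holomorphic[OF assms] by (intro holomorphic_deriv) auto
next
  fix r :: real assume r: "r < 1"
  \<comment> \<open>A radius between r and 1 leaves room for Cauchy circles of radius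
    \<open>\<rho> - r\<close>; \<open>max r 0\<close> keeps \<rho> positive for negative r.\<close>
  define \<rho> where "\<rho> = (1 + max r 0) / 2"
  have rho: "\<rho> < 1" "r < \<rho>" "\<rho> > 0" using r by (auto simp: \<rho>_def)
  obtain B where B: "B > 0" "\<And>x z. cmod z \<le> \<rho> \<Longrightarrow> cmod (F x z) \<le> B"
    using locally_bounded_familyD[OF assms rho(1)] by metis
  have "cmod (deriv (F x) z) \<le> B / (\<rho> - r)" if "z \<in> cball 0 r" for x z
  proof -
    have sub: "cball z (\<rho> - r) \<subseteq> cball 0 \<rho>"
      using that by (intro subsetI) (auto simp: dist_norm, smt (verit) norm_triangle_sub norm_minus_commute)
    have sub2: "cball 0 \<rho> \<subseteq> ball (0::complex) 1" using rho by auto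
    have hol: "F x holomorphic_on cball z (\<rho> - r)"
      using locally_bounded_family_holomorphic[OF assms] sub sub2 holomorphic_on_subset by (metis subset_trans)
    have "norm ((deriv ^^ 1) (F x) z) \<le> fact 1 * B / (\<rho> - r) ^ 1"
    proof (rule Cauchy_inequality)
      show "F x holomorphic_on ball z (\<rho> - r)" using hol by (rule holomorphic_on_subset) auto
      show "continuous_on (cball z (\<rho> - r)) (F x)" using hol by (rule holomorphic_on_imp_continuous_on)
      show "0 < \<rho> - r" using rho by simp
      fix w assume "cmod (z - w) = \<rho> - r"
      hence "w \<in> cball z (\<rho> - r)" by (simp add: dist_norm)
      thus "cmod (F x w) \<le> B" using sub B(2) by auto
    qed
    thus ?thesis by simp
  qed
  thus "\<exists>B. \<forall>x. \<forall>z\<in>cball 0 r. cmod (deriv (F x) z) \<le> B" by blast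
qed

lemma locally_bounded_family_higher_deriv:
  assumes "locally_bounded_family F"
  shows "locally_bounded_family (\<lambda>x. (deriv ^^ j) (F x))"
  by (induction j) (use assms locally_bounded_family_deriv in auto)

text \<open>Taylor's formula, with C a bound for the second derivative that is uniform in x. The
  uniformity serves three times: for measurability of derivatives, for differentiation under the
  integral, and for approximating derivatives inside the closed span.\<close>

lemma locally_bounded_family_difference_quotient:
  assumes "locally_bounded_family F" "z \<in> ball 0 1"
  obtains C d where "C > 0" "d > 0" "cmod z + d < 1"
    "\<And>x h. 0 < cmod h \<Longrightarrow> cmod h < d \<Longrightarrow> cmod ((F x (z + h) - F x z) / h - deriv (F x) z) \<le> C * cmod h"
proof -
  define d where "d = (1 - cmod z) / 2"
  have d: "d > 0" "cmod z + d < 1" using assms(2) by (auto simp: d_def field_simps)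
  obtain C where C: "C > 0" "\<And>x w. cmod w \<le> cmod z + d \<Longrightarrow> cmod ((deriv ^^ 2) (F x) w) \<le> C"
    using locally_bounded_familyD[OF locally_bounded_family_higher_deriv[OF assms(1), of 2] d(2)] by metis
  have "cmod ((F x (z + h) - F x z) / h - deriv (F x) z) \<le> C * cmod h"
    if h: "0 < cmod h" "cmod h < d" for x h
  proof -
    have hol: "F x holomorphic_on ball 0 1" using locally_bounded_family_holomorphic[OF assms(1)] .
    have "0 < d" using h by linarith
    have in_ball: "w \<in> ball 0 1" if "w \<in> ball z d" for w
      using that d by (auto simp: dist_norm) (smt (verit) norm_triangle_sub norm_minus_commute)
    have "cmod ((deriv ^^ 0) (F x) (z + h) - (\<Sum>i\<le>1. (deriv ^^ i) (F x) z * (z + h - z) ^ i / fact i))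
        \<le> C * cmod (z + h - z) ^ Suc 1 / fact 1"
    proof (rule complex_Taylor[where S = "ball z d"])
      show "convex (ball z d)" by simp
      show "((deriv ^^ i) (F x) has_field_derivative (deriv ^^ Suc i) (F x) w) (at w within ball z d)"
        if "w \<in> ball z d" "i \<le> 1" for i w
        using has_field_derivative_higher_deriv[OF hol, of w i] in_ball[OF that(1)]
        by (auto intro: has_field_derivative_at_within)
      show "cmod ((deriv ^^ Suc 1) (F x) w) \<le> C" if "w \<in> ball z d" for w
        using C(2)[of w x] that by (auto simp: dist_norm numeral_2_eq_2)
          (smt (verit) norm_triangle_sub norm_minus_commute)
      show "z \<in> ball z d" using \<open>0 < d\<close> by simp
      show "z + h \<in> ball z d" using h by (simp add: dist_norm)
    qed
    hence "cmod (F x (z + h) - F x z - deriv (F x) z * h) \<le> C * cmod h ^ 2"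
      by (simp add: algebra_simps power2_eq_square)
    moreover have "(F x (z + h) - F x z) / h - deriv (F x) z = (F x (z + h) - F x z - deriv (F x) z * h) / h"
      using h by (auto simp: field_simps)
    ultimately show ?thesis using h by (simp add: norm_divide divide_simps power2_eq_square mult.assoc)
  qed
  with C(1) d show ?thesis using that by blast
qed

text \<open>The derivative is a pointwise limit of difference quotients along one fixed sequence of
  increments.\<close>

lemma measurable_deriv_family:
  assumes "locally_bounded_family F" "\<And>z. z \<in> ball 0 1 \<Longrightarrow> (\<lambda>x. F x z) \<in> borel_measurable M"
    and z: "z \<in> ball 0 1"
  shows "(\<lambda>x. deriv (F x) z) \<in> borel_measurable M"
proof -
  obtain C d where C: "C > 0" "d > 0" "cmod z + d < 1"
    "\<And>x h. 0 < cmod h \<Longrightarrow> cmod h < d \<Longrightarrow> cmod ((F x (z + h) - F x z) / h - deriv (F x) z) \<le> C * cmod h"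
    using locally_bounded_family_difference_quotient[OF assms(1) z] by metis
  define h :: "nat \<Rightarrow> complex" where "h n = of_real (d / real (n + 2))" for n
  have h: "0 < cmod (h n)" "cmod (h n) < d" for n
    using C(2) by (auto simp: h_def norm_divide divide_simps simp del: of_real_divide)
  have h0: "h \<longlonglongrightarrow> 0"
  proof -
    have "(\<lambda>n. d / real (n + 2)) \<longlonglongrightarrow> 0"
      by (rule LIMSEQ_ignore_initial_segment[OF lim_const_over_n])
    thus ?thesis unfolding h_def using tendsto_of_real_iff[of "\<lambda>n. d / real (n + 2)" 0] by (metis of_real_0)
  qed
  show ?thesis
  proof (rule borel_measurable_LIMSEQ_metric[where f = "\<lambda>n x. (F x (z + h n) - F x z) / h n"])
    fix n
    have "z + h n \<in> ball 0 1" using h(2)[of n] C(3) norm_triangle_ineq[of z "h n"] by auto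
    thus "(\<lambda>x. (F x (z + h n) - F x z) / h n) \<in> borel_measurable M"
      using assms(2) z by (intro borel_measurable_divide borel_measurable_diff) auto
  next
    fix x
    have "(\<lambda>n. (F x (z + h n) - F x z) / h n - deriv (F x) z) \<longlonglongrightarrow> 0"
    proof (rule Lim_null_comparison)
      show "\<forall>\<^sub>F n in sequentially. cmod ((F x (z + h n) - F x z) / h n - deriv (F x) z) \<le> C * cmod (h n)"
        using C(4) h by auto
      show "(\<lambda>n. C * cmod (h n)) \<longlonglongrightarrow> 0" using tendsto_mult_left[OF tendsto_norm[OF h0], of C] by simp
    qed
    thus "(\<lambda>n. (F x (z + h n) - F x z) / h n) \<longlonglongrightarrow> deriv (F x) z"
      using LIM_zero_iff by blast
  qed
qed

lemma measurable_higher_deriv_family: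
  assumes "locally_bounded_family F" "\<And>z. z \<in> ball 0 1 \<Longrightarrow> (\<lambda>x. F x z) \<in> borel_measurable M"
    and "z \<in> ball 0 1"
  shows "(\<lambda>x. (deriv ^^ j) (F x) z) \<in> borel_measurable M"
  using assms(3)
proof (induction j arbitrary: z)
  case 0 thus ?case using assms(2) by simp
next
  case (Suc j)
  show ?case
    using measurable_deriv_family[OF locally_bounded_family_higher_deriv[OF assms(1), of j], of M z] Suc
    by simp
qed

lemma integrable_locally_bounded_family:
  assumes "finite_measure M" "locally_bounded_family F"
    "\<And>z. z \<in> ball 0 1 \<Longrightarrow> (\<lambda>x. F x z) \<in> borel_measurable M" "z \<in> ball 0 1"
  shows "integrable M (\<lambda>x. F x z)"
proof -
  have "cmod z < 1" using assms by auto
  then obtain B where "\<And>x w. cmod w \<le> cmod z \<Longrightarrow> cmod (F x w) \<le> B"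
    using locally_bounded_familyD[OF assms(2)] by metis
  thus ?thesis using assms(1,3,4)
    by (intro finite_measure.integrable_const_bound[where B = B]) auto
qed

text \<open>The error \<open>C * cmod h\<close> of the difference quotient holds for all x at once,
  so integrating it over a finite measure costs only the total mass. Measurability in x for each
  fixed z suffices.\<close>

lemma has_field_derivative_integral_family:
  assumes M: "finite_measure M" and F: "locally_bounded_family F"
    "\<And>z. z \<in> ball 0 1 \<Longrightarrow> (\<lambda>x. F x z) \<in> borel_measurable M" and z: "z \<in> ball 0 1"
  shows "((\<lambda>z. \<integral>x. F x z \<partial>M) has_field_derivative (\<integral>x. deriv (F x) z \<partial>M)) (at z)"
proof -
  interpret finite_measure M by fact
  obtain C d where C: "C > 0" "d > 0" "cmod z + d < 1"
    "\<And>x h. 0 < cmod h \<Longrightarrow> cmod h < d \<Longrightarrow> cmod ((F x (z + h) - F x z) / h - deriv (F x) z) \<le> C * cmod h"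
    using locally_bounded_family_difference_quotient[OF F(1) z] by metis
  have int: "integrable M (\<lambda>x. F x w)" if "w \<in> ball 0 1" for w
    using integrable_locally_bounded_family[OF M F that] .
  have int': "integrable M (\<lambda>x. deriv (F x) z)"
    using integrable_locally_bounded_family[OF M locally_bounded_family_deriv[OF F(1)]
        measurable_deriv_family[OF F] z] .
  have bound: "cmod (((\<integral>x. F x (z + h) \<partial>M) - (\<integral>x. F x z \<partial>M)) / h - (\<integral>x. deriv (F x) z \<partial>M))
      \<le> C * measure M (space M) * cmod h" if h: "0 < cmod h" "cmod h < d" for h
  proof -
    have zh: "z + h \<in> ball 0 1" using h C norm_triangle_ineq[of z h] by auto
    have "((\<integral>x. F x (z + h) \<partial>M) - (\<integral>x. F x z \<partial>M)) / h - (\<integral>x. deriv (F x) z \<partial>M)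
        = (\<integral>x. (F x (z + h) - F x z) / h - deriv (F x) z \<partial>M)"
      using int[OF zh] int[OF z] int' by simp
    also have "cmod \<dots> \<le> (\<integral>x. C * cmod h \<partial>M)"
      using int[OF zh] int[OF z] int' C(4)[OF h] by (intro norm_integral_le integrable_const) auto
    finally show ?thesis by (simp add: mult_ac)
  qed
  have "((\<lambda>h. ((\<integral>x. F x (z + h) \<partial>M) - (\<integral>x. F x z \<partial>M)) / h - (\<integral>x. deriv (F x) z \<partial>M)) \<longlongrightarrow> 0) (at 0)"
  proof (rule Lim_null_comparison)
    show "\<forall>\<^sub>F h in at 0. cmod (((\<integral>x. F x (z + h) \<partial>M) - (\<integral>x. F x z \<partial>M)) / h - (\<integral>x. deriv (F x) z \<partial>M))
      \<le> C * measure M (space M) * cmod h"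
      unfolding eventually_at using C(2) bound by (intro exI[of _ d]) auto
    show "((\<lambda>h. C * measure M (space M) * cmod h) \<longlongrightarrow> 0) (at 0)"
      by (rule tendsto_eq_intros refl | simp)+
  qed
  thus ?thesis unfolding DERIV_def using LIM_zero_iff by blast
qed

lemma holomorphic_on_integral_family:
  assumes "finite_measure M" "locally_bounded_family F"
    "\<And>z. z \<in> ball 0 1 \<Longrightarrow> (\<lambda>x. F x z) \<in> borel_measurable M"
  shows "(\<lambda>z. \<integral>x. F x z \<partial>M) holomorphic_on ball 0 1"
  unfolding holomorphic_on_open[OF open_ball] using has_field_derivative_integral_family[OF assms] by blast

lemma higher_deriv_integral_family:
  assumes M: "finite_measure M" and F: "locally_bounded_family F"
    "\<And>z. z \<in> ball 0 1 \<Longrightarrow> (\<lambda>x. F x z) \<in> borel_measurable M" and z: "z \<in> ball 0 1"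
  shows "(deriv ^^ j) (\<lambda>z. \<integral>x. F x z \<partial>M) z = (\<integral>x. (deriv ^^ j) (F x) z \<partial>M)"
  using z
proof (induction j arbitrary: z)
  case (Suc j)
  have "(deriv ^^ Suc j) (\<lambda>z. \<integral>x. F x z \<partial>M) z = deriv ((deriv ^^ j) (\<lambda>z. \<integral>x. F x z \<partial>M)) z"
    by simp
  also have "\<dots> = deriv (\<lambda>z. \<integral>x. (deriv ^^ j) (F x) z \<partial>M) z"
  proof (rule deriv_cong_ev)
    show "\<forall>\<^sub>F w in nhds z. (deriv ^^ j) (\<lambda>z. \<integral>x. F x z \<partial>M) w = (\<integral>x. (deriv ^^ j) (F x) w \<partial>M)"
      using Suc by (intro eventually_nhds[THEN iffD2] exI[of _ "ball 0 1"]) auto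
  qed simp
  also have "\<dots> = (\<integral>x. deriv ((deriv ^^ j) (F x)) z \<partial>M)"
    by (rule DERIV_imp_deriv, rule has_field_derivative_integral_family[OF M])
       (use locally_bounded_family_higher_deriv[OF F(1)] measurable_higher_deriv_family[OF F] Suc.prems in auto)
  finally show ?case by simp
qed simp

lemma borel_measurable_cnj: "f \<in> borel_measurable M \<Longrightarrow> (\<lambda>x. cnj (f x)) \<in> borel_measurable M"
  by (rule borel_measurable_continuous_on[where f = cnj]) (auto intro: continuous_intros)

section \<open>Norms in H(b) as L2 norms of representing functions\<close>

locale kernel_model = finite_measure M for M :: "'x measure" +
  fixes G :: "'x \<Rightarrow> complex \<Rightarrow> complex" and b :: "complex \<Rightarrow> complex"
  assumes G_family: "locally_bounded_family G"
    and G_measurable: "\<And>z. z \<in> ball 0 1 \<Longrightarrow> (\<lambda>x. G x z) \<in> borel_measurable M"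
    and kernel: "\<And>z w. z \<in> ball 0 1 \<Longrightarrow> w \<in> ball 0 1 \<Longrightarrow> kb b z w = (\<integral>x. G x w * cnj (G x z) \<partial>M)"
begin

text \<open>Bounded functions stand in for L2 classes: every function whose \<open>nrm\<close> is
  taken is bounded in x as long as z stays inside the disc, and over a finite measure all products
  of such functions are integrable.\<close>

definition bdd :: "('x \<Rightarrow> complex) \<Rightarrow> bool" where
  "bdd h \<longleftrightarrow> h \<in> borel_measurable M \<and> (\<exists>B. \<forall>x. cmod (h x) \<le> B)"

definition nrm :: "('x \<Rightarrow> complex) \<Rightarrow> real" where
  "nrm h = sqrt (\<integral>x. (cmod (h x))\<^sup>2 \<partial>M)"

lemma bdd_measurable [measurable_dest]: "bdd h \<Longrightarrow> h \<in> borel_measurable M"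
  by (simp add: bdd_def)

lemma bdd_add: "bdd g \<Longrightarrow> bdd h \<Longrightarrow> bdd (\<lambda>x. g x + h x)"
  unfolding bdd_def by (auto intro: norm_triangle_mono)

lemma bdd_cmult: "bdd g \<Longrightarrow> bdd (\<lambda>x. c * g x)"
  unfolding bdd_def by (auto simp: norm_mult intro!: exI[of _ "cmod c * _"] mult_left_mono)

lemma bdd_diff: "bdd g \<Longrightarrow> bdd h \<Longrightarrow> bdd (\<lambda>x. g x - h x)"
  using bdd_add[OF _ bdd_cmult[of h "-1"], of g] by simp

lemma bdd_sum: "(\<And>i. i \<in> I \<Longrightarrow> bdd (g i)) \<Longrightarrow> bdd (\<lambda>x. \<Sum>i\<in>I. g i x)"
  by (induction I rule: infinite_finite_induct) (auto intro: bdd_add simp: bdd_def[of "\<lambda>_. 0"] intro!: exI[of _ 0])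

lemma bdd_higher_deriv:
  assumes "z \<in> ball 0 1" shows "bdd (\<lambda>x. (deriv ^^ j) (G x) z)"
proof -
  have "cmod z < 1" using assms by simp
  then obtain B where "\<And>x w. cmod w \<le> cmod z \<Longrightarrow> cmod ((deriv ^^ j) (G x) w) \<le> B"
    using locally_bounded_familyD[OF locally_bounded_family_higher_deriv[OF G_family, of j]] by metis
  thus ?thesis unfolding bdd_def
    using measurable_higher_deriv_family[OF G_family G_measurable assms] by auto
qed

lemma bdd_G: "z \<in> ball 0 1 \<Longrightarrow> bdd (\<lambda>x. G x z)"
  using bdd_higher_deriv[of z 0] by simp

lemma bdd_integrable_mult: "bdd g \<Longrightarrow> bdd h \<Longrightarrow> integrable M (\<lambda>x. g x * cnj (h x))"
proof -
  assume *: "bdd g" "bdd h"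
  then obtain B C where "\<And>x. cmod (g x) \<le> B" "\<And>x. cmod (h x) \<le> C" by (auto simp: bdd_def)
  hence "cmod (g x * cnj (h x)) \<le> B * C" for x
    unfolding norm_mult complex_mod_cnj by (intro mult_mono) (auto intro: order_trans[OF norm_ge_zero])
  moreover have "(\<lambda>x. cnj (h x)) \<in> borel_measurable M"
    using bdd_measurable[OF *(2)] by (rule borel_measurable_cnj)
  ultimately show ?thesis using * by (intro integrable_const_bound[where B = "B * C"]) (auto dest!: bdd_measurable)
qed

lemma bdd_integrable_norm_mult: "bdd g \<Longrightarrow> bdd h \<Longrightarrow> integrable M (\<lambda>x. cmod (g x) * cmod (h x))"
  using integrable_norm[OF bdd_integrable_mult[of g h]] by (simp add: norm_mult)

lemma bdd_integrable_sq: "bdd g \<Longrightarrow> integrable M (\<lambda>x. (cmod (g x))\<^sup>2)"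
  using bdd_integrable_norm_mult[of g g] by (simp add: power2_eq_square)

lemma nrm_nonneg [simp]: "nrm h \<ge> 0"
  by (simp add: nrm_def Bochner_Integration.integral_nonneg)

lemma nrm_sq: "(nrm h)\<^sup>2 = (\<integral>x. (cmod (h x))\<^sup>2 \<partial>M)"
  by (simp add: nrm_def Bochner_Integration.integral_nonneg)

lemma Cauchy_Schwarz_norm:
  assumes "bdd g" "bdd h"
  shows "(\<integral>x. cmod (g x) * cmod (h x) \<partial>M) \<le> nrm g * nrm h"
proof -
  define A where "A = (\<integral>x. (cmod (g x))\<^sup>2 \<partial>M)"
  define B where "B = (\<integral>x. cmod (g x) * cmod (h x) \<partial>M)"
  define C where "C = (\<integral>x. (cmod (h x))\<^sup>2 \<partial>M)"
  note ints = bdd_integrable_sq[OF assms(1)] bdd_integrable_sq[OF assms(2)] bdd_integrable_norm_mult[OF assms]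
  have nonneg: "A \<ge> 0" "B \<ge> 0" "C \<ge> 0" unfolding A_def B_def C_def by (auto intro!: Bochner_Integration.integral_nonneg)
  have quad: "0 \<le> A - 2 * t * B + t\<^sup>2 * C" for t
  proof -
    have "0 \<le> (\<integral>x. (cmod (g x) - t * cmod (h x))\<^sup>2 \<partial>M)" by (intro Bochner_Integration.integral_nonneg) auto
    also have "\<dots> = (\<integral>x. (cmod (g x))\<^sup>2 - 2 * t * (cmod (g x) * cmod (h x)) + t\<^sup>2 * (cmod (h x))\<^sup>2 \<partial>M)"
      by (intro Bochner_Integration.integral_cong) (auto simp: power2_eq_square algebra_simps)
    also have "\<dots> = A - 2 * t * B + t\<^sup>2 * C" using ints by (simp add: A_def B_def C_def)
    finally show ?thesis .
  qed
  have "B\<^sup>2 \<le> A * C"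
  proof (cases "C = 0")
    case True
    have "B = 0"
    proof (rule ccontr)
      assume "B \<noteq> 0"
      \<comment> \<open>For C = 0 the quadratic is affine in t, and this t gives it the value
        -1.\<close>
      thus False using quad[of "(A + 1) / (2 * B)"] True nonneg by (simp add: field_simps)
    qed
    thus ?thesis using True by simp
  next
    case False
    hence "C > 0" using nonneg by simp
    \<comment> \<open>The quadratic attains its minimum at \<open>t = B / C\<close>.\<close>
    thus ?thesis using quad[of "B / C"] by (simp add: field_simps power2_eq_square)
  qed
  hence "sqrt (B\<^sup>2) \<le> sqrt (A * C)" by (rule real_sqrt_le_mono)
  thus ?thesis using nonneg by (simp add: nrm_def A_def B_def C_def real_sqrt_mult)
qed

lemma Cauchy_Schwarz:
  assumes "bdd g" "bdd h"
  shows "cmod (\<integral>x. g x * cnj (h x) \<partial>M) \<le> nrm g * nrm h"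
proof -
  have "cmod (\<integral>x. g x * cnj (h x) \<partial>M) \<le> (\<integral>x. cmod (g x) * cmod (h x) \<partial>M)"
    using integral_norm_bound[of M "\<lambda>x. g x * cnj (h x)"] by (simp add: norm_mult)
  thus ?thesis using Cauchy_Schwarz_norm[OF assms] by simp
qed

lemma nrm_triangle:
  assumes "bdd g" "bdd h"
  shows "nrm (\<lambda>x. g x + h x) \<le> nrm g + nrm h"
proof (rule power2_le_imp_le)
  note ints = bdd_integrable_sq[OF assms(1)] bdd_integrable_sq[OF assms(2)] bdd_integrable_norm_mult[OF assms]
  have "(nrm (\<lambda>x. g x + h x))\<^sup>2 \<le> (\<integral>x. (cmod (g x))\<^sup>2 + 2 * (cmod (g x) * cmod (h x)) + (cmod (h x))\<^sup>2 \<partial>M)"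
    unfolding nrm_sq
  proof (intro integral_mono bdd_integrable_sq bdd_add assms)
    fix x
    have "(cmod (g x + h x))\<^sup>2 \<le> (cmod (g x) + cmod (h x))\<^sup>2"
      by (intro power_mono norm_triangle_ineq) auto
    thus "(cmod (g x + h x))\<^sup>2 \<le> (cmod (g x))\<^sup>2 + 2 * (cmod (g x) * cmod (h x)) + (cmod (h x))\<^sup>2"
      by (simp add: power2_eq_square algebra_simps)
  qed (use ints in auto)
  also have "\<dots> = (nrm g)\<^sup>2 + 2 * (\<integral>x. cmod (g x) * cmod (h x) \<partial>M) + (nrm h)\<^sup>2"
    using ints by (simp add: nrm_sq)
  also have "\<dots> \<le> (nrm g + nrm h)\<^sup>2"
    using Cauchy_Schwarz_norm[OF assms] by (simp add: power2_eq_square algebra_simps)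
  finally show "(nrm (\<lambda>x. g x + h x))\<^sup>2 \<le> (nrm g + nrm h)\<^sup>2" .
qed simp

lemma nrm_cmult: "nrm (\<lambda>x. c * h x) = cmod c * nrm h"
proof -
  have "(\<integral>x. (cmod (c * h x))\<^sup>2 \<partial>M) = (cmod c)\<^sup>2 * (\<integral>x. (cmod (h x))\<^sup>2 \<partial>M)"
    by (simp add: norm_mult power_mult_distrib)
  thus ?thesis by (simp add: nrm_def real_sqrt_mult)
qed

lemma nrm_bound:
  assumes "bdd h" "\<And>x. cmod (h x) \<le> B"
  shows "nrm h \<le> B * sqrt (measure M (space M))"
proof -
  have B: "B \<ge> 0" using assms(2) norm_ge_zero order_trans by blast
  have "(\<integral>x. (cmod (h x))\<^sup>2 \<partial>M) \<le> (\<integral>x. B\<^sup>2 \<partial>M)"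
    using assms by (intro integral_mono bdd_integrable_sq power_mono) auto
  hence "nrm h \<le> sqrt (\<integral>x. B\<^sup>2 \<partial>M)" unfolding nrm_def by (rule real_sqrt_le_mono)
  also have "\<dots> = B * sqrt (measure M (space M))" using B by (simp add: real_sqrt_mult)
  finally show ?thesis .
qed

definition comb :: "complex set \<Rightarrow> (complex \<Rightarrow> complex) \<Rightarrow> 'x \<Rightarrow> complex" where
  "comb F d x = (\<Sum>z\<in>F. d z * G x z)"

lemma bdd_comb: "F \<subseteq> ball 0 1 \<Longrightarrow> bdd (comb F d)"
  unfolding comb_def by (intro bdd_sum bdd_cmult bdd_G) auto

text \<open>By Aronszajn's criterion this says that \<phi> belongs to H(b) with norm at most
  c.\<close>

definition admissible :: "(complex \<Rightarrow> complex) \<Rightarrow> real \<Rightarrow> bool" where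
  "admissible \<phi> c \<longleftrightarrow> c \<ge> 0 \<and>
     psd_kernel (\<lambda>x y. complex_of_real (c\<^sup>2) * kb b y x - \<phi> x * cnj (\<phi> y)) (ball 0 1)"

lemma Hb_norm_eq_Inf: "Hb_norm b \<phi> = Inf {c. admissible \<phi> c}"
  by (simp add: Hb_norm_def rkhs_norm_def admissible_def)

lemma nrm_comb:
  assumes F: "finite F" "F \<subseteq> ball 0 1"
  shows "complex_of_real ((nrm (comb F d))\<^sup>2) = (\<Sum>x\<in>F. \<Sum>y\<in>F. d x * cnj (d y) * kb b y x)"
proof -
  have int: "integrable M (\<lambda>t. G t x * cnj (G t y))" if "x \<in> F" "y \<in> F" for x y
    using F that by (intro bdd_integrable_mult bdd_G) auto
  have "(\<Sum>x\<in>F. \<Sum>y\<in>F. d x * cnj (d y) * kb b y x)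
     = (\<Sum>x\<in>F. \<Sum>y\<in>F. (\<integral>t. d x * cnj (d y) * (G t x * cnj (G t y)) \<partial>M))"
    using F by (intro sum.cong refl) (auto simp: kernel subset_iff)
  also have "\<dots> = (\<integral>t. (\<Sum>x\<in>F. \<Sum>y\<in>F. d x * cnj (d y) * (G t x * cnj (G t y))) \<partial>M)"
    using int by (subst Bochner_Integration.integral_sum, force)
      (intro sum.cong refl, subst Bochner_Integration.integral_sum, auto)
  also have "\<dots> = (\<integral>t. complex_of_real ((cmod (comb F d t))\<^sup>2) \<partial>M)"
    by (intro Bochner_Integration.integral_cong refl)
       (simp only: complex_norm_square comb_def cnj_sum sum_product complex_cnj_mult mult_ac)
  finally show ?thesis by (simp only: nrm_sq integral_complex_of_real)
qed

text \<open>Subtracting the rank-one kernel turns the quadratic form into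
  \<open>(c * nrm (comb F d))^2 - |sum of d z * \<phi> z|^2\<close>, which is real by itself.
  Admissibility thus means that a functional on the span of the \<open>G x z\<close> has norm at
  most c, and all later arguments use this dual form.\<close>

lemma admissible_iff:
  "admissible \<phi> c \<longleftrightarrow> c \<ge> 0 \<and> (\<forall>F d. finite F \<longrightarrow> F \<subseteq> ball 0 1 \<longrightarrow>
     cmod (\<Sum>z\<in>F. d z * \<phi> z) \<le> c * nrm (comb F d))"
proof -
  have "(let s = (\<Sum>x\<in>F. \<Sum>y\<in>F. d x * cnj (d y) * (complex_of_real (c\<^sup>2) * kb b y x - \<phi> x * cnj (\<phi> y)))
         in Im s = 0 \<and> Re s \<ge> 0) \<longleftrightarrow> cmod (\<Sum>z\<in>F. d z * \<phi> z) \<le> c * nrm (comb F d)"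
    if F: "finite F" "F \<subseteq> ball 0 1" and c: "c \<ge> 0" for F d
  proof -
    have "(\<Sum>x\<in>F. \<Sum>y\<in>F. d x * cnj (d y) * (complex_of_real (c\<^sup>2) * kb b y x - \<phi> x * cnj (\<phi> y)))
      = complex_of_real (c\<^sup>2) * (\<Sum>x\<in>F. \<Sum>y\<in>F. d x * cnj (d y) * kb b y x)
        - (\<Sum>x\<in>F. d x * \<phi> x) * cnj (\<Sum>x\<in>F. d x * \<phi> x)"
    proof -
      have 1: "(\<Sum>x\<in>F. d x * \<phi> x) * cnj (\<Sum>x\<in>F. d x * \<phi> x)
          = (\<Sum>x\<in>F. \<Sum>y\<in>F. (d x * \<phi> x) * (cnj (d y) * cnj (\<phi> y)))"
        by (simp only: cnj_sum sum_product complex_cnj_mult)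
      have 2: "complex_of_real (c\<^sup>2) * (\<Sum>x\<in>F. \<Sum>y\<in>F. d x * cnj (d y) * kb b y x)
          = (\<Sum>x\<in>F. \<Sum>y\<in>F. complex_of_real (c\<^sup>2) * (d x * cnj (d y) * kb b y x))"
        by (simp only: sum_distrib_left)
      show ?thesis unfolding 1 2 sum_subtractf[symmetric]
        by (intro sum.cong refl) (simp only: right_diff_distrib mult_ac)
    qed
    also have "\<dots> = complex_of_real ((c * nrm (comb F d))\<^sup>2 - (cmod (\<Sum>z\<in>F. d z * \<phi> z))\<^sup>2)"
      using nrm_comb[OF F, of d] by (simp only: complex_norm_square[symmetric] power_mult_distrib of_real_diff of_real_mult)
    finally have eq: "(\<Sum>x\<in>F. \<Sum>y\<in>F. d x * cnj (d y) * (complex_of_real (c\<^sup>2) * kb b y x - \<phi> x * cnj (\<phi> y)))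
      = complex_of_real ((c * nrm (comb F d))\<^sup>2 - (cmod (\<Sum>z\<in>F. d z * \<phi> z))\<^sup>2)" .
    have "c * nrm (comb F d) \<ge> 0" using c by simp
    thus ?thesis unfolding eq Let_def Im_complex_of_real Re_complex_of_real
      using abs_le_square_iff[of "cmod (\<Sum>z\<in>F. d z * \<phi> z)" "c * nrm (comb F d)"] by auto
  qed
  thus ?thesis unfolding admissible_def psd_kernel_def by (intro conj_cong refl iff_allI imp_cong)
qed

text \<open>Cauchy-Schwarz. The representing function h is arbitrary, so its norm may exceed the
  norm of \<phi>.\<close>

lemma admissible_representation:
  assumes "bdd h" "\<And>w. w \<in> ball 0 1 \<Longrightarrow> \<phi> w = (\<integral>x. G x w * cnj (h x) \<partial>M)"
  shows "admissible \<phi> (nrm h)"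
  unfolding admissible_iff
proof (intro conjI allI impI)
  fix F d assume F: "finite F" "F \<subseteq> ball (0::complex) 1"
  have "(\<Sum>z\<in>F. d z * \<phi> z) = (\<Sum>z\<in>F. (\<integral>x. d z * (G x z * cnj (h x)) \<partial>M))"
    using F assms(2) by (intro sum.cong refl) auto
  also have "\<dots> = (\<integral>x. comb F d x * cnj (h x) \<partial>M)"
    unfolding comb_def sum_distrib_right mult.assoc
    using F bdd_integrable_mult[OF bdd_G assms(1)] by (subst Bochner_Integration.integral_sum) auto
  finally show "cmod (\<Sum>z\<in>F. d z * \<phi> z) \<le> nrm h * nrm (comb F d)"
    using Cauchy_Schwarz[OF bdd_comb[OF F(2)] assms(1)] by (simp add: mult.commute)
qed simp

lemma admissible_add:
  assumes "admissible \<phi> c" "admissible \<psi> c'"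
  shows "admissible (\<lambda>w. \<phi> w - \<psi> w) (c + c')"
  unfolding admissible_iff
proof (intro conjI allI impI)
  show "0 \<le> c + c'" using assms by (auto simp: admissible_iff)
  fix F d assume F: "finite F" "F \<subseteq> ball (0::complex) 1"
  have "cmod (\<Sum>z\<in>F. d z * (\<phi> z - \<psi> z)) \<le> cmod (\<Sum>z\<in>F. d z * \<phi> z) + cmod (\<Sum>z\<in>F. d z * \<psi> z)"
    by (simp add: right_diff_distrib sum_subtractf norm_triangle_ineq4)
  also have "\<dots> \<le> c * nrm (comb F d) + c' * nrm (comb F d)"
    using assms F by (intro add_mono) (auto simp: admissible_iff)
  finally show "cmod (\<Sum>z\<in>F. d z * (\<phi> z - \<psi> z)) \<le> (c + c') * nrm (comb F d)"
    by (simp add: algebra_simps)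
qed

text \<open>Each instance of the dual condition involves finitely many values of the function, so it
  passes to pointwise limits. This is the lower semicontinuity of the norm that carries estimates
  over to the boundary kernel.\<close>

lemma admissible_limit:
  assumes "L \<noteq> bot" "\<forall>\<^sub>F t in L. admissible (\<phi> t) c" "\<And>w. w \<in> ball 0 1 \<Longrightarrow> ((\<lambda>t. \<phi> t w) \<longlongrightarrow> \<psi> w) L"
  shows "admissible \<psi> c"
  unfolding admissible_iff
proof (intro conjI allI impI)
  show "c \<ge> 0" using eventually_happens'[OF assms(1,2)] by (auto simp: admissible_iff)
  fix F d assume F: "finite F" "F \<subseteq> ball (0::complex) 1"
  have "((\<lambda>t. cmod (\<Sum>z\<in>F. d z * \<phi> t z)) \<longlongrightarrow> cmod (\<Sum>z\<in>F. d z * \<psi> z)) L"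
    using F assms(3) by (intro tendsto_intros) auto
  thus "cmod (\<Sum>z\<in>F. d z * \<psi> z) \<le> c * nrm (comb F d)"
    by (rule tendsto_upperbound)
       (use assms(1,2) F in \<open>auto elim!: eventually_mono simp: admissible_iff\<close>)
qed

text \<open>The representing functions of minimal norm: in the closed span of the
  \<open>G x z\<close> the L2 norm equals the norm in H(b).\<close>

definition in_closed_span :: "('x \<Rightarrow> complex) \<Rightarrow> bool" where
  "in_closed_span h \<longleftrightarrow> bdd h \<and>
     (\<forall>\<epsilon>>0. \<exists>F d. finite F \<and> F \<subseteq> ball 0 1 \<and> nrm (\<lambda>x. h x - comb F d x) < \<epsilon>)"

lemma in_closed_spanI:
  assumes "bdd h" "\<And>\<epsilon>. \<epsilon> > 0 \<Longrightarrow> \<exists>g. in_closed_span g \<and> nrm (\<lambda>x. h x - g x) < \<epsilon>"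
  shows "in_closed_span h"
  unfolding in_closed_span_def
proof (intro conjI allI impI)
  fix \<epsilon> :: real assume "\<epsilon> > 0"
  then obtain g where g: "in_closed_span g" "nrm (\<lambda>x. h x - g x) < \<epsilon> / 2" using assms(2)[of "\<epsilon>/2"] by auto
  then obtain F d where F: "finite F" "F \<subseteq> ball 0 1" "nrm (\<lambda>x. g x - comb F d x) < \<epsilon> / 2"
    using \<open>\<epsilon> > 0\<close> unfolding in_closed_span_def by (meson half_gt_zero)
  have "nrm (\<lambda>x. (h x - g x) + (g x - comb F d x)) \<le> nrm (\<lambda>x. h x - g x) + nrm (\<lambda>x. g x - comb F d x)"
    using assms(1) g(1) F(2) by (intro nrm_triangle bdd_diff bdd_comb) (auto simp: in_closed_span_def)
  hence "nrm (\<lambda>x. h x - comb F d x) < \<epsilon>" using g F by simp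
  thus "\<exists>F d. finite F \<and> F \<subseteq> ball 0 1 \<and> nrm (\<lambda>x. h x - comb F d x) < \<epsilon>" using F by blast
qed (fact assms)

lemma in_closed_span_lincomb:
  assumes "in_closed_span g" "in_closed_span h"
  shows "in_closed_span (\<lambda>x. c * g x + c' * h x)"
  unfolding in_closed_span_def
proof (intro conjI allI impI)
  have bd: "bdd g" "bdd h" using assms by (auto simp: in_closed_span_def)
  show "bdd (\<lambda>x. c * g x + c' * h x)" by (intro bdd_add bdd_cmult bd)
  fix \<epsilon> :: real assume e: "\<epsilon> > 0"
  define P where "P = cmod c + cmod c' + 1"
  define \<eta> where "\<eta> = \<epsilon> / (2 * P)"
  have pos: "P > 0" by (simp add: P_def add_nonneg_pos)
  have \<eta>: "\<eta> > 0" using e pos by (simp add: \<eta>_def)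
  obtain F d where F: "finite F" "F \<subseteq> ball 0 1" "nrm (\<lambda>x. g x - comb F d x) < \<eta>"
    using assms(1) \<eta> unfolding in_closed_span_def by meson
  obtain F' d' where F': "finite F'" "F' \<subseteq> ball 0 1" "nrm (\<lambda>x. h x - comb F' d' x) < \<eta>"
    using assms(2) \<eta> unfolding in_closed_span_def by meson
  define D where "D z = (if z \<in> F then c * d z else 0) + (if z \<in> F' then c' * d' z else 0)" for z
  have D: "comb (F \<union> F') D x = c * comb F d x + c' * comb F' d' x" for x
  proof -
    have "comb (F \<union> F') D x = (\<Sum>z\<in>F \<union> F'. (if z \<in> F then c * (d z * G x z) else 0))
         + (\<Sum>z\<in>F \<union> F'. (if z \<in> F' then c' * (d' z * G x z) else 0))"
      unfolding comb_def sum.distrib[symmetric] D_def by (intro sum.cong) (auto simp: algebra_simps)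
    thus ?thesis using F F' by (simp add: sum.If_cases comb_def sum_distrib_left Un_Int_eq mult.assoc)
  qed
  have "nrm (\<lambda>x. c * (g x - comb F d x) + c' * (h x - comb F' d' x))
     \<le> cmod c * nrm (\<lambda>x. g x - comb F d x) + cmod c' * nrm (\<lambda>x. h x - comb F' d' x)"
    unfolding nrm_cmult[symmetric] using bd F(2) F'(2)
    by (intro nrm_triangle bdd_cmult bdd_diff bdd_comb) auto
  also have "\<dots> \<le> cmod c * \<eta> + cmod c' * \<eta>" using F F' by (intro add_mono mult_left_mono) auto
  also have "\<dots> \<le> P * \<eta>" using \<eta> by (simp add: P_def algebra_simps)
  also have "\<dots> = \<epsilon> / 2" using pos by (simp add: \<eta>_def)
  also have "\<dots> < \<epsilon>" using e by simp
  finally have "nrm (\<lambda>x. (c * g x + c' * h x) - comb (F \<union> F') D x) < \<epsilon>"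
    by (simp add: D algebra_simps)
  thus "\<exists>F d. finite F \<and> F \<subseteq> ball 0 1 \<and> nrm (\<lambda>x. (c * g x + c' * h x) - comb F d x) < \<epsilon>"
    using F F' by (intro exI[of _ "F \<union> F'"] exI[of _ D]) auto
qed

lemma in_closed_span_G:
  assumes "z \<in> ball 0 1" shows "in_closed_span (\<lambda>x. G x z)"
  unfolding in_closed_span_def
proof (intro conjI allI impI)
  fix \<epsilon> :: real assume e: "\<epsilon> > 0"
  have "nrm (\<lambda>x. G x z - comb {z} (\<lambda>_. 1) x) < \<epsilon>" using e by (simp add: comb_def nrm_def)
  thus "\<exists>F d. finite F \<and> F \<subseteq> ball 0 1 \<and> nrm (\<lambda>x. G x z - comb F d x) < \<epsilon>"
    using assms by (intro exI[of _ "{z}"] exI) auto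
qed (use assms bdd_G in auto)

text \<open>A derivative in z is the L2 limit of difference quotients, which are combinations of
  derivatives of lower order, and their error is uniform in x.\<close>

lemma in_closed_span_higher_deriv:
  assumes "z \<in> ball 0 1" shows "in_closed_span (\<lambda>x. (deriv ^^ j) (G x) z)"
  using assms
proof (induction j arbitrary: z)
  case 0 thus ?case using in_closed_span_G by simp
next
  case (Suc j)
  let ?F = "\<lambda>x. (deriv ^^ j) (G x)"
  obtain C d where C: "C > 0" "d > 0" "cmod z + d < 1"
    "\<And>x h. 0 < cmod h \<Longrightarrow> cmod h < d \<Longrightarrow> cmod ((?F x (z + h) - ?F x z) / h - deriv (?F x) z) \<le> C * cmod h"
    using locally_bounded_family_difference_quotient[OF locally_bounded_family_higher_deriv[OF G_family] Suc.prems, of j]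
    by metis
  show ?case
  proof (rule in_closed_spanI)
    show "bdd (\<lambda>x. (deriv ^^ Suc j) (G x) z)" by (rule bdd_higher_deriv) fact
    fix \<epsilon> :: real assume e: "\<epsilon> > 0"
    define S where "S = sqrt (measure M (space M))"
    have S: "S \<ge> 0" by (simp add: S_def)
    \<comment> \<open>The first bound keeps the increment where the quotient estimate holds, the
      second makes the error \<open>C * cmod h * S\<close> at most \<epsilon> / 2;
      \<open>S + 1\<close> allows a measure of mass 0.\<close>
    define h where "h = complex_of_real (min (d / 2) (\<epsilon> / (2 * C * (S + 1))))"
    have min_pos: "min (d / 2) (\<epsilon> / (2 * C * (S + 1))) > 0" using C e S by auto
    have cmod_h: "cmod h = min (d / 2) (\<epsilon> / (2 * C * (S + 1)))"
      unfolding h_def using min_pos by (simp only: norm_of_real)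
    have h: "0 < cmod h" "cmod h < d" "cmod h \<le> \<epsilon> / (2 * C * (S + 1))"
      using min_pos C(2) unfolding cmod_h by auto
    have zh: "z + h \<in> ball 0 1" using h C norm_triangle_ineq[of z h] by auto
    let ?g = "\<lambda>x. (1 / h) * ?F x (z + h) + (- 1 / h) * ?F x z"
    have "in_closed_span ?g" by (intro in_closed_span_lincomb Suc.IH zh Suc.prems)
    moreover have "nrm (\<lambda>x. (deriv ^^ Suc j) (G x) z - ?g x) < \<epsilon>"
    proof -
      have "nrm (\<lambda>x. (deriv ^^ Suc j) (G x) z - ?g x) \<le> (C * cmod h) * S"
        unfolding S_def
      proof (rule nrm_bound)
        show "bdd (\<lambda>x. (deriv ^^ Suc j) (G x) z - ?g x)"
          by (intro bdd_diff bdd_add bdd_cmult bdd_higher_deriv zh Suc.prems)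
        show "cmod ((deriv ^^ Suc j) (G x) z - ?g x) \<le> C * cmod h" for x
          using C(4)[OF h(1,2), of x] by (simp add: norm_minus_commute diff_divide_distrib)
      qed
      also have "\<dots> \<le> C * (\<epsilon> / (2 * C * (S + 1))) * S"
        using h(3) C S by (intro mult_right_mono mult_left_mono) auto
      also have "\<dots> = \<epsilon> / 2 * (S / (S + 1))" using C(1) by simp
      also have "\<dots> \<le> \<epsilon> / 2 * 1" using e S by (intro mult_left_mono) auto
      also have "\<dots> < \<epsilon>" using e by simp
      finally show ?thesis .
    qed
    ultimately show "\<exists>g. in_closed_span g \<and> nrm (\<lambda>x. (deriv ^^ Suc j) (G x) z - g x) < \<epsilon>" by blast
  qed
qed

text \<open>Replacing one factor h in \<open>(nrm h)^2\<close> by a nearby combination turns the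
  integral into a sum of values of \<phi>, which admissibility bounds by
  \<open>c * nrm (comb F d)\<close>. In the limit \<open>(nrm h)^2 <= c * nrm h\<close>.\<close>

lemma nrm_le_admissible:
  assumes h: "in_closed_span h" and rep: "\<And>w. w \<in> ball 0 1 \<Longrightarrow> \<phi> w = (\<integral>x. G x w * cnj (h x) \<partial>M)"
    and adm: "admissible \<phi> c"
  shows "nrm h \<le> c"
proof -
  have bh: "bdd h" using h by (simp add: in_closed_span_def)
  have c: "c \<ge> 0" using adm by (simp add: admissible_iff)
  have "(nrm h)\<^sup>2 \<le> c * nrm h + \<epsilon>" if \<epsilon>: "\<epsilon> > 0" for \<epsilon>
  proof -
    \<comment> \<open>The two approximation errors below add up to
      \<open>(c + nrm h) * \<eta>\<close>.\<close>
    define \<eta> where "\<eta> = \<epsilon> / (c + nrm h + 1)"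
    have pos: "c + nrm h + 1 > 0" using c nrm_nonneg[of h] by linarith
    have \<eta>: "\<eta> > 0" using \<epsilon> pos by (simp add: \<eta>_def)
    obtain F d where F: "finite F" "F \<subseteq> ball 0 1" "nrm (\<lambda>x. h x - comb F d x) < \<eta>"
      using h \<eta> unfolding in_closed_span_def by meson
    let ?g = "comb F d"
    have bg: "bdd ?g" by (rule bdd_comb) fact
    have "complex_of_real ((nrm h)\<^sup>2) = (\<integral>x. complex_of_real ((cmod (h x))\<^sup>2) \<partial>M)"
      by (simp only: nrm_sq integral_complex_of_real)
    also have "\<dots> = (\<integral>x. ?g x * cnj (h x) + (h x - ?g x) * cnj (h x) \<partial>M)"
      by (intro Bochner_Integration.integral_cong refl) (simp only: complex_norm_square, simp add: algebra_simps)
    also have "\<dots> = (\<integral>x. ?g x * cnj (h x) \<partial>M) + (\<integral>x. (h x - ?g x) * cnj (h x) \<partial>M)"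
      by (intro Bochner_Integration.integral_add bdd_integrable_mult bdd_diff bg bh)
    also have "(\<integral>x. ?g x * cnj (h x) \<partial>M) = (\<Sum>z\<in>F. d z * \<phi> z)"
    proof -
      have "(\<Sum>z\<in>F. d z * \<phi> z) = (\<Sum>z\<in>F. (\<integral>x. d z * (G x z * cnj (h x)) \<partial>M))"
        using F rep by (intro sum.cong refl) auto
      also have "\<dots> = (\<integral>x. comb F d x * cnj (h x) \<partial>M)"
        unfolding comb_def sum_distrib_right mult.assoc
        using F bdd_integrable_mult[OF bdd_G bh] by (subst Bochner_Integration.integral_sum) auto
      finally show ?thesis by simp
    qed
    finally have "(nrm h)\<^sup>2 = cmod ((\<Sum>z\<in>F. d z * \<phi> z) + (\<integral>x. (h x - ?g x) * cnj (h x) \<partial>M))"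
      by (metis norm_of_real abs_of_nonneg zero_le_power2)
    also have "\<dots> \<le> cmod (\<Sum>z\<in>F. d z * \<phi> z) + cmod (\<integral>x. (h x - ?g x) * cnj (h x) \<partial>M)"
      by (rule norm_triangle_ineq)
    also have "\<dots> \<le> c * nrm ?g + nrm (\<lambda>x. h x - ?g x) * nrm h"
      using adm F by (intro add_mono Cauchy_Schwarz bdd_diff bg bh) (auto simp: admissible_iff)
    also have "nrm ?g \<le> nrm h + nrm (\<lambda>x. h x - ?g x)"
      using nrm_triangle[OF bh bdd_cmult[OF bdd_diff[OF bh bg], of "-1"]]
      by (simp only: nrm_cmult) simp
    also have "c * (nrm h + nrm (\<lambda>x. h x - ?g x)) + nrm (\<lambda>x. h x - ?g x) * nrm h
        \<le> c * (nrm h + \<eta>) + \<eta> * nrm h"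
      using F(3) c by (intro add_mono mult_left_mono mult_right_mono) auto
    also have "\<dots> = c * nrm h + (c + nrm h) * \<eta>" by (simp add: algebra_simps)
    also have "\<dots> \<le> c * nrm h + (c + nrm h + 1) * \<eta>" using \<eta> by (simp add: algebra_simps)
    also have "\<dots> = c * nrm h + \<epsilon>" using pos by (simp add: \<eta>_def)
    finally show ?thesis using c by (simp add: mult_left_mono)
  qed
  hence "(nrm h)\<^sup>2 \<le> c * nrm h" by (rule field_le_epsilon)
  thus ?thesis using nrm_nonneg[of h] c by (cases "nrm h = 0") (auto simp: power2_eq_square)
qed

end

section \<open>Derivatives of the model functions near the boundary point\<close>

lemma higher_deriv_inverse_linear:
  fixes a c z :: complex
  assumes "c + a * z \<noteq> 0"
  shows "(deriv ^^ i) (\<lambda>z. 1 / (c + a * z)) z = (- a) ^ i * fact i / (c + a * z) ^ (i + 1)"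
  using assms
proof (induction i arbitrary: z)
  case (Suc i)
  have op: "open {z. c + a * z \<noteq> 0}" by (intro open_Collect_neq continuous_intros)
  have "(deriv ^^ Suc i) (\<lambda>z. 1 / (c + a * z)) z = deriv (\<lambda>z. (- a) ^ i * fact i / (c + a * z) ^ (i + 1)) z"
    unfolding funpow.simps o_def
    by (rule deriv_cong_ev)
       (use Suc op in \<open>auto intro!: eventually_nhds[THEN iffD2] exI[of _ "{z. c + a * z \<noteq> 0}"]\<close>)
  also have "\<dots> = (- a) ^ Suc i * fact (Suc i) / (c + a * z) ^ (Suc i + 1)"
  proof (rule DERIV_imp_deriv)
    have "((\<lambda>z. (c + a * z) ^ (i + 1)) has_field_derivative of_nat (i + 1) * (c + a * z) ^ i * a) (at z)"
      by (rule DERIV_cong[OF DERIV_power[where D = a]]) (auto intro!: derivative_eq_intros)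
    from DERIV_divide[OF DERIV_const[of "(- a) ^ i * fact i"] this]
    have "((\<lambda>z. (- a) ^ i * fact i / (c + a * z) ^ (i + 1)) has_field_derivative
        (- ((- a) ^ i * fact i * (of_nat (i + 1) * (c + a * z) ^ i * a))) / ((c + a * z) ^ (i + 1) * (c + a * z) ^ (i + 1))) (at z)"
      using Suc.prems by simp
    moreover have "(- ((- a) ^ i * fact i * (of_nat (i + 1) * y ^ i * a))) / (y ^ (i + 1) * y ^ (i + 1))
      = (- a) ^ Suc i * fact (Suc i) / y ^ (Suc i + 1)" if "y \<noteq> 0" for y
      using that by (simp add: field_simps)
    ultimately show "((\<lambda>z. (- a) ^ i * fact i / (c + a * z) ^ (i + 1)) has_field_derivative
        (- a) ^ Suc i * fact (Suc i) / (c + a * z) ^ (Suc i + 1)) (at z)"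
      using Suc.prems by metis
  qed
  finally show ?case .
qed simp

text \<open>The distances \<open>|1 - cnj (e x) * z|\<close> are at most 2, so a smaller exponent
  can be raised to the critical one at the cost of a power of 2.\<close>

lemma inverse_power_le:
  fixes d :: real
  assumes "0 < d" "d \<le> 2" "i \<le> j"
  shows "1 / d ^ i \<le> 2 ^ (j - i) / d ^ j"
proof -
  have "d ^ (j - i) * d ^ i \<le> 2 ^ (j - i) * d ^ i" using assms by (intro mult_right_mono power_mono) auto
  thus ?thesis using assms by (simp add: power_add[symmetric] field_simps)
qed

text \<open>The derivative bound is required for every constant C and not for C0 alone, since it is
  applied also at points outside \<open>\<Omega>\<close> where Q has another bound. The inequality
  \<open>b_le_f\<close> is what remains of "f x divides b": it hands a lower bound for b to all f x
  at once.\<close>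

locale boundary_model = finite_measure M for M :: "'x measure" +
  fixes e :: "'x \<Rightarrow> complex" and f :: "'x \<Rightarrow> complex \<Rightarrow> complex" and b :: "complex \<Rightarrow> complex"
    and m :: nat and \<Omega> :: "complex set" and C0 :: real
  assumes e_measurable [measurable]: "e \<in> borel_measurable M"
    and e_le_1: "cmod (e x) \<le> 1"
    and f_holomorphic: "f x holomorphic_on ball 0 1"
    and f_le_1: "z \<in> ball 0 1 \<Longrightarrow> cmod (f x z) \<le> 1"
    and f_measurable: "z \<in> ball 0 1 \<Longrightarrow> (\<lambda>x. f x z) \<in> borel_measurable M"
    and f_kernel: "z \<in> ball 0 1 \<Longrightarrow> w \<in> ball 0 1 \<Longrightarrow>
       kb b z w = (\<integral>x. f x w / (1 - cnj (e x) * w) * cnj (f x z / (1 - cnj (e x) * z)) \<partial>M)"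
    and b_le_f: "z \<in> ball 0 1 \<Longrightarrow> cmod (b z) \<le> cmod (f x z)"
    and f_deriv_bound: "\<exists>K. \<forall>z\<in>ball 0 1. cmod (b z) \<ge> 1/2 \<longrightarrow>
       (\<integral>\<^sup>+x. ennreal (1 / cmod (1 - cnj (e x) * z) ^ (2*m+2)) \<partial>M) \<le> ennreal C \<longrightarrow>
       (\<forall>x. \<forall>j\<le>m+1. cmod ((deriv ^^ j) (f x) z) \<le> K)"
    and region: "approach_region \<Omega>"
    and Q_le: "z \<in> \<Omega> \<Longrightarrow> (\<integral>\<^sup>+x. ennreal (1 / cmod (1 - cnj (e x) * z) ^ (2*m+2)) \<partial>M) \<le> ennreal C0"
    and C0_nonneg: "C0 \<ge> 0"
begin

definition G :: "'x \<Rightarrow> complex \<Rightarrow> complex" where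
  "G x z = f x z / (1 - cnj (e x) * z)"

definition u :: "'x \<Rightarrow> complex \<Rightarrow> real" where
  "u x z = cmod (1 - cnj (e x) * z)"

definition Q :: "complex \<Rightarrow> ennreal" where
  "Q z = (\<integral>\<^sup>+x. ennreal (1 / u x z ^ (2*m+2)) \<partial>M)"

lemma u_ge: "u x z \<ge> 1 - cmod z"
proof -
  have "cmod (cnj (e x) * z) \<le> 1 * cmod z"
    unfolding norm_mult complex_mod_cnj by (intro mult_right_mono e_le_1) auto
  thus ?thesis unfolding u_def using norm_triangle_ineq2[of 1 "cnj (e x) * z"] by simp
qed

lemma u_le_2: "z \<in> cball 0 1 \<Longrightarrow> u x z \<le> 2"
proof -
  assume "z \<in> cball 0 1"
  hence "cmod (cnj (e x) * z) \<le> 1 * 1"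
    unfolding norm_mult complex_mod_cnj by (intro mult_mono e_le_1) auto
  thus ?thesis unfolding u_def using norm_triangle_ineq4[of 1 "cnj (e x) * z"] by simp
qed

lemma u_pos: "z \<in> ball 0 1 \<Longrightarrow> u x z > 0"
  using u_ge[of z x] by simp

lemma u_nz: "z \<in> ball 0 1 \<Longrightarrow> 1 - cnj (e x) * z \<noteq> 0"
  using u_pos[of z x] by (auto simp: u_def)

lemma u_measurable [measurable]: "(\<lambda>x. u x z) \<in> borel_measurable M"
  unfolding u_def using borel_measurable_cnj[OF e_measurable] by measurable

lemma G_holomorphic: "G x holomorphic_on ball 0 1"
  unfolding G_def using u_nz f_holomorphic by (intro holomorphic_intros) auto

lemma G_family: "locally_bounded_family G"
  unfolding locally_bounded_family_def
proof (intro conjI allI impI G_holomorphic)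
  fix r :: real assume r: "r < 1"
  have "cmod (G x z) \<le> 1 / (1 - r)" if "z \<in> cball 0 r" for x z
  proof -
    have z: "cmod z \<le> r" "z \<in> ball 0 1" using that r by auto
    have "cmod (G x z) = cmod (f x z) / u x z" by (simp add: G_def u_def norm_divide)
    also have "\<dots> \<le> 1 / (1 - r)"
      using f_le_1[OF z(2)] u_ge[of z x] z r by (intro frac_le) auto
    finally show ?thesis .
  qed
  thus "\<exists>B. \<forall>x. \<forall>z\<in>cball 0 r. cmod (G x z) \<le> B" by blast
qed

sublocale kernel_model M G b
proof
  show "locally_bounded_family G" by (rule G_family)
  show "(\<lambda>x. G x z) \<in> borel_measurable M" if "z \<in> ball 0 1" for z
    unfolding G_def using f_measurable[OF that] borel_measurable_cnj[OF e_measurable] by measurable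
  show "kb b z w = (\<integral>x. G x w * cnj (G x z) \<partial>M)" if "z \<in> ball 0 1" "w \<in> ball 0 1" for z w
    unfolding G_def by (rule f_kernel[OF that])
qed

lemma Q_alt: "Q z = (\<integral>\<^sup>+x. ennreal (1 / cmod (1 - cnj (e x) * z) ^ (2*m+2)) \<partial>M)"
  by (simp add: Q_def u_def)

lemma inverse_u_power_le:
  assumes "z \<in> ball 0 1" "i \<le> j"
  shows "1 / u x z ^ i \<le> 2 ^ (j - i) / u x z ^ j"
  using u_pos[OF assms(1), of x] u_le_2[of z x] assms by (intro inverse_power_le) auto

text \<open>The kernel on the diagonal is at most \<open>4 ^ m * C\<close>, by raising the exponent
  2 to 2m+2, and \<open>1 - |z|^2 <= 2 |z - 1|\<close>. At the stated distance this makes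
  \<open>1 - |b(z)|^2\<close> at most 1/2; the summand 1 in the denominator covers C = 0.\<close>

lemma b_ge_half:
  assumes C: "C \<ge> 0" and z: "z \<in> ball 0 1" and Q: "Q z \<le> ennreal C"
    and near: "cmod (z - 1) < 1 / (4 * (4 ^ m * C + 1))"
  shows "cmod (b z) \<ge> 1/2"
proof -
  have cz: "cmod z < 1" using z by simp
  have "1 - (cmod z)\<^sup>2 = (1 - cmod z) * (1 + cmod z)" by (simp add: power2_eq_square algebra_simps)
  also have "\<dots> \<le> (1 - cmod z) * 2" using cz by (intro mult_left_mono) auto
  also have "1 - cmod z \<le> cmod (z - 1)"
    using norm_triangle_ineq2[of 1 z] by (simp add: norm_minus_commute)
  finally have 1: "1 - (cmod z)\<^sup>2 \<le> 2 * cmod (z - 1)" by simp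
  have "complex_of_real (1 - (cmod (b z))\<^sup>2) = kb b z z * complex_of_real (1 - (cmod z)\<^sup>2)"
  proof -
    have "(cmod z)\<^sup>2 < 1" using cz by (simp add: power_less_one_iff abs_square_less_1)
    hence "complex_of_real (1 - (cmod z)\<^sup>2) \<noteq> 0" by (simp only: of_real_eq_0_iff)
    moreover have "kb b z z = complex_of_real (1 - (cmod (b z))\<^sup>2) / complex_of_real (1 - (cmod z)\<^sup>2)"
      by (simp only: kb_def of_real_diff of_real_1 complex_norm_square mult.commute[of "cnj _"])
    ultimately show ?thesis by simp
  qed
  also have "kb b z z = complex_of_real ((nrm (\<lambda>x. G x z))\<^sup>2)"
    unfolding kernel[OF z z] nrm_sq complex_norm_square[symmetric] by (rule integral_complex_of_real)
  finally have 2: "1 - (cmod (b z))\<^sup>2 = (nrm (\<lambda>x. G x z))\<^sup>2 * (1 - (cmod z)\<^sup>2)"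
    by (simp only: of_real_mult[symmetric] of_real_eq_iff)
  have 3: "(nrm (\<lambda>x. G x z))\<^sup>2 \<le> 4 ^ m * C"
  proof -
    have "ennreal ((nrm (\<lambda>x. G x z))\<^sup>2) = (\<integral>\<^sup>+x. ennreal ((cmod (G x z))\<^sup>2) \<partial>M)"
      unfolding nrm_sq by (rule nn_integral_eq_integral[symmetric]) (use bdd_integrable_sq[OF bdd_G[OF z]] in auto)
    also have "\<dots> \<le> (\<integral>\<^sup>+x. ennreal (4 ^ m) * ennreal (1 / u x z ^ (2*m+2)) \<partial>M)"
    proof (rule nn_integral_mono)
      fix x
      have "(cmod (G x z))\<^sup>2 = (cmod (f x z))\<^sup>2 * (1 / u x z ^ 2)"
        by (simp add: G_def u_def norm_divide power_divide)
      also have "\<dots> \<le> 1 * (2 ^ (2*m+2 - 2) / u x z ^ (2*m+2))"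
        by (intro mult_mono inverse_u_power_le z power_le_one f_le_1) auto
      also have "\<dots> = 4 ^ m * (1 / u x z ^ (2*m+2))" by (simp add: power_mult)
      finally show "ennreal ((cmod (G x z))\<^sup>2) \<le> ennreal (4 ^ m) * ennreal (1 / u x z ^ (2*m+2))"
        by (simp add: ennreal_mult[symmetric] ennreal_leI u_def del: power_Suc power_add)
    qed
    also have "\<dots> = ennreal (4 ^ m) * Q z" unfolding Q_def by (rule nn_integral_cmult) measurable
    also have "\<dots> \<le> ennreal (4 ^ m) * ennreal C" by (intro mult_left_mono Q) auto
    also have "\<dots> = ennreal (4 ^ m * C)" using C by (simp add: ennreal_mult)
    finally show ?thesis using C by (simp add: ennreal_le_iff)
  qed
  have "1 - (cmod (b z))\<^sup>2 \<le> 4 ^ m * C * (2 * cmod (z - 1))"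
    unfolding 2 using 1 3 C cz by (intro mult_mono) (auto simp: power_le_one_iff)
  also have "\<dots> \<le> 4 ^ m * C * (2 * (1 / (4 * (4 ^ m * C + 1))))"
    using near C by (intro mult_left_mono) auto
  also have "\<dots> \<le> 1 / 2"
  proof -
    have "X * (2 * (1 / (4 * (X + 1)))) \<le> 1 / 2" if "X \<ge> 0" for X :: real
      using that by (simp add: field_simps)
    note * = this
    show ?thesis by (rule *) (use C in simp)
  qed
  finally have "(1/2)\<^sup>2 \<le> (cmod (b z))\<^sup>2" by (simp add: power2_eq_square)
  thus ?thesis by (rule power2_le_imp_le) simp
qed

lemma f_deriv_bound_near:
  obtains K \<delta> where "K > 0" "\<delta> > 0"
    "\<And>z x j. z \<in> ball 0 1 \<Longrightarrow> cmod (z - 1) < \<delta> \<Longrightarrow> Q z \<le> ennreal C \<Longrightarrow> j \<le> m + 1 \<Longrightarrow>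
       cmod ((deriv ^^ j) (f x) z) \<le> K"
    "\<And>z x. z \<in> ball 0 1 \<Longrightarrow> cmod (z - 1) < \<delta> \<Longrightarrow> Q z \<le> ennreal C \<Longrightarrow> cmod (f x z) \<ge> 1/2"
proof -
  obtain K where K: "\<And>z x j. z\<in>ball 0 1 \<Longrightarrow> cmod (b z) \<ge> 1/2 \<Longrightarrow> Q z \<le> ennreal (max C 0) \<Longrightarrow> j\<le>m+1
     \<Longrightarrow> cmod ((deriv ^^ j) (f x) z) \<le> K"
    using f_deriv_bound[of "max C 0"] unfolding Q_alt by blast
  define \<delta> where "\<delta> = 1 / (4 * (4 ^ m * max C 0 + 1))"
  have Q: "Q z \<le> ennreal (max C 0)" if "Q z \<le> ennreal C" for z
    using that by (rule order_trans) (auto intro: ennreal_leI)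
  have half: "cmod (b z) \<ge> 1/2" if "z \<in> ball 0 1" "cmod (z - 1) < \<delta>" "Q z \<le> ennreal C" for z
    using b_ge_half[of "max C 0" z] that Q unfolding \<delta>_def by auto
  show ?thesis
  proof (rule that[of "max K 1" \<delta>])
    show "\<delta> > 0" by (simp add: \<delta>_def add_nonneg_pos)
    show "cmod ((deriv ^^ j) (f x) z) \<le> max K 1"
      if "z \<in> ball 0 1" "cmod (z - 1) < \<delta>" "Q z \<le> ennreal C" "j \<le> m + 1" for z x j
      using K[OF that(1) half[OF that(1-3)] Q[OF that(3)] that(4), of x] by simp
    show "cmod (f x z) \<ge> 1/2" if "z \<in> ball 0 1" "cmod (z - 1) < \<delta>" "Q z \<le> ennreal C" for z x
      using half[OF that] b_le_f[OF that(1), of x] by simp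
  qed simp
qed

lemma G_higher_deriv:
  assumes z: "z \<in> ball 0 1"
  shows "(deriv ^^ j) (G x) z = (\<Sum>i=0..j. of_nat (j choose i) * (deriv ^^ i) (f x) z
     * (cnj (e x) ^ (j - i) * fact (j - i) / (1 - cnj (e x) * z) ^ (j - i + 1)))"
proof -
  have eq: "G x = (\<lambda>w. f x w * (1 / (1 + (- cnj (e x)) * w)))" by (auto simp: G_def)
  have "(deriv ^^ j) (G x) z = (\<Sum>i=0..j. of_nat (j choose i) * (deriv ^^ i) (f x) z
     * (deriv ^^ (j - i)) (\<lambda>w. 1 / (1 + (- cnj (e x)) * w)) z)"
    unfolding eq using u_nz by (intro higher_deriv_mult[of _ "ball 0 1"] f_holomorphic z holomorphic_intros) auto
  thus ?thesis using u_nz[OF z, of x] by (subst (asm) higher_deriv_inverse_linear) auto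
qed

text \<open>In the Leibniz sum only the term i = 0 carries the full power of 1/u, and its
  coefficient is \<open>f x z\<close>, of modulus at least 1/2. Bounding all terms gives the first
  estimate; isolating the term i = 0 at order m gives the second, with the lower order terms as a
  correction \<open>1 / u x z ^ m\<close>.\<close>

lemma G_deriv_bound:
  obtains K \<delta> where "K > 0" "\<delta> > 0"
    "\<And>z x j. z \<in> ball 0 1 \<Longrightarrow> cmod (z - 1) < \<delta> \<Longrightarrow> Q z \<le> ennreal C \<Longrightarrow> j \<le> m + 1 \<Longrightarrow>
       cmod ((deriv ^^ j) (G x) z) \<le> K / u x z ^ (j + 1)"
    "\<And>z x. z \<in> ball 0 1 \<Longrightarrow> cmod (z - 1) < \<delta> \<Longrightarrow> Q z \<le> ennreal C \<Longrightarrow>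
       1 / u x z ^ (m + 1) \<le> K * (cmod ((deriv ^^ m) (G x) z) + 1 / u x z ^ m)"
proof -
  obtain K \<delta> where K: "K > 0" "\<delta> > 0"
    "\<And>z x j. z \<in> ball 0 1 \<Longrightarrow> cmod (z - 1) < \<delta> \<Longrightarrow> Q z \<le> ennreal C \<Longrightarrow> j \<le> m + 1 \<Longrightarrow>
       cmod ((deriv ^^ j) (f x) z) \<le> K"
    "\<And>z x. z \<in> ball 0 1 \<Longrightarrow> cmod (z - 1) < \<delta> \<Longrightarrow> Q z \<le> ennreal C \<Longrightarrow> cmod (f x z) \<ge> 1/2"
    using f_deriv_bound_near[of C] by metis
  define t where "t x z j i = complex_of_nat (j choose i) * (deriv ^^ i) (f x) z
     * (cnj (e x) ^ (j - i) * fact (j - i) / (1 - cnj (e x) * z) ^ (j - i + 1))" for x z j i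
  define A where "A = (\<Sum>j\<le>m+1. \<Sum>i=0..j. real (j choose i) * K * fact (j - i) * 2 ^ i)"
  have sums: "(\<Sum>i=0..j. real (j choose i) * K * fact (j - i) * 2 ^ i) \<le> A" if "j \<le> m + 1" for j
    unfolding A_def using that K(1)
    by (intro member_le_sum[of j _ "\<lambda>j. \<Sum>i=0..j. real (j choose i) * K * fact (j - i) * 2 ^ i"] sum_nonneg) auto
  have A: "A \<ge> 0" unfolding A_def using K(1) by (intro sum_nonneg) auto
  have tb: "cmod (t x z j i) \<le> real (j choose i) * K * fact (j - i) * (1 / u x z ^ (j - i + 1))"
    if "z \<in> ball 0 1" "cmod (z - 1) < \<delta>" "Q z \<le> ennreal C" "j \<le> m + 1" "i \<le> j" for x z j i
  proof -
    have "cmod (t x z j i) = real (j choose i) * cmod ((deriv ^^ i) (f x) z)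
      * (cmod (e x) ^ (j - i) * fact (j - i) / u x z ^ (j - i + 1))"
      by (simp add: t_def norm_mult norm_divide norm_power u_def)
    also have "\<dots> \<le> real (j choose i) * K * (1 * fact (j - i) / u x z ^ (j - i + 1))"
      using K(1) K(3)[of z i x] that u_pos[OF that(1), of x] e_le_1[of x]
      by (intro mult_mono divide_right_mono power_le_one) auto
    finally show ?thesis by simp
  qed
  have up: "cmod ((deriv ^^ j) (G x) z) \<le> A / u x z ^ (j + 1)"
    if z: "z \<in> ball 0 1" "cmod (z - 1) < \<delta>" "Q z \<le> ennreal C" "j \<le> m + 1" for x z j
  proof -
    have "cmod ((deriv ^^ j) (G x) z) \<le> (\<Sum>i=0..j. cmod (t x z j i))"
      unfolding G_higher_deriv[OF z(1)] t_def by (rule norm_sum)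
    also have "\<dots> \<le> (\<Sum>i=0..j. real (j choose i) * K * fact (j - i) * (2 ^ i / u x z ^ (j + 1)))"
    proof (rule sum_mono)
      fix i assume i: "i \<in> {0..j}"
      have "1 / u x z ^ (j - i + 1) \<le> 2 ^ i / u x z ^ (j + 1)"
        using inverse_u_power_le[OF z(1), of "j - i + 1" "j + 1" x] i by simp
      hence "real (j choose i) * K * fact (j - i) * (1 / u x z ^ (j - i + 1))
         \<le> real (j choose i) * K * fact (j - i) * (2 ^ i / u x z ^ (j + 1))"
        using K(1) by (intro mult_left_mono) auto
      thus "cmod (t x z j i) \<le> real (j choose i) * K * fact (j - i) * (2 ^ i / u x z ^ (j + 1))"
        using tb[OF z, of i x] i by simp
    qed
    also have "\<dots> = (\<Sum>i=0..j. real (j choose i) * K * fact (j - i) * 2 ^ i) / u x z ^ (j + 1)"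
      by (simp add: sum_divide_distrib)
    also have "\<dots> \<le> A / u x z ^ (j + 1)" using sums[OF z(4)] u_pos[OF z(1), of x]
      by (intro divide_right_mono) auto
    finally show ?thesis .
  qed
  \<comment> \<open>The power of 2 undoes the lower bounds 1/2 for \<open>f x z\<close> and for each
    of the m factors \<open>e x\<close>; \<open>1 + A\<close> pays for the lower order
    terms.\<close>
  define B where "B = 2 ^ (m + 1) * (1 + A)"
  have low: "1 / u x z ^ (m + 1) \<le> B * (cmod ((deriv ^^ m) (G x) z) + 1 / u x z ^ m)"
    if z: "z \<in> ball 0 1" "cmod (z - 1) < \<delta>" "Q z \<le> ennreal C" for x z
  \<comment> \<open>The leading term contains \<open>cnj (e x) ^ m\<close>, which degenerates for
    nodes near 0. For those u is at least 1/2, and the correction \<open>1 / u x z ^ m\<close> alone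
    suffices.\<close>
  proof (cases "cmod (e x) \<ge> 1/2")
    case True
    have t0: "t x z m 0 = (deriv ^^ m) (G x) z - (\<Sum>i=1..m. t x z m i)"
      unfolding G_higher_deriv[OF z(1)] t_def by (simp add: sum.atLeast_Suc_atMost)
    have "(\<Sum>i=1..m. cmod (t x z m i)) \<le> (\<Sum>i=1..m. real (m choose i) * K * fact (m - i) * 2 ^ i * (1 / u x z ^ m))"
    proof (rule sum_mono)
      fix i assume i: "i \<in> {1..m}"
      have "1 / u x z ^ (m - i + 1) \<le> 2 ^ (m - (m - i + 1)) / u x z ^ m"
        using i by (intro inverse_u_power_le z(1)) auto
      also have "\<dots> \<le> 2 ^ i / u x z ^ m"
        using i u_pos[OF z(1), of x] by (intro divide_right_mono power_increasing) auto
      finally have "real (m choose i) * K * fact (m - i) * (1 / u x z ^ (m - i + 1))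
         \<le> real (m choose i) * K * fact (m - i) * (2 ^ i / u x z ^ m)"
        using K(1) by (intro mult_left_mono) auto
      thus "cmod (t x z m i) \<le> real (m choose i) * K * fact (m - i) * 2 ^ i * (1 / u x z ^ m)"
        using tb[OF z, of m i x] i by simp
    qed
    also have "\<dots> = (\<Sum>i=1..m. real (m choose i) * K * fact (m - i) * 2 ^ i) * (1 / u x z ^ m)"
      by (rule sum_distrib_right[symmetric])
    also have "\<dots> \<le> (\<Sum>i=0..m. real (m choose i) * K * fact (m - i) * 2 ^ i) * (1 / u x z ^ m)"
      using K(1) u_pos[OF z(1), of x] by (intro mult_right_mono sum_mono2) auto
    also have "\<dots> \<le> A * (1 / u x z ^ m)"
      using sums[of m] u_pos[OF z(1), of x] by (intro mult_right_mono) auto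
    finally have s: "(\<Sum>i=1..m. cmod (t x z m i)) \<le> A * (1 / u x z ^ m)" .
    have "(1/2) ^ (m + 1) * (1 / u x z ^ (m + 1)) \<le> (1/2) * ((1/2) ^ m * fact m / u x z ^ (m + 1))"
      using u_pos[OF z(1), of x] by (simp add: divide_right_mono)
    also have "\<dots> \<le> cmod (f x z) * (cmod (e x) ^ m * fact m / u x z ^ (m + 1))"
      using K(4)[OF z, of x] True u_pos[OF z(1), of x]
      by (intro mult_mono divide_right_mono power_mono) auto
    also have "\<dots> = cmod (t x z m 0)"
      by (simp add: t_def norm_mult norm_divide norm_power u_def)
    also have "\<dots> \<le> cmod ((deriv ^^ m) (G x) z) + cmod (\<Sum>i=1..m. t x z m i)"
      unfolding t0 by (rule norm_triangle_ineq4)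
    also have "\<dots> \<le> cmod ((deriv ^^ m) (G x) z) + A * (1 / u x z ^ m)"
      using s norm_sum[of "t x z m" "{1..m}"] by simp
    also have "\<dots> \<le> (1 + A) * (cmod ((deriv ^^ m) (G x) z) + 1 / u x z ^ m)"
    proof -
      have "p + A * q \<le> (1 + A) * (p + q)" if "p \<ge> 0" "q \<ge> 0" for p q :: real
        using A that mult_nonneg_nonneg[of A p] by (simp add: algebra_simps)
      from this[of "cmod ((deriv ^^ m) (G x) z)" "1 / u x z ^ m"] show ?thesis
        using u_pos[OF z(1), of x] by simp
    qed
    finally have I: "2 ^ (m + 1) * ((1/2) ^ (m + 1) * (1 / u x z ^ (m + 1)))
       \<le> 2 ^ (m + 1) * ((1 + A) * (cmod ((deriv ^^ m) (G x) z) + 1 / u x z ^ m))"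
      by (intro mult_left_mono) auto
    have eq: "2 ^ (m + 1) * ((1/2) ^ (m + 1) * (1 / u x z ^ (m + 1))) = 1 / u x z ^ (m + 1)"
      by (simp only: mult.assoc[symmetric] power_mult_distrib[symmetric]) simp
    show ?thesis using I unfolding eq B_def mult.assoc .
  next
    case False
    have "cmod (cnj (e x) * z) \<le> (1/2) * 1"
      unfolding norm_mult complex_mod_cnj using False z(1) by (intro mult_mono) auto
    hence "u x z \<ge> 1/2" unfolding u_def using norm_triangle_ineq2[of 1 "cnj (e x) * z"] by simp
    hence "1 / u x z ^ (m + 1) \<le> 2 * (1 / u x z ^ m)"
      using u_pos[OF z(1), of x] by (simp add: field_simps)
    also have "\<dots> \<le> B * (cmod ((deriv ^^ m) (G x) z) + 1 / u x z ^ m)"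
    proof (intro mult_mono)
      have "(2::real) * 1 \<le> 2 ^ (m + 1) * (1 + A)" using A by (intro mult_mono) (auto simp: two_realpow_ge_one)
      thus "2 \<le> B" by (simp add: B_def)
    qed (use u_pos[OF z(1), of x] A in \<open>auto simp: B_def\<close>)
    finally show ?thesis .
  qed
  have AB: "A \<le> max A B" "B \<le> max A B" by auto
  show ?thesis
  proof (rule that[of "max A B" \<delta>])
    show "max A B > 0" using A by (simp add: B_def less_max_iff_disj)
    show "cmod ((deriv ^^ j) (G x) z) \<le> max A B / u x z ^ (j + 1)"
      if "z \<in> ball 0 1" "cmod (z - 1) < \<delta>" "Q z \<le> ennreal C" "j \<le> m + 1" for z x j
      using up[OF that, of x] divide_right_mono[OF AB(1), of "u x z ^ (j + 1)"] u_pos[OF that(1), of x] by simp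
    show "1 / u x z ^ (m + 1) \<le> max A B * (cmod ((deriv ^^ m) (G x) z) + 1 / u x z ^ m)"
      if "z \<in> ball 0 1" "cmod (z - 1) < \<delta>" "Q z \<le> ennreal C" for z x
      using low[OF that, of x] mult_right_mono[OF AB(2), of "cmod ((deriv ^^ m) (G x) z) + 1 / u x z ^ m"]
        u_pos[OF that(1), of x] by simp
  qed (use K in auto)
qed

end

section \<open>Limits along the approach region\<close>

context boundary_model
begin

lemma region_subset: "\<Omega> \<subseteq> ball 0 1"
  using region by (simp add: approach_region_def)

lemma one_in_closure: "1 \<in> closure \<Omega>"
  using region by (auto simp: approach_region_def frontier_def)

lemma one_notin_region: "1 \<notin> \<Omega>"
  using region_subset by auto

lemma at_one_nontrivial: "at 1 within \<Omega> \<noteq> bot"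
  using one_in_closure one_notin_region by (metis at_within_eq_bot_iff Diff_empty Diff_insert0)

lemma Q_region: "z \<in> \<Omega> \<Longrightarrow> Q z \<le> ennreal C0"
  unfolding Q_alt by (rule Q_le)

lemma region_sequence:
  obtains s where "\<And>n. s n \<in> \<Omega>" "s \<longlonglongrightarrow> (1::complex)"
  using one_in_closure unfolding closure_sequential by blast

text \<open>A point mass at the node 1 would contribute \<open>mass / |1 - s n|^(2m+2)\<close> to Q,
  which is unbounded as \<open>s n\<close> tends to 1.\<close>

lemma emeasure_e_eq_1: "emeasure M {x \<in> space M. e x = 1} = 0"
proof -
  obtain s where s: "\<And>n. s n \<in> \<Omega>" "s \<longlonglongrightarrow> (1::complex)" using region_sequence by metis
  let ?A = "{x \<in> space M. e x = 1}"
  have A: "?A \<in> sets M" by measurable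
  have bound: "measure M ?A \<le> C0 * cmod (1 - s n) ^ (2*m+2)" for n
  proof -
    have sn: "s n \<in> ball 0 1" using s(1)[of n] region_subset by auto
    hence pos: "cmod (1 - s n) > 0" by auto
    have "ennreal (1 / cmod (1 - s n) ^ (2*m+2)) * emeasure M ?A
        = (\<integral>\<^sup>+x. ennreal (1 / cmod (1 - s n) ^ (2*m+2)) * indicator ?A x \<partial>M)"
      using A by (simp add: nn_integral_cmult_indicator)
    also have "\<dots> \<le> Q (s n)"
      unfolding Q_def by (intro nn_integral_mono) (auto simp: indicator_def u_def)
    also have "\<dots> \<le> ennreal C0" by (rule Q_region) fact
    finally have "ennreal (1 / cmod (1 - s n) ^ (2*m+2)) * ennreal (measure M ?A) \<le> ennreal C0"
      by (simp add: emeasure_eq_measure)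
    hence "ennreal (1 / cmod (1 - s n) ^ (2*m+2) * measure M ?A) \<le> ennreal C0"
      by (subst ennreal_mult) auto
    hence "1 / cmod (1 - s n) ^ (2*m+2) * measure M ?A \<le> C0"
      using C0_nonneg by (simp only: ennreal_le_iff)
    moreover have "a \<le> c * p" if "1 / p * a \<le> c" "p > 0" for a c p :: real
      using that by (simp add: field_simps)
    ultimately show ?thesis using pos by (meson zero_less_power)
  qed
  have "(\<lambda>n. C0 * cmod (1 - s n) ^ (2*m+2)) \<longlonglongrightarrow> C0 * cmod (1 - 1) ^ (2*m+2)"
    by (intro tendsto_intros s)
  hence "(\<lambda>n. C0 * cmod (1 - s n) ^ (2*m+2)) \<longlonglongrightarrow> 0" by simp
  hence "measure M ?A \<le> 0" using bound by (intro LIMSEQ_le_const) auto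
  thus ?thesis by (simp add: emeasure_eq_measure measure_le_0_iff)
qed

lemma AE_e_neq_1: "AE x in M. e x \<noteq> 1"
  by (rule AE_I[OF _ emeasure_e_eq_1]) auto

lemma u_1: "u x 1 = cmod (1 - e x)"
  unfolding u_def using complex_mod_cnj[of "1 - e x"] by simp

lemma u_1_pos: "e x \<noteq> 1 \<Longrightarrow> u x 1 > 0"
  by (simp add: u_1)

lemma tendsto_u: "(s \<longlongrightarrow> z) F \<Longrightarrow> ((\<lambda>n. u x (s n)) \<longlongrightarrow> u x z) F"
  unfolding u_def by (intro tendsto_intros)

text \<open>Fatou's lemma along a sequence in \<open>\<Omega>\<close>. Off the null set of nodes
  equal to 1 the integrand at 1 is the limit of the integrands, whereas at such a node it would be
  \<open>1 / 0 = 0\<close>.\<close>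

lemma Q_1_le: "Q 1 \<le> ennreal C0"
proof -
  obtain s where s: "\<And>n. s n \<in> \<Omega>" "s \<longlonglongrightarrow> (1::complex)" using region_sequence by metis
  have "Q 1 = (\<integral>\<^sup>+x. liminf (\<lambda>n. ennreal (1 / u x (s n) ^ (2*m+2))) \<partial>M)"
    unfolding Q_def
  proof (rule nn_integral_cong_AE, use AE_e_neq_1 in eventually_elim)
    fix x assume "e x \<noteq> 1"
    hence "(\<lambda>n. ennreal (1 / u x (s n) ^ (2*m+2))) \<longlonglongrightarrow> ennreal (1 / u x 1 ^ (2*m+2))"
      using u_1_pos[of x] by (intro tendsto_intros tendsto_u s) auto
    thus "ennreal (1 / u x 1 ^ (2*m+2)) = liminf (\<lambda>n. ennreal (1 / u x (s n) ^ (2*m+2)))"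
      by (intro lim_imp_Liminf[symmetric]) auto
  qed
  also have "\<dots> \<le> liminf (\<lambda>n. Q (s n))"
    unfolding Q_def by (rule nn_integral_liminf) measurable
  also have "\<dots> \<le> ennreal C0"
    by (rule Liminf_le) (use s Q_region in auto)
  finally show ?thesis .
qed

text \<open>Dilating towards 1 keeps \<open>Q\<close> bounded: this controls \<open>Q\<close> between two segments ending at 1,
  where the region itself gives no information.\<close>

lemma u_dilate:
  assumes "cmod p \<le> \<rho>" "\<rho> < 1" "0 < t" "t \<le> 1"
  shows "u x 1 \<le> (1 + 2 / (1 - \<rho>)) * u x (1 + of_real t * (p - 1))"
proof -
  let ?q = "1 + of_real t * (p - 1)"
  have \<rho>: "\<rho> \<ge> 0" using assms(1) norm_ge_zero order_trans by blast
  \<comment> \<open>Dilates of a compact part of the disc approach 1 nontangentially: u at the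
    dilated point is at least \<open>t * (1 - \<rho>)\<close>, whereas moving from there to 1
    changes u by at most 2t.\<close>
  have "cmod ?q = cmod (of_real (1 - t) + of_real t * p)" by (simp add: algebra_simps)
  also have "\<dots> \<le> cmod (of_real (1 - t)) + cmod (of_real t * p)" by (rule norm_triangle_ineq)
  also have "\<dots> = (1 - t) + t * cmod p" using assms unfolding norm_mult norm_of_real by simp
  also have "\<dots> \<le> (1 - t) + t * \<rho>" using assms by simp
  finally have 1: "t * (1 - \<rho>) \<le> u x ?q" using u_ge[of ?q x] by (simp add: algebra_simps)
  have "u x 1 \<le> u x ?q + cmod (cnj (e x) * (of_real t * (p - 1)))"
    unfolding u_def using norm_triangle_ineq[of "1 - cnj (e x) * ?q" "cnj (e x) * (of_real t * (p - 1))"]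
    by (simp add: algebra_simps)
  also have "cmod (cnj (e x) * (of_real t * (p - 1))) \<le> 1 * (t * 2)"
  proof -
    have "cmod (p - 1) \<le> 2" using norm_triangle_ineq4[of p 1] assms by simp
    thus ?thesis unfolding norm_mult complex_mod_cnj using assms(3) e_le_1[of x]
      by (intro mult_mono) auto
  qed
  also have "1 * (t * 2) = 2 / (1 - \<rho>) * (t * (1 - \<rho>))" using assms by simp
  also have "\<dots> \<le> 2 / (1 - \<rho>) * u x ?q" using 1 assms by (intro mult_left_mono) auto
  finally show ?thesis by (simp add: algebra_simps)
qed

lemma Q_dilate:
  assumes "cmod p \<le> \<rho>" "\<rho> < 1" "0 < t" "t \<le> 1"
  shows "Q (1 + of_real t * (p - 1)) \<le> ennreal ((1 + 2 / (1 - \<rho>)) ^ (2*m+2) * C0)"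
proof -
  let ?A = "1 + 2 / (1 - \<rho>)" and ?q = "1 + of_real t * (p - 1)"
  have A: "?A > 0" using assms by (simp add: add_pos_nonneg)
  have gen: "1 / b \<le> c * (1 / a)" if "a \<le> c * b" "a > 0" "b > 0" for a b c :: real
    using that by (simp add: field_simps)
  have "Q ?q \<le> (\<integral>\<^sup>+x. ennreal (?A ^ (2*m+2)) * ennreal (1 / u x 1 ^ (2*m+2)) \<partial>M)"
    unfolding Q_def
  proof (rule nn_integral_mono_AE, use AE_e_neq_1 in eventually_elim)
    fix x assume "e x \<noteq> 1"
    hence pos: "u x 1 > 0" by (rule u_1_pos)
    have le: "u x 1 \<le> ?A * u x ?q" by (rule u_dilate[OF assms])
    hence uq: "u x ?q > 0" using pos A by (metis le_less_trans not_less zero_less_mult_pos order_less_le_trans)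
    have "u x 1 ^ (2*m+2) \<le> (?A * u x ?q) ^ (2*m+2)" using le pos by (intro power_mono) auto
    hence "1 / u x ?q ^ (2*m+2) \<le> ?A ^ (2*m+2) * (1 / u x 1 ^ (2*m+2))"
      unfolding power_mult_distrib by (rule gen) (use pos uq in auto)
    thus "ennreal (1 / u x ?q ^ (2*m+2)) \<le> ennreal (?A ^ (2*m+2)) * ennreal (1 / u x 1 ^ (2*m+2))"
      using A by (subst ennreal_mult[symmetric]) (auto intro!: ennreal_leI zero_le_power simp: u_def)
  qed
  also have "\<dots> = ennreal (?A ^ (2*m+2)) * Q 1" unfolding Q_def by (rule nn_integral_cmult) measurable
  also have "\<dots> \<le> ennreal (?A ^ (2*m+2)) * ennreal C0" by (intro mult_left_mono Q_1_le) auto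
  also have "\<dots> = ennreal (?A ^ (2*m+2) * C0)" using A C0_nonneg by (intro ennreal_mult[symmetric]) auto
  finally show ?thesis .
qed

text \<open>On the segments of \<open>\<Omega>\<close> ending at 1 the function is Lipschitz with
  one constant K. To compare two points, both are moved along their segments by a factor t and
  joined there. On the joining segment the derivative is bounded by a constant K' depending on the
  two points, but the length of that segment is proportional to t, so its cost disappears as t tends
  to 0. The dependence of K' on the points is the reason why the derivative bound is assumed for
  every C.\<close>

lemma limit_within_region:
  assumes F: "F holomorphic_on ball 0 1"
    and bound: "\<And>C. \<exists>K \<delta>. \<delta> > 0 \<and> (\<forall>z\<in>ball 0 1. cmod (z - 1) < \<delta> \<longrightarrow> Q z \<le> ennreal C \<longrightarrow> cmod (deriv F z) \<le> K)"
  shows "\<exists>l. (F \<longlongrightarrow> l) (at 1 within \<Omega>)"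
proof -
  obtain \<delta>\<^sub>0 where \<delta>\<^sub>0: "\<delta>\<^sub>0 > 0" "\<And>z. z \<in> \<Omega> \<Longrightarrow> dist z 1 < \<delta>\<^sub>0 \<Longrightarrow> closed_segment z 1 - {1} \<subseteq> \<Omega>"
    using region unfolding approach_region_def by (elim conjE exE) (rule that, auto)
  obtain K\<^sub>1 \<delta>\<^sub>1 where K\<^sub>1: "\<delta>\<^sub>1 > 0" "\<And>z. z \<in> ball 0 1 \<Longrightarrow> cmod (z - 1) < \<delta>\<^sub>1 \<Longrightarrow> Q z \<le> ennreal C0 \<Longrightarrow> cmod (deriv F z) \<le> K\<^sub>1"
    using bound[of C0] by blast
  define K where "K = max K\<^sub>1 0"
  define \<delta> where "\<delta> = min \<delta>\<^sub>0 \<delta>\<^sub>1"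
  have \<delta>: "\<delta> > 0" using \<delta>\<^sub>0 K\<^sub>1 by (simp add: \<delta>_def)
  have K1: "cmod (deriv F z) \<le> K" if "z \<in> \<Omega>" "cmod (z - 1) < \<delta>" for z
  proof -
    have "cmod (deriv F z) \<le> K\<^sub>1"
      by (rule K\<^sub>1(2)) (use that region_subset Q_region in \<open>auto simp: \<delta>_def\<close>)
    thus ?thesis by (simp add: K_def)
  qed
  have K0: "K \<ge> 0" by (simp add: K_def)
  note K = K0 K1
  define dil where "dil t z = 1 + complex_of_real t * (z - 1)" for t z
  have lip: "cmod (F w - F w') \<le> k * cmod (w - w')"
    if "convex S" "S \<subseteq> ball 0 1" "w \<in> S" "w' \<in> S" "\<And>z. z \<in> S \<Longrightarrow> cmod (deriv F z) \<le> k" for S w w' k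
  proof (rule field_differentiable_bound[OF that(1) _ _ that(3,4)])
    show "(F has_field_derivative deriv F z) (at z within S)" if "z \<in> S" for z
      using holomorphic_derivI[OF F open_ball, of z] that \<open>S \<subseteq> ball 0 1\<close> by auto
  qed (use that in auto)
  have seg: "cmod (F z - F (dil t z)) \<le> K * cmod (z - 1)"
    if z: "z \<in> \<Omega>" "cmod (z - 1) < \<delta>" and t: "0 < t" "t \<le> 1" for z t
  proof -
    let ?S = "closed_segment z (dil t z)"
    have S: "w \<in> \<Omega> \<and> cmod (w - 1) < \<delta>" if w_in: "w \<in> ?S" for w
    proof -
      obtain s where s: "0 \<le> s" "s \<le> 1" "w = (1 - s) *\<^sub>R z + s *\<^sub>R dil t z"
        using w_in unfolding closed_segment_def by blast
      define r where "r = 1 - s + s * t"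
      have "s * t \<le> s * 1" using s t by (intro mult_left_mono) auto
      moreover have "r > 0" using s t by (cases "s = 1") (auto simp: r_def add_pos_nonneg)
      ultimately have r: "0 < r" "r \<le> 1" by (auto simp: r_def)
      have w: "w = 1 + of_real r * (z - 1)"
        unfolding s(3) dil_def r_def by (simp add: scaleR_conv_of_real algebra_simps)
      have "z \<noteq> 1" using z one_notin_region by auto
      hence "w \<noteq> 1" using r unfolding w by auto
      moreover have "w = (1 - (1 - r)) *\<^sub>R z + (1 - r) *\<^sub>R 1"
        unfolding w by (simp add: scaleR_conv_of_real algebra_simps)
      hence "w \<in> closed_segment z 1" unfolding closed_segment_def using r by (intro CollectI exI[of _ "1 - r"]) auto
      moreover have "dist z 1 < \<delta>\<^sub>0" using z by (simp add: dist_norm \<delta>_def)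
      ultimately have "w \<in> \<Omega>" using \<delta>\<^sub>0(2)[OF z(1)] by auto
      moreover have "cmod (w - 1) = r * cmod (z - 1)" using r unfolding w by (simp add: norm_mult)
      hence "cmod (w - 1) \<le> 1 * cmod (z - 1)" using r by (simp add: mult_left_le_one_le)
      ultimately show ?thesis using z by simp
    qed
    have "cmod (F z - F (dil t z)) \<le> K * cmod (z - dil t z)"
      by (rule lip[of ?S]) (use S K region_subset in auto)
    also have "z - dil t z = of_real (1 - t) * (z - 1)" by (simp add: dil_def algebra_simps)
    also have "cmod \<dots> \<le> 1 * cmod (z - 1)" unfolding norm_mult norm_of_real using t by (intro mult_right_mono) auto
    finally show ?thesis using K(1) by (simp add: mult_left_mono)
  qed
  have cauchy: "cmod (F z - F z') \<le> K * (cmod (z - 1) + cmod (z' - 1))"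
    if z: "z \<in> \<Omega>" "cmod (z - 1) < \<delta>" and z': "z' \<in> \<Omega>" "cmod (z' - 1) < \<delta>" for z z'
  proof -
    \<comment> \<open>The segment from z to z' stays in this disc, so one constant bounds Q on all
      its dilates.\<close>
    define \<rho> where "\<rho> = max (cmod z) (cmod z')"
    have \<rho>: "\<rho> < 1" using z z' region_subset by (auto simp: \<rho>_def)
    obtain K' \<delta>' where K': "\<delta>' > 0" "\<And>w. w \<in> ball 0 1 \<Longrightarrow> cmod (w - 1) < \<delta>' \<Longrightarrow>
       Q w \<le> ennreal ((1 + 2 / (1 - \<rho>)) ^ (2*m+2) * C0) \<Longrightarrow> cmod (deriv F w) \<le> K'"
      using bound[of "(1 + 2 / (1 - \<rho>)) ^ (2*m+2) * C0"] by blast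
    have cross: "cmod (F (dil t z) - F (dil t z')) \<le> K' * (t * cmod (z - z'))"
      if t: "0 < t" "t \<le> 1" "t * 2 < \<delta>'" for t
    proof -
      let ?S = "closed_segment (dil t z) (dil t z')"
      have S: "w \<in> ball 0 1 \<and> cmod (deriv F w) \<le> K'" if w_in: "w \<in> ?S" for w
      proof -
        obtain s where s: "0 \<le> s" "s \<le> 1" "w = (1 - s) *\<^sub>R dil t z + s *\<^sub>R dil t z'"
          using w_in unfolding closed_segment_def by blast
        define p where "p = (1 - s) *\<^sub>R z + s *\<^sub>R z'"
        have w: "w = 1 + of_real t * (p - 1)"
          unfolding s(3) dil_def p_def by (simp add: scaleR_conv_of_real algebra_simps)
        have "p \<in> closed_segment z z'" using s by (auto simp: p_def closed_segment_def)
        moreover have "closed_segment z z' \<subseteq> cball 0 \<rho>"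
          by (rule closed_segment_subset) (auto simp: \<rho>_def)
        ultimately have p: "cmod p \<le> \<rho>" by auto
        have "cmod (p - 1) \<le> 2" using norm_triangle_ineq4[of p 1] p \<rho> by simp
        hence "cmod (w - 1) \<le> t * 2" using t unfolding w by (simp add: norm_mult mult_left_mono)
        hence 1: "cmod (w - 1) < \<delta>'" using t by simp
        have "cmod w \<le> cmod (of_real (1 - t)) + cmod (of_real t * p)"
          unfolding w using norm_triangle_ineq[of "of_real (1 - t)" "of_real t * p"] by (simp add: algebra_simps)
        also have "\<dots> = (1 - t) + t * cmod p" using t unfolding norm_mult norm_of_real by simp
        also have "\<dots> < (1 - t) + t * 1" using t p \<rho> by (intro add_strict_left_mono mult_strict_left_mono) auto
        finally have 2: "w \<in> ball 0 1" by simp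
        show ?thesis using K'(2)[OF 2 1] Q_dilate[OF p \<rho> t(1,2)] 2 unfolding w by blast
      qed
      have "cmod (F (dil t z) - F (dil t z')) \<le> K' * cmod (dil t z - dil t z')"
        by (rule lip[of ?S]) (use S in auto)
      also have "dil t z - dil t z' = of_real t * (z - z')" by (simp add: dil_def algebra_simps)
      finally show ?thesis using t by (simp add: norm_mult)
    qed
    have "((\<lambda>t. K * cmod (z - 1) + K' * (t * cmod (z - z')) + K * cmod (z' - 1)) \<longlongrightarrow>
       K * cmod (z - 1) + K' * (0 * cmod (z - z')) + K * cmod (z' - 1)) (at_right 0)"
      by (intro tendsto_intros)
    moreover have "\<forall>\<^sub>F t in at_right 0. cmod (F z - F z') \<le> K * cmod (z - 1) + K' * (t * cmod (z - z')) + K * cmod (z' - 1)"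
      unfolding eventually_at_right_field
    proof (intro exI[of _ "min 1 (\<delta>'/2)"] conjI allI impI)
      show "0 < min 1 (\<delta>'/2)" using K' by simp
      fix t :: real assume t: "0 < t" "t < min 1 (\<delta>'/2)"
      have "cmod (F z - F z') \<le> cmod (F z - F (dil t z)) + cmod (F (dil t z) - F (dil t z')) + cmod (F z' - F (dil t z'))"
        by (smt (verit, ccfv_threshold) norm_triangle_ineq4 norm_triangle_ineq diff_add_cancel add_diff_eq norm_minus_commute)
      thus "cmod (F z - F z') \<le> K * cmod (z - 1) + K' * (t * cmod (z - z')) + K * cmod (z' - 1)"
        using seg[OF z, of t] seg[OF z', of t] cross[of t] t by linarith
    qed
    ultimately have "cmod (F z - F z') \<le> K * cmod (z - 1) + K' * (0 * cmod (z - z')) + K * cmod (z' - 1)"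
      by (rule tendsto_lowerbound) simp
    thus ?thesis by (simp add: algebra_simps)
  qed
  obtain s where s: "\<And>n. s n \<in> \<Omega>" "s \<longlonglongrightarrow> (1::complex)" using region_sequence by metis
  have near: "\<forall>\<^sub>F n in sequentially. cmod (s n - 1) < \<epsilon>" if "\<epsilon> > 0" for \<epsilon>
    using tendstoD[OF s(2) that] by (simp add: dist_norm)
  have "Cauchy (\<lambda>n. F (s n))"
  proof (rule metric_CauchyI)
    fix \<epsilon> :: real assume \<epsilon>: "\<epsilon> > 0"
    define \<eta> where "\<eta> = min \<delta> (\<epsilon> / (2 * (K + 1)))"
    have \<eta>: "\<eta> > 0" using \<delta> \<epsilon> K by (simp add: \<eta>_def)
    then obtain N where N: "\<And>n. n \<ge> N \<Longrightarrow> cmod (s n - 1) < \<eta>"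
      using near[of \<eta>] by (auto simp: eventually_sequentially)
    have "dist (F (s n)) (F (s k)) < \<epsilon>" if "n \<ge> N" "k \<ge> N" for n k
    proof -
      have "cmod (F (s n) - F (s k)) \<le> K * (cmod (s n - 1) + cmod (s k - 1))"
        using N[OF that(1)] N[OF that(2)] by (intro cauchy s) (auto simp: \<eta>_def)
      also have "\<dots> \<le> K * (2 * \<eta>)" using N[OF that(1)] N[OF that(2)] K by (intro mult_left_mono) auto
      also have "\<dots> < (K + 1) * (2 * \<eta>)" using \<eta> by simp
      also have "\<dots> \<le> (K + 1) * (2 * (\<epsilon> / (2 * (K + 1))))" using K by (intro mult_left_mono) (auto simp: \<eta>_def)
      also have "\<dots> = \<epsilon>" using K0 by (simp add: field_simps)
      finally show ?thesis by (simp add: dist_norm)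
    qed
    thus "\<exists>N. \<forall>n\<ge>N. \<forall>k\<ge>N. dist (F (s n)) (F (s k)) < \<epsilon>" by blast
  qed
  then obtain l where l: "(\<lambda>n. F (s n)) \<longlonglongrightarrow> l" using Cauchy_convergent convergent_def by blast
  have bound_l: "cmod (F z - l) \<le> K * cmod (z - 1)" if z: "z \<in> \<Omega>" "cmod (z - 1) < \<delta>" for z
  proof (rule LIMSEQ_le)
    show "(\<lambda>n. cmod (F z - F (s n))) \<longlonglongrightarrow> cmod (F z - l)" by (intro tendsto_intros l)
    have "(\<lambda>n. K * (cmod (z - 1) + cmod (s n - 1))) \<longlonglongrightarrow> K * (cmod (z - 1) + cmod (1 - 1))"
      by (intro tendsto_intros s)
    thus "(\<lambda>n. K * (cmod (z - 1) + cmod (s n - 1))) \<longlonglongrightarrow> K * cmod (z - 1)" by simp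
    show "\<exists>N. \<forall>n\<ge>N. cmod (F z - F (s n)) \<le> K * (cmod (z - 1) + cmod (s n - 1))"
      using near[OF \<delta>] cauchy[OF z s(1)] unfolding eventually_sequentially by blast
  qed
  have "((\<lambda>z. F z - l) \<longlongrightarrow> 0) (at 1 within \<Omega>)"
  proof (rule Lim_null_comparison)
    show "\<forall>\<^sub>F z in at 1 within \<Omega>. cmod (F z - l) \<le> K * cmod (z - 1)"
      unfolding eventually_at using bound_l \<delta> by (intro exI[of _ \<delta>]) (auto simp: dist_norm)
    have "((\<lambda>z. K * cmod (z - 1)) \<longlongrightarrow> K * cmod (1 - 1)) (at 1 within \<Omega>)" by (intro tendsto_intros)
    thus "((\<lambda>z. K * cmod (z - 1)) \<longlongrightarrow> 0) (at 1 within \<Omega>)" by simp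
  qed
  thus ?thesis using LIM_zero_iff by blast
qed

end

lemma square_power: "((a::real) ^ (m + 1))\<^sup>2 = a ^ (2*m+2)"
proof -
  have "(m + 1) * 2 = 2*m+2" by simp
  thus ?thesis by (simp only: power_mult[symmetric])
qed

section \<open>Norm convergence as a Cauchy condition in L2\<close>

context boundary_model
begin

definition h :: "complex \<Rightarrow> 'x \<Rightarrow> complex" where
  "h z x = (deriv ^^ m) (G x) z"

lemma bdd_h: "z \<in> ball 0 1 \<Longrightarrow> bdd (h z)"
  unfolding h_def by (rule bdd_higher_deriv)

text \<open>For a fixed node other than 1, u stays above half its value at 1 near that point, so the
  derivative of order m+1 is bounded there wherever Q is.\<close>

lemma h_limit:
  assumes "e x \<noteq> 1"
  shows "\<exists>l. ((\<lambda>z. h z x) \<longlongrightarrow> l) (at 1 within \<Omega>)"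
  unfolding h_def
proof (rule limit_within_region)
  show "(deriv ^^ m) (G x) holomorphic_on ball 0 1"
    by (intro holomorphic_higher_deriv G_holomorphic) auto
  fix C
  obtain K \<delta> where K: "K > 0" "\<delta> > 0"
    "\<And>z x j. z \<in> ball 0 1 \<Longrightarrow> cmod (z - 1) < \<delta> \<Longrightarrow> Q z \<le> ennreal C \<Longrightarrow> j \<le> m + 1 \<Longrightarrow>
       cmod ((deriv ^^ j) (G x) z) \<le> K / u x z ^ (j + 1)"
    using G_deriv_bound[of C] by metis
  have pos: "u x 1 > 0" using u_1_pos assms by simp
  have "cmod (deriv ((deriv ^^ m) (G x)) z) \<le> K / (u x 1 / 2) ^ (m + 2)"
    if z: "z \<in> ball 0 1" "cmod (z - 1) < min \<delta> (u x 1 / 2)" "Q z \<le> ennreal C" for z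
  proof -
    have "u x 1 \<le> u x z + cmod (cnj (e x) * (z - 1))"
      unfolding u_def using norm_triangle_ineq[of "1 - cnj (e x) * z" "cnj (e x) * (z - 1)"]
      by (simp add: algebra_simps)
    also have "cmod (cnj (e x) * (z - 1)) \<le> 1 * cmod (z - 1)"
      unfolding norm_mult complex_mod_cnj by (intro mult_right_mono e_le_1) auto
    finally have "u x 1 / 2 \<le> u x z" using z by simp
    hence "K / u x z ^ (m + 2) \<le> K / (u x 1 / 2) ^ (m + 2)"
      using pos K(1) by (intro divide_left_mono power_mono mult_pos_pos zero_less_power) auto
    thus ?thesis using K(3)[of z "m + 1" x] z by simp
  qed
  thus "\<exists>K \<delta>. \<delta> > 0 \<and> (\<forall>z\<in>ball 0 1. cmod (z - 1) < \<delta> \<longrightarrow> Q z \<le> ennreal C \<longrightarrow>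
      cmod (deriv ((deriv ^^ m) (G x)) z) \<le> K)"
    using K(2) pos by (intro exI[of _ "K / (u x 1 / 2) ^ (m + 2)"] exI[of _ "min \<delta> (u x 1 / 2)"]) auto
qed

text \<open>The derivative is taken in the holomorphic variable; by the symmetry of the kernel it is
  the conjugate of the derivative in \<open>dkb\<close>.\<close>

lemma kb_higher_deriv:
  assumes "z \<in> ball 0 1" "w \<in> ball 0 1"
  shows "(deriv ^^ j) (\<lambda>\<zeta>. kb b w \<zeta>) z = (\<integral>x. (deriv ^^ j) (G x) z * cnj (G x w) \<partial>M)"
    and "(\<lambda>\<zeta>. kb b w \<zeta>) holomorphic_on ball 0 1"
proof -
  let ?F = "\<lambda>x \<zeta>. cnj (G x w) * G x \<zeta>"
  have fam: "locally_bounded_family ?F"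
    unfolding locally_bounded_family_def
  proof (intro conjI allI impI)
    show "?F x holomorphic_on ball 0 1" for x by (intro holomorphic_intros G_holomorphic)
    fix r :: real assume r: "r < 1"
    obtain B where B: "B > 0" "\<And>x z. cmod z \<le> r \<Longrightarrow> cmod (G x z) \<le> B"
      using locally_bounded_familyD[OF G_family r] by metis
    obtain B' where B': "\<And>x. cmod (G x w) \<le> B'" using bdd_G[OF assms(2)] by (auto simp: bdd_def)
    have "cmod (?F x z) \<le> B' * B" if "z \<in> cball 0 r" for x z
      unfolding norm_mult complex_mod_cnj using B' B that
      by (intro mult_mono) (auto intro: order_trans[OF norm_ge_zero])
    thus "\<exists>B. \<forall>x. \<forall>z\<in>cball 0 r. cmod (?F x z) \<le> B" by blast
  qed
  have meas: "(\<lambda>x. ?F x z) \<in> borel_measurable M" if "z \<in> ball 0 1" for z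
    using borel_measurable_cnj[OF G_measurable[OF assms(2)]] G_measurable[OF that]
    by (intro borel_measurable_times) auto
  have eq: "kb b w \<zeta> = (\<integral>x. ?F x \<zeta> \<partial>M)" if "\<zeta> \<in> ball 0 1" for \<zeta>
    using kernel[OF assms(2) that] by (simp add: mult.commute)
  have "(deriv ^^ j) (\<lambda>\<zeta>. kb b w \<zeta>) z = (deriv ^^ j) (\<lambda>\<zeta>. \<integral>x. ?F x \<zeta> \<partial>M) z"
    by (rule higher_deriv_cong_ev[OF _ refl])
       (use assms eq in \<open>auto intro!: eventually_nhds[THEN iffD2] exI[of _ "ball 0 1"]\<close>)
  also have "\<dots> = (\<integral>x. (deriv ^^ j) (?F x) z \<partial>M)"
    by (rule higher_deriv_integral_family[OF finite_measure_axioms fam meas assms(1)])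
  also have "\<dots> = (\<integral>x. (deriv ^^ j) (G x) z * cnj (G x w) \<partial>M)"
    by (intro Bochner_Integration.integral_cong refl)
       (subst higher_deriv_cmult[OF G_holomorphic assms(1)], auto)
  finally show "(deriv ^^ j) (\<lambda>\<zeta>. kb b w \<zeta>) z = (\<integral>x. (deriv ^^ j) (G x) z * cnj (G x w) \<partial>M)" .
  show "(\<lambda>\<zeta>. kb b w \<zeta>) holomorphic_on ball 0 1"
    by (rule holomorphic_transform[OF holomorphic_on_integral_family[OF finite_measure_axioms fam meas]])
       (use eq in auto)
qed

lemma dkb_eq_deriv_kb: "dkb b m z w = cnj ((deriv ^^ m) (\<lambda>\<zeta>. kb b w \<zeta>) z)"
  by (simp add: dkb_def kb_def mult.commute)

lemma dkb_representation:
  assumes "z \<in> ball 0 1" "w \<in> ball 0 1"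
  shows "dkb b m z w = (\<integral>x. G x w * cnj (h z x) \<partial>M)"
proof -
  have "dkb b m z w = cnj (\<integral>x. h z x * cnj (G x w) \<partial>M)"
    unfolding dkb_eq_deriv_kb kb_higher_deriv(1)[OF assms] h_def ..
  also have "\<dots> = (\<integral>x. cnj (h z x * cnj (G x w)) \<partial>M)"
    by (rule Bochner_Integration.integral_cnj[symmetric])
  finally show ?thesis by (simp add: mult.commute)
qed

text \<open>For fixed w only one factor of the integrand degenerates: \<open>G x w\<close> is
  bounded in x, and the derivative of order m+1 of the other factor has size
  \<open>1 / u ^ (m + 2)\<close>, whose exponent is at most 2m+2. Hence Q controls the derivative,
  and \<open>Lim\<close> in \<open>dkb1\<close> is a true limit.\<close>

lemma dkb_tendsto:
  assumes w: "w \<in> ball 0 1"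
  shows "((\<lambda>z. dkb b m z w) \<longlongrightarrow> dkb1 b m \<Omega> w) (at 1 within \<Omega>)"
proof -
  let ?F = "(deriv ^^ m) (\<lambda>\<zeta>. kb b w \<zeta>)"
  have "\<exists>l. (?F \<longlongrightarrow> l) (at 1 within \<Omega>)"
  proof (rule limit_within_region)
    show "?F holomorphic_on ball 0 1"
      using kb_higher_deriv(2)[OF w w] by (intro holomorphic_higher_deriv) auto
    fix C
    obtain K \<delta> where K: "K > 0" "\<delta> > 0"
      "\<And>z x j. z \<in> ball 0 1 \<Longrightarrow> cmod (z - 1) < \<delta> \<Longrightarrow> Q z \<le> ennreal (max C 0) \<Longrightarrow> j \<le> m + 1 \<Longrightarrow>
         cmod ((deriv ^^ j) (G x) z) \<le> K / u x z ^ (j + 1)"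
      using G_deriv_bound[of "max C 0"] by metis
    obtain B where B: "\<And>x. cmod (G x w) \<le> B" using bdd_G[OF w] by (auto simp: bdd_def)
    have B0: "B \<ge> 0" using B norm_ge_zero order_trans by blast
    have "cmod (deriv ?F z) \<le> K * 2 ^ m * B * max C 0"
      if z: "z \<in> ball 0 1" "cmod (z - 1) < \<delta>" "Q z \<le> ennreal C" for z
    proof -
      have Qz: "Q z \<le> ennreal (max C 0)"
        using z(3) by (rule order_trans) (auto intro: ennreal_leI)
      have eq: "deriv ?F z = (\<integral>x. (deriv ^^ Suc m) (G x) z * cnj (G x w) \<partial>M)"
        using kb_higher_deriv(1)[OF z(1) w, of "Suc m"] by simp
      have int: "integrable M (\<lambda>x. (deriv ^^ Suc m) (G x) z * cnj (G x w))"
        by (intro bdd_integrable_mult bdd_higher_deriv bdd_G z w)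
      have "ennreal (cmod (deriv ?F z)) \<le> (\<integral>\<^sup>+x. ennreal (cmod ((deriv ^^ Suc m) (G x) z * cnj (G x w))) \<partial>M)"
        unfolding eq by (rule integral_norm_bound_ennreal[OF int])
      also have "\<dots> \<le> (\<integral>\<^sup>+x. ennreal (K * 2 ^ m * B) * ennreal (1 / u x z ^ (2*m+2)) \<partial>M)"
      proof (rule nn_integral_mono)
        fix x
        have "1 / u x z ^ (m + 2) \<le> 2 ^ m / u x z ^ (2*m+2)"
          using inverse_u_power_le[OF z(1), of "m + 2" "2*m+2" x] by simp
        hence "K * (1 / u x z ^ (m + 2)) * B \<le> K * (2 ^ m / u x z ^ (2*m+2)) * B"
          using K B0 by (intro mult_left_mono mult_right_mono) auto
        moreover have "cmod ((deriv ^^ Suc m) (G x) z) * cmod (G x w) \<le> K / u x z ^ (m + 2) * B"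
          using K(3)[OF z(1,2) Qz, of "m + 1" x] B[of x] K(1) u_pos[OF z(1), of x]
          by (intro mult_mono) auto
        ultimately have "cmod ((deriv ^^ Suc m) (G x) z * cnj (G x w)) \<le> K * 2 ^ m * B * (1 / u x z ^ (2*m+2))"
          unfolding norm_mult complex_mod_cnj by (simp add: mult_ac)
        thus "ennreal (cmod ((deriv ^^ Suc m) (G x) z * cnj (G x w))) \<le> ennreal (K * 2 ^ m * B) * ennreal (1 / u x z ^ (2*m+2))"
          using K(1) B0 u_pos[OF z(1), of x] by (subst ennreal_mult[symmetric]) (auto intro: ennreal_leI)
      qed
      also have "\<dots> = ennreal (K * 2 ^ m * B) * Q z" unfolding Q_def by (rule nn_integral_cmult) measurable
      also have "\<dots> \<le> ennreal (K * 2 ^ m * B) * ennreal (max C 0)" by (intro mult_left_mono Qz) auto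
      also have "\<dots> = ennreal (K * 2 ^ m * B * max C 0)" using K B0 by (intro ennreal_mult[symmetric]) auto
      finally show ?thesis using K B0 by (subst (asm) ennreal_le_iff) auto
    qed
    thus "\<exists>K \<delta>. \<delta> > 0 \<and> (\<forall>z\<in>ball 0 1. cmod (z - 1) < \<delta> \<longrightarrow> Q z \<le> ennreal C \<longrightarrow> cmod (deriv ?F z) \<le> K)"
      using K(2) by blast
  qed
  then obtain l where "(?F \<longlongrightarrow> l) (at 1 within \<Omega>)" by blast
  hence "((\<lambda>z. dkb b m z w) \<longlongrightarrow> cnj l) (at 1 within \<Omega>)"
    unfolding dkb_eq_deriv_kb by (intro tendsto_intros)
  thus ?thesis unfolding dkb1_def using tendsto_Lim[OF at_one_nontrivial] by metis
qed

lemma admissible_nonneg: "admissible \<phi> c \<Longrightarrow> c \<ge> 0"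
  by (simp add: admissible_def)

lemma admissible_mono: "admissible \<phi> c \<Longrightarrow> c \<le> c' \<Longrightarrow> admissible \<phi> c'"
  unfolding admissible_iff using mult_right_mono[OF _ nrm_nonneg] by (meson order_trans)

lemma dkb_diff_admissible:
  assumes "z \<in> ball 0 1" "z' \<in> ball 0 1"
  shows "admissible (\<lambda>w. dkb b m z w - dkb b m z' w) (nrm (\<lambda>x. h z x - h z' x))"
proof (rule admissible_representation)
  show "bdd (\<lambda>x. h z x - h z' x)" by (intro bdd_diff bdd_h assms)
  fix w :: complex assume w: "w \<in> ball 0 1"
  show "dkb b m z w - dkb b m z' w = (\<integral>x. G x w * cnj (h z x - h z' x) \<partial>M)"
    using bdd_integrable_mult[OF bdd_G[OF w] bdd_h] assms
    by (simp add: dkb_representation[OF _ w] right_diff_distrib)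
qed

text \<open>The half of the isometry that depends on minimality: \<open>h z - h z'\<close> lies in
  the closed span because derivatives of the \<open>G x z\<close> do.\<close>

lemma dkb_diff_nrm_le:
  assumes "z \<in> ball 0 1" "z' \<in> ball 0 1" "admissible (\<lambda>w. dkb b m z w - dkb b m z' w) c"
  shows "nrm (\<lambda>x. h z x - h z' x) \<le> c"
proof (rule nrm_le_admissible)
  show "in_closed_span (\<lambda>x. h z x - h z' x)"
    using in_closed_span_lincomb[OF in_closed_span_higher_deriv[OF assms(1)] in_closed_span_higher_deriv[OF assms(2)], of 1 m "-1" m]
    by (simp add: h_def)
  fix w :: complex assume w: "w \<in> ball 0 1"
  show "dkb b m z w - dkb b m z' w = (\<integral>x. G x w * cnj (h z x - h z' x) \<partial>M)"
    using bdd_integrable_mult[OF bdd_G[OF w] bdd_h] assms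
    by (simp add: dkb_representation[OF _ w] right_diff_distrib)
qed (fact assms)

lemma nrm_sq_ennreal: "bdd g \<Longrightarrow> ennreal ((nrm g)\<^sup>2) = (\<integral>\<^sup>+x. ennreal ((cmod (g x))\<^sup>2) \<partial>M)"
  unfolding nrm_sq by (rule nn_integral_eq_integral[symmetric]) (use bdd_integrable_sq in auto)

lemma nrm_h_bound:
  obtains R \<delta> where "\<delta> > 0" "\<And>z. z \<in> \<Omega> \<Longrightarrow> cmod (z - 1) < \<delta> \<Longrightarrow> nrm (h z) \<le> R"
proof -
  obtain K \<delta> where K: "K > 0" "\<delta> > 0"
    "\<And>z x j. z \<in> ball 0 1 \<Longrightarrow> cmod (z - 1) < \<delta> \<Longrightarrow> Q z \<le> ennreal C0 \<Longrightarrow> j \<le> m + 1 \<Longrightarrow>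
       cmod ((deriv ^^ j) (G x) z) \<le> K / u x z ^ (j + 1)"
    using G_deriv_bound[of C0] by metis
  have "nrm (h z) \<le> sqrt (K\<^sup>2 * C0)" if z: "z \<in> \<Omega>" "cmod (z - 1) < \<delta>" for z
  proof -
    have zb: "z \<in> ball 0 1" using z region_subset by auto
    have "ennreal ((nrm (h z))\<^sup>2) = (\<integral>\<^sup>+x. ennreal ((cmod (h z x))\<^sup>2) \<partial>M)"
      by (rule nrm_sq_ennreal[OF bdd_h[OF zb]])
    also have "\<dots> \<le> (\<integral>\<^sup>+x. ennreal (K\<^sup>2) * ennreal (1 / u x z ^ (2*m+2)) \<partial>M)"
    proof (rule nn_integral_mono)
      fix x
      have "(cmod (h z x))\<^sup>2 \<le> (K / u x z ^ (m + 1))\<^sup>2"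
        unfolding h_def using K(3)[OF zb z(2) Q_region[OF z(1)], of m x] by (intro power_mono) auto
      also have "\<dots> = K\<^sup>2 * (1 / u x z ^ (2*m+2))"
        unfolding power_divide square_power by simp
      finally show "ennreal ((cmod (h z x))\<^sup>2) \<le> ennreal (K\<^sup>2) * ennreal (1 / u x z ^ (2*m+2))"
        using K(1) u_pos[OF zb, of x] by (subst ennreal_mult[symmetric]) (auto intro: ennreal_leI)
    qed
    also have "\<dots> = ennreal (K\<^sup>2) * Q z" unfolding Q_def by (rule nn_integral_cmult) measurable
    also have "\<dots> \<le> ennreal (K\<^sup>2) * ennreal C0" by (intro mult_left_mono Q_region z) auto
    also have "\<dots> = ennreal (K\<^sup>2 * C0)" using C0_nonneg by (intro ennreal_mult[symmetric]) auto
    finally have "(nrm (h z))\<^sup>2 \<le> K\<^sup>2 * C0" using C0_nonneg by (subst (asm) ennreal_le_iff) auto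
    thus ?thesis by (simp add: real_le_rsqrt)
  qed
  thus ?thesis using that K(2) by blast
qed

text \<open>A Cauchy condition refers only to the bounded functions \<open>h z\<close>; the boundary
  kernel would require a limit function that need not be bounded.\<close>

definition norm_cauchy :: bool where
  "norm_cauchy \<longleftrightarrow> (\<forall>\<eta>>0. \<exists>\<delta>>0. \<forall>z\<in>\<Omega>. \<forall>z'\<in>\<Omega>. cmod (z - 1) < \<delta> \<longrightarrow> cmod (z' - 1) < \<delta> \<longrightarrow>
     nrm (\<lambda>x. h z x - h z' x) \<le> \<eta>)"

lemma admissible_dkb1I:
  assumes z: "z \<in> \<Omega>" and "\<delta> > 0"
    and le: "\<And>z'. z' \<in> \<Omega> \<Longrightarrow> cmod (z' - 1) < \<delta> \<Longrightarrow> nrm (\<lambda>x. h z x - h z' x) \<le> c"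
  shows "admissible (\<lambda>w. dkb b m z w - dkb1 b m \<Omega> w) c"
proof (rule admissible_limit[OF at_one_nontrivial])
  show "\<forall>\<^sub>F z' in at 1 within \<Omega>. admissible (\<lambda>w. dkb b m z w - dkb b m z' w) c"
    unfolding eventually_at
  proof (intro exI[of _ \<delta>] conjI ballI impI)
    fix z' assume "z' \<in> \<Omega>" "z' \<noteq> 1 \<and> dist z' 1 < \<delta>"
    thus "admissible (\<lambda>w. dkb b m z w - dkb b m z' w) c"
      using z region_subset
      by (intro admissible_mono[OF dkb_diff_admissible le]) (auto simp: dist_norm)
  qed fact
  show "((\<lambda>z'. dkb b m z w - dkb b m z' w) \<longlongrightarrow> dkb b m z w - dkb1 b m \<Omega> w) (at 1 within \<Omega>)"
    if "w \<in> ball 0 1" for w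
    by (intro tendsto_intros dkb_tendsto that)
qed

lemma admissible_bdd_below: "bdd_below {c. admissible \<phi> c}"
  by (rule bdd_belowI[of _ 0]) (auto dest: admissible_nonneg)

theorem Hb_norm_tendsto_iff_cauchy:
  "((\<lambda>z. Hb_norm b (\<lambda>w. dkb b m z w - dkb1 b m \<Omega> w)) \<longlongrightarrow> 0) (at 1 within \<Omega>) \<longleftrightarrow> norm_cauchy"
proof
  assume lim: "((\<lambda>z. Hb_norm b (\<lambda>w. dkb b m z w - dkb1 b m \<Omega> w)) \<longlongrightarrow> 0) (at 1 within \<Omega>)"
  obtain R \<delta>\<^sub>0 where R: "\<delta>\<^sub>0 > 0" "\<And>z. z \<in> \<Omega> \<Longrightarrow> cmod (z - 1) < \<delta>\<^sub>0 \<Longrightarrow> nrm (h z) \<le> R"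
    using nrm_h_bound by metis
  \<comment> \<open>The infimum of an empty set of reals carries no information, so smallness of
    \<open>Hb_norm\<close> is meaningful only once some admissible bound is known.\<close>
  have ne: "\<exists>c. admissible (\<lambda>w. dkb b m z w - dkb1 b m \<Omega> w) c" if z: "z \<in> \<Omega>" "cmod (z - 1) < \<delta>\<^sub>0" for z
  proof (rule exI, rule admissible_dkb1I[OF z(1) R(1)])
    fix z' assume z': "z' \<in> \<Omega>" "cmod (z' - 1) < \<delta>\<^sub>0"
    have "nrm (\<lambda>x. h z x + (- 1) * h z' x) \<le> nrm (h z) + nrm (\<lambda>x. (-1) * h z' x)"
      using z z' region_subset by (intro nrm_triangle bdd_cmult bdd_h) auto
    also have "\<dots> \<le> R + R" unfolding nrm_cmult using R(2)[OF z] R(2)[OF z'] by simp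
    finally show "nrm (\<lambda>x. h z x - h z' x) \<le> R + R" by simp
  qed
  show norm_cauchy
    unfolding norm_cauchy_def
  proof (intro allI impI)
    fix \<eta> :: real assume \<eta>: "\<eta> > 0"
    have "\<forall>\<^sub>F z in at 1 within \<Omega>. dist (Hb_norm b (\<lambda>w. dkb b m z w - dkb1 b m \<Omega> w)) 0 < \<eta> / 2"
      using tendstoD[OF lim, of "\<eta>/2"] \<eta> by simp
    then obtain \<delta>\<^sub>1 where \<delta>\<^sub>1: "\<delta>\<^sub>1 > 0" "\<And>z. z \<in> \<Omega> \<Longrightarrow> z \<noteq> 1 \<Longrightarrow> cmod (z - 1) < \<delta>\<^sub>1 \<Longrightarrow>
       \<bar>Hb_norm b (\<lambda>w. dkb b m z w - dkb1 b m \<Omega> w)\<bar> < \<eta> / 2"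
      unfolding eventually_at dist_norm by auto
    have adm: "admissible (\<lambda>w. dkb b m z w - dkb1 b m \<Omega> w) (\<eta> / 2)"
      if z: "z \<in> \<Omega>" "cmod (z - 1) < min \<delta>\<^sub>0 \<delta>\<^sub>1" for z
    proof -
      have "z \<noteq> 1" using z one_notin_region by metis
      hence lt: "Inf {c. admissible (\<lambda>w. dkb b m z w - dkb1 b m \<Omega> w) c} < \<eta> / 2"
        using \<delta>\<^sub>1(2)[of z] z unfolding Hb_norm_eq_Inf by linarith
      have nonempty: "{c. admissible (\<lambda>w. dkb b m z w - dkb1 b m \<Omega> w) c} \<noteq> {}"
        using ne[OF z(1)] z(2) by simp
      obtain c where c: "c \<in> {c. admissible (\<lambda>w. dkb b m z w - dkb1 b m \<Omega> w) c}" "c < \<eta> / 2"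
        using cInf_lessD[OF nonempty lt] by (elim bexE)
      show ?thesis by (rule admissible_mono[of _ c]) (use c in simp_all)
    qed
    show "\<exists>\<delta>>0. \<forall>z\<in>\<Omega>. \<forall>z'\<in>\<Omega>. cmod (z - 1) < \<delta> \<longrightarrow> cmod (z' - 1) < \<delta> \<longrightarrow> nrm (\<lambda>x. h z x - h z' x) \<le> \<eta>"
    proof (intro exI[of _ "min \<delta>\<^sub>0 \<delta>\<^sub>1"] conjI ballI impI)
      show "0 < min \<delta>\<^sub>0 \<delta>\<^sub>1" using R \<delta>\<^sub>1 by simp
      fix z z' assume z: "z \<in> \<Omega>" "z' \<in> \<Omega>" "cmod (z - 1) < min \<delta>\<^sub>0 \<delta>\<^sub>1" "cmod (z' - 1) < min \<delta>\<^sub>0 \<delta>\<^sub>1"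
      \<comment> \<open>The boundary kernel cancels in the difference of the two estimates.\<close>
      have "admissible (\<lambda>w. dkb b m z w - dkb b m z' w) \<eta>"
        using admissible_add[OF adm[OF z(1,3)] adm[OF z(2,4)]] by simp
      thus "nrm (\<lambda>x. h z x - h z' x) \<le> \<eta>" using z region_subset by (intro dkb_diff_nrm_le) auto
    qed
  qed
next
  assume cauchy: norm_cauchy
  show "((\<lambda>z. Hb_norm b (\<lambda>w. dkb b m z w - dkb1 b m \<Omega> w)) \<longlongrightarrow> 0) (at 1 within \<Omega>)"
  proof (rule tendstoI)
    fix \<epsilon> :: real assume \<epsilon>: "\<epsilon> > 0"
    \<comment> \<open>The value \<epsilon> / 2 leaves a strict inequality after z' has tended to 1
      in the non-strict bound.\<close>
    then obtain \<delta> where \<delta>: "\<delta> > 0" "\<And>z z'. z \<in> \<Omega> \<Longrightarrow> z' \<in> \<Omega> \<Longrightarrow> cmod (z - 1) < \<delta> \<Longrightarrow> cmod (z' - 1) < \<delta> \<Longrightarrow>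
       nrm (\<lambda>x. h z x - h z' x) \<le> \<epsilon> / 2"
      using cauchy unfolding norm_cauchy_def by (meson half_gt_zero)
    show "\<forall>\<^sub>F z in at 1 within \<Omega>. dist (Hb_norm b (\<lambda>w. dkb b m z w - dkb1 b m \<Omega> w)) 0 < \<epsilon>"
      unfolding eventually_at
    proof (intro exI[of _ \<delta>] conjI ballI impI)
      fix z assume z: "z \<in> \<Omega>" "z \<noteq> 1 \<and> dist z 1 < \<delta>"
      have adm: "admissible (\<lambda>w. dkb b m z w - dkb1 b m \<Omega> w) (\<epsilon> / 2)"
        using z \<delta> by (intro admissible_dkb1I[of _ \<delta>]) (auto simp: dist_norm)
      hence "Hb_norm b (\<lambda>w. dkb b m z w - dkb1 b m \<Omega> w) \<le> \<epsilon> / 2"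
        unfolding Hb_norm_eq_Inf by (intro cInf_lower admissible_bdd_below) auto
      moreover have "Hb_norm b (\<lambda>w. dkb b m z w - dkb1 b m \<Omega> w) \<ge> 0"
        unfolding Hb_norm_eq_Inf using adm by (intro cInf_greatest) (auto dest: admissible_nonneg)
      ultimately show "dist (Hb_norm b (\<lambda>w. dkb b m z w - dkb1 b m \<Omega> w)) 0 < \<epsilon>" using \<epsilon> by simp
    qed (fact \<delta>)
  qed
qed

end

section \<open>Geometry of the sectors\<close>

lemma cmod_one_minus_cis: "cmod (1 - cis t) = 2 * \<bar>sin (t / 2)\<bar>"
  using dist_exp_i_1[of t] by (simp add: cis_conv_exp norm_minus_commute)

text \<open>Applied with a and x half the arguments of z and of a node. The addition formula gives
  \<open>|sin x| <= |sin a| + |sin (a - x)|\<close>, and outside the sector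
  \<open>|sin a| <= 2 |sin (a - x)|\<close> because a - x has modulus at least a/2. Hence the
  constant 3.\<close>

lemma abs_sin_outside_sector:
  fixes a x :: real
  assumes a: "\<bar>a\<bar> \<le> pi / 4" and x: "\<bar>x\<bar> \<le> pi / 2"
    and out: "\<not> (0 < a \<and> a / 2 < x \<and> x < 2 * a)" "\<not> (a < 0 \<and> 2 * a < x \<and> x < a / 2)"
  shows "\<bar>sin x\<bar> \<le> 3 * \<bar>sin (a - x)\<bar>"
proof -
  have pos: "\<bar>sin x\<bar> \<le> 3 * \<bar>sin (a - x)\<bar>"
    if a: "0 < a" "a \<le> pi / 4" and x: "\<bar>x\<bar> \<le> pi / 2" and out: "x \<le> a / 2 \<or> 2 * a \<le> x" for a x :: real
  proof -
    have "\<bar>sin (a - (a - x))\<bar> \<le> \<bar>sin a * cos (a - x)\<bar> + \<bar>cos a * sin (a - x)\<bar>"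
      unfolding sin_diff[of a "a - x"] by (rule abs_triangle_ineq4)
    also have "\<dots> \<le> \<bar>sin a\<bar> * 1 + 1 * \<bar>sin (a - x)\<bar>"
      unfolding abs_mult by (intro add_mono mult_mono) auto
    finally have 1: "\<bar>sin x\<bar> \<le> \<bar>sin a\<bar> + \<bar>sin (a - x)\<bar>" by simp
    have sin_a: "sin a \<ge> 0" using a by (intro sin_ge_zero) auto
    have 2: "sin a \<le> 2 * \<bar>sin (a - x)\<bar>"
    proof (cases "2 * a \<le> x")
      case True
      have "sin a \<le> sin (x - a)" using True a x by (intro sin_monotone_2pi_le) auto
      moreover have "sin (x - a) = - sin (a - x)" using sin_minus[of "a - x"] by simp
      ultimately show ?thesis using sin_a by linarith
    next
      case False
      hence y: "a / 2 \<le> a - x" using out by auto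
      have half: "sin a \<le> 2 * sin (a / 2)"
      proof -
        have "sin a = 2 * sin (a / 2) * cos (a / 2)" using sin_double[of "a / 2"] by simp
        moreover have "sin (a / 2) \<ge> 0" using a by (intro sin_ge_zero) auto
        hence "2 * sin (a / 2) * cos (a / 2) \<le> 2 * sin (a / 2) * 1" by (intro mult_left_mono) auto
        ultimately show ?thesis by simp
      qed
      show ?thesis
      proof (cases "a - x \<le> pi / 2")
        case True
        have "sin (a / 2) \<le> sin (a - x)" using y True a by (intro sin_monotone_2pi_le) auto
        thus ?thesis using half sin_a by linarith
      next
        case False
        \<comment> \<open>Beyond pi/2 the sine decreases, but \<open>x >= - pi/2\<close> gives
          \<open>a - x - pi/2 <= a\<close>, and \<open>sin a <= cos a\<close> up to pi/4.\<close>
        have "sin (a - x) = cos (a - x - pi / 2)" by (simp add: cos_diff)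
        moreover have "cos a \<le> cos (a - x - pi / 2)" using False x a by (intro cos_monotone_0_pi_le) auto
        moreover have "sin a \<le> cos a"
        proof -
          have "sin a \<le> sin (pi / 2 - a)" using a by (intro sin_monotone_2pi_le) auto
          thus ?thesis by (simp add: sin_diff)
        qed
        ultimately show ?thesis using sin_a by linarith
      qed
    qed
    show ?thesis using 1 2 sin_a by linarith
  qed
  consider "a > 0" | "a = 0" | "a < 0" by linarith
  thus ?thesis
  proof cases
    case 1 thus ?thesis using pos[of a x] a x out(1) by auto
  next
    case 2 thus ?thesis by simp
  next
    case 3
    have "\<bar>sin (- x)\<bar> \<le> 3 * \<bar>sin (- a - - x)\<bar>"
      using 3 a x out(2) by (intro pos) auto
    moreover have "- a - - x = - (a - x)" by simp
    ultimately show ?thesis unfolding sin_minus by (metis abs_minus_cancel sin_minus)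
  qed
qed

text \<open>The zeros lie in the open disc and the measures on the circle. \<open>Sset z\<close>
  meets only the former and \<open>Eset z\<close> only the latter, so a single Borel set encodes all
  three restrictions.\<close>

definition sector :: "complex \<Rightarrow> complex set" where
  "sector z = Sset z \<union> Eset z"

lemma sector_Arg:
  assumes a: "a \<noteq> 0" "cmod a \<le> 1"
    and Arg: "(0 < Arg z \<and> Arg z / 2 < Arg a \<and> Arg a < 2 * Arg z) \<or> (Arg z < 0 \<and> 2 * Arg z < Arg a \<and> Arg a < Arg z / 2)"
    and z: "\<bar>Arg z\<bar> < pi / 2"
  shows "a \<in> sector z"
proof -
  have E: "cis (Arg a) \<in> Eset z" using Arg z unfolding Eset_def by auto
  have a_eq: "a = of_real (cmod a) * cis (Arg a)" using rcis_cmod_Arg[of a] by (simp add: rcis_def)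
  show ?thesis
  proof (cases "cmod a = 1")
    case True thus ?thesis using E a_eq by (simp add: sector_def)
  next
    case False
    hence "a \<in> Sset z" unfolding Sset_def using E a a_eq by force
    thus ?thesis by (simp add: sector_def)
  qed
qed

text \<open>The distance to 1 splits into an angular part, at most 6 times the right-hand modulus by
  the comparison of half angles, and the radial part \<open>1 - |a|\<close>, at most that modulus
  once. This is the 7.\<close>

lemma outside_sector_bound:
  assumes a: "cmod a \<le> 1" "a \<notin> sector z" and z: "cmod z < 1" "\<bar>Arg z\<bar> < pi / 2"
  shows "cmod (1 - a) \<le> 7 * cmod (1 - cnj a * z)"
proof (cases "a = 0 \<or> z = 0")
  case True thus ?thesis using a norm_triangle_ineq4[of 1 a] by auto
next
  case False
  define \<alpha> \<beta> where "\<alpha> = Arg z" and "\<beta> = Arg a"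
  have \<beta>: "\<bar>\<beta>\<bar> \<le> pi" using Arg_bounded[of a] by (auto simp: \<beta>_def)
  have a_eq: "a = of_real (cmod a) * cis \<beta>" using rcis_cmod_Arg[of a] by (simp add: rcis_def \<beta>_def)
  have z_eq: "z = of_real (cmod z) * cis \<alpha>" using rcis_cmod_Arg[of z] by (simp add: rcis_def \<alpha>_def)
  define t where "t = cmod a * cmod z"
  have t: "0 \<le> t" "t \<le> cmod a" using a z by (auto simp: t_def mult_left_le)
  have prod: "cnj a * z = of_real t * cis (\<alpha> - \<beta>)"
  proof -
    have "cnj a * z = (of_real (cmod a) * cis (- \<beta>)) * (of_real (cmod z) * cis \<alpha>)"
      by (subst a_eq, subst z_eq) (simp add: cis_cnj)
    also have "\<dots> = of_real t * (cis (- \<beta>) * cis \<alpha>)" by (simp add: t_def)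
    finally show ?thesis by (simp add: cis_mult)
  qed
  let ?U = "cmod (1 - cnj a * z)"
  have 1: "1 - t \<le> ?U"
    using norm_triangle_ineq2[of 1 "cnj a * z"] t unfolding prod by (simp add: norm_mult)
  \<comment> \<open>Projecting \<open>cnj a * z\<close> radially to the circle moves it by 1 - t,
    which is again at most the modulus \<open>?U\<close>.\<close>
  have "cmod (1 - cis (\<alpha> - \<beta>)) \<le> ?U + cmod (of_real t * cis (\<alpha> - \<beta>) - cis (\<alpha> - \<beta>))"
    unfolding prod using norm_triangle_ineq[of "1 - of_real t * cis (\<alpha> - \<beta>)" "of_real t * cis (\<alpha> - \<beta>) - cis (\<alpha> - \<beta>)"] by simp
  also have "of_real t * cis (\<alpha> - \<beta>) - cis (\<alpha> - \<beta>) = of_real (t - 1) * cis (\<alpha> - \<beta>)" by (simp add: algebra_simps)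
  also have "cmod \<dots> = 1 - t" using t a unfolding norm_mult norm_of_real by simp
  finally have 2: "2 * \<bar>sin ((\<alpha> - \<beta>) / 2)\<bar> \<le> 2 * ?U" using 1 by (simp add: cmod_one_minus_cis)
  have out: "\<not> (0 < \<alpha> \<and> \<alpha> / 2 < \<beta> \<and> \<beta> < 2 * \<alpha>)" "\<not> (\<alpha> < 0 \<and> 2 * \<alpha> < \<beta> \<and> \<beta> < \<alpha> / 2)"
    using sector_Arg[of a z] a False z unfolding \<alpha>_def \<beta>_def by auto
  have "\<bar>sin (\<beta> / 2)\<bar> \<le> 3 * \<bar>sin (\<alpha> / 2 - \<beta> / 2)\<bar>"
    by (rule abs_sin_outside_sector) (use z(2) \<beta> out in \<open>auto simp: \<alpha>_def[symmetric]\<close>)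
  hence 3: "cmod (1 - cis \<beta>) \<le> 6 * ?U" using 2 unfolding cmod_one_minus_cis by (simp add: diff_divide_distrib)
  have "cmod (1 - a) \<le> cmod (1 - cis \<beta>) + cmod (cis \<beta> - a)"
    using norm_triangle_ineq[of "1 - cis \<beta>" "cis \<beta> - a"] by simp
  also have "cis \<beta> - a = of_real (1 - cmod a) * cis \<beta>" by (subst a_eq) (simp add: algebra_simps)
  also have "cmod \<dots> = 1 - cmod a" using a unfolding norm_mult norm_of_real by simp
  finally show ?thesis using 1 3 t by linarith
qed

lemma tendsto_Arg_1: "(Arg \<longlongrightarrow> 0) (at 1)"
proof -
  have "isCont Arg 1" by (rule continuous_at_Arg) (auto simp: complex_nonpos_Reals_iff)
  thus ?thesis by (simp add: isCont_def)
qed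

text \<open>The arguments in the sector fill an interval with endpoints \<open>Arg z / 2\<close> and
  \<open>2 * Arg z\<close>, which never contains 0 and shrinks towards it.\<close>

lemma eventually_notin_sector:
  "\<forall>\<^sub>F z in at 1. a \<notin> sector z"
proof -
  have nz: "\<forall>\<^sub>F z in at 1. \<bar>Arg z\<bar> < d" if "d > 0" for d
    using tendstoD[OF tendsto_Arg_1 that] by (simp add: dist_real_def)
  \<comment> \<open>Below \<open>|Arg a| / 2\<close> the sector has not yet reached a; below pi/2
    the angles \<open>2 * Arg z\<close> stay in the principal range of \<open>Arg\<close>.\<close>
  define d where "d = (if Arg a = 0 then pi / 2 else min (pi / 2) (\<bar>Arg a\<bar> / 2))"
  have d: "d > 0" by (auto simp: d_def)
  show ?thesis
    using nz[OF d]
  proof eventually_elim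
    case (elim z)
    show ?case
    proof
      assume "a \<in> sector z"
      then obtain r \<zeta> where r: "a = of_real r * \<zeta>" "0 < r" "\<zeta> \<in> Eset z"
        unfolding sector_def Sset_def by (auto intro: that[of 1])
      obtain t where t: "\<zeta> = cis t" "(0 < Arg z \<and> Arg z / 2 < t \<and> t < 2 * Arg z) \<or> (Arg z < 0 \<and> 2 * Arg z < t \<and> t < Arg z / 2)"
        using r(3) unfolding Eset_def by (auto split: if_splits)
      have "\<bar>Arg z\<bar> < pi / 2" using elim by (auto simp: d_def split: if_splits)
      hence "Arg a = t" unfolding r(1) t(1) using t(2) r(2) Arg_rcis[of t r] by (auto simp: rcis_def)
      thus False using t(2) elim by (auto simp: d_def split: if_splits)
    qed
  qed
qed

text \<open>An open set is a countable union of compact sets, whose images are compact and hence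
  closed.\<close>

lemma continuous_image_open_borel:
  fixes f :: "'a::euclidean_space \<Rightarrow> 'b::t2_space"
  assumes "open S" "continuous_on S f"
  shows "f ` S \<in> sets borel"
proof -
  obtain C :: "nat \<Rightarrow> 'a set" where C: "\<And>n. compact (C n)" "\<And>n. C n \<subseteq> S" "\<Union>(range C) = S"
    using open_Union_compact_subsets[OF assms(1)] by metis
  have "f ` C n \<in> sets borel" for n
    using compact_imp_closed[OF compact_continuous_image[OF continuous_on_subset[OF assms(2) C(2)] C(1)]]
    by (rule borel_closed)
  hence "(\<Union>n. f ` C n) \<in> sets borel" by auto
  thus ?thesis using C(3) by (metis image_UN)
qed

lemma Eset_eq_image: "\<exists>I. open I \<and> Eset z = cis ` I"
proof -
  consider "0 < Arg z \<and> Arg z < pi" | "Arg z < 0" | "\<not> (0 < Arg z \<and> Arg z < pi)" "\<not> Arg z < 0" by blast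
  thus ?thesis
  proof cases
    case 1
    thus ?thesis unfolding Eset_def by (intro exI[of _ "{Arg z / 2 <..< 2 * Arg z}"]) auto
  next
    case 2
    thus ?thesis unfolding Eset_def by (intro exI[of _ "{2 * Arg z <..< Arg z / 2}"]) auto
  next
    case 3
    thus ?thesis unfolding Eset_def by (intro exI[of _ "{}"]) auto
  qed
qed

lemma Eset_borel: "Eset z \<in> sets borel"
proof -
  obtain I where I: "open I" "Eset z = cis ` I" using Eset_eq_image by blast
  have "continuous_on I (\<lambda>t. cis t)" by (intro continuous_intros)
  with I show ?thesis by (simp add: continuous_image_open_borel)
qed

lemma Sset_borel: "Sset z \<in> sets borel"
proof -
  obtain I where I: "open I" "Eset z = cis ` I" using Eset_eq_image by blast
  have "Sset z = (\<lambda>(r, t). of_real r * cis t) ` ({0<..<1} \<times> I)"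
    unfolding Sset_def I by force
  also have "\<dots> \<in> sets borel"
    by (intro continuous_image_open_borel open_Times I open_greaterThanLessThan)
       (auto simp: case_prod_beta intro!: continuous_intros)
  finally show ?thesis .
qed

lemma sector_borel [measurable]: "sector z \<in> sets borel"
  unfolding sector_def by (intro sets.Un Eset_borel Sset_borel)

lemma Eset_subset_sphere: "Eset z \<subseteq> sphere 0 1"
  unfolding Eset_def by auto

lemma sphere_notin_Sset: "cmod \<zeta> = 1 \<Longrightarrow> \<zeta> \<notin> Sset z"
  using Eset_subset_sphere[of z] by (fastforce simp: Sset_def norm_mult)

section \<open>Norm convergence against concentration of mass in the sectors\<close>

context boundary_model
begin

definition tail :: "complex \<Rightarrow> ennreal" where
  "tail z = (\<integral>\<^sup>+x. indicator (sector z) (e x) * ennreal (1 / u x z ^ (2*m+2)) \<partial>M)"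

lemma sector_preimage [measurable]: "{x \<in> space M. e x \<in> sector z} \<in> sets M"
  using measurable_sets[OF e_measurable sector_borel] by (simp add: vimage_def Int_def conj_commute)

lemma eventually_notin_sector_region: "\<forall>\<^sub>F z in at 1 within \<Omega>. a \<notin> sector z"
  using eventually_notin_sector[of a] filter_leD[OF at_le[of \<Omega> UNIV 1]] by simp

lemma eventually_outside_bound:
  "\<forall>\<^sub>F z in at 1 within \<Omega>. \<forall>x. e x \<notin> sector z \<longrightarrow> u x 1 \<le> 7 * u x z"
proof -
  have "\<forall>\<^sub>F z in at 1. \<bar>Arg z\<bar> < pi / 2"
    using tendstoD[OF tendsto_Arg_1, of "pi/2"] by (simp add: dist_real_def)
  hence "\<forall>\<^sub>F z in at 1 within \<Omega>. \<bar>Arg z\<bar> < pi / 2"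
    using filter_leD[OF at_le[of \<Omega> UNIV 1]] by simp
  moreover have "\<forall>\<^sub>F z in at 1 within \<Omega>. z \<in> \<Omega>" by (auto simp: eventually_at_filter)
  ultimately show ?thesis
  proof eventually_elim
    case (elim z)
    thus ?case using outside_sector_bound[OF e_le_1, of _ z] region_subset by (auto simp: u_def[of _ z] u_1)
  qed
qed

text \<open>Every node eventually leaves the sectors, and constants are integrable over the finite
  measure M.\<close>

lemma measure_sector_tendsto_0:
  "((\<lambda>z. measure M {x \<in> space M. e x \<in> sector z}) \<longlongrightarrow> 0) (at 1 within \<Omega>)"
  unfolding tendsto_at_iff_sequentially o_def
proof (intro allI impI)
  fix X :: "nat \<Rightarrow> complex" assume X: "\<forall>i. X i \<in> \<Omega> - {1}" "X \<longlonglongrightarrow> 1"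
  have ev: "\<forall>\<^sub>F i in sequentially. a \<notin> sector (X i)" for a
  proof -
    have "filterlim X (at 1 within \<Omega>) sequentially"
      using X by (auto simp: filterlim_at)
    thus ?thesis using eventually_notin_sector_region[of a] eventually_compose_filterlim by blast
  qed
  have "(\<lambda>i. \<integral>x. indicator {x \<in> space M. e x \<in> sector (X i)} x \<partial>M) \<longlonglongrightarrow> (\<integral>x. (0::real) \<partial>M)"
  proof (rule integral_dominated_convergence[where w = "\<lambda>_. 1"])
    show "AE x in M. (\<lambda>i. indicator {x \<in> space M. e x \<in> sector (X i)} x) \<longlonglongrightarrow> (0::real)"
    proof (rule AE_I2)
      fix x
      have "\<forall>\<^sub>F i in sequentially. indicator {x \<in> space M. e x \<in> sector (X i)} x = (0::real)"
        using ev[of "e x"] by eventually_elim auto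
      thus "(\<lambda>i. indicator {x \<in> space M. e x \<in> sector (X i)} x) \<longlonglongrightarrow> (0::real)"
        by (rule tendsto_eventually)
    qed
  qed (auto simp: indicator_def)
  thus "(\<lambda>i. measure M {x \<in> space M. e x \<in> sector (X i)}) \<longlonglongrightarrow> 0" by simp
qed

text \<open>The lower order terms of \<open>h z\<close> are absorbed by interpolation between the exponents 0 and \<open>2m+2\<close>.\<close>

lemma inverse_power_interpolate:
  fixes v \<theta> :: real
  assumes "v > 0" "\<theta> > 0"
  shows "1 / v ^ (2*m) \<le> \<theta> * (1 / v ^ (2*m+2)) + 1 / \<theta> ^ m"
proof (cases "v\<^sup>2 \<le> \<theta>")
  case True
  have "1 / v ^ (2*m) = v\<^sup>2 * (1 / v ^ (2*m+2))" using assms by (simp add: power2_eq_square)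
  also have "\<dots> \<le> \<theta> * (1 / v ^ (2*m+2))" using True assms by (intro mult_right_mono) auto
  finally show ?thesis using assms by (simp add: add_increasing2)
next
  case False
  have "1 / v ^ (2*m) = 1 / (v\<^sup>2) ^ m" by (simp add: power_mult)
  also have "\<dots> \<le> 1 / \<theta> ^ m" using False assms by (intro divide_left_mono power_mono mult_pos_pos) auto
  finally show ?thesis using assms by (simp add: add_increasing)
qed

text \<open>In the sector \<open>1 / u ^ (m + 1)\<close> is bounded by \<open>h z\<close> and a
  lower order term. Comparing \<open>h z\<close> with \<open>h z'\<close> at a fixed z' leaves the
  L2 distance and a constant B, and interpolation replaces the lower order term by a small multiple
  of Q and another constant. The constants are integrated only over the sector, whose measure tends
  to 0.\<close>

lemma tail_bound:
  assumes K: "K > 0" "\<And>x. 1 / u x z ^ (m + 1) \<le> K * (cmod (h z x) + 1 / u x z ^ m)"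
    and z: "z \<in> \<Omega>" and z': "z' \<in> ball 0 1" "\<And>x. cmod (h z' x) \<le> B" and \<theta>: "\<theta> > 0"
  shows "tail z \<le> ennreal (4 * K\<^sup>2 * (nrm (\<lambda>x. h z x - h z' x))\<^sup>2 + 2 * K\<^sup>2 * \<theta> * C0
     + (4 * K\<^sup>2 * B\<^sup>2 + 2 * K\<^sup>2 / \<theta> ^ m) * measure M {x \<in> space M. e x \<in> sector z})"
proof -
  have zb: "z \<in> ball 0 1" using z region_subset by auto
  let ?S = "{x \<in> space M. e x \<in> sector z}"
  define g1 where "g1 x = ennreal (4 * K\<^sup>2) * ennreal ((cmod (h z x - h z' x))\<^sup>2)" for x
  define g2 where "g2 x = ennreal (2 * K\<^sup>2 * \<theta>) * ennreal (1 / u x z ^ (2*m+2))" for x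
  define g3 where "g3 x = ennreal (4 * K\<^sup>2 * B\<^sup>2 + 2 * K\<^sup>2 / \<theta> ^ m) * indicator ?S x" for x
  have [measurable]: "h z \<in> borel_measurable M" "h z' \<in> borel_measurable M"
    using bdd_h[OF zb] bdd_h[OF z'(1)] by (auto dest: bdd_measurable)
  have "tail z \<le> (\<integral>\<^sup>+x. g1 x + g2 x + g3 x \<partial>M)"
    unfolding tail_def
  proof (rule nn_integral_mono)
    fix x assume x: "x \<in> space M"
    show "indicator (sector z) (e x) * ennreal (1 / u x z ^ (2*m+2)) \<le> g1 x + g2 x + g3 x"
    proof (cases "e x \<in> sector z")
      case True
      have sq: "(s + t)\<^sup>2 \<le> 2 * s\<^sup>2 + 2 * t\<^sup>2" for s t :: real
        using sum_squares_bound[of s t] by (simp add: power2_sum)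
      have up: "u x z > 0" by (rule u_pos[OF zb])
      have "1 / u x z ^ (2*m+2) = (1 / u x z ^ (m + 1))\<^sup>2" unfolding power_divide square_power by simp
      also have "\<dots> \<le> (K * (cmod (h z x) + 1 / u x z ^ m))\<^sup>2"
        using K(2) up by (intro power_mono) auto
      also have "\<dots> = K\<^sup>2 * (cmod (h z x) + 1 / u x z ^ m)\<^sup>2" by (simp add: power_mult_distrib)
      also have "\<dots> \<le> K\<^sup>2 * (2 * (cmod (h z x))\<^sup>2 + 2 * (1 / u x z ^ m)\<^sup>2)"
        by (intro mult_left_mono sq) auto
      also have "(1 / u x z ^ m)\<^sup>2 = 1 / u x z ^ (2*m)" by (simp add: power_divide power_mult[symmetric] mult.commute)
      also have "(cmod (h z x))\<^sup>2 \<le> 2 * (cmod (h z x - h z' x))\<^sup>2 + 2 * B\<^sup>2"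
      proof -
        have "(cmod (h z x))\<^sup>2 \<le> (cmod (h z x - h z' x) + cmod (h z' x))\<^sup>2"
          using norm_triangle_ineq[of "h z x - h z' x" "h z' x"] by (intro power_mono) auto
        also have "\<dots> \<le> 2 * (cmod (h z x - h z' x))\<^sup>2 + 2 * (cmod (h z' x))\<^sup>2" by (rule sq)
        also have "(cmod (h z' x))\<^sup>2 \<le> B\<^sup>2" using z'(2) by (intro power_mono) auto
        finally show ?thesis by simp
      qed
      also have "1 / u x z ^ (2*m) \<le> \<theta> * (1 / u x z ^ (2*m+2)) + 1 / \<theta> ^ m"
        by (rule inverse_power_interpolate[OF up \<theta>])
      finally have "1 / u x z ^ (2*m+2) \<le> K\<^sup>2 * (2 * (2 * (cmod (h z x - h z' x))\<^sup>2 + 2 * B\<^sup>2)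
         + 2 * (\<theta> * (1 / u x z ^ (2*m+2)) + 1 / \<theta> ^ m))"
        by (simp add: mult_left_mono)
      also have "\<dots> = 4 * K\<^sup>2 * (cmod (h z x - h z' x))\<^sup>2 + 2 * K\<^sup>2 * \<theta> * (1 / u x z ^ (2*m+2))
         + (4 * K\<^sup>2 * B\<^sup>2 + 2 * K\<^sup>2 / \<theta> ^ m)" by (simp add: algebra_simps)
      finally have "ennreal (1 / u x z ^ (2*m+2)) \<le> ennreal (4 * K\<^sup>2 * (cmod (h z x - h z' x))\<^sup>2
         + 2 * K\<^sup>2 * \<theta> * (1 / u x z ^ (2*m+2)) + (4 * K\<^sup>2 * B\<^sup>2 + 2 * K\<^sup>2 / \<theta> ^ m))" by (rule ennreal_leI)
      also have "\<dots> = g1 x + g2 x + g3 x"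
        unfolding g1_def g2_def g3_def using \<theta> up True x
        by (simp add: ennreal_plus[symmetric] ennreal_mult[symmetric] del: ennreal_plus power_Suc)
      finally show ?thesis using True by simp
    qed simp
  qed
  also have "\<dots> = (\<integral>\<^sup>+x. g1 x \<partial>M) + (\<integral>\<^sup>+x. g2 x \<partial>M) + (\<integral>\<^sup>+x. g3 x \<partial>M)"
    unfolding g1_def g2_def g3_def by (subst nn_integral_add; (measurable)?)+
  also have "(\<integral>\<^sup>+x. g1 x \<partial>M) = ennreal (4 * K\<^sup>2) * ennreal ((nrm (\<lambda>x. h z x - h z' x))\<^sup>2)"
    unfolding g1_def nrm_sq_ennreal[OF bdd_diff[OF bdd_h[OF zb] bdd_h[OF z'(1)]]]
    by (rule nn_integral_cmult) measurable
  also have "(\<integral>\<^sup>+x. g2 x \<partial>M) = ennreal (2 * K\<^sup>2 * \<theta>) * Q z"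
    unfolding g2_def Q_def by (rule nn_integral_cmult) measurable
  also have "(\<integral>\<^sup>+x. g3 x \<partial>M) = ennreal (4 * K\<^sup>2 * B\<^sup>2 + 2 * K\<^sup>2 / \<theta> ^ m) * ennreal (measure M ?S)"
    unfolding g3_def by (subst nn_integral_cmult_indicator) (auto simp: emeasure_eq_measure)
  also have "ennreal (4 * K\<^sup>2) * ennreal ((nrm (\<lambda>x. h z x - h z' x))\<^sup>2) + ennreal (2 * K\<^sup>2 * \<theta>) * Q z
      + ennreal (4 * K\<^sup>2 * B\<^sup>2 + 2 * K\<^sup>2 / \<theta> ^ m) * ennreal (measure M ?S)
    \<le> ennreal (4 * K\<^sup>2) * ennreal ((nrm (\<lambda>x. h z x - h z' x))\<^sup>2) + ennreal (2 * K\<^sup>2 * \<theta>) * ennreal C0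
      + ennreal (4 * K\<^sup>2 * B\<^sup>2 + 2 * K\<^sup>2 / \<theta> ^ m) * ennreal (measure M ?S)"
    by (intro add_mono mult_left_mono Q_region z order_refl) auto
  also have "\<dots> = ennreal (4 * K\<^sup>2 * (nrm (\<lambda>x. h z x - h z' x))\<^sup>2 + 2 * K\<^sup>2 * \<theta> * C0
     + (4 * K\<^sup>2 * B\<^sup>2 + 2 * K\<^sup>2 / \<theta> ^ m) * measure M ?S)"
    using \<theta> C0_nonneg by (simp add: ennreal_plus[symmetric] ennreal_mult[symmetric] del: ennreal_plus)
  finally show ?thesis .
qed

lemma cauchy_imp_tail:
  assumes cauchy: norm_cauchy
  shows "(tail \<longlongrightarrow> 0) (at 1 within \<Omega>)"
proof (rule tendsto_zero_ennreal)
  fix r :: real assume r: "0 < r"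
  obtain K \<delta> where K: "K > 0" "\<delta> > 0"
    "\<And>z x. z \<in> ball 0 1 \<Longrightarrow> cmod (z - 1) < \<delta> \<Longrightarrow> Q z \<le> ennreal C0 \<Longrightarrow>
       1 / u x z ^ (m + 1) \<le> K * (cmod (h z x) + 1 / u x z ^ m)"
    using G_deriv_bound[of C0] unfolding h_def by metis
  \<comment> \<open>With this choice the interpolated term
    \<open>2 * K\<^sup>2 * \<theta> * C0\<close> is at most r/4.\<close>
  define \<theta> where "\<theta> = r / (8 * K\<^sup>2 * (C0 + 1))"
  have \<theta>: "\<theta> > 0" using r K C0_nonneg by (simp add: \<theta>_def)
  have \<theta>_le: "2 * K\<^sup>2 * \<theta> * C0 \<le> r / 4"
  proof -
    have "2 * K\<^sup>2 * \<theta> * C0 \<le> 2 * K\<^sup>2 * \<theta> * (C0 + 1)" using \<theta> by (intro mult_left_mono) auto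
    also have "\<dots> = r / 4"
    proof -
      have "2 * k * (r / (8 * k * c)) * c = r / 4" if "k > 0" "c > 0" for k c :: real
        using that by (simp add: field_simps)
      note * = this
      show ?thesis unfolding \<theta>_def by (rule *) (use K(1) C0_nonneg in auto)
    qed
    finally show ?thesis .
  qed
  define \<eta> where "\<eta> = sqrt r / (4 * K)"
  have \<eta>: "\<eta> > 0" "4 * K\<^sup>2 * \<eta>\<^sup>2 = r / 4"
    using r K(1) by (auto simp: \<eta>_def power_divide power_mult_distrib)
  obtain \<delta>\<^sub>1 where \<delta>\<^sub>1: "\<delta>\<^sub>1 > 0" "\<And>z z'. z \<in> \<Omega> \<Longrightarrow> z' \<in> \<Omega> \<Longrightarrow> cmod (z - 1) < \<delta>\<^sub>1 \<Longrightarrow> cmod (z' - 1) < \<delta>\<^sub>1 \<Longrightarrow>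
       nrm (\<lambda>x. h z x - h z' x) \<le> \<eta>"
    using cauchy \<eta>(1) unfolding norm_cauchy_def by meson
  \<comment> \<open>The comparison point is fixed before z varies, so the bound B for
    \<open>h z'\<close> and the constant A built from it do not depend on z.\<close>
  obtain z' where z': "z' \<in> \<Omega>" "cmod (z' - 1) < \<delta>\<^sub>1"
    using one_in_closure \<delta>\<^sub>1(1) unfolding closure_approachable dist_norm by blast
  have z'b: "z' \<in> ball 0 1" using z' region_subset by auto
  obtain B where B: "\<And>x. cmod (h z' x) \<le> B" using bdd_h[OF z'b] by (auto simp: bdd_def)
  define A where "A = 4 * K\<^sup>2 * B\<^sup>2 + 2 * K\<^sup>2 / \<theta> ^ m"
  have "((\<lambda>z. A * measure M {x \<in> space M. e x \<in> sector z}) \<longlongrightarrow> A * 0) (at 1 within \<Omega>)"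
    by (intro tendsto_intros measure_sector_tendsto_0)
  hence "\<forall>\<^sub>F z in at 1 within \<Omega>. dist (A * measure M {x \<in> space M. e x \<in> sector z}) (A * 0) < r / 4"
    using r by (intro tendstoD) auto
  moreover have "\<forall>\<^sub>F z in at 1 within \<Omega>. z \<in> \<Omega> \<and> cmod (z - 1) < min \<delta> \<delta>\<^sub>1"
    unfolding eventually_at using K \<delta>\<^sub>1 by (intro exI[of _ "min \<delta> \<delta>\<^sub>1"]) (auto simp: dist_norm)
  ultimately show "\<forall>\<^sub>F z in at 1 within \<Omega>. tail z < ennreal r"
  proof eventually_elim
    case (elim z)
    have zb: "z \<in> ball 0 1" using elim region_subset by auto
    have "4 * K\<^sup>2 * (nrm (\<lambda>x. h z x - h z' x))\<^sup>2 \<le> 4 * K\<^sup>2 * \<eta>\<^sup>2"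
      using \<delta>\<^sub>1(2)[of z z'] elim z' by (intro mult_left_mono power_mono) auto
    moreover have "A * measure M {x \<in> space M. e x \<in> sector z} < r / 4"
      using elim by (simp add: dist_real_def)
    ultimately have "4 * K\<^sup>2 * (nrm (\<lambda>x. h z x - h z' x))\<^sup>2 + 2 * K\<^sup>2 * \<theta> * C0
       + A * measure M {x \<in> space M. e x \<in> sector z} < r"
      using \<eta>(2) \<theta>_le r by linarith
    moreover have "tail z \<le> ennreal (4 * K\<^sup>2 * (nrm (\<lambda>x. h z x - h z' x))\<^sup>2 + 2 * K\<^sup>2 * \<theta> * C0
       + A * measure M {x \<in> space M. e x \<in> sector z})"
      unfolding A_def using elim Q_region K zb by (intro tail_bound z'b B \<theta>) auto
    ultimately show ?case using r by (meson ennreal_lessI order_le_less_trans)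
  qed
qed

text \<open>The functions \<open>h z\<close> have a pointwise limit H almost everywhere. Outside the
  sector \<open>|h z - H|^2\<close> is dominated by a multiple of \<open>1 / u x 1 ^ (2m+2)\<close>,
  which is integrable since Q is finite at 1. Inside it the part due to \<open>h z\<close> is the
  tail and the part due to H is dominated in the same way. Dominated convergence gives L2
  convergence to H.\<close>

lemma tail_imp_cauchy:
  assumes tail: "(tail \<longlongrightarrow> 0) (at 1 within \<Omega>)"
  shows norm_cauchy
proof -
  obtain K \<delta> where K: "K > 0" "\<delta> > 0"
    "\<And>z x j. z \<in> ball 0 1 \<Longrightarrow> cmod (z - 1) < \<delta> \<Longrightarrow> Q z \<le> ennreal C0 \<Longrightarrow> j \<le> m + 1 \<Longrightarrow>
       cmod ((deriv ^^ j) (G x) z) \<le> K / u x z ^ (j + 1)"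
    using G_deriv_bound[of C0] by metis
  have hK: "cmod (h z x) \<le> K / u x z ^ (m + 1)" if "z \<in> \<Omega>" "cmod (z - 1) < \<delta>" for z x
    unfolding h_def using K(3)[of z m x] that Q_region region_subset by auto
  obtain \<delta>\<^sub>1 where \<delta>\<^sub>1: "\<delta>\<^sub>1 > 0"
    "\<And>z x. z \<in> \<Omega> \<Longrightarrow> cmod (z - 1) < \<delta>\<^sub>1 \<Longrightarrow> e x \<notin> sector z \<Longrightarrow> u x 1 \<le> 7 * u x z"
    using eventually_outside_bound one_notin_region unfolding eventually_at dist_norm by metis
  define \<Omega>' where "\<Omega>' = \<Omega> \<inter> ball 1 (min \<delta> \<delta>\<^sub>1)"
  have at_eq: "at 1 within \<Omega> = at 1 within \<Omega>'"
    unfolding \<Omega>'_def by (rule at_within_nhd[of _ "ball 1 (min \<delta> \<delta>\<^sub>1)"]) (use K \<delta>\<^sub>1 in auto)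
  have \<Omega>': "z \<in> \<Omega>" "cmod (z - 1) < \<delta>" "cmod (z - 1) < \<delta>\<^sub>1" "z \<in> ball 0 1" if "z \<in> \<Omega>'" for z
    using that region_subset by (auto simp: \<Omega>'_def dist_norm norm_minus_commute)
  obtain s where s: "\<And>n. s n \<in> \<Omega>" "s \<longlonglongrightarrow> (1::complex)" using region_sequence by metis
  have filter_seq: "filterlim X (at 1 within \<Omega>) sequentially"
    if "\<And>n. X n \<in> \<Omega>" "X \<longlonglongrightarrow> (1::complex)" for X
  proof -
    have "X n \<noteq> 1" for n using that(1) one_notin_region by metis
    thus ?thesis using that by (simp add: filterlim_at)
  qed
  \<comment> \<open>The limit is known only for nodes other than 1; the value 0 on the null set of
    the others keeps H measurable.\<close>
  define H where "H x = (if e x = 1 then 0 else Lim (at 1 within \<Omega>) (\<lambda>z. h z x))" for x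
  have H: "((\<lambda>z. h z x) \<longlongrightarrow> H x) (at 1 within \<Omega>)" if "e x \<noteq> 1" for x
    using h_limit[OF that] tendsto_Lim[OF at_one_nontrivial] that unfolding H_def by metis
  have h_meas [measurable]: "h z \<in> borel_measurable M" if "z \<in> \<Omega>" for z
    using bdd_h[of z] that region_subset by (auto dest: bdd_measurable)
  have H_meas [measurable]: "H \<in> borel_measurable M"
  proof (rule borel_measurable_LIMSEQ_metric[where f = "\<lambda>n x. if e x = 1 then 0 else h (s n) x"])
    show "(\<lambda>x. if e x = 1 then 0 else h (s n) x) \<in> borel_measurable M" for n
      using h_meas[OF s(1)] by measurable
    show "(\<lambda>n. if e x = 1 then 0 else h (s n) x) \<longlonglongrightarrow> H x" for x
      using filterlim_compose[OF H filter_seq[OF s]] by (cases "e x = 1") (auto simp: H_def)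
  qed
  have H_bound: "cmod (H x) \<le> K / u x 1 ^ (m + 1)" if "e x \<noteq> 1" for x
  proof (rule tendsto_le[OF at_one_nontrivial])
    show "((\<lambda>z. cmod (h z x)) \<longlongrightarrow> cmod (H x)) (at 1 within \<Omega>)" by (intro tendsto_intros H that)
    show "((\<lambda>z. K / u x z ^ (m + 1)) \<longlongrightarrow> K / u x 1 ^ (m + 1)) (at 1 within \<Omega>)"
      using u_1_pos[OF that] by (intro tendsto_intros tendsto_u) auto
    show "\<forall>\<^sub>F z in at 1 within \<Omega>. cmod (h z x) \<le> K / u x z ^ (m + 1)"
      unfolding eventually_at using K(2) hK by (intro exI[of _ \<delta>]) (auto simp: dist_norm)
  qed
  define ind where "ind z x = (indicator (sector z) (e x) :: real)" for z x
  have ind_meas [measurable]: "ind z \<in> borel_measurable M" for z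
    unfolding ind_def by measurable
  \<comment> \<open>What remains of \<open>|h z - H|^2\<close> after the tail is split off; it has
    an integrable majorant and tends to 0 almost everywhere.\<close>
  define g where "g z x = 2 * ind z x * (cmod (H x))\<^sup>2 + (1 - ind z x) * (cmod (h z x - H x))\<^sup>2" for z x
  define D where "D z = (\<integral>\<^sup>+x. ennreal ((cmod (h z x - H x))\<^sup>2) \<partial>M)" for z
  have ptwise: "(cmod (h z x - H x))\<^sup>2 \<le> 2 * K\<^sup>2 * (ind z x * (1 / u x z ^ (2*m+2))) + g z x"
    if z: "z \<in> \<Omega>'" for z x
  proof (cases "e x \<in> sector z")
    case True
    have "(cmod (h z x - H x))\<^sup>2 \<le> (cmod (h z x) + cmod (H x))\<^sup>2"
      by (intro power_mono norm_triangle_ineq4) auto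
    also have "\<dots> \<le> 2 * (cmod (h z x))\<^sup>2 + 2 * (cmod (H x))\<^sup>2"
      using sum_squares_bound[of "cmod (h z x)" "cmod (H x)"] by (simp add: power2_sum)
    also have "(cmod (h z x))\<^sup>2 \<le> (K / u x z ^ (m + 1))\<^sup>2" using hK[of z x] \<Omega>'[OF z] by (intro power_mono) auto
    also have "\<dots> = K\<^sup>2 * (1 / u x z ^ (2*m+2))" unfolding power_divide square_power by simp
    finally show ?thesis using True by (simp add: g_def ind_def)
  qed (simp add: g_def ind_def)
  have D_le: "D z \<le> ennreal (2 * K\<^sup>2) * tail z + (\<integral>\<^sup>+x. ennreal (g z x) \<partial>M)" if z: "z \<in> \<Omega>'" for z
  proof -
    have [measurable]: "h z \<in> borel_measurable M" using h_meas \<Omega>'[OF z] by auto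
    have "D z \<le> (\<integral>\<^sup>+x. ennreal (2 * K\<^sup>2) * (indicator (sector z) (e x) * ennreal (1 / u x z ^ (2*m+2))) + ennreal (g z x) \<partial>M)"
      unfolding D_def
    proof (rule nn_integral_mono)
      fix x
      have "ennreal ((cmod (h z x - H x))\<^sup>2) \<le> ennreal (2 * K\<^sup>2 * (ind z x * (1 / u x z ^ (2*m+2))) + g z x)"
        by (intro ennreal_leI ptwise z)
      also have "\<dots> = ennreal (2 * K\<^sup>2) * (ennreal (ind z x) * ennreal (1 / u x z ^ (2*m+2))) + ennreal (g z x)"
      proof -
        have q: "1 / u x z ^ (2*m+2) \<ge> 0" using u_pos[OF \<Omega>'(4)[OF z], of x] by simp
        have i: "ind z x \<ge> 0" "ind z x \<le> 1" by (auto simp: ind_def indicator_def)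
        hence "g z x \<ge> 0" by (simp add: g_def)
        thus ?thesis
          using ennreal_mult''[OF q, of "ind z x"] ennreal_mult''[OF mult_nonneg_nonneg[OF i(1) q], of "2 * K\<^sup>2"] i q
          by (subst ennreal_plus) auto
      qed
      finally show "ennreal ((cmod (h z x - H x))\<^sup>2) \<le>
         ennreal (2 * K\<^sup>2) * (indicator (sector z) (e x) * ennreal (1 / u x z ^ (2*m+2))) + ennreal (g z x)"
        by (simp add: ind_def ennreal_indicator)
    qed
    also have "\<dots> = (\<integral>\<^sup>+x. ennreal (2 * K\<^sup>2) * (indicator (sector z) (e x) * ennreal (1 / u x z ^ (2*m+2))) \<partial>M) + (\<integral>\<^sup>+x. ennreal (g z x) \<partial>M)"
      unfolding g_def by (rule nn_integral_add) measurable
    also have "(\<integral>\<^sup>+x. ennreal (2 * K\<^sup>2) * (indicator (sector z) (e x) * ennreal (1 / u x z ^ (2*m+2))) \<partial>M) = ennreal (2 * K\<^sup>2) * tail z"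
      unfolding tail_def by (rule nn_integral_cmult) measurable
    finally show ?thesis .
  qed
  have g_lim: "((\<lambda>z. \<integral>\<^sup>+x. ennreal (g z x) \<partial>M) \<longlongrightarrow> 0) (at 1 within \<Omega>')"
    unfolding tendsto_at_iff_sequentially o_def
  proof (intro allI impI)
    fix X :: "nat \<Rightarrow> complex" assume X: "\<forall>i. X i \<in> \<Omega>' - {1}" "X \<longlonglongrightarrow> 1"
    have X': "X i \<in> \<Omega>'" "X i \<in> \<Omega>" for i using X \<Omega>' by auto
    have fl: "filterlim X (at 1 within \<Omega>) sequentially" by (rule filter_seq[OF X'(2) X(2)])
    \<comment> \<open>The first summand covers nodes in the sector. Outside it \<open>h\<close> is
      at most \<open>7 ^ (m + 1) * K\<close> and H at most K, both times
      \<open>1 / u x 1 ^ (m + 1)\<close>.\<close>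
    define L where "L = 2 * K\<^sup>2 + (7 ^ (m + 1) * K + K)\<^sup>2"
    have "(\<lambda>i. \<integral>\<^sup>+x. ennreal (g (X i) x) \<partial>M) \<longlonglongrightarrow> (\<integral>\<^sup>+x. 0 \<partial>M)"
    proof (rule nn_integral_dominated_convergence[where w = "\<lambda>x. ennreal L * ennreal (1 / u x 1 ^ (2*m+2))"])
      show "(\<lambda>x. ennreal (g (X i) x)) \<in> borel_measurable M" for i
        using h_meas[OF X'(2)] unfolding g_def by measurable
      show "(\<lambda>x. ennreal L * ennreal (1 / u x 1 ^ (2*m+2))) \<in> borel_measurable M" by measurable
      show "AE x in M. ennreal (g (X i) x) \<le> ennreal L * ennreal (1 / u x 1 ^ (2*m+2))" for i
        using AE_e_neq_1
      proof eventually_elim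
        case (elim x)
        define v where "v = u x 1"
        have v: "v > 0" using u_1_pos elim by (simp add: v_def)
        have HL: "(cmod (H x))\<^sup>2 \<le> (K / v ^ (m + 1))\<^sup>2"
          using H_bound[OF elim] by (intro power_mono) (auto simp: v_def)
        have "g (X i) x \<le> L * (1 / v ^ (2*m+2))"
        proof (cases "e x \<in> sector (X i)")
          case True
          have "g (X i) x \<le> 2 * (K / v ^ (m + 1))\<^sup>2" using True HL by (simp add: g_def ind_def)
          also have "\<dots> = 2 * K\<^sup>2 * (1 / v ^ (2*m+2))" unfolding power_divide square_power by simp
          also have "\<dots> \<le> L * (1 / v ^ (2*m+2))" using v by (intro mult_right_mono) (auto simp: L_def)
          finally show ?thesis .
        next
          case False
          have "v \<le> 7 * u x (X i)" unfolding v_def using \<Omega>'[OF X'(1)] False by (intro \<delta>\<^sub>1(2)) auto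
          hence "v ^ (m + 1) \<le> 7 ^ (m + 1) * u x (X i) ^ (m + 1)"
            using v by (metis power_mono power_mult_distrib less_imp_le)
          hence "K * v ^ (m + 1) \<le> 7 ^ (m + 1) * K * u x (X i) ^ (m + 1)" using K(1) by simp
          hence "K / u x (X i) ^ (m + 1) \<le> 7 ^ (m + 1) * K / v ^ (m + 1)"
            using v u_pos[OF \<Omega>'(4)[OF X'(1)], of x i] by (subst frac_le_eq) (auto simp: divide_le_0_iff)
          hence "cmod (h (X i) x) \<le> 7 ^ (m + 1) * K / v ^ (m + 1)"
            using hK[of "X i" x] \<Omega>'[OF X'(1)] by force
          hence "cmod (h (X i) x - H x) \<le> (7 ^ (m + 1) * K + K) / v ^ (m + 1)"
            using H_bound[OF elim] norm_triangle_ineq4[of "h (X i) x" "H x"]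
            unfolding add_divide_distrib v_def by linarith
          hence "(cmod (h (X i) x - H x))\<^sup>2 \<le> ((7 ^ (m + 1) * K + K) / v ^ (m + 1))\<^sup>2" by (intro power_mono) auto
          hence "g (X i) x \<le> (7 ^ (m + 1) * K + K)\<^sup>2 * (1 / v ^ (2*m+2))"
            using False unfolding power_divide square_power by (simp add: g_def ind_def)
          also have "\<dots> \<le> L * (1 / v ^ (2*m+2))" using v by (intro mult_right_mono) (auto simp: L_def)
          finally show ?thesis .
        qed
        thus ?case using v by (subst ennreal_mult[symmetric]) (auto intro: ennreal_leI simp: L_def v_def)
      qed
      have "(\<integral>\<^sup>+x. ennreal L * ennreal (1 / u x 1 ^ (2*m+2)) \<partial>M) = ennreal L * Q 1"
        unfolding Q_def by (rule nn_integral_cmult) measurable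
      also have "\<dots> < \<infinity>" using Q_1_le by (simp add: ennreal_mult_less_top) (meson ennreal_less_top le_less_trans)
      finally show "(\<integral>\<^sup>+x. ennreal L * ennreal (1 / u x 1 ^ (2*m+2)) \<partial>M) < \<infinity>" .
      show "AE x in M. (\<lambda>i. ennreal (g (X i) x)) \<longlonglongrightarrow> 0"
        using AE_e_neq_1
      proof eventually_elim
        case (elim x)
        have "\<forall>\<^sub>F i in sequentially. e x \<notin> sector (X i)"
          using eventually_compose_filterlim[OF eventually_notin_sector_region fl] .
        hence ev: "\<forall>\<^sub>F i in sequentially. (cmod (h (X i) x - H x))\<^sup>2 = g (X i) x"
          by eventually_elim (simp add: g_def ind_def)
        have "(\<lambda>i. (cmod (h (X i) x - H x))\<^sup>2) \<longlonglongrightarrow> (cmod (H x - H x))\<^sup>2"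
          by (intro tendsto_intros filterlim_compose[OF H[OF elim] fl])
        hence "(\<lambda>i. g (X i) x) \<longlonglongrightarrow> 0" using Lim_transform_eventually[OF _ ev] by simp
        thus ?case using tendsto_ennrealI by fastforce
      qed
    qed auto
    thus "(\<lambda>i. \<integral>\<^sup>+x. ennreal (g (X i) x) \<partial>M) \<longlonglongrightarrow> 0" by simp
  qed
  have "((\<lambda>z. ennreal (2 * K\<^sup>2) * tail z + (\<integral>\<^sup>+x. ennreal (g z x) \<partial>M)) \<longlongrightarrow> ennreal (2 * K\<^sup>2) * 0 + 0) (at 1 within \<Omega>)"
    using tail g_lim unfolding at_eq[symmetric]
    by (intro tendsto_add ennreal_tendsto_cmult) auto
  hence lim: "((\<lambda>z. ennreal (2 * K\<^sup>2) * tail z + (\<integral>\<^sup>+x. ennreal (g z x) \<partial>M)) \<longlongrightarrow> 0) (at 1 within \<Omega>')"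
    unfolding at_eq by simp
  show norm_cauchy
    unfolding norm_cauchy_def
  proof (intro allI impI)
    fix \<eta> :: real assume \<eta>: "\<eta> > 0"
    \<comment> \<open>The bound \<eta>^2 / 4 enters twice, each time with the factor 2 from squaring
      a sum.\<close>
    have "\<forall>\<^sub>F z in at 1 within \<Omega>'. ennreal (2 * K\<^sup>2) * tail z + (\<integral>\<^sup>+x. ennreal (g z x) \<partial>M) < ennreal (\<eta>\<^sup>2 / 4)"
      using order_tendstoD(2)[OF lim, of "ennreal (\<eta>\<^sup>2 / 4)"] \<eta> by simp
    then obtain \<delta>\<^sub>2 where \<delta>\<^sub>2: "\<delta>\<^sub>2 > 0" "\<And>z. z \<in> \<Omega>' \<Longrightarrow> z \<noteq> 1 \<Longrightarrow> cmod (z - 1) < \<delta>\<^sub>2 \<Longrightarrow>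
       ennreal (2 * K\<^sup>2) * tail z + (\<integral>\<^sup>+x. ennreal (g z x) \<partial>M) < ennreal (\<eta>\<^sup>2 / 4)"
      unfolding eventually_at dist_norm by metis
    have D_small: "D z \<le> ennreal (\<eta>\<^sup>2 / 4)" if "z \<in> \<Omega>'" "cmod (z - 1) < \<delta>\<^sub>2" for z
    proof -
      have "z \<noteq> 1" using that \<Omega>' one_notin_region by metis
      thus ?thesis using D_le[OF that(1)] \<delta>\<^sub>2(2)[OF that(1) _ that(2)] by (meson le_less_trans less_imp_le)
    qed
    have "nrm (\<lambda>x. h z x - h z' x) \<le> \<eta>"
      if z: "z \<in> \<Omega>" "cmod (z - 1) < min \<delta>\<^sub>2 (min \<delta> \<delta>\<^sub>1)" and z': "z' \<in> \<Omega>" "cmod (z' - 1) < min \<delta>\<^sub>2 (min \<delta> \<delta>\<^sub>1)" for z z'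
    proof -
      have in': "z \<in> \<Omega>'" "z' \<in> \<Omega>'" using z z' by (auto simp: \<Omega>'_def dist_norm norm_minus_commute)
      note [measurable] = h_meas[OF z(1)] h_meas[OF z'(1)]
      have "ennreal ((nrm (\<lambda>x. h z x - h z' x))\<^sup>2) = (\<integral>\<^sup>+x. ennreal ((cmod (h z x - h z' x))\<^sup>2) \<partial>M)"
        by (rule nrm_sq_ennreal) (intro bdd_diff bdd_h \<Omega>'(4) in')
      also have "\<dots> \<le> (\<integral>\<^sup>+x. ennreal 2 * ennreal ((cmod (h z x - H x))\<^sup>2) + ennreal 2 * ennreal ((cmod (h z' x - H x))\<^sup>2) \<partial>M)"
      proof (rule nn_integral_mono)
        fix x
        have "(cmod (h z x - h z' x))\<^sup>2 \<le> (cmod (h z x - H x) + cmod (h z' x - H x))\<^sup>2"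
          using norm_triangle_ineq4[of "h z x - H x" "h z' x - H x"] by (intro power_mono) auto
        also have "\<dots> \<le> 2 * (cmod (h z x - H x))\<^sup>2 + 2 * (cmod (h z' x - H x))\<^sup>2"
          using sum_squares_bound[of "cmod (h z x - H x)" "cmod (h z' x - H x)"] by (simp add: power2_sum)
        finally show "ennreal ((cmod (h z x - h z' x))\<^sup>2) \<le> ennreal 2 * ennreal ((cmod (h z x - H x))\<^sup>2) + ennreal 2 * ennreal ((cmod (h z' x - H x))\<^sup>2)"
          by (simp add: ennreal_mult'[symmetric] ennreal_leI flip: ennreal_plus ennreal_numeral)
      qed
      also have "\<dots> = ennreal 2 * D z + ennreal 2 * D z'"
        unfolding D_def by (subst nn_integral_add; (measurable)?) (subst (1 2) nn_integral_cmult; (measurable)?)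
      also have "\<dots> \<le> ennreal 2 * ennreal (\<eta>\<^sup>2 / 4) + ennreal 2 * ennreal (\<eta>\<^sup>2 / 4)"
        using z z' by (intro add_mono mult_left_mono D_small in') auto
      also have "\<dots> = ennreal (\<eta>\<^sup>2)"
        by (subst (1 2) ennreal_mult[symmetric], simp_all, subst ennreal_plus[symmetric]) auto
      finally have "(nrm (\<lambda>x. h z x - h z' x))\<^sup>2 \<le> \<eta>\<^sup>2" by (subst (asm) ennreal_le_iff) auto
      thus ?thesis by (rule power2_le_imp_le) (use \<eta> in simp)
    qed
    thus "\<exists>\<delta>>0. \<forall>z\<in>\<Omega>. \<forall>z'\<in>\<Omega>. cmod (z - 1) < \<delta> \<longrightarrow> cmod (z' - 1) < \<delta> \<longrightarrow> nrm (\<lambda>x. h z x - h z' x) \<le> \<eta>"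
      using K \<delta>\<^sub>1 \<delta>\<^sub>2 by (intro exI[of _ "min \<delta>\<^sub>2 (min \<delta> \<delta>\<^sub>1)"]) auto
  qed
qed

theorem Hb_norm_tendsto_iff_tail:
  "((\<lambda>z. Hb_norm b (\<lambda>w. dkb b m z w - dkb1 b m \<Omega> w)) \<longlongrightarrow> 0) (at 1 within \<Omega>)
     \<longleftrightarrow> (tail \<longlongrightarrow> 0) (at 1 within \<Omega>)"
  unfolding Hb_norm_tendsto_iff_cauchy using cauchy_imp_tail tail_imp_cauchy by blast

end

section \<open>Blaschke products\<close>

text \<open>For \<open>cmod a = 1\<close> the factor is identically 1, so a sequence in the closed disc with
  \<open>cmod (a n) = 1\<close> for the unused indices also describes finitely many zeros.\<close>

definition blaschke_factor :: "complex \<Rightarrow> complex \<Rightarrow> complex" where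
  "blaschke_factor a z = (if a = 0 then z else of_real (cmod a) / a * ((a - z) / (1 - cnj a * z)))"

definition blaschke_partial :: "(nat \<Rightarrow> complex) \<Rightarrow> nat \<Rightarrow> complex \<Rightarrow> complex" where
  "blaschke_partial a n z = (\<Prod>i<n. blaschke_factor (a i) z)"

definition blaschke :: "(nat \<Rightarrow> complex) \<Rightarrow> complex \<Rightarrow> complex" where
  "blaschke a z = lim (\<lambda>n. blaschke_partial a n z)"

lemma one_minus_cnj_mult_bounds:
  assumes "cmod a \<le> 1" "cmod z < 1"
  shows "1 - cmod z \<le> cmod (1 - cnj a * z)" "cmod (1 - cnj a * z) \<le> 2" "1 - cnj a * z \<noteq> 0"
proof -
  have "cmod (cnj a * z) \<le> 1 * cmod z"
    unfolding norm_mult complex_mod_cnj by (intro mult_right_mono assms) auto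
  thus *: "1 - cmod z \<le> cmod (1 - cnj a * z)" and "cmod (1 - cnj a * z) \<le> 2"
    using norm_triangle_ineq2[of 1 "cnj a * z"] norm_triangle_ineq4[of 1 "cnj a * z"] assms(2) by auto
  show "1 - cnj a * z \<noteq> 0" using * assms(2) by auto
qed

lemma blaschke_factor_holomorphic:
  assumes "cmod a \<le> 1" shows "blaschke_factor a holomorphic_on ball 0 1"
proof (cases "a = 0")
  case False
  have "(\<lambda>z. of_real (cmod a) / a * ((a - z) / (1 - cnj a * z))) holomorphic_on ball 0 1"
    using one_minus_cnj_mult_bounds(3)[OF assms] by (intro holomorphic_intros) auto
  thus ?thesis using False by (simp add: blaschke_factor_def[abs_def])
qed (simp add: blaschke_factor_def[abs_def])

text \<open>After division by \<open>1 - w * cnj z\<close> this is the rank-one kernel of a single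
  factor. It supplies the node a and the weight \<open>1 - |a|^2\<close> of the model
  measure.\<close>

lemma blaschke_factor_kernel:
  assumes "cmod a \<le> 1" "cmod z < 1" "cmod w < 1"
  shows "1 - blaschke_factor a w * cnj (blaschke_factor a z)
     = of_real (1 - (cmod a)\<^sup>2) * (1 - w * cnj z) / ((1 - cnj a * w) * cnj (1 - cnj a * z))"
proof (cases "a = 0")
  case False
  define s where "s = complex_of_real (cmod a) / a"
  have s: "s * cnj s = 1"
    using False by (simp add: s_def complex_norm_square[symmetric] power2_eq_square flip: of_real_mult)
  have nz: "1 - cnj a * w \<noteq> 0" "1 - a * cnj z \<noteq> 0"
    using one_minus_cnj_mult_bounds(3)[OF assms(1,3)] one_minus_cnj_mult_bounds(3)[OF assms(1,2)]
    by (metis, metis complex_cnj_cancel_iff complex_cnj_cnj complex_cnj_diff complex_cnj_mult complex_cnj_one complex_cnj_zero)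
  have "blaschke_factor a w * cnj (blaschke_factor a z)
      = (s * cnj s) * ((a - w) / (1 - cnj a * w) * ((cnj a - cnj z) / (1 - a * cnj z)))"
  proof -
    have fac: "blaschke_factor a x = s * ((a - x) / (1 - cnj a * x))" for x
      using False by (simp add: blaschke_factor_def s_def)
    show ?thesis
      by (simp only: fac complex_cnj_mult complex_cnj_divide complex_cnj_diff complex_cnj_cnj complex_cnj_one mult_ac)
  qed
  also have "\<dots> = (a - w) * (cnj a - cnj z) / ((1 - cnj a * w) * (1 - a * cnj z))" unfolding s by simp
  finally have "1 - blaschke_factor a w * cnj (blaschke_factor a z)
     = ((1 - cnj a * w) * (1 - a * cnj z) - (a - w) * (cnj a - cnj z)) / ((1 - cnj a * w) * (1 - a * cnj z))"
    using nz by (simp add: diff_divide_distrib)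
  also have "(1 - cnj a * w) * (1 - a * cnj z) - (a - w) * (cnj a - cnj z) = (1 - a * cnj a) * (1 - w * cnj z)"
    by (simp add: algebra_simps)
  also have "1 - a * cnj a = of_real (1 - (cmod a)\<^sup>2)" by (simp add: complex_norm_square del: of_real_power)
  finally show ?thesis by simp
qed (simp add: blaschke_factor_def)

lemma blaschke_factor_le_1:
  assumes "cmod a \<le> 1" "cmod z < 1" shows "cmod (blaschke_factor a z) \<le> 1"
proof -
  let ?d = "cmod (1 - cnj a * z)"
  have "complex_of_real (1 - (cmod (blaschke_factor a z))\<^sup>2)
      = of_real (1 - (cmod a)\<^sup>2) * of_real (1 - (cmod z)\<^sup>2) / of_real (?d\<^sup>2)"
    using blaschke_factor_kernel[OF assms(1,2,2)] unfolding of_real_diff complex_norm_square by simp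
  also have "\<dots> = of_real ((1 - (cmod a)\<^sup>2) * (1 - (cmod z)\<^sup>2) / ?d\<^sup>2)" by simp
  finally have "1 - (cmod (blaschke_factor a z))\<^sup>2 = (1 - (cmod a)\<^sup>2) * (1 - (cmod z)\<^sup>2) / ?d\<^sup>2"
    by (simp only: of_real_eq_iff)
  moreover have "(1 - (cmod a)\<^sup>2) * (1 - (cmod z)\<^sup>2) / ?d\<^sup>2 \<ge> 0"
    using assms by (intro divide_nonneg_nonneg mult_nonneg_nonneg) (auto simp: power_le_one)
  ultimately have "(cmod (blaschke_factor a z))\<^sup>2 \<le> 1\<^sup>2" by simp
  thus ?thesis by (rule power2_le_imp_le) simp
qed

text \<open>The bound is linear in \<open>1 - |a|\<close>, so the Blaschke condition gives a
  convergent majorant for the product on each smaller disc.\<close>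

lemma blaschke_factor_minus_1:
  assumes "cmod a \<le> 1" "cmod z < 1"
  shows "cmod (blaschke_factor a z - 1) \<le> 2 / (1 - cmod z) * (1 - cmod a)"
proof (cases "a = 0")
  case True
  have "cmod (z - 1) \<le> 2" using norm_triangle_ineq4[of z 1] assms by simp
  also have "2 \<le> 2 / (1 - cmod z)" using assms by (simp add: field_simps)
  finally show ?thesis using True by (simp add: blaschke_factor_def)
next
  case False
  note nz = one_minus_cnj_mult_bounds[OF assms]
  define \<rho> where "\<rho> = complex_of_real (cmod a)"
  have aa: "a * cnj a = \<rho> * \<rho>" by (simp add: \<rho>_def complex_norm_square[symmetric] power2_eq_square)
  have num: "\<rho> * (a - z) - a * (1 - cnj a * z) = (\<rho> - 1) * (a + \<rho> * z)"
  proof -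
    have 1: "a * (1 - cnj a * z) = a - (a * cnj a) * z" by (simp add: algebra_simps)
    show ?thesis unfolding 1 aa by (simp add: algebra_simps)
  qed
  have "blaschke_factor a z - 1 = (\<rho> * (a - z) - a * (1 - cnj a * z)) / (a * (1 - cnj a * z))"
  proof -
    have "r / c * (n / d) - 1 = (r * n - c * d) / (c * d)" if "c \<noteq> 0" "d \<noteq> 0" for r c n d :: complex
      using that by (simp add: field_simps)
    from this[OF False nz(3), of \<rho> "a - z"] show ?thesis
      unfolding blaschke_factor_def \<rho>_def if_not_P[OF False] .
  qed
  also have "cmod \<dots> = (1 - cmod a) * (cmod (a + \<rho> * z) / cmod a) / cmod (1 - cnj a * z)"
  proof -
    have "cmod (\<rho> - 1) = 1 - cmod a"
    proof -
      have "\<rho> - 1 = of_real (cmod a - 1)" by (simp add: \<rho>_def)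
      thus ?thesis using assms(1) by (simp only: norm_of_real)
    qed
    thus ?thesis unfolding num by (simp add: norm_mult norm_divide)
  qed
  also have "\<dots> \<le> (1 - cmod a) * 2 / (1 - cmod z)"
  proof (intro frac_le mult_left_mono)
    have "cmod (a + \<rho> * z) \<le> cmod a + cmod a * cmod z"
      using norm_triangle_ineq[of a "\<rho> * z"] by (simp add: \<rho>_def norm_mult)
    also have "\<dots> \<le> cmod a + cmod a * 1" using assms by (intro add_mono mult_left_mono) auto
    finally show "cmod (a + \<rho> * z) / cmod a \<le> 2" using False by (simp add: field_simps)
  qed (use assms nz in auto)
  finally show ?thesis by (simp add: mult.commute)
qed

lemma blaschke_factor_deriv:
  assumes a: "cmod a \<le> 1" and z: "cmod z < 1" "z \<noteq> a"
  shows "deriv (blaschke_factor a) z = blaschke_factor a z * (1 / (z - a) + cnj a / (1 - cnj a * z))"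
proof (cases "a = 0")
  case True thus ?thesis using z by (simp add: blaschke_factor_def[abs_def])
next
  case False
  note nz = one_minus_cnj_mult_bounds(3)[OF a z(1)]
  have fac_eq: "blaschke_factor a = (\<lambda>z. of_real (cmod a) / a * ((a - z) / (1 - cnj a * z)))"
    using False by (auto simp: blaschke_factor_def)
  have "((\<lambda>z. of_real (cmod a) / a * ((a - z) / (1 - cnj a * z))) has_field_derivative
     of_real (cmod a) / a * ((- 1 * (1 - cnj a * z) - (a - z) * (- cnj a)) / ((1 - cnj a * z) * (1 - cnj a * z)))) (at z)"
  proof (rule DERIV_cmult[OF DERIV_divide])
    show "((\<lambda>z. a - z) has_field_derivative - 1) (at z)" "((\<lambda>z. 1 - cnj a * z) has_field_derivative - cnj a) (at z)"
      by (auto intro!: derivative_eq_intros)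
  qed (fact nz)
  hence "deriv (\<lambda>z. of_real (cmod a) / a * ((a - z) / (1 - cnj a * z))) z
     = of_real (cmod a) / a * ((- 1 * (1 - cnj a * z) - (a - z) * (- cnj a)) / ((1 - cnj a * z) * (1 - cnj a * z)))"
    by (rule DERIV_imp_deriv)
  also have "(- 1 * (1 - cnj a * z) - (a - z) * (- cnj a)) / ((1 - cnj a * z) * (1 - cnj a * z))
     = (a - z) / (1 - cnj a * z) * (1 / (z - a) + cnj a / (1 - cnj a * z))"
    using nz z(2) by (simp add: divide_simps) (simp add: algebra_simps)
  finally show ?thesis unfolding fac_eq mult.assoc .
qed

lemma cmod_blaschke_factor:
  assumes "cmod a \<le> 1"
  shows "cmod (blaschke_factor a z) = cmod (a - z) / cmod (1 - cnj a * z)"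
  by (auto simp: blaschke_factor_def norm_mult norm_divide)

text \<open>With \<open>U = 1 / (a - z)\<close> and \<open>V = cnj a / (1 - cnj a z)\<close> one has
  \<open>V - U = - (1 - (cmod a)\<^sup>2) / ((a - z) (1 - cnj a z))\<close>, which yields the gain \<open>1 - (cmod a)\<^sup>2\<close>.\<close>

lemma blaschke_factor_logderiv_bound:
  assumes a: "cmod a \<le> 1" and z: "cmod z < 1" and half: "cmod (blaschke_factor a z) \<ge> 1/2"
  shows "cmod ((deriv ^^ k) (\<lambda>z. 1 / (z - a) + cnj a / (1 - cnj a * z)) z)
    \<le> fact (k + 1) * 2 ^ (k + 1) * ((1 - (cmod a)\<^sup>2) / cmod (1 - cnj a * z) ^ (k + 2))"
proof -
  define d where "d = cmod (1 - cnj a * z)"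
  note nz = one_minus_cnj_mult_bounds[OF a z]
  have d: "d > 0" using nz by (simp add: d_def)
  \<comment> \<open>The lower bound for the factor keeps z away from its zero, at a distance
    comparable to the distance d in the other denominator.\<close>
  have az: "d / 2 \<le> cmod (a - z)"
    using half d unfolding cmod_blaschke_factor[OF a] d_def[symmetric] by (simp add: field_simps)
  hence az0: "z - a \<noteq> 0" "a - z \<noteq> 0" using d by auto
  define U V where "U = 1 / (a - z)" and "V = cnj a / (1 - cnj a * z)"
  have "(\<lambda>z. 1 / (z - a)) holomorphic_on - {a}" "(\<lambda>z. cnj a / (1 - cnj a * z)) holomorphic_on {z. 1 - cnj a * z \<noteq> 0}"
    by (auto intro!: holomorphic_intros)
  moreover have op: "open {z. 1 - cnj a * z \<noteq> 0}" by (intro open_Collect_neq continuous_intros)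
  ultimately have "(deriv ^^ k) (\<lambda>z. 1 / (z - a) + cnj a / (1 - cnj a * z)) z
     = (deriv ^^ k) (\<lambda>z. 1 / (z - a)) z + (deriv ^^ k) (\<lambda>z. cnj a / (1 - cnj a * z)) z"
    using az0 nz(3) by (intro higher_deriv_add[of _ "- {a} \<inter> {z. 1 - cnj a * z \<noteq> 0}"])
      (auto elim: holomorphic_on_subset intro!: open_Int)
  also have "(deriv ^^ k) (\<lambda>z. 1 / (z - a)) z = - (fact k * U ^ (k + 1))"
  proof -
    have "(\<lambda>z. 1 / (z - a)) = (\<lambda>z. 1 / (- a + 1 * z))" by auto
    moreover have "(- 1) ^ k * fact k / (z - a) ^ (k + 1) = - (fact k * U ^ (k + 1))"
    proof -
      have "z - a = - (a - z)" by simp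
      hence "(z - a) ^ (k + 1) = (- 1) ^ (k + 1) * (a - z) ^ (k + 1)" by (metis power_minus)
      thus ?thesis by (simp add: U_def power_one_over divide_simps)
    qed
    ultimately show ?thesis using higher_deriv_inverse_linear[of "- a" 1 z k] az0(1) by simp
  qed
  also have "(deriv ^^ k) (\<lambda>z. cnj a / (1 - cnj a * z)) z = fact k * V ^ (k + 1)"
  proof -
    have "(\<lambda>z. cnj a / (1 - cnj a * z)) = (\<lambda>z. cnj a * (1 / (1 + (- cnj a) * z)))" by auto
    moreover have "(deriv ^^ k) (\<lambda>z. cnj a * (1 / (1 + (- cnj a) * z))) z = cnj a * (deriv ^^ k) (\<lambda>z. 1 / (1 + (- cnj a) * z)) z"
      using op nz(3) by (intro higher_deriv_cmult[of _ "{z. 1 - cnj a * z \<noteq> 0}"] holomorphic_intros) auto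
    ultimately show ?thesis using higher_deriv_inverse_linear[of 1 "- cnj a" z k] nz(3)
      by (simp add: V_def power_divide)
  qed
  finally have eq: "(deriv ^^ k) (\<lambda>z. 1 / (z - a) + cnj a / (1 - cnj a * z)) z = fact k * (V ^ (k + 1) - U ^ (k + 1))"
    by (simp add: algebra_simps)
  have "V - U = - of_real (1 - (cmod a)\<^sup>2) / ((a - z) * (1 - cnj a * z))"
    using az0 nz(3) unfolding U_def V_def of_real_diff complex_norm_square by (simp add: divide_simps) (simp add: algebra_simps)
  also have "cmod \<dots> = (1 - (cmod a)\<^sup>2) / (cmod (a - z) * d)"
  proof -
    have "(cmod a)\<^sup>2 \<le> 1" using a by (simp add: power_le_one)
    thus "cmod (- of_real (1 - (cmod a)\<^sup>2) / ((a - z) * (1 - cnj a * z))) = (1 - (cmod a)\<^sup>2) / (cmod (a - z) * d)"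
      unfolding norm_divide norm_minus_cancel norm_mult norm_of_real d_def by simp
  qed
  also have "\<dots> \<le> (1 - (cmod a)\<^sup>2) / (d / 2 * d)"
    using az d a by (intro divide_left_mono mult_right_mono mult_pos_pos) (auto simp: power_le_one)
  also have "\<dots> = 2 * ((1 - (cmod a)\<^sup>2) / d\<^sup>2)"
  proof -
    have "A / (d / 2 * d) = 2 * (A / d\<^sup>2)" for A by (simp add: power2_eq_square)
    thus ?thesis .
  qed
  finally have VU: "cmod (V - U) \<le> 2 * ((1 - (cmod a)\<^sup>2) / d\<^sup>2)" .
  have U: "cmod U \<le> 2 / d" using az d az0 unfolding U_def norm_divide by (simp add: field_simps)
  have V: "cmod V \<le> 2 / d" using a d unfolding V_def norm_divide complex_mod_cnj d_def[symmetric]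
    by (intro divide_right_mono) auto
  \<comment> \<open>Factoring out \<open>V - U\<close> preserves the gain of
    \<open>1 - |a|^2\<close>, which estimating the two powers separately would lose.\<close>
  have "V ^ (k + 1) - U ^ (k + 1) = (V - U) * (\<Sum>i<k + 1. U ^ (k + 1 - Suc i) * V ^ i)"
    by (rule power_diff_sumr2)
  also have "cmod \<dots> \<le> cmod (V - U) * (\<Sum>i<k + 1. (2 / d) ^ (k + 1 - Suc i) * (2 / d) ^ i)"
    unfolding norm_mult using U V d
    by (intro mult_left_mono order_trans[OF norm_sum] sum_mono)
       (auto simp: norm_mult norm_power intro!: mult_mono power_mono)
  also have "(\<Sum>i<k + 1. (2 / d) ^ (k + 1 - Suc i) * (2 / d) ^ i) = (k + 1) * (2 / d) ^ k"
    by (simp add: power_add[symmetric])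
  also have "cmod (V - U) * ((k + 1) * (2 / d) ^ k) \<le> (2 * ((1 - (cmod a)\<^sup>2) / d\<^sup>2)) * ((k + 1) * (2 / d) ^ k)"
    using d by (intro mult_right_mono VU) auto
  also have "\<dots> = (k + 1) * 2 ^ (k + 1) * ((1 - (cmod a)\<^sup>2) / d ^ (k + 2))"
  proof -
    have "(2 * (A / d\<^sup>2)) * ((k + 1) * (2 / d) ^ k) = (k + 1) * 2 ^ (k + 1) * (A / d ^ (k + 2))" for A
      by (simp add: power_divide power2_eq_square mult_ac) (simp add: algebra_simps)
    thus ?thesis .
  qed
  finally have "fact k * cmod (V ^ (k + 1) - U ^ (k + 1)) \<le> fact k * ((k + 1) * 2 ^ (k + 1) * ((1 - (cmod a)\<^sup>2) / d ^ (k + 2)))"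
    by (intro mult_left_mono) auto
  thus ?thesis unfolding eq norm_mult d_def by (simp add: algebra_simps)
qed

text \<open>Induction through f' = f L and the Leibniz rule. The order of the quantifiers is the
  point: K depends only on n and D, hence serves all divisors simultaneously.\<close>

lemma higher_deriv_bound_of_logderiv:
  fixes D :: real
  shows "\<exists>K. \<forall>f L S z. open S \<longrightarrow> z \<in> S \<longrightarrow> f holomorphic_on S \<longrightarrow> L holomorphic_on S \<longrightarrow>
    (\<forall>w\<in>S. deriv f w = f w * L w) \<longrightarrow> cmod (f z) \<le> 1 \<longrightarrow> (\<forall>k<n. cmod ((deriv ^^ k) L z) \<le> D) \<longrightarrow>
    (\<forall>j\<le>n. cmod ((deriv ^^ j) f z) \<le> K)"
proof (induction n)
  case 0 show ?case by (intro exI[of _ 1]) auto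
next
  case (Suc n)
  obtain K where K: "\<forall>f L S z. open S \<longrightarrow> z \<in> S \<longrightarrow> f holomorphic_on S \<longrightarrow> L holomorphic_on S \<longrightarrow>
    (\<forall>w\<in>S. deriv f w = f w * L w) \<longrightarrow> cmod (f z) \<le> 1 \<longrightarrow> (\<forall>k<n. cmod ((deriv ^^ k) L z) \<le> D) \<longrightarrow>
    (\<forall>j\<le>n. cmod ((deriv ^^ j) f z) \<le> K)"
    using Suc.IH by (elim exE) (rule that)
  show ?case
  proof (intro exI[of _ "max K (\<Sum>i=0..n. real (n choose i) * K * D)"] allI impI)
    fix f L :: "complex \<Rightarrow> complex" and S z j
    assume *: "open S" "z \<in> S" "f holomorphic_on S" "L holomorphic_on S" "\<forall>w\<in>S. deriv f w = f w * L w"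
      "cmod (f z) \<le> 1" "\<forall>k<Suc n. cmod ((deriv ^^ k) L z) \<le> D" "j \<le> Suc n"
    have IH: "cmod ((deriv ^^ j) f z) \<le> K" if "j \<le> n" for j by (rule K[rule_format, of S z f L]) (use * that in auto)
    show "cmod ((deriv ^^ j) f z) \<le> max K (\<Sum>i=0..n. real (n choose i) * K * D)"
    proof (cases "j = Suc n")
      case True
      have "(deriv ^^ Suc n) f z = (deriv ^^ n) (deriv f) z" by (simp add: funpow_Suc_right del: funpow.simps)
      also have "\<dots> = (deriv ^^ n) (\<lambda>w. f w * L w) z"
        by (rule higher_deriv_cong_ev[OF _ refl])
           (use * in \<open>auto intro!: eventually_nhds[THEN iffD2] exI[of _ S]\<close>)
      also have "\<dots> = (\<Sum>i=0..n. of_nat (n choose i) * (deriv ^^ i) f z * (deriv ^^ (n - i)) L z)"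
        using * by (intro higher_deriv_mult[of _ S]) auto
      also have "cmod \<dots> \<le> (\<Sum>i=0..n. real (n choose i) * K * D)"
      proof (intro order_trans[OF norm_sum] sum_mono)
        fix i assume "i \<in> {0..n}"
        hence 1: "cmod ((deriv ^^ i) f z) \<le> K" "cmod ((deriv ^^ (n - i)) L z) \<le> D" using IH *(7) by auto
        moreover have "0 \<le> K" using order_trans[OF norm_ge_zero 1(1)] .
        ultimately show "cmod (of_nat (n choose i) * (deriv ^^ i) f z * (deriv ^^ (n - i)) L z) \<le> real (n choose i) * K * D"
          unfolding norm_mult norm_of_nat by (intro mult_mono) auto
      qed
      finally show ?thesis using True by simp
    qed (use IH * in \<open>auto simp: le_max_iff_disj\<close>)
  qed
qed

lemma blaschke_partial_holomorphic:
  assumes "\<And>n. cmod (a n) \<le> 1" shows "blaschke_partial a n holomorphic_on ball 0 1"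
  unfolding blaschke_partial_def[abs_def] by (intro holomorphic_intros blaschke_factor_holomorphic assms)

lemma blaschke_partial_le_1:
  assumes "\<And>n. cmod (a n) \<le> 1" "cmod z < 1" shows "cmod (blaschke_partial a n z) \<le> 1"
  unfolding blaschke_partial_def prod_norm[symmetric]
  by (intro prod_le_1) (use blaschke_factor_le_1[OF assms(1,2)] in auto)

lemma blaschke_partial_antimono:
  assumes "\<And>n. cmod (a n) \<le> 1" "cmod z < 1" "n \<le> k"
  shows "cmod (blaschke_partial a k z) \<le> cmod (blaschke_partial a n z)"
  using assms(3)
proof (induction k rule: dec_induct)
  case (step k)
  have "cmod (blaschke_partial a (Suc k) z) = cmod (blaschke_partial a k z) * cmod (blaschke_factor (a k) z)"
    by (simp add: blaschke_partial_def norm_mult)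
  also have "\<dots> \<le> cmod (blaschke_partial a k z) * 1"
    by (intro mult_left_mono blaschke_factor_le_1 assms) auto
  finally show ?case using step by simp
qed simp

lemma blaschke_partial_le_factor:
  assumes "\<And>n. cmod (a n) \<le> 1" "cmod z < 1" "i < n"
  shows "cmod (blaschke_partial a n z) \<le> cmod (blaschke_factor (a i) z)"
proof -
  have "cmod (blaschke_partial a n z) \<le> cmod (blaschke_partial a (Suc i) z)"
    using assms by (intro blaschke_partial_antimono) auto
  also have "\<dots> = cmod (blaschke_partial a i z) * cmod (blaschke_factor (a i) z)"
    by (simp add: blaschke_partial_def norm_mult)
  also have "\<dots> \<le> 1 * cmod (blaschke_factor (a i) z)"
    by (intro mult_right_mono blaschke_partial_le_1 assms) auto
  finally show ?thesis by simp
qed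

lemma blaschke_uniform_limit:
  assumes a: "\<And>n. cmod (a n) \<le> 1" and s: "summable (\<lambda>n. 1 - cmod (a n))" and r: "r < 1"
  shows "uniform_limit (cball 0 r) (blaschke_partial a) (blaschke a) sequentially"
proof -
  have "uniformly_convergent_on (cball 0 r) (\<lambda>N z. \<Prod>n<N. blaschke_factor (a n) z)"
  proof (rule uniformly_convergent_on_prod')
    have "cball 0 r \<subseteq> ball (0::complex) 1" using r by auto
    thus "continuous_on (cball 0 r) (blaschke_factor (a n))" for n
      using blaschke_factor_holomorphic[OF a] by (meson continuous_on_subset holomorphic_on_imp_continuous_on)
    show "uniformly_convergent_on (cball 0 r) (\<lambda>N z. \<Sum>n<N. cmod (blaschke_factor (a n) z - 1))"
    proof (rule Weierstrass_m_test')
      show "summable (\<lambda>n. 2 / (1 - r) * (1 - cmod (a n)))" by (intro summable_mult s)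
      fix n and z :: complex assume z: "z \<in> cball 0 r"
      have "cmod (blaschke_factor (a n) z - 1) \<le> 2 / (1 - cmod z) * (1 - cmod (a n))"
        using z r by (intro blaschke_factor_minus_1 a) auto
      also have "\<dots> \<le> 2 / (1 - r) * (1 - cmod (a n))"
        using z r a by (intro mult_right_mono frac_le) auto
      finally show "norm (cmod (blaschke_factor (a n) z - 1)) \<le> 2 / (1 - r) * (1 - cmod (a n))" by simp
    qed
  qed auto
  hence "uniformly_convergent_on (cball 0 r) (blaschke_partial a)"
    by (simp add: blaschke_partial_def[abs_def])
  thus ?thesis unfolding uniformly_convergent_uniform_limit_iff by (simp add: blaschke_def[abs_def])
qed

lemma blaschke_tendsto:
  assumes "\<And>n. cmod (a n) \<le> 1" "summable (\<lambda>n. 1 - cmod (a n))" "cmod z < 1"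
  shows "(\<lambda>n. blaschke_partial a n z) \<longlonglongrightarrow> blaschke a z"
  by (rule tendsto_uniform_limitI[OF blaschke_uniform_limit[OF assms]]) simp

lemma blaschke_holomorphic:
  assumes "\<And>n. cmod (a n) \<le> 1" "summable (\<lambda>n. 1 - cmod (a n))"
  shows "blaschke a holomorphic_on ball 0 1"
proof (rule holomorphic_uniform_sequence[OF open_ball blaschke_partial_holomorphic[OF assms(1)]])
  fix x :: complex assume x: "x \<in> ball 0 1"
  define d where "d = (1 - cmod x) / 2"
  have d: "d > 0" "cmod x + d < 1" using x by (auto simp: d_def field_simps)
  have sub: "cball x d \<subseteq> cball 0 (cmod x + d)"
  proof
    fix w assume "w \<in> cball x d"
    thus "w \<in> cball 0 (cmod x + d)" using norm_triangle_sub[of w x] by (simp add: dist_norm norm_minus_commute)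
  qed
  have "uniform_limit (cball x d) (blaschke_partial a) (blaschke a) sequentially"
    by (rule uniform_limit_on_subset[OF blaschke_uniform_limit[OF assms d(2)] sub])
  moreover have "cball 0 (cmod x + d) \<subseteq> ball (0::complex) 1" using d by auto
  with sub have "cball x d \<subseteq> ball 0 1" by (rule subset_trans)
  ultimately show "\<exists>d>0. cball x d \<subseteq> ball 0 1 \<and> uniform_limit (cball x d) (blaschke_partial a) (blaschke a) sequentially"
    using d by blast
qed

lemma blaschke_le_partial:
  assumes "\<And>n. cmod (a n) \<le> 1" "summable (\<lambda>n. 1 - cmod (a n))" "cmod z < 1"
  shows "cmod (blaschke a z) \<le> cmod (blaschke_partial a n z)"
proof (rule LIMSEQ_le_const2)
  show "(\<lambda>k. cmod (blaschke_partial a k z)) \<longlonglongrightarrow> cmod (blaschke a z)"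
    by (intro tendsto_norm blaschke_tendsto assms)
  show "\<exists>N. \<forall>k\<ge>N. cmod (blaschke_partial a k z) \<le> cmod (blaschke_partial a n z)"
    by (intro exI[of _ n] allI impI blaschke_partial_antimono assms(1,3))
qed

lemma blaschke_le_1:
  assumes "\<And>n. cmod (a n) \<le> 1" "summable (\<lambda>n. 1 - cmod (a n))" "cmod z < 1"
  shows "cmod (blaschke a z) \<le> 1"
  by (rule order_trans[OF blaschke_le_partial[where n = 0] blaschke_partial_le_1]) (use assms in auto)

text \<open>The products \<open>P n\<close> of two partial products telescope, and each difference
  is the kernel of one factor weighted by the preceding partial products.\<close>

lemma blaschke_kernel_sums:
  assumes a: "\<And>n. cmod (a n) \<le> 1" "summable (\<lambda>n. 1 - cmod (a n))" and z: "cmod z < 1" and w: "cmod w < 1"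
  shows "(\<lambda>n. of_real (1 - (cmod (a n))\<^sup>2) * (blaschke_partial a n w / (1 - cnj (a n) * w)
     * cnj (blaschke_partial a n z / (1 - cnj (a n) * z)))) sums
     ((1 - blaschke a w * cnj (blaschke a z)) / (1 - w * cnj z))"
proof -
  have nz: "1 - w * cnj z \<noteq> 0"
    using one_minus_cnj_mult_bounds(3)[of z w] z w by (simp add: mult.commute)
  let ?P = "\<lambda>n. blaschke_partial a n w * cnj (blaschke_partial a n z)"
  have "(\<lambda>n. ?P n - ?P (Suc n)) sums (?P 0 - blaschke a w * cnj (blaschke a z))"
    by (intro telescope_sums' tendsto_mult tendsto_cnj blaschke_tendsto[OF a] z w)
  hence "(\<lambda>n. (?P n - ?P (Suc n)) / (1 - w * cnj z)) sums ((1 - blaschke a w * cnj (blaschke a z)) / (1 - w * cnj z))"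
    by (intro sums_divide) (simp add: blaschke_partial_def)
  moreover have "(?P n - ?P (Suc n)) / (1 - w * cnj z) = of_real (1 - (cmod (a n))\<^sup>2) *
     (blaschke_partial a n w / (1 - cnj (a n) * w) * cnj (blaschke_partial a n z / (1 - cnj (a n) * z)))" for n
  proof -
    have "?P n - ?P (Suc n) = ?P n * (1 - blaschke_factor (a n) w * cnj (blaschke_factor (a n) z))"
      by (simp add: blaschke_partial_def algebra_simps)
    also have "\<dots> = ?P n * (of_real (1 - (cmod (a n))\<^sup>2) / ((1 - cnj (a n) * w) * cnj (1 - cnj (a n) * z))) * (1 - w * cnj z)"
      unfolding blaschke_factor_kernel[OF a(1) z w] by simp
    finally show ?thesis using nz by simp
  qed
  ultimately show ?thesis by simp
qed

section \<open>Herglotz integrals and the canonical factorization\<close>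

definition sum_measure :: "'a measure \<Rightarrow> 'a measure \<Rightarrow> 'a measure" where
  "sum_measure M N = measure_of (space M) (sets M) (\<lambda>A. emeasure M A + emeasure N A)"

lemma space_sum_measure [simp]: "space (sum_measure M N) = space M"
  by (simp add: sum_measure_def)

lemma sets_sum_measure [simp, measurable_cong]: "sets (sum_measure M N) = sets M"
  by (simp add: sum_measure_def)

lemma emeasure_sum_measure:
  assumes "sets N = sets M" "A \<in> sets M"
  shows "emeasure (sum_measure M N) A = emeasure M A + emeasure N A"
proof -
  have "countably_additive (sets M) (\<lambda>A. emeasure M A + emeasure N A)"
  proof (rule countably_additiveI)
    fix A :: "nat \<Rightarrow> 'a set" assume A: "range A \<subseteq> sets M" "disjoint_family A" "\<Union>(range A) \<in> sets M"
    have "(\<Sum>i. emeasure M (A i) + emeasure N (A i)) = (\<Sum>i. emeasure M (A i)) + (\<Sum>i. emeasure N (A i))"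
      by (intro suminf_add[symmetric]) auto
    thus "(\<Sum>i. emeasure M (A i) + emeasure N (A i)) = emeasure M (\<Union>(range A)) + emeasure N (\<Union>(range A))"
      using A assms(1) by (simp add: suminf_emeasure)
  qed
  thus ?thesis using assms(2)
    by (intro emeasure_measure_of[OF sum_measure_def]) (auto simp: positive_def sets.space_closed)
qed

text \<open>For measures carried by complementary sets each summand is the restriction of the sum to
  its carrier. Integrals over the sum are thereby reduced to integrals against densities.\<close>

lemma density_sum_measure:
  assumes N: "sets N = sets M" and S: "S \<in> sets M"
    and null: "emeasure M (space M - S) = 0" "emeasure N S = 0"
  shows "density (sum_measure M N) (indicator S) = M" "density (sum_measure M N) (indicator (space M - S)) = N"
proof -
  have sp: "space N = space M" using sets_eq_imp_space_eq[OF N] .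
  have *: "emeasure (density (sum_measure M N) (indicator T)) A = emeasure M (T \<inter> A) + emeasure N (T \<inter> A)"
    if "A \<in> sets M" "T \<in> sets M" for A T
  proof -
    have "emeasure (density (sum_measure M N) (indicator T)) A = (\<integral>\<^sup>+x. indicator (T \<inter> A) x \<partial>sum_measure M N)"
      using that by (subst emeasure_density) (auto simp: indicator_inter_arith[symmetric])
    thus ?thesis using that N by (simp add: emeasure_sum_measure)
  qed
  have split: "emeasure L A = emeasure L (S \<inter> A) + emeasure L ((space M - S) \<inter> A)" if "A \<in> sets M" "sets L = sets M" for A L
  proof -
    have "emeasure L (S \<inter> A) + emeasure L ((space M - S) \<inter> A) = emeasure L ((S \<inter> A) \<union> ((space M - S) \<inter> A))"
    proof (rule plus_emeasure)
      show "S \<inter> A \<in> sets L" "(space M - S) \<inter> A \<in> sets L"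
        unfolding that(2) using that(1) S by (metis sets.Int, metis sets.Int sets.compl_sets)
    qed blast
    moreover have "(S \<inter> A) \<union> ((space M - S) \<inter> A) = A" using sets.sets_into_space[OF that(1)] by auto
    ultimately show ?thesis by simp
  qed
  show "density (sum_measure M N) (indicator S) = M"
  proof (rule measure_eqI)
    fix A assume "A \<in> sets (density (sum_measure M N) (indicator S))"
    hence A: "A \<in> sets M" by simp
    have "emeasure N (S \<inter> A) = 0" by (rule emeasure_eq_0[OF _ null(2)]) (use S N in auto)
    moreover have "emeasure M ((space M - S) \<inter> A) = 0" by (rule emeasure_eq_0[OF _ null(1)]) (use S in auto)
    ultimately show "emeasure (density (sum_measure M N) (indicator S)) A = emeasure M A"
      using *[OF A S] split[OF A refl] by simp
  qed simp
  show "density (sum_measure M N) (indicator (space M - S)) = N"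
  proof (rule measure_eqI)
    fix A assume "A \<in> sets (density (sum_measure M N) (indicator (space M - S)))"
    hence A: "A \<in> sets M" by simp
    have "emeasure N (S \<inter> A) = 0" by (rule emeasure_eq_0[OF _ null(2)]) (use S N in auto)
    moreover have "emeasure M ((space M - S) \<inter> A) = 0" by (rule emeasure_eq_0[OF _ null(1)]) (use S in auto)
    ultimately show "emeasure (density (sum_measure M N) (indicator (space M - S))) A = emeasure N A"
      using *[OF A, of "space M - S"] split[OF A N] S by simp
  qed (simp add: N)
qed

lemma nn_integral_sum_measure:
  assumes N: "sets N = sets M" and S: "S \<in> sets M" "emeasure M (space M - S) = 0" "emeasure N S = 0"
    and f: "f \<in> borel_measurable M"
  shows "(\<integral>\<^sup>+x. f x \<partial>sum_measure M N) = (\<integral>\<^sup>+x. f x \<partial>M) + (\<integral>\<^sup>+x. f x \<partial>N)"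
proof -
  have f': "f \<in> borel_measurable (sum_measure M N)" using f by simp
  have "(\<integral>\<^sup>+x. f x \<partial>sum_measure M N) = (\<integral>\<^sup>+x. indicator S x * f x + indicator (space M - S) x * f x \<partial>sum_measure M N)"
    by (intro nn_integral_cong) (auto simp: indicator_def)
  also have "\<dots> = (\<integral>\<^sup>+x. indicator S x * f x \<partial>sum_measure M N) + (\<integral>\<^sup>+x. indicator (space M - S) x * f x \<partial>sum_measure M N)"
    using f' S by (intro nn_integral_add) auto
  also have "(\<integral>\<^sup>+x. indicator S x * f x \<partial>sum_measure M N) = (\<integral>\<^sup>+x. f x \<partial>density (sum_measure M N) (indicator S))"
    using S f' by (intro nn_integral_density[symmetric]) auto
  also have "(\<integral>\<^sup>+x. indicator (space M - S) x * f x \<partial>sum_measure M N) = (\<integral>\<^sup>+x. f x \<partial>density (sum_measure M N) (indicator (space M - S)))"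
    using S f' by (intro nn_integral_density[symmetric]) auto
  finally show ?thesis unfolding density_sum_measure[OF N S] .
qed

lemma integral_sum_measure:
  fixes f :: "'a \<Rightarrow> 'b::{banach, second_countable_topology}"
  assumes N: "sets N = sets M" and S: "S \<in> sets M" "emeasure M (space M - S) = 0" "emeasure N S = 0"
    and f: "integrable M f" "integrable N f"
  shows "(\<integral>x. f x \<partial>sum_measure M N) = (\<integral>x. f x \<partial>M) + (\<integral>x. f x \<partial>N)"
proof -
  have f': "f \<in> borel_measurable (sum_measure M N)" using f by simp
  have ind: "(\<lambda>x. ennreal (indicator T x)) = indicator T" for T :: "'a set" by (auto simp: indicator_def)
  have d: "density (sum_measure M N) (\<lambda>x. ennreal (indicator S x)) = M"
    "density (sum_measure M N) (\<lambda>x. ennreal (indicator (space M - S) x)) = N"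
    using density_sum_measure[OF N S] unfolding ind by auto
  have int: "integrable (sum_measure M N) (\<lambda>x. indicator S x *\<^sub>R f x)"
    "integrable (sum_measure M N) (\<lambda>x. indicator (space M - S) x *\<^sub>R f x)"
    using f S f' by (auto simp: d intro!: integrable_density[THEN iffD1])
  have "(\<integral>x. f x \<partial>sum_measure M N) = (\<integral>x. indicator S x *\<^sub>R f x + indicator (space M - S) x *\<^sub>R f x \<partial>sum_measure M N)"
    by (intro Bochner_Integration.integral_cong) (auto simp: indicator_def)
  also have "\<dots> = (\<integral>x. indicator S x *\<^sub>R f x \<partial>sum_measure M N) + (\<integral>x. indicator (space M - S) x *\<^sub>R f x \<partial>sum_measure M N)"
    by (rule Bochner_Integration.integral_add[OF int])
  also have "(\<integral>x. indicator S x *\<^sub>R f x \<partial>sum_measure M N) = (\<integral>x. f x \<partial>density (sum_measure M N) (\<lambda>x. ennreal (indicator S x)))"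
    using S f' by (intro integral_density[symmetric]) auto
  also have "(\<integral>x. indicator (space M - S) x *\<^sub>R f x \<partial>sum_measure M N) = (\<integral>x. f x \<partial>density (sum_measure M N) (\<lambda>x. ennreal (indicator (space M - S) x)))"
    using S f' by (intro integral_density[symmetric]) auto
  finally show ?thesis unfolding d .
qed

section \<open>Herglotz integrals and the exponential chain\<close>

definition proj_circle :: "complex \<Rightarrow> complex" where
  "proj_circle \<zeta> = (if cmod \<zeta> = 1 then \<zeta> else 1)"

definition herglotz :: "complex measure \<Rightarrow> complex \<Rightarrow> complex" where
  "herglotz \<mu> z = (\<integral>\<zeta>. (\<zeta> + z) / (\<zeta> - z) \<partial>\<mu>)"

lemma cmod_proj_circle [simp]: "cmod (proj_circle \<zeta>) = 1"
  by (simp add: proj_circle_def)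

lemma proj_circle_measurable [measurable]: "proj_circle \<in> borel_measurable borel"
  unfolding proj_circle_def[abs_def] by measurable

lemma unit_mult_cnj: "cmod \<zeta> = 1 \<Longrightarrow> \<zeta> * cnj \<zeta> = 1"
  by (simp add: complex_norm_square[symmetric])

lemma unit_minus_eq: "cmod \<zeta> = 1 \<Longrightarrow> \<zeta> - z = \<zeta> * (1 - cnj \<zeta> * z)"
proof -
  assume "cmod \<zeta> = 1"
  moreover have "\<zeta> * (1 - cnj \<zeta> * z) = \<zeta> - (\<zeta> * cnj \<zeta>) * z" by (simp add: algebra_simps)
  ultimately show ?thesis by (simp add: unit_mult_cnj)
qed

lemma cmod_unit_minus: "cmod \<zeta> = 1 \<Longrightarrow> cmod (\<zeta> - z) = cmod (1 - cnj \<zeta> * z)"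
  by (subst unit_minus_eq) (simp_all add: norm_mult)

lemma unit_minus_nz: "cmod \<zeta> = 1 \<Longrightarrow> cmod z < 1 \<Longrightarrow> \<zeta> - z \<noteq> 0"
  by auto

text \<open>The polarized form of the Poisson kernel. The factor 2 is the origin of the density 2 in
  the model measure.\<close>

lemma herglotz_kernel_identity:
  assumes "cmod \<zeta> = 1" "cmod z < 1" "cmod w < 1"
  shows "(\<zeta> + w) / (\<zeta> - w) + cnj ((\<zeta> + z) / (\<zeta> - z))
    = (1 - w * cnj z) * (2 * (1 / (1 - cnj \<zeta> * w) * cnj (1 / (1 - cnj \<zeta> * z))))"
proof -
  have \<zeta>: "\<zeta> \<noteq> 0" "\<zeta> * cnj \<zeta> = 1" using assms(1) unit_mult_cnj by auto
  have nz: "1 - cnj \<zeta> * w \<noteq> 0" "1 - cnj \<zeta> * z \<noteq> 0"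
    using one_minus_cnj_mult_bounds(3)[of \<zeta>] assms by auto
  hence nz': "1 - \<zeta> * cnj z \<noteq> 0"
    by (metis complex_cnj_cancel_iff complex_cnj_cnj complex_cnj_diff complex_cnj_mult complex_cnj_one complex_cnj_zero)
  have p: "\<zeta> + v = \<zeta> * (1 + cnj \<zeta> * v)" for v
    using unit_minus_eq[OF assms(1), of "- v"] by simp
  have "(\<zeta> + v) / (\<zeta> - v) = (1 + cnj \<zeta> * v) / (1 - cnj \<zeta> * v)" for v
    using \<zeta>(1) by (subst unit_minus_eq[OF assms(1)], subst p) simp
  hence "(\<zeta> + w) / (\<zeta> - w) + cnj ((\<zeta> + z) / (\<zeta> - z))
    = (1 + cnj \<zeta> * w) / (1 - cnj \<zeta> * w) + (1 + \<zeta> * cnj z) / (1 - \<zeta> * cnj z)" by simp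
  also have "\<dots> = 2 * (1 - (cnj \<zeta> * w) * (\<zeta> * cnj z)) / ((1 - cnj \<zeta> * w) * (1 - \<zeta> * cnj z))"
    using nz nz' by (simp add: divide_simps) (simp add: algebra_simps)
  also have "(cnj \<zeta> * w) * (\<zeta> * cnj z) = (\<zeta> * cnj \<zeta>) * (w * cnj z)" by (simp only: mult_ac)
  also have "\<dots> = w * cnj z" using \<zeta>(2) by simp
  finally show ?thesis by simp
qed

text \<open>Stated with the factor c in front, so that c = 0 is included.\<close>

lemma exp_integral:
  fixes c :: complex
  shows "c * (\<integral>s. indicator {0..1} s *\<^sub>R exp (- (of_real s * c)) \<partial>lborel) = 1 - exp (- c)"
proof (cases "c = 0")
  case False
  have "(\<integral>s. indicator {0..1} s *\<^sub>R exp (- (of_real s * c)) \<partial>lborel)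
     = (- exp (- (of_real 1 * c)) / c) - (- exp (- (of_real 0 * c)) / c)"
  proof (rule integral_FTC_Icc)
    fix x :: real
    have "((\<lambda>s. - exp (- (s * c)) / c) has_field_derivative exp (- (of_real x * c))) (at (of_real x))"
      using False by (auto intro!: derivative_eq_intros)
    thus "((\<lambda>s. - exp (- (of_real s * c)) / c) has_vector_derivative exp (- (of_real x * c))) (at x within {0..1})"
      by (rule has_vector_derivative_real_field)
  qed (auto intro!: continuous_intros)
  thus ?thesis using False by (simp add: field_simps)
qed simp

section \<open>The model measure and its nodes\<close>

type_synonym index = "nat \<times> real \<times> complex"

abbreviation index_space :: "index measure" where
  "index_space \<equiv> count_space UNIV \<Otimes>\<^sub>M (borel \<Otimes>\<^sub>M borel)"

abbreviation unit_lborel :: "real measure" where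
  "unit_lborel \<equiv> density lborel (indicator {0..1})"

lemma emeasure_unit_lborel: "emeasure unit_lborel UNIV = 1"
  by (subst emeasure_density) auto

locale canonical_factorization =
  fixes a :: "nat \<Rightarrow> complex" and \<mu> :: "complex measure" and b :: "complex \<Rightarrow> complex" and \<gamma> :: complex
  assumes a_le_1: "cmod (a n) \<le> 1"
    and a_summable: "summable (\<lambda>n. 1 - cmod (a n))"
    and mu_finite: "finite_measure \<mu>"
    and mu_borel: "sets \<mu> = sets borel"
    and mu_circle: "AE \<zeta> in \<mu>. cmod \<zeta> = 1"
    and gamma: "cmod \<gamma> = 1"
    and b_eq: "z \<in> ball 0 1 \<Longrightarrow> b z = \<gamma> * blaschke a z * exp (- herglotz \<mu> z)"
begin

sublocale mu: finite_measure \<mu> by (rule mu_finite)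
sublocale unit: finite_measure unit_lborel
  by standard (simp add: emeasure_unit_lborel)
sublocale mu2: finite_measure "density \<mu> (\<lambda>_. 2)"
  by standard (simp add: emeasure_density_const ennreal_mult_eq_top_iff)
sublocale pair_sigma_finite unit_lborel "density \<mu> (\<lambda>_. 2)" ..

lemma measurable_mu [measurable_cong]: "sets \<mu> = sets borel"
  by (rule mu_borel)

lemma AE_proj_circle: "AE \<zeta> in \<mu>. proj_circle \<zeta> = \<zeta>"
  using mu_circle by eventually_elim (simp add: proj_circle_def)

text \<open>The indices are shifted by \<open>Suc\<close> because the first coordinate 0 is reserved
  for the part coming from \<mu>; that coordinate alone separates the two parts.\<close>

definition zeros_measure :: "index measure" where
  "zeros_measure = distr (density (count_space UNIV) (\<lambda>n. ennreal (1 - (cmod (a n))\<^sup>2))) index_space (\<lambda>n. (Suc n, 0, 0))"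

definition sing_measure :: "index measure" where
  "sing_measure = distr (unit_lborel \<Otimes>\<^sub>M density \<mu> (\<lambda>_. 2)) index_space (\<lambda>(s, \<zeta>). (0, s, \<zeta>))"

definition model_measure :: "index measure" where
  "model_measure = sum_measure sing_measure zeros_measure"

text \<open>\<open>proj_circle\<close> alters the node only on a \<mu>-null set. It makes the bound
  by 1, and everything derived from it, hold for every index and not just almost everywhere.\<close>

definition node :: "index \<Rightarrow> complex" where
  "node x = (case x of (n, s, \<zeta>) \<Rightarrow> if n = 0 then proj_circle \<zeta> else a (n - 1))"

text \<open>Along the singular part the chain of divisors is \<open>s \<mapsto> B exp (- s p)\<close> for \<open>0 \<le> s \<le> 1\<close>;
  along the zeros it is the sequence of partial products.\<close>

definition divisor :: "index \<Rightarrow> complex \<Rightarrow> complex" where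
  "divisor x z = (case x of (n, s, \<zeta>) \<Rightarrow>
     if n = 0 then blaschke a z * exp (- (of_real (max 0 (min 1 s)) * herglotz \<mu> z))
     else blaschke_partial a (n - 1) z)"

lemma wt_nonneg: "1 - (cmod (a n))\<^sup>2 \<ge> 0"
  using a_le_1[of n] by (simp add: power_le_one)

lemma sets_parts: "sets zeros_measure = sets index_space" "sets sing_measure = sets index_space"
  by (simp_all add: zeros_measure_def sing_measure_def)

lemma sets_model_measure [measurable_cong]: "sets model_measure = sets index_space"
  by (simp add: model_measure_def sets_parts)

lemma zeros_embed_measurable:
  "(\<lambda>n. (Suc n, 0, 0)) \<in> density (count_space UNIV) w \<rightarrow>\<^sub>M index_space"
  by (simp add: space_pair_measure)

lemma sing_embed_measurable:
  "(\<lambda>(s, \<zeta>). (0, s, \<zeta>)) \<in> (unit_lborel \<Otimes>\<^sub>M density \<mu> (\<lambda>_. 2)) \<rightarrow>\<^sub>M index_space"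
  by measurable

lemma parts_singular:
  defines "S \<equiv> {0} \<times> UNIV"
  shows "S \<in> sets sing_measure" "emeasure sing_measure (space sing_measure - S) = 0" "emeasure zeros_measure S = 0"
proof -
  have "UNIV \<in> sets (borel \<Otimes>\<^sub>M borel :: (real \<times> complex) measure)"
    using sets.top[of "borel \<Otimes>\<^sub>M borel :: (real \<times> complex) measure"] by (simp add: space_pair_measure)
  hence S: "S \<in> sets index_space" unfolding S_def by (intro pair_measureI) auto
  thus "S \<in> sets sing_measure" by (simp add: sets_parts)
  have sp: "space sing_measure = space index_space" using sets_parts(2) by (rule sets_eq_imp_space_eq)
  have "emeasure sing_measure (space sing_measure - S) =
     emeasure (unit_lborel \<Otimes>\<^sub>M density \<mu> (\<lambda>_. 2)) ((\<lambda>(s, \<zeta>). (0::nat, s, \<zeta>)) -` (space index_space - S) \<inter> space (unit_lborel \<Otimes>\<^sub>M density \<mu> (\<lambda>_. 2)))"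
    unfolding sp using S by (subst sing_measure_def, intro emeasure_distr) auto
  also have "(\<lambda>(s, \<zeta>). (0::nat, s, \<zeta>)) -` (space index_space - S) = {}" by (auto simp: S_def)
  finally show "emeasure sing_measure (space sing_measure - S) = 0" by simp
  have "emeasure zeros_measure S = emeasure (density (count_space UNIV) (\<lambda>n. ennreal (1 - (cmod (a n))\<^sup>2)))
      ((\<lambda>n. (Suc n, 0, 0)) -` S \<inter> space (density (count_space UNIV) (\<lambda>n. ennreal (1 - (cmod (a n))\<^sup>2))))"
    by (subst zeros_measure_def, rule emeasure_distr[OF zeros_embed_measurable S])
  also have "(\<lambda>n. (Suc n, 0::real, 0::complex)) -` S = {}" by (auto simp: S_def)
  finally show "emeasure zeros_measure S = 0" by simp
qed

lemma node_measurable [measurable]: "node \<in> borel_measurable index_space"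
  unfolding node_def[abs_def] case_prod_beta by measurable

lemma divisor_measurable: "(\<lambda>x. divisor x z) \<in> borel_measurable index_space"
  unfolding divisor_def[abs_def] case_prod_beta by measurable

text \<open>The chain parameter s does not enter the node and has total mass 1, so it integrates
  out.\<close>

lemma nn_integral_node:
  assumes [measurable]: "F \<in> borel_measurable borel"
  shows "(\<integral>\<^sup>+x. F (node x) \<partial>model_measure)
    = (\<Sum>n. ennreal (1 - (cmod (a n))\<^sup>2) * F (a n)) + 2 * (\<integral>\<^sup>+\<zeta>. F \<zeta> \<partial>\<mu>)"
proof -
  have Fm: "(\<lambda>x. F (node x)) \<in> borel_measurable index_space" by measurable
  have "(\<integral>\<^sup>+x. F (node x) \<partial>model_measure) = (\<integral>\<^sup>+x. F (node x) \<partial>sing_measure) + (\<integral>\<^sup>+x. F (node x) \<partial>zeros_measure)"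
    unfolding model_measure_def using Fm
    by (intro nn_integral_sum_measure[OF _ parts_singular]) (auto simp: sets_parts measurable_cong_sets[OF sets_parts(2) refl])
  also have "(\<integral>\<^sup>+x. F (node x) \<partial>zeros_measure) = (\<Sum>n. ennreal (1 - (cmod (a n))\<^sup>2) * F (a n))"
    unfolding zeros_measure_def
    by (subst nn_integral_distr[OF zeros_embed_measurable])
       (use Fm in \<open>simp_all add: nn_integral_density nn_integral_count_space_nat node_def\<close>)
  also have "(\<integral>\<^sup>+x. F (node x) \<partial>sing_measure) = (\<integral>\<^sup>+x. F (proj_circle (snd x)) \<partial>(unit_lborel \<Otimes>\<^sub>M density \<mu> (\<lambda>_. 2)))"
    unfolding sing_measure_def
    by (subst nn_integral_distr[OF sing_embed_measurable])
       (use Fm in \<open>simp_all add: node_def case_prod_beta\<close>)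
  also have "\<dots> = (\<integral>\<^sup>+\<zeta>. (\<integral>\<^sup>+s. F (proj_circle \<zeta>) \<partial>unit_lborel) \<partial>density \<mu> (\<lambda>_. 2))"
    by (subst nn_integral_snd[symmetric]) simp_all
  also have "\<dots> = (\<integral>\<^sup>+\<zeta>. F (proj_circle \<zeta>) \<partial>density \<mu> (\<lambda>_. 2))"
    by (simp add: emeasure_unit_lborel)
  also have "\<dots> = 2 * (\<integral>\<^sup>+\<zeta>. F (proj_circle \<zeta>) \<partial>\<mu>)"
    by (simp add: nn_integral_density nn_integral_cmult)
  also have "(\<integral>\<^sup>+\<zeta>. F (proj_circle \<zeta>) \<partial>\<mu>) = (\<integral>\<^sup>+\<zeta>. F \<zeta> \<partial>\<mu>)"
    using AE_proj_circle by (intro nn_integral_cong_AE) (auto elim: eventually_mono)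
  finally show ?thesis by (simp add: add.commute)
qed

lemma wt_summable: "summable (\<lambda>n. 1 - (cmod (a n))\<^sup>2)"
proof (rule summable_comparison_test'[where N = 0])
  show "summable (\<lambda>n. 2 * (1 - cmod (a n)))" by (intro summable_mult a_summable)
  fix n
  have "1 - (cmod (a n))\<^sup>2 = (1 + cmod (a n)) * (1 - cmod (a n))" by (simp add: power2_eq_square algebra_simps)
  also have "\<dots> \<le> 2 * (1 - cmod (a n))" using a_le_1[of n] by (intro mult_right_mono) auto
  finally show "norm (1 - (cmod (a n))\<^sup>2) \<le> 2 * (1 - cmod (a n))" using wt_nonneg[of n] by simp
qed

lemma finite_model_measure: "finite_measure model_measure"
proof
  have "emeasure model_measure (space model_measure) = (\<integral>\<^sup>+x. 1 \<partial>model_measure)" by simp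
  also have "\<dots> = (\<Sum>n. ennreal (1 - (cmod (a n))\<^sup>2)) + 2 * emeasure \<mu> (space \<mu>)"
    using nn_integral_node[of "\<lambda>_. 1"] by simp
  also have "\<dots> < \<infinity>"
    using ennreal_suminf_neq_top[OF wt_summable wt_nonneg] mu.emeasure_finite[of "space \<mu>"]
    by (auto simp: less_top[symmetric] ennreal_mult_eq_top_iff)
  finally show "emeasure model_measure (space model_measure) \<noteq> \<infinity>" by simp
qed

definition P :: "complex \<Rightarrow> complex \<Rightarrow> complex" where
  "P \<zeta> z = (proj_circle \<zeta> + z) / (proj_circle \<zeta> - z)"

lemma P_family: "locally_bounded_family P"
  unfolding locally_bounded_family_def
proof (intro conjI allI impI)
  show "P \<zeta> holomorphic_on ball 0 1" for \<zeta>
    unfolding P_def[abs_def] using unit_minus_nz[OF cmod_proj_circle] by (intro holomorphic_intros) auto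
  fix r :: real assume r: "r < 1"
  have "cmod (P \<zeta> z) \<le> 2 / (1 - r)" if "z \<in> cball 0 r" for \<zeta> z
  proof -
    have z: "cmod z \<le> r" using that by simp
    have "cmod (proj_circle \<zeta> + z) \<le> 2" using norm_triangle_ineq[of "proj_circle \<zeta>" z] z r by simp
    moreover have "1 - r \<le> cmod (proj_circle \<zeta> - z)" using norm_triangle_ineq2[of "proj_circle \<zeta>" z] z by simp
    ultimately show ?thesis unfolding P_def norm_divide using r by (intro frac_le) auto
  qed
  thus "\<exists>B. \<forall>\<zeta>. \<forall>z\<in>cball 0 r. cmod (P \<zeta> z) \<le> B" by blast
qed

lemma P_measurable [measurable]: "(\<lambda>\<zeta>. P \<zeta> z) \<in> borel_measurable \<mu>"
  unfolding P_def by measurable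

lemma herglotz_eq: "herglotz \<mu> z = (\<integral>\<zeta>. P \<zeta> z \<partial>\<mu>)"
  unfolding herglotz_def
  by (rule integral_cong_AE, measurable) (use AE_proj_circle in eventually_elim, simp add: P_def)

lemma herglotz_fun_eq: "herglotz \<mu> = (\<lambda>z. \<integral>\<zeta>. P \<zeta> z \<partial>\<mu>)"
  using herglotz_eq by auto

lemma herglotz_holomorphic: "herglotz \<mu> holomorphic_on ball 0 1"
  unfolding herglotz_fun_eq by (rule holomorphic_on_integral_family[OF mu_finite P_family]) measurable

lemma P_integrable: "z \<in> ball 0 1 \<Longrightarrow> integrable \<mu> (\<lambda>\<zeta>. P \<zeta> z)"
  by (rule integrable_locally_bounded_family[OF mu_finite P_family]) measurable

lemma herglotz_kernel:
  assumes z: "z \<in> ball 0 1" and w: "w \<in> ball 0 1"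
  shows "herglotz \<mu> w + cnj (herglotz \<mu> z) = (1 - w * cnj z) *
     (\<integral>\<zeta>. 2 * (1 / (1 - cnj (proj_circle \<zeta>) * w) * cnj (1 / (1 - cnj (proj_circle \<zeta>) * z))) \<partial>\<mu>)"
proof -
  have "herglotz \<mu> w + cnj (herglotz \<mu> z) = (\<integral>\<zeta>. P \<zeta> w \<partial>\<mu>) + (\<integral>\<zeta>. cnj (P \<zeta> z) \<partial>\<mu>)"
    by (simp add: herglotz_eq)
  also have "\<dots> = (\<integral>\<zeta>. P \<zeta> w + cnj (P \<zeta> z) \<partial>\<mu>)"
    by (intro Bochner_Integration.integral_add[symmetric] P_integrable w)
       (use P_integrable[OF z] in simp)
  also have "\<dots> = (\<integral>\<zeta>. (1 - w * cnj z) * (2 * (1 / (1 - cnj (proj_circle \<zeta>) * w) * cnj (1 / (1 - cnj (proj_circle \<zeta>) * z)))) \<partial>\<mu>)"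
    unfolding P_def using z w by (intro Bochner_Integration.integral_cong refl herglotz_kernel_identity) auto
  also have "\<dots> = (1 - w * cnj z) *
     (\<integral>\<zeta>. 2 * (1 / (1 - cnj (proj_circle \<zeta>) * w) * cnj (1 / (1 - cnj (proj_circle \<zeta>) * z))) \<partial>\<mu>)"
    by (rule integral_mult_right_zero)
  finally show ?thesis .
qed

lemma Re_herglotz_nonneg:
  assumes z: "z \<in> ball 0 1" shows "Re (herglotz \<mu> z) \<ge> 0"
proof -
  have "Re (P \<zeta> z) \<ge> 0" for \<zeta>
  proof -
    have "2 * Re (P \<zeta> z) = Re (P \<zeta> z + cnj (P \<zeta> z))" by simp
    also have "P \<zeta> z + cnj (P \<zeta> z) = (1 - z * cnj z) * (2 * (1 / (1 - cnj (proj_circle \<zeta>) * z) * cnj (1 / (1 - cnj (proj_circle \<zeta>) * z))))"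
      unfolding P_def using z by (intro herglotz_kernel_identity) auto
    also have "\<dots> = complex_of_real ((1 - (cmod z)\<^sup>2) * (2 * (cmod (1 / (1 - cnj (proj_circle \<zeta>) * z)))\<^sup>2))"
      by (simp only: complex_norm_square of_real_mult of_real_diff of_real_1 of_real_numeral)
    also have "Re \<dots> = (1 - (cmod z)\<^sup>2) * (2 * (cmod (1 / (1 - cnj (proj_circle \<zeta>) * z)))\<^sup>2)" by (rule Re_complex_of_real)
    also have "\<dots> \<ge> 0" using z by (intro mult_nonneg_nonneg) (auto simp: power_le_one)
    finally show ?thesis by simp
  qed
  hence "(\<integral>\<zeta>. Re (P \<zeta> z) \<partial>\<mu>) \<ge> 0" by (intro Bochner_Integration.integral_nonneg)
  thus ?thesis unfolding herglotz_eq by (simp only: integral_Re[OF P_integrable[OF z]])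
qed

lemma P_higher_deriv:
  assumes z: "z \<in> ball 0 1"
  shows "(deriv ^^ Suc k) (P \<zeta>) z = 2 * proj_circle \<zeta> * fact (Suc k) / (proj_circle \<zeta> - z) ^ (k + 2)"
proof -
  define c where "c = proj_circle \<zeta>"
  have nz: "c + (- 1) * w \<noteq> 0" if "w \<in> ball 0 1" for w
    using unit_minus_nz[OF cmod_proj_circle, of w \<zeta>] that by (auto simp: c_def)
  have hol: "(\<lambda>w. 1 / (c + (- 1) * w)) holomorphic_on ball 0 1" using nz by (intro holomorphic_intros) auto
  \<comment> \<open>A constant plus a simple pole: only the pole contributes to derivatives of
    positive order.\<close>
  have eq: "P \<zeta> w = - 1 + (2 * c) * (1 / (c + (- 1) * w))" if "w \<in> ball 0 1" for w
    using nz[OF that] unfolding P_def c_def[symmetric] by (simp add: field_simps)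
  have "(deriv ^^ Suc k) (P \<zeta>) z = (deriv ^^ Suc k) (\<lambda>w. - 1 + (2 * c) * (1 / (c + (- 1) * w))) z"
    by (rule higher_deriv_cong_ev[OF _ refl])
       (use z eq in \<open>auto intro!: eventually_nhds[THEN iffD2] exI[of _ "ball 0 1"]\<close>)
  also have "\<dots> = (deriv ^^ Suc k) (\<lambda>w. - 1) z + (deriv ^^ Suc k) (\<lambda>w. (2 * c) * (1 / (c + (- 1) * w))) z"
    by (intro higher_deriv_add[of _ "ball 0 1"] holomorphic_intros hol z) auto
  also have "(deriv ^^ Suc k) (\<lambda>w. - 1::complex) z = 0" by (simp only: higher_deriv_const) simp
  also have "(deriv ^^ Suc k) (\<lambda>w. (2 * c) * (1 / (c + (- 1) * w))) z = (2 * c) * (deriv ^^ Suc k) (\<lambda>w. 1 / (c + (- 1) * w)) z"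
    by (intro higher_deriv_cmult[of _ "ball 0 1"] hol z) auto
  also have "(deriv ^^ Suc k) (\<lambda>w. 1 / (c + (- 1) * w)) z = (- (- 1)) ^ Suc k * fact (Suc k) / (c + (- 1) * z) ^ (Suc k + 1)"
    by (rule higher_deriv_inverse_linear[OF nz[OF z]])
  finally show ?thesis by (simp add: c_def)
qed

end

section \<open>The kernel formula and the divisors\<close>

context canonical_factorization
begin

lemma divisor_le_1:
  assumes z: "z \<in> ball 0 1" shows "cmod (divisor x z) \<le> 1"
proof -
  obtain n s \<zeta> where x: "x = (n, s, \<zeta>)" by (cases x)
  have z': "cmod z < 1" using z by simp
  show ?thesis
  proof (cases "n = 0")
    case True
    have "cmod (blaschke a z) * exp (- (max 0 (min 1 s) * Re (herglotz \<mu> z))) \<le> 1 * 1"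
      using Re_herglotz_nonneg[OF z] by (intro mult_mono blaschke_le_1 a_le_1 a_summable z') auto
    thus ?thesis using True by (simp add: x divisor_def norm_mult)
  next
    case False
    thus ?thesis using blaschke_partial_le_1[where a = a and n = "n - 1", OF a_le_1 z'] by (simp add: x divisor_def)
  qed
qed

text \<open>A divisor arises from b by dropping a unimodular constant and further factors of modulus
  at most 1.\<close>

lemma b_le_divisor:
  assumes z: "z \<in> ball 0 1" shows "cmod (b z) \<le> cmod (divisor x z)"
proof -
  obtain n s \<zeta> where x: "x = (n, s, \<zeta>)" by (cases x)
  have z': "cmod z < 1" using z by simp
  have bz: "cmod (b z) = cmod (blaschke a z) * exp (- Re (herglotz \<mu> z))"
    by (simp add: b_eq[OF z] norm_mult gamma)
  show ?thesis
  proof (cases "n = 0")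
    case True
    have "max 0 (min 1 s) * Re (herglotz \<mu> z) \<le> 1 * Re (herglotz \<mu> z)"
      using Re_herglotz_nonneg[OF z] by (intro mult_right_mono) auto
    thus ?thesis using True unfolding bz by (simp add: x divisor_def norm_mult mult_left_mono)
  next
    case False
    have "cmod (b z) \<le> cmod (blaschke_partial a (n - 1) z) * 1"
      unfolding bz using Re_herglotz_nonneg[OF z]
      by (intro mult_mono blaschke_le_partial a_le_1 a_summable z') auto
    thus ?thesis using False by (simp add: x divisor_def)
  qed
qed

lemma divisor_holomorphic: "divisor x holomorphic_on ball 0 1"
proof -
  obtain n s \<zeta> where x: "x = (n, s, \<zeta>)" by (cases x)
  show ?thesis
    by (cases "n = 0") (auto simp: x divisor_def[abs_def] intro!: holomorphic_intros
        blaschke_holomorphic a_le_1 a_summable herglotz_holomorphic blaschke_partial_holomorphic)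
qed

lemma cmod_node_le_1: "cmod (node x) \<le> 1"
  using a_le_1 by (auto simp: node_def split: prod.splits)

definition kernel_integrand :: "complex \<Rightarrow> complex \<Rightarrow> index \<Rightarrow> complex" where
  "kernel_integrand z w x = divisor x w / (1 - cnj (node x) * w) * cnj (divisor x z / (1 - cnj (node x) * z))"

lemma kernel_integrand_measurable: "kernel_integrand z w \<in> borel_measurable index_space"
proof -
  have [measurable]: "(\<lambda>x. cnj (node x)) \<in> borel_measurable index_space"
    by (rule borel_measurable_cnj[OF node_measurable])
  note [measurable] = divisor_measurable
  show ?thesis unfolding kernel_integrand_def[abs_def]
    by (intro borel_measurable_times borel_measurable_cnj) measurable
qed

lemma kernel_integrand_bound:
  assumes "z \<in> ball 0 1" "w \<in> ball 0 1"
  shows "cmod (kernel_integrand z w x) \<le> 1 / (1 - cmod w) * (1 / (1 - cmod z))"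
proof -
  have "cmod (divisor x v / (1 - cnj (node x) * v)) \<le> 1 / (1 - cmod v)" if "v \<in> ball 0 1" for v
    unfolding norm_divide using divisor_le_1[OF that, of x] that one_minus_cnj_mult_bounds(1)[OF cmod_node_le_1, of v x]
    by (intro frac_le) auto
  thus ?thesis unfolding kernel_integrand_def norm_mult complex_mod_cnj using assms by (intro mult_mono) auto
qed

lemma finite_parts: "finite_measure sing_measure" "finite_measure zeros_measure"
proof -
  have "emeasure sing_measure (space sing_measure) + emeasure zeros_measure (space sing_measure) \<noteq> \<infinity>"
    using finite_measure.emeasure_finite[OF finite_model_measure, of "space sing_measure"]
    by (subst (asm) model_measure_def, subst (asm) emeasure_sum_measure[OF _ sets.top]) (auto simp: sets_parts)
  moreover have "space zeros_measure = space sing_measure"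
    by (rule sets_eq_imp_space_eq) (simp add: sets_parts)
  ultimately show "finite_measure sing_measure" "finite_measure zeros_measure"
    by (auto intro!: finite_measureI)
qed

lemma kernel_integrand_integrable:
  assumes "z \<in> ball 0 1" "w \<in> ball 0 1"
  shows "integrable sing_measure (kernel_integrand z w)" "integrable zeros_measure (kernel_integrand z w)"
  using finite_measure.integrable_const_bound[OF finite_parts(1), where f = "kernel_integrand z w" and B = "1 / (1 - cmod w) * (1 / (1 - cmod z))"]
    finite_measure.integrable_const_bound[OF finite_parts(2), where f = "kernel_integrand z w" and B = "1 / (1 - cmod w) * (1 / (1 - cmod z))"]
    kernel_integrand_bound[OF assms] kernel_integrand_measurable[of z w]
  by (auto simp: measurable_cong_sets[OF sets_parts(1) refl] measurable_cong_sets[OF sets_parts(2) refl])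

lemma kernel_zeros:
  assumes z: "z \<in> ball 0 1" and w: "w \<in> ball 0 1"
  shows "(\<integral>x. kernel_integrand z w x \<partial>zeros_measure) = (1 - blaschke a w * cnj (blaschke a z)) / (1 - w * cnj z)"
proof -
  define g where "g n = kernel_integrand z w (Suc n, 0, 0)" for n
  have g: "g n = blaschke_partial a n w / (1 - cnj (a n) * w) * cnj (blaschke_partial a n z / (1 - cnj (a n) * z))" for n
    by (simp add: g_def kernel_integrand_def divisor_def node_def)
  have "(\<integral>x. kernel_integrand z w x \<partial>zeros_measure) = (\<integral>n. g n \<partial>density (count_space UNIV) (\<lambda>n. ennreal (1 - (cmod (a n))\<^sup>2)))"
    unfolding zeros_measure_def g_def by (rule integral_distr[OF zeros_embed_measurable kernel_integrand_measurable])
  also have "\<dots> = (\<integral>n. (1 - (cmod (a n))\<^sup>2) *\<^sub>R g n \<partial>count_space UNIV)"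
    by (rule integral_density[OF _ _ AE_I2[OF wt_nonneg]]) auto
  also have "\<dots> = (\<Sum>n. (1 - (cmod (a n))\<^sup>2) *\<^sub>R g n)"
  proof (rule integral_count_space_nat, unfold integrable_count_space_nat_iff, rule summable_comparison_test'[where N = 0])
    show "summable (\<lambda>n. (1 - (cmod (a n))\<^sup>2) * (1 / (1 - cmod w) * (1 / (1 - cmod z))))"
      by (intro summable_mult2 wt_summable)
    show "norm (norm ((1 - (cmod (a n))\<^sup>2) *\<^sub>R g n)) \<le> (1 - (cmod (a n))\<^sup>2) * (1 / (1 - cmod w) * (1 / (1 - cmod z)))" for n
      using mult_left_mono[OF kernel_integrand_bound[OF z w, of "(Suc n, 0, 0)"] wt_nonneg[of n]] wt_nonneg[of n]
      by (simp add: g_def)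
  qed
  also have "\<dots> = (1 - blaschke a w * cnj (blaschke a z)) / (1 - w * cnj z)"
    using blaschke_kernel_sums[OF a_le_1 a_summable, of z w] z w unfolding g scaleR_conv_of_real
    by (intro sums_unique[symmetric]) auto
  finally show ?thesis .
qed

text \<open>The integrand is a function of s times a function of \<zeta>. The \<zeta>-integral is V
  with \<open>c = (1 - w * cnj z) * V\<close> for the sum c of Herglotz values, and the s-integral
  of \<open>exp (- s * c)\<close> closes the chain from 1 to \<open>exp (- c)\<close>.\<close>

lemma kernel_sing:
  assumes z: "z \<in> ball 0 1" and w: "w \<in> ball 0 1"
  shows "(\<integral>x. kernel_integrand z w x \<partial>sing_measure) = blaschke a w * cnj (blaschke a z) *
     (1 - exp (- herglotz \<mu> w) * cnj (exp (- herglotz \<mu> z))) / (1 - w * cnj z)"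
proof -
  define c where "c = herglotz \<mu> w + cnj (herglotz \<mu> z)"
  define v where "v \<zeta> = 1 / (1 - cnj (proj_circle \<zeta>) * w) * cnj (1 / (1 - cnj (proj_circle \<zeta>) * z))" for \<zeta>
  define BB where "BB = blaschke a w * cnj (blaschke a z)"
  define U where "U s = BB * exp (- (of_real (max 0 (min 1 s)) * c))" for s :: real
  define V where "V = (\<integral>\<zeta>. 2 * v \<zeta> \<partial>\<mu>)"
  have nz: "1 - w * cnj z \<noteq> 0"
    using one_minus_cnj_mult_bounds(3)[of z w] z w by (simp add: mult.commute)
  have c: "c = (1 - w * cnj z) * V"
    unfolding c_def V_def v_def by (rule herglotz_kernel[OF z w])
  have split: "kernel_integrand z w (0, s, \<zeta>) = U s * v \<zeta>" for s \<zeta>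
  proof -
    have "exp (- (of_real t * herglotz \<mu> w)) * cnj (exp (- (of_real t * herglotz \<mu> z))) = exp (- (of_real t * c))" for t
      by (simp add: c_def exp_cnj exp_add[symmetric] algebra_simps)
    note e = this[of "max 0 (min 1 s)"]
    show ?thesis unfolding U_def e[symmetric] by (simp add: kernel_integrand_def divisor_def node_def v_def BB_def)
  qed
  have split': "kernel_integrand z w (0, x) = U (fst x) * v (snd x)" for x
    by (cases x) (simp add: split)
  have v_meas: "v \<in> borel_measurable borel"
    unfolding v_def[abs_def]
    by (intro borel_measurable_times borel_measurable_cnj borel_measurable_divide borel_measurable_diff
        borel_measurable_const proj_circle_measurable)
  have int: "integrable (unit_lborel \<Otimes>\<^sub>M density \<mu> (\<lambda>_. 2)) (\<lambda>x. U (fst x) * v (snd x))"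
    using kernel_integrand_integrable(1)[OF z w] unfolding sing_measure_def
    by (subst (asm) integrable_distr_eq[OF sing_embed_measurable kernel_integrand_measurable])
       (simp add: split' case_prod_beta)
  have "(\<integral>x. kernel_integrand z w x \<partial>sing_measure) = (\<integral>x. U (fst x) * v (snd x) \<partial>(unit_lborel \<Otimes>\<^sub>M density \<mu> (\<lambda>_. 2)))"
    unfolding sing_measure_def
    by (subst integral_distr[OF sing_embed_measurable kernel_integrand_measurable]) (simp add: split' case_prod_beta)
  also have "\<dots> = (\<integral>s. (\<integral>\<zeta>. U s * v \<zeta> \<partial>density \<mu> (\<lambda>_. 2)) \<partial>unit_lborel)"
    using integral_fst'[OF int] by simp
  also have "\<dots> = (\<integral>s. U s * V \<partial>unit_lborel)"
  proof (rule Bochner_Integration.integral_cong[OF refl])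
    fix s
    have "(\<integral>\<zeta>. v \<zeta> \<partial>density \<mu> (\<lambda>_. ennreal 2)) = (\<integral>\<zeta>. 2 *\<^sub>R v \<zeta> \<partial>\<mu>)"
      using v_meas by (intro integral_density) auto
    hence "(\<integral>\<zeta>. v \<zeta> \<partial>density \<mu> (\<lambda>_. 2)) = V" by (simp add: V_def scaleR_conv_of_real)
    thus "(\<integral>\<zeta>. U s * v \<zeta> \<partial>density \<mu> (\<lambda>_. 2)) = U s * V" by simp
  qed
  also have "\<dots> = (\<integral>s. U s \<partial>unit_lborel) * V" by simp
  also have "(\<integral>s. U s \<partial>unit_lborel) = (\<integral>s. indicator {0..1} s *\<^sub>R U s \<partial>lborel)"
  proof -
    have "(\<integral>s. U s \<partial>density lborel (\<lambda>s. ennreal (indicator {0..1} s))) = (\<integral>s. indicator {0..1} s *\<^sub>R U s \<partial>lborel)"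
      unfolding U_def by (rule integral_density) auto
    moreover have "(\<lambda>s. ennreal (indicator {0..1} s)) = (indicator {0..1} :: real \<Rightarrow> ennreal)"
      by (auto simp: ennreal_indicator)
    ultimately show ?thesis by simp
  qed
  also have "\<dots> = (\<integral>s. BB * (indicator {0..1} s *\<^sub>R exp (- (of_real s * c))) \<partial>lborel)"
    by (intro Bochner_Integration.integral_cong refl) (auto simp: U_def indicator_def)
  also have "\<dots> = BB * (\<integral>s. indicator {0..1} s *\<^sub>R exp (- (of_real s * c)) \<partial>lborel)"
    by (rule integral_mult_right_zero)
  \<comment> \<open>Multiplying by \<open>1 - w * cnj z\<close> turns V into c, so no division by c,
    which may vanish, takes place.\<close>
  finally have "(\<integral>x. kernel_integrand z w x \<partial>sing_measure) * (1 - w * cnj z)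
     = BB * (c * (\<integral>s. indicator {0..1} s *\<^sub>R exp (- (of_real s * c)) \<partial>lborel))" unfolding c by simp
  also have "\<dots> = BB * (1 - exp (- c))" unfolding exp_integral ..
  also have "exp (- c) = exp (- herglotz \<mu> w) * cnj (exp (- herglotz \<mu> z))"
    by (simp add: c_def exp_cnj exp_add[symmetric])
  finally show ?thesis using nz by (simp add: BB_def field_simps)
qed

text \<open>The zeros account for the step from 1 to B, the rest of the measure for the step from B
  to \<open>B * exp (- p)\<close>; the sum of the two defects telescopes.\<close>

lemma model_kernel:
  assumes z: "z \<in> ball 0 1" and w: "w \<in> ball 0 1"
  shows "kb b z w = (\<integral>x. kernel_integrand z w x \<partial>model_measure)"
proof -
  have g: "\<gamma> * cnj \<gamma> = 1" by (rule unit_mult_cnj[OF gamma])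
  define BB EE where "BB = blaschke a w * cnj (blaschke a z)"
    and "EE = exp (- herglotz \<mu> w) * cnj (exp (- herglotz \<mu> z))"
  have "(\<integral>x. kernel_integrand z w x \<partial>model_measure)
    = (\<integral>x. kernel_integrand z w x \<partial>sing_measure) + (\<integral>x. kernel_integrand z w x \<partial>zeros_measure)"
    unfolding model_measure_def
    by (rule integral_sum_measure[OF _ parts_singular kernel_integrand_integrable[OF z w]]) (simp add: sets_parts)
  also have "\<dots> = (BB * (1 - EE) + (1 - BB)) / (1 - w * cnj z)"
    unfolding kernel_zeros[OF z w] kernel_sing[OF z w] BB_def EE_def by (simp add: add_divide_distrib)
  also have "BB * (1 - EE) + (1 - BB) = 1 - (\<gamma> * cnj \<gamma>) * (BB * EE)" unfolding g by (simp add: algebra_simps)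
  also have "(\<gamma> * cnj \<gamma>) * (BB * EE) = cnj (b z) * b w"
    unfolding b_eq[OF z] b_eq[OF w] BB_def EE_def by (simp add: mult_ac)
  finally show ?thesis by (simp add: kb_def mult.commute)
qed

text \<open>The logarithmic derivative of a finite Blaschke product times
  \<open>exp (- s * p)\<close>. With N finite it has finitely many poles and can be differentiated
  term by term.\<close>

definition logder :: "nat \<Rightarrow> real \<Rightarrow> complex \<Rightarrow> complex" where
  "logder N s w = (\<Sum>i<N. 1 / (w - a i) + cnj (a i) / (1 - cnj (a i) * w)) - of_real s * deriv (herglotz \<mu>) w"

abbreviation pdiv :: "nat \<Rightarrow> real \<Rightarrow> complex \<Rightarrow> complex" where
  "pdiv N s w \<equiv> blaschke_partial a N w * exp (- (of_real s * herglotz \<mu> w))"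

lemma blaschke_partial_deriv:
  assumes "w \<in> ball 0 1" "w \<notin> a ` {..<N}"
  shows "(blaschke_partial a N has_field_derivative
     blaschke_partial a N w * (\<Sum>i<N. 1 / (w - a i) + cnj (a i) / (1 - cnj (a i) * w))) (at w)"
  using assms(2)
proof (induction N)
  case 0 thus ?case by (simp add: blaschke_partial_def[abs_def])
next
  case (Suc N)
  have "w \<noteq> a N" using Suc.prems by auto
  hence d: "deriv (blaschke_factor (a N)) w = blaschke_factor (a N) w * (1 / (w - a N) + cnj (a N) / (1 - cnj (a N) * w))"
    using assms(1) by (intro blaschke_factor_deriv a_le_1) auto
  have fac: "(blaschke_factor (a N) has_field_derivative
     blaschke_factor (a N) w * (1 / (w - a N) + cnj (a N) / (1 - cnj (a N) * w))) (at w)"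
    unfolding d[symmetric] by (rule holomorphic_derivI[OF blaschke_factor_holomorphic[OF a_le_1] open_ball assms(1)])
  have eq: "blaschke_partial a (Suc N) = (\<lambda>w. blaschke_partial a N w * blaschke_factor (a N) w)"
    by (auto simp: blaschke_partial_def)
  show ?case unfolding eq
    by (rule DERIV_cong[OF DERIV_mult[OF Suc.IH fac]]) (use Suc.prems in \<open>auto simp: algebra_simps\<close>)
qed

lemma pdiv_deriv:
  assumes "w \<in> ball 0 1" "w \<notin> a ` {..<N}"
  shows "deriv (pdiv N s) w = pdiv N s w * logder N s w"
proof -
  have "(herglotz \<mu> has_field_derivative deriv (herglotz \<mu>) w) (at w)"
    by (rule holomorphic_derivI[OF herglotz_holomorphic open_ball assms(1)])
  hence "((\<lambda>w. exp (- (of_real s * herglotz \<mu> w))) has_field_derivative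
      exp (- (of_real s * herglotz \<mu> w)) * (- (of_real s * deriv (herglotz \<mu>) w))) (at w)"
    by (auto intro!: derivative_eq_intros)
  from DERIV_mult[OF blaschke_partial_deriv[OF assms] this] show ?thesis
    unfolding logder_def by (intro DERIV_imp_deriv) (auto elim!: DERIV_cong simp: algebra_simps)
qed

end

lemma higher_deriv_sum_fun:
  assumes "finite I" "\<And>i. i \<in> I \<Longrightarrow> f i holomorphic_on S" "open S" "z \<in> S"
  shows "(deriv ^^ k) (\<lambda>w. \<Sum>i\<in>I. f i w) z = (\<Sum>i\<in>I. (deriv ^^ k) (f i) z)"
  using assms(1,2)
proof (induction I rule: finite_induct)
  case (insert i I)
  have "(deriv ^^ k) (\<lambda>w. f i w + (\<Sum>i\<in>I. f i w)) z = (deriv ^^ k) (f i) z + (deriv ^^ k) (\<lambda>w. \<Sum>i\<in>I. f i w) z"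
    using insert.prems assms by (intro higher_deriv_add[of _ S] holomorphic_intros) auto
  thus ?case using insert by simp
qed simp

context canonical_factorization
begin

text \<open>Converts the bound on Q into real inequalities, with a partial sum over the zeros so
  that the estimates are uniform in N. A negative C means the bound 0 for \<open>ennreal\<close>,
  hence \<open>max C 0\<close>.\<close>

lemma Q_split:
  fixes z :: complex and m :: nat
  defines "q \<equiv> (\<lambda>c::complex. 1 / cmod (1 - cnj c * z) ^ (2*m+2))"
  assumes z: "z \<in> ball 0 1" and Q: "(\<integral>\<^sup>+x. ennreal (q (node x)) \<partial>model_measure) \<le> ennreal C"
  shows "(\<Sum>i<N. (1 - (cmod (a i))\<^sup>2) * q (a i)) + (\<integral>\<zeta>. 2 * q (proj_circle \<zeta>) \<partial>\<mu>) \<le> max C 0"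
    and "integrable \<mu> (\<lambda>\<zeta>. 2 * q (proj_circle \<zeta>))"
proof -
  have [measurable]: "q \<in> borel_measurable borel"
    unfolding q_def using borel_measurable_cnj[of "\<lambda>c. c" borel] by measurable
  have q0: "q c \<ge> 0" for c by (simp add: q_def)
  show int: "integrable \<mu> (\<lambda>\<zeta>. 2 * q (proj_circle \<zeta>))"
  proof (rule mu.integrable_const_bound)
    show "AE \<zeta> in \<mu>. norm (2 * q (proj_circle \<zeta>)) \<le> 2 * (1 / (1 - cmod z) ^ (2*m+2))"
    proof (rule AE_I2)
      fix \<zeta>
      have "1 / cmod (1 - cnj (proj_circle \<zeta>) * z) ^ (2*m+2) \<le> 1 / (1 - cmod z) ^ (2*m+2)"
        using one_minus_cnj_mult_bounds[of "proj_circle \<zeta>" z] z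
        by (intro divide_left_mono power_mono mult_pos_pos zero_less_power) auto
      thus "norm (2 * q (proj_circle \<zeta>)) \<le> 2 * (1 / (1 - cmod z) ^ (2*m+2))" by (simp add: q_def)
    qed
  qed measurable
  have "ennreal ((\<Sum>i<N. (1 - (cmod (a i))\<^sup>2) * q (a i)) + (\<integral>\<zeta>. 2 * q (proj_circle \<zeta>) \<partial>\<mu>))
    = (\<Sum>i<N. ennreal (1 - (cmod (a i))\<^sup>2) * ennreal (q (a i))) + ennreal (\<integral>\<zeta>. 2 * q (proj_circle \<zeta>) \<partial>\<mu>)"
    using q0 wt_nonneg by (subst ennreal_plus)
      (auto intro!: sum_nonneg Bochner_Integration.integral_nonneg simp: sum_ennreal[symmetric] ennreal_mult)
  also have "ennreal (\<integral>\<zeta>. 2 * q (proj_circle \<zeta>) \<partial>\<mu>) = (\<integral>\<^sup>+\<zeta>. ennreal (2 * q (proj_circle \<zeta>)) \<partial>\<mu>)"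
    using int q0 by (intro nn_integral_eq_integral[symmetric]) auto
  also have "\<dots> = (\<integral>\<^sup>+\<zeta>. 2 * ennreal (q \<zeta>) \<partial>\<mu>)"
    using AE_proj_circle by (intro nn_integral_cong_AE) (auto elim!: eventually_mono simp: ennreal_mult')
  also have "\<dots> = 2 * (\<integral>\<^sup>+\<zeta>. ennreal (q \<zeta>) \<partial>\<mu>)" by (rule nn_integral_cmult) measurable
  also have "(\<Sum>i<N. ennreal (1 - (cmod (a i))\<^sup>2) * ennreal (q (a i))) + 2 * (\<integral>\<^sup>+\<zeta>. ennreal (q \<zeta>) \<partial>\<mu>)
     \<le> (\<Sum>i. ennreal (1 - (cmod (a i))\<^sup>2) * ennreal (q (a i))) + 2 * (\<integral>\<^sup>+\<zeta>. ennreal (q \<zeta>) \<partial>\<mu>)"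
    by (intro add_mono sum_le_suminf) auto
  also have "\<dots> \<le> ennreal C" using Q nn_integral_node[of "\<lambda>c. ennreal (q c)"] by simp
  also have "\<dots> \<le> ennreal (max C 0)" by (intro ennreal_leI) auto
  finally show "(\<Sum>i<N. (1 - (cmod (a i))\<^sup>2) * q (a i)) + (\<integral>\<zeta>. 2 * q (proj_circle \<zeta>) \<partial>\<mu>) \<le> max C 0"
    by (subst (asm) ennreal_le_iff) auto
qed

text \<open>The remaining factors of b have modulus at most 1, so each single Blaschke factor
  inherits the lower bound of b.\<close>

lemma half_le_factor:
  assumes z: "z \<in> ball 0 1" "cmod (b z) \<ge> 1/2"
  shows "cmod (blaschke_factor (a i) z) \<ge> 1/2" "z \<noteq> a i"
proof -
  have z': "cmod z < 1" using z by simp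
  have "1/2 \<le> cmod (divisor (Suc (Suc i), 0, 0) z)" using b_le_divisor[OF z(1), of "(Suc (Suc i), 0, 0)"] z(2) by linarith
  also have "\<dots> = cmod (blaschke_partial a (Suc i) z)" by (simp add: divisor_def)
  also have "\<dots> \<le> cmod (blaschke_factor (a i) z)"
    by (rule blaschke_partial_le_factor[OF a_le_1 z']) simp
  finally show *: "cmod (blaschke_factor (a i) z) \<ge> 1/2" .
  thus "z \<noteq> a i" using cmod_blaschke_factor[OF a_le_1, of i z] by auto
qed

text \<open>The k-th derivative of each term has size \<open>1 / |1 - cnj c * z|^(k+2)\<close> times
  the mass at the node c. For k at most m this exponent does not exceed 2m+2, and raising it to 2m+2
  makes the sum and the integral parts of Q.\<close>

lemma logder_deriv_bound:
  assumes z: "z \<in> ball 0 1" "cmod (b z) \<ge> 1/2"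
    and Q: "(\<integral>\<^sup>+x. ennreal (1 / cmod (1 - cnj (node x) * z) ^ (2*m+2)) \<partial>model_measure) \<le> ennreal C"
    and s: "0 \<le> s" "s \<le> 1" and k: "k \<le> m"
  shows "cmod ((deriv ^^ k) (logder N s) z) \<le> fact (m + 1) * 2 ^ (2*m+1) * max C 0"
    and "logder N s holomorphic_on ball 0 1 - a ` {..<N}"
proof -
  let ?S = "ball 0 1 - a ` {..<N}"
  define q where "q c = 1 / cmod (1 - cnj c * z) ^ (2*m+2)" for c :: complex
  define A :: real where "A = fact (k + 1) * 2 ^ (2*m+1)"
  have z': "cmod z < 1" using z by simp
  have opS: "open ?S" by (intro open_Diff finite_imp_closed) auto
  have zS: "z \<in> ?S" using z half_le_factor[OF z] by auto
  define R where "R i w = 1 / (w - a i) + cnj (a i) / (1 - cnj (a i) * w)" for i w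
  have R_hol: "R i holomorphic_on ?S" if "i \<in> {..<N}" for i
    unfolding R_def[abs_def] using that one_minus_cnj_mult_bounds(3)[OF a_le_1]
    by (intro holomorphic_intros) auto
  have dp_hol: "deriv (herglotz \<mu>) holomorphic_on ?S"
    by (rule holomorphic_on_subset[OF holomorphic_deriv[OF herglotz_holomorphic open_ball]]) auto
  have eq: "logder N s = (\<lambda>w. (\<Sum>i<N. R i w) - of_real s * deriv (herglotz \<mu>) w)"
    by (auto simp: logder_def R_def)
  show "logder N s holomorphic_on ?S"
    unfolding eq by (intro holomorphic_intros R_hol dp_hol) auto
  have pow: "1 / cmod (1 - cnj c * z) ^ (k + 2) \<le> 2 ^ (2*m - k) * q c" if "cmod c \<le> 1" for c
    unfolding q_def using inverse_power_le[of "cmod (1 - cnj c * z)" "k + 2" "2*m+2"]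
      one_minus_cnj_mult_bounds[OF that z'] k by (simp add: q_def)
  \<comment> \<open>The power \<open>2 ^ (k + 1)\<close> comes from differentiating one factor,
    \<open>2 ^ (2*m - k)\<close> from raising the exponent k+2 to 2m+2.\<close>
  have two: "(2::real) ^ (k + 1) * 2 ^ (2*m - k) = 2 ^ (2*m+1)"
    using k by (simp add: power_add[symmetric])
  have R_bound: "cmod ((deriv ^^ k) (R i) z) \<le> A * ((1 - (cmod (a i))\<^sup>2) * q (a i))" for i
  proof -
    have "cmod ((deriv ^^ k) (R i) z)
       \<le> fact (k + 1) * 2 ^ (k + 1) * ((1 - (cmod (a i))\<^sup>2) * (1 / cmod (1 - cnj (a i) * z) ^ (k + 2)))"
      unfolding R_def[abs_def]
      using blaschke_factor_logderiv_bound[OF a_le_1 z' half_le_factor(1)[OF z], of k i] by simp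
    also have "\<dots> \<le> fact (k + 1) * 2 ^ (k + 1) * ((1 - (cmod (a i))\<^sup>2) * (2 ^ (2*m - k) * q (a i)))"
      by (intro mult_left_mono pow a_le_1 wt_nonneg) auto
    also have "\<dots> = fact (k + 1) * (2 ^ (k + 1) * 2 ^ (2*m - k)) * ((1 - (cmod (a i))\<^sup>2) * q (a i))"
      by (simp only: mult_ac)
    finally show ?thesis unfolding two A_def .
  qed
  have p_bound: "cmod ((deriv ^^ Suc k) (herglotz \<mu>) z) \<le> A * (\<integral>\<zeta>. 2 * q (proj_circle \<zeta>) \<partial>\<mu>)"
  proof -
    have "(deriv ^^ Suc k) (herglotz \<mu>) z = (\<integral>\<zeta>. (deriv ^^ Suc k) (P \<zeta>) z \<partial>\<mu>)"
      unfolding herglotz_fun_eq by (rule higher_deriv_integral_family[OF mu_finite P_family _ z(1)]) measurable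
    also have "cmod \<dots> \<le> (\<integral>\<zeta>. A * (2 * q (proj_circle \<zeta>)) \<partial>\<mu>)"
    proof (rule norm_integral_le)
      show "integrable \<mu> (\<lambda>\<zeta>. (deriv ^^ Suc k) (P \<zeta>) z)"
        by (rule integrable_locally_bounded_family[OF mu_finite locally_bounded_family_higher_deriv[OF P_family]
             measurable_higher_deriv_family[OF P_family P_measurable] z(1)])
      show "integrable \<mu> (\<lambda>\<zeta>. A * (2 * q (proj_circle \<zeta>)))"
        unfolding q_def by (rule integrable_mult_right) (rule Q_split(2)[OF z(1) Q])
      show "AE \<zeta> in \<mu>. cmod ((deriv ^^ Suc k) (P \<zeta>) z) \<le> A * (2 * q (proj_circle \<zeta>))"
      proof (rule AE_I2)
        fix \<zeta>
        have "cmod ((deriv ^^ Suc k) (P \<zeta>) z) = 2 * fact (k + 1) * (1 / cmod (1 - cnj (proj_circle \<zeta>) * z) ^ (k + 2))"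
          unfolding P_higher_deriv[OF z(1)]
          by (simp only: norm_mult norm_divide norm_power cmod_unit_minus[OF cmod_proj_circle]
              norm_fact norm_numeral cmod_proj_circle) simp
        also have "\<dots> \<le> 2 * fact (k + 1) * (2 ^ (2*m - k) * q (proj_circle \<zeta>))"
          by (intro mult_left_mono pow) auto
        also have "\<dots> \<le> 2 * fact (k + 1) * (2 ^ (2*m + 1) * q (proj_circle \<zeta>))"
          by (intro mult_left_mono mult_right_mono power_increasing) (auto simp: q_def)
        also have "\<dots> = A * (2 * q (proj_circle \<zeta>))" unfolding A_def by (simp only: mult_ac)
        finally show "cmod ((deriv ^^ Suc k) (P \<zeta>) z) \<le> A * (2 * q (proj_circle \<zeta>))" .
      qed
    qed
    also have "\<dots> = A * (\<integral>\<zeta>. 2 * q (proj_circle \<zeta>) \<partial>\<mu>)" by (rule integral_mult_right_zero)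
    finally show ?thesis .
  qed
  have "(deriv ^^ k) (logder N s) z = (\<Sum>i<N. (deriv ^^ k) (R i) z) - of_real s * (deriv ^^ k) (deriv (herglotz \<mu>)) z"
  proof -
    have "(deriv ^^ k) (logder N s) z = (deriv ^^ k) (\<lambda>w. \<Sum>i<N. R i w) z - (deriv ^^ k) (\<lambda>w. of_real s * deriv (herglotz \<mu>) w) z"
      unfolding eq by (rule higher_deriv_diff[OF _ _ opS zS]) (intro holomorphic_intros R_hol dp_hol; simp)+
    thus ?thesis
      by (simp only: higher_deriv_sum_fun[OF finite_lessThan R_hol opS zS] higher_deriv_cmult[OF dp_hol zS opS])
  qed
  also have "(deriv ^^ k) (deriv (herglotz \<mu>)) z = (deriv ^^ Suc k) (herglotz \<mu>) z"
    by (simp add: funpow_Suc_right del: funpow.simps)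
  also have "cmod ((\<Sum>i<N. (deriv ^^ k) (R i) z) - of_real s * (deriv ^^ Suc k) (herglotz \<mu>) z)
     \<le> cmod (\<Sum>i<N. (deriv ^^ k) (R i) z) + cmod (of_real s * (deriv ^^ Suc k) (herglotz \<mu>) z)"
    by (rule norm_triangle_ineq4)
  also have "\<dots> \<le> (\<Sum>i<N. A * ((1 - (cmod (a i))\<^sup>2) * q (a i))) + 1 * (A * (\<integral>\<zeta>. 2 * q (proj_circle \<zeta>) \<partial>\<mu>))"
    unfolding norm_mult norm_of_real using s
    by (intro add_mono mult_mono p_bound order_trans[OF norm_sum] sum_mono R_bound) auto
  also have "\<dots> = A * ((\<Sum>i<N. (1 - (cmod (a i))\<^sup>2) * q (a i)) + (\<integral>\<zeta>. 2 * q (proj_circle \<zeta>) \<partial>\<mu>))"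
    by (simp only: sum_distrib_left distrib_left mult_1)
  also have "\<dots> \<le> A * max C 0"
    using Q_split(1)[OF z(1) Q, of N] unfolding q_def by (intro mult_left_mono) (auto simp: A_def)
  also have "\<dots> \<le> fact (m + 1) * 2 ^ (2*m+1) * max C 0"
    unfolding A_def using k by (intro mult_right_mono fact_mono) auto
  finally show "cmod ((deriv ^^ k) (logder N s) z) \<le> fact (m + 1) * 2 ^ (2*m+1) * max C 0" .
qed

text \<open>The logarithmic derivative is used for finite products only. The resulting bound does
  not depend on N, and derivatives of the partial products converge to those of the infinite
  product.\<close>

lemma divisor_deriv_bound:
  "\<exists>K. \<forall>z\<in>ball 0 1. cmod (b z) \<ge> 1/2 \<longrightarrow>
     (\<integral>\<^sup>+x. ennreal (1 / cmod (1 - cnj (node x) * z) ^ (2*m+2)) \<partial>model_measure) \<le> ennreal C \<longrightarrow>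
     (\<forall>x. \<forall>j\<le>m+1. cmod ((deriv ^^ j) (divisor x) z) \<le> K)"
proof -
  obtain K where K: "\<forall>f L S z. open S \<longrightarrow> z \<in> S \<longrightarrow> f holomorphic_on S \<longrightarrow> L holomorphic_on S \<longrightarrow>
    (\<forall>w\<in>S. deriv f w = f w * L w) \<longrightarrow> cmod (f z) \<le> 1 \<longrightarrow>
    (\<forall>k<m+1. cmod ((deriv ^^ k) L z) \<le> fact (m + 1) * 2 ^ (2*m+1) * max C 0) \<longrightarrow>
    (\<forall>j\<le>m+1. cmod ((deriv ^^ j) f z) \<le> K)"
    using higher_deriv_bound_of_logderiv[of "m+1" "fact (m + 1) * 2 ^ (2*m+1) * max C 0"] by (elim exE) (rule that)
  show ?thesis
  proof (intro exI[of _ K] ballI impI allI)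
    fix z j and x :: index
    assume z: "z \<in> ball 0 1" "cmod (b z) \<ge> 1/2" and j: "j \<le> m + 1"
      and Q: "(\<integral>\<^sup>+x. ennreal (1 / cmod (1 - cnj (node x) * z) ^ (2*m+2)) \<partial>model_measure) \<le> ennreal C"
    have exp_hol: "(\<lambda>w. exp (- (of_real s * herglotz \<mu> w))) holomorphic_on ball 0 1" for s :: real
      by (intro holomorphic_intros herglotz_holomorphic)
    have pdiv: "cmod ((deriv ^^ j) (pdiv N s) z) \<le> K" if s: "0 \<le> s" "s \<le> 1" for N s
    proof (rule K[rule_format, of "ball 0 1 - a ` {..<N}" z "pdiv N s" "logder N s"])
      show "open (ball 0 1 - a ` {..<N})" by (intro open_Diff finite_imp_closed) auto
      show "z \<in> ball 0 1 - a ` {..<N}" using z half_le_factor[OF z] by auto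
      show "pdiv N s holomorphic_on ball 0 1 - a ` {..<N}"
        by (rule holomorphic_on_subset[of _ "ball 0 1"])
           (intro holomorphic_intros exp_hol blaschke_partial_holomorphic a_le_1 herglotz_holomorphic, auto)
      show "logder N s holomorphic_on ball 0 1 - a ` {..<N}" by (rule logder_deriv_bound(2)[OF z Q s le0])
      show "deriv (pdiv N s) w = pdiv N s w * logder N s w" if "w \<in> ball 0 1 - a ` {..<N}" for w
        using that by (intro pdiv_deriv) auto
      have "0 \<le> s * Re (herglotz \<mu> z)" using Re_herglotz_nonneg[OF z(1)] s by simp
      hence "cmod (blaschke_partial a N z) * exp (- (s * Re (herglotz \<mu> z))) \<le> 1 * 1"
        using z(1) by (intro mult_mono blaschke_partial_le_1 a_le_1) auto
      thus "cmod (pdiv N s z) \<le> 1" by (simp add: norm_mult)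
      show "cmod ((deriv ^^ k) (logder N s) z) \<le> fact (m + 1) * 2 ^ (2*m+1) * max C 0" if "k < m + 1" for k
        using that by (intro logder_deriv_bound(1)[OF z Q s]) auto
    qed (fact j)
    obtain n t \<zeta> where x: "x = (n, t, \<zeta>)" by (cases x)
    define s where "s = max 0 (min 1 t)"
    have s: "0 \<le> s" "s \<le> 1" by (auto simp: s_def)
    show "cmod ((deriv ^^ j) (divisor x) z) \<le> K"
    proof (cases "n = 0")
      case False
      \<comment> \<open>Partial products are the case s = 0 of the combined chain.\<close>
      hence "divisor x = pdiv (n - 1) 0" by (auto simp: x divisor_def)
      thus ?thesis using pdiv[of 0 "n - 1"] by simp
    next
      case True
      define r where "r = (1 + cmod z) / 2"
      have r: "r < 1" "z \<in> ball 0 r" using z by (auto simp: r_def)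
      have eq: "divisor x = (\<lambda>w. blaschke a w * exp (- (of_real s * herglotz \<mu> w)))"
        using True by (auto simp: x divisor_def s_def)
      have lim: "(\<lambda>N. (deriv ^^ i) (blaschke_partial a N) z) \<longlonglongrightarrow> (deriv ^^ i) (blaschke a) z" for i
      proof (rule higher_deriv_complex_uniform_limit)
        show "uniform_limit (ball 0 r) (blaschke_partial a) (blaschke a) sequentially"
          by (rule uniform_limit_on_subset[OF blaschke_uniform_limit[OF a_le_1 a_summable r(1)]]) auto
        show "\<forall>\<^sub>F N in sequentially. blaschke_partial a N holomorphic_on ball 0 r"
          using r by (intro always_eventually allI holomorphic_on_subset[OF blaschke_partial_holomorphic[OF a_le_1]]) auto
      qed (use r in auto)
      have leib: "(deriv ^^ j) (\<lambda>w. g w * exp (- (of_real s * herglotz \<mu> w))) z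
        = (\<Sum>i=0..j. of_nat (j choose i) * (deriv ^^ i) g z * (deriv ^^ (j - i)) (\<lambda>w. exp (- (of_real s * herglotz \<mu> w))) z)"
        if "g holomorphic_on ball 0 1" for g
        by (rule higher_deriv_mult[OF that exp_hol open_ball z(1)])
      have "(\<lambda>N. (deriv ^^ j) (pdiv N s) z) \<longlonglongrightarrow> (deriv ^^ j) (divisor x) z"
        unfolding eq leib[OF blaschke_partial_holomorphic[OF a_le_1]] leib[OF blaschke_holomorphic[OF a_le_1 a_summable]]
        by (intro tendsto_intros lim)
      hence "(\<lambda>N. cmod ((deriv ^^ j) (pdiv N s) z)) \<longlonglongrightarrow> cmod ((deriv ^^ j) (divisor x) z)" by (rule tendsto_norm)
      thus ?thesis by (rule LIMSEQ_le_const2) (use pdiv[OF s] in blast)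
    qed
  qed
qed

end

context canonical_factorization
begin

theorem Hb_norm_tendsto_iff:
  assumes region: "approach_region \<Omega>"
    and bound: "\<And>z. z \<in> \<Omega> \<Longrightarrow> (\<integral>\<^sup>+x. ennreal (1 / cmod (1 - cnj (node x) * z) ^ (2*m+2)) \<partial>model_measure) \<le> ennreal C"
    and C: "C \<ge> 0"
  shows "((\<lambda>z. Hb_norm b (\<lambda>w. dkb b m z w - dkb1 b m \<Omega> w)) \<longlongrightarrow> 0) (at 1 within \<Omega>) \<longleftrightarrow>
    ((\<lambda>z. \<integral>\<^sup>+x. indicator (sector z) (node x) * ennreal (1 / cmod (1 - cnj (node x) * z) ^ (2*m+2)) \<partial>model_measure)
       \<longlongrightarrow> 0) (at 1 within \<Omega>)"
proof -
  interpret mm: finite_measure model_measure by (rule finite_model_measure)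
  interpret bm: boundary_model model_measure node divisor b m \<Omega> C
  proof
    show "node \<in> borel_measurable model_measure"
      using node_measurable by (simp add: measurable_cong_sets[OF sets_model_measure refl])
    show "cmod (node x) \<le> 1" for x by (rule cmod_node_le_1)
    show "divisor x holomorphic_on ball 0 1" for x by (rule divisor_holomorphic)
    show "cmod (divisor x z) \<le> 1" if "z \<in> ball 0 1" for z x by (rule divisor_le_1[OF that])
    show "(\<lambda>x. divisor x z) \<in> borel_measurable model_measure" for z
      using divisor_measurable by (simp add: measurable_cong_sets[OF sets_model_measure refl])
    show "kb b z w = (\<integral>x. divisor x w / (1 - cnj (node x) * w) * cnj (divisor x z / (1 - cnj (node x) * z)) \<partial>model_measure)"
      if "z \<in> ball 0 1" "w \<in> ball 0 1" for z w
      using model_kernel[OF that] by (simp only: kernel_integrand_def)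
    show "cmod (b z) \<le> cmod (divisor x z)" if "z \<in> ball 0 1" for z x by (rule b_le_divisor[OF that])
  qed (use divisor_deriv_bound region bound C in auto)
  show ?thesis
    using bm.Hb_norm_tendsto_iff_tail unfolding bm.tail_def[abs_def] bm.u_def .
qed

end

section \<open>Radial limits of bounded holomorphic functions\<close>

definition circle_weight :: "real \<Rightarrow> real" where
  "circle_weight t = indicator {-pi<..pi} t / (2 * pi)"

lemma circle_weight_nonneg [simp]: "circle_weight t \<ge> 0"
  by (simp add: circle_weight_def)

lemma circle_weight_measurable [measurable]: "circle_weight \<in> borel_measurable borel"
  unfolding circle_weight_def[abs_def] by measurable

lemma cis_measurable [measurable]: "cis \<in> borel_measurable borel"
proof -
  have "continuous_on UNIV (\<lambda>t. cis t)" by (intro continuous_intros)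
  thus ?thesis by (rule borel_measurable_continuous_onI)
qed

lemma mT_eq: "mT = distr (density lborel (\<lambda>t. ennreal (circle_weight t))) borel cis"
  by (simp add: mT_def circle_weight_def)

lemma sets_mT [measurable_cong]: "sets mT = sets borel"
  by (simp add: mT_eq)

lemma space_mT [simp]: "space mT = UNIV"
  by (simp add: mT_eq)

lemma nn_integral_mT:
  assumes [measurable]: "f \<in> borel_measurable borel"
  shows "(\<integral>\<^sup>+\<zeta>. f \<zeta> \<partial>mT) = (\<integral>\<^sup>+t. ennreal (circle_weight t) * f (cis t) \<partial>lborel)"
  unfolding mT_eq by (subst nn_integral_distr) (simp_all add: nn_integral_density)

lemma integral_mT:
  fixes f :: "complex \<Rightarrow> 'b::{banach, second_countable_topology}"
  assumes [measurable]: "f \<in> borel_measurable borel"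
  shows "(\<integral>\<zeta>. f \<zeta> \<partial>mT) = (\<integral>t. circle_weight t *\<^sub>R f (cis t) \<partial>lborel)"
  unfolding mT_eq by (subst integral_distr) (simp_all add: integral_density)

lemma AE_mT_iff:
  assumes "{\<zeta>. P \<zeta>} \<in> sets borel"
  shows "(AE \<zeta> in mT. P \<zeta>) \<longleftrightarrow> (AE t in lborel. -pi < t \<and> t \<le> pi \<longrightarrow> P (cis t))"
proof -
  have "(AE \<zeta> in mT. P \<zeta>) \<longleftrightarrow> (AE t in density lborel (\<lambda>t. ennreal (circle_weight t)). P (cis t))"
    unfolding mT_eq using assms by (subst AE_distr_iff) auto
  also have "\<dots> \<longleftrightarrow> (AE t in lborel. 0 < ennreal (circle_weight t) \<longrightarrow> P (cis t))"
    by (rule AE_density) measurable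
  also have "(\<lambda>t. 0 < ennreal (circle_weight t) \<longrightarrow> P (cis t)) = (\<lambda>t. -pi < t \<and> t \<le> pi \<longrightarrow> P (cis t))"
    by (auto simp: circle_weight_def indicator_def)
  finally show ?thesis .
qed

lemma AE_mT_circle: "AE \<zeta> in mT. cmod \<zeta> = 1"
  by (subst AE_mT_iff) auto

lemma emeasure_mT: "emeasure mT UNIV = 1"
proof -
  have "emeasure mT UNIV = (\<integral>\<^sup>+\<zeta>. 1 \<partial>mT)" by simp
  also have "\<dots> = (\<integral>\<^sup>+t. ennreal (1 / (2 * pi)) * indicator {-pi<..pi} t \<partial>lborel)"
    by (subst nn_integral_mT) (auto intro!: nn_integral_cong simp: circle_weight_def indicator_def)
  also have "\<dots> = ennreal (1 / (2 * pi)) * ennreal (2 * pi)"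
    by (subst nn_integral_cmult_indicator) auto
  also have "\<dots> = 1" by (subst ennreal_mult[symmetric]) auto
  finally show ?thesis .
qed

interpretation mT: finite_measure mT
  by standard (simp add: emeasure_mT)

lemma measure_mT_UNIV: "measure mT UNIV = 1"
  by (simp add: measure_def emeasure_mT)

section \<open>Taylor coefficients and the Poisson formula on circles\<close>

lemma integral_cis:
  fixes k :: int
  shows "(\<integral>t. circle_weight t *\<^sub>R cis (of_int k * t) \<partial>lborel) = (if k = 0 then 1 else 0)"
proof (cases "k = 0")
  case True
  have "(\<integral>t. circle_weight t *\<^sub>R (1::complex) \<partial>lborel) = (\<integral>\<zeta>. 1 \<partial>mT)" by (subst integral_mT) auto
  also have "\<dots> = 1" by (simp add: measure_mT_UNIV)
  finally show ?thesis using True by simp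
next
  case False
  define F where "F t = cis (of_int k * t) / (\<i> * of_int k)" for t
  have "(\<integral>t. indicator {-pi..pi} t *\<^sub>R cis (of_int k * t) \<partial>lborel) = F pi - F (- pi)"
  proof (rule integral_FTC_Icc)
    fix t :: real
    have "((\<lambda>z. exp (\<i> * of_int k * z) / (\<i> * of_int k)) has_field_derivative exp (\<i> * of_int k * of_real t)) (at (of_real t))"
      using False by (auto intro!: derivative_eq_intros)
    from has_vector_derivative_real_field[OF this]
    show "(F has_vector_derivative cis (of_int k * t)) (at t within {-pi..pi})"
      by (simp add: F_def[abs_def] cis_conv_exp mult.assoc)
  qed (auto intro!: continuous_intros)
  also have "F pi - F (- pi) = 0"
  proof -
    have "cis (of_int k * pi) = cis (- (of_int k * pi)) * cis (2 * pi * of_int k)" by (simp add: cis_mult algebra_simps)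
    also have "cis (2 * pi * of_int k) = 1" by simp
    finally show ?thesis by (simp add: F_def)
  qed
  finally have 0: "(\<integral>t. indicator {-pi..pi} t *\<^sub>R cis (of_int k * t) \<partial>lborel) = 0" .
  have "(\<integral>t. circle_weight t *\<^sub>R cis (of_int k * t) \<partial>lborel)
      = (\<integral>t. (1 / (2 * pi)) *\<^sub>R (indicator {-pi..pi} t *\<^sub>R cis (of_int k * t)) \<partial>lborel)"
  proof (rule integral_cong_AE)
    have [measurable]: "(\<lambda>t. cis (of_int k * t)) \<in> borel_measurable borel" by measurable
    show "(\<lambda>t. circle_weight t *\<^sub>R cis (of_int k * t)) \<in> borel_measurable lborel" by measurable
    show "(\<lambda>t. (1 / (2 * pi)) *\<^sub>R (indicator {-pi..pi} t *\<^sub>R cis (of_int k * t))) \<in> borel_measurable lborel" by measurable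
    \<comment> \<open>The weight lives on a half-open interval, the fundamental theorem on the
      closed one; they differ in the null set containing only -pi.\<close>
    show "AE t in lborel. circle_weight t *\<^sub>R cis (of_int k * t) = (1 / (2 * pi)) *\<^sub>R (indicator {-pi..pi} t *\<^sub>R cis (of_int k * t))"
      using AE_lborel_singleton[of "-pi"] by eventually_elim (auto simp: circle_weight_def indicator_def)
  qed
  also have "\<dots> = (1 / (2 * pi)) *\<^sub>R (\<integral>t. indicator {-pi..pi} t *\<^sub>R cis (of_int k * t) \<partial>lborel)"
    by (rule integral_scaleR_right)
  finally show ?thesis using 0 False by simp
qed

lemma circle_orthogonality:
  "(\<integral>\<zeta>. \<zeta> ^ j * cnj (\<zeta> ^ k) \<partial>mT) = (if j = k then 1 else 0)"
proof -
  have "(\<integral>\<zeta>. \<zeta> ^ j * cnj (\<zeta> ^ k) \<partial>mT) = (\<integral>t. circle_weight t *\<^sub>R cis (of_int (int j - int k) * t) \<partial>lborel)"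
  proof (subst integral_mT)
    show "(\<lambda>\<zeta>::complex. \<zeta> ^ j * cnj (\<zeta> ^ k)) \<in> borel_measurable borel"
      by (intro borel_measurable_continuous_onI continuous_intros)
    have "cis t ^ j * cnj (cis t ^ k) = cis (of_int (int j - int k) * t)" for t
    proof -
      have "cis t ^ j * cnj (cis t ^ k) = cis (of_nat j * t) * cis (- (of_nat k * t))"
        by (simp add: Complex.DeMoivre cis_cnj)
      thus ?thesis by (simp add: cis_mult algebra_simps)
    qed
    thus "(\<integral>t. circle_weight t *\<^sub>R (cis t ^ j * cnj (cis t ^ k)) \<partial>lborel) = (\<integral>t. circle_weight t *\<^sub>R cis (of_int (int j - int k) * t) \<partial>lborel)"
      by simp
  qed
  thus ?thesis unfolding integral_cis by simp
qed

lemma circle_measurable: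
  fixes g :: "complex \<Rightarrow> complex"
  assumes "continuous_on (sphere 0 1) g"
  shows "(\<lambda>\<zeta>. if cmod \<zeta> = 1 then g \<zeta> else 0) \<in> borel_measurable borel"
proof -
  have "(\<lambda>\<zeta>. if \<zeta> \<in> sphere 0 1 then g \<zeta> else 0) \<in> borel_measurable borel"
    by (rule borel_measurable_continuous_on_if[OF _ assms]) auto
  thus ?thesis by (simp add: dist_norm)
qed

text \<open>Replacing a function by 0 off the circle makes it Borel without changing its integral over \<open>mT\<close>.\<close>

definition on_circle :: "(complex \<Rightarrow> complex) \<Rightarrow> complex \<Rightarrow> complex" where
  "on_circle g \<zeta> = (if cmod \<zeta> = 1 then g \<zeta> else 0)"

lemma on_circle_measurable: "continuous_on (sphere 0 1) g \<Longrightarrow> on_circle g \<in> borel_measurable borel"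
  unfolding on_circle_def[abs_def] by (rule circle_measurable)

lemma on_circle_integrable:
  assumes "continuous_on (sphere 0 1) g" shows "integrable mT (on_circle g)"
proof -
  have "bounded (g ` sphere 0 1)"
    by (intro compact_imp_bounded compact_continuous_image assms compact_sphere)
  then obtain B where "\<forall>x\<in>g ` sphere 0 1. cmod x \<le> B" unfolding bounded_iff by blast
  hence B: "cmod (g \<zeta>) \<le> B" if "cmod \<zeta> = 1" for \<zeta> using that by auto
  show ?thesis
    using on_circle_measurable[OF assms]
    by (intro mT.integrable_const_bound[where B = "max B 0"]) (auto simp: on_circle_def B le_max_iff_disj measurable_cong_sets[OF sets_mT refl])
qed

lemma uniform_limit_circle_integral:
  assumes "\<And>n. continuous_on (sphere 0 1) (f n)" "uniform_limit (sphere 0 1) f g sequentially"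
  shows "(\<lambda>n. \<integral>\<zeta>. on_circle (f n) \<zeta> \<partial>mT) \<longlonglongrightarrow> (\<integral>\<zeta>. on_circle g \<zeta> \<partial>mT)"
proof -
  have g: "continuous_on (sphere 0 1) g"
    by (rule uniform_limit_theorem[OF _ assms(2)]) (use assms(1) in auto)
  show ?thesis
  proof (rule tendstoI)
    fix \<epsilon> :: real assume \<epsilon>: "\<epsilon> > 0"
    have "\<forall>\<^sub>F n in sequentially. \<forall>\<zeta>\<in>sphere 0 1. dist (f n \<zeta>) (g \<zeta>) < \<epsilon> / 2"
      using uniform_limitD[OF assms(2), of "\<epsilon> / 2"] \<epsilon> by simp
    thus "\<forall>\<^sub>F n in sequentially. dist (\<integral>\<zeta>. on_circle (f n) \<zeta> \<partial>mT) (\<integral>\<zeta>. on_circle g \<zeta> \<partial>mT) < \<epsilon>"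
    proof eventually_elim
      case (elim n)
      have "(\<integral>\<zeta>. on_circle (f n) \<zeta> \<partial>mT) - (\<integral>\<zeta>. on_circle g \<zeta> \<partial>mT) = (\<integral>\<zeta>. on_circle (f n) \<zeta> - on_circle g \<zeta> \<partial>mT)"
        by (intro Bochner_Integration.integral_diff[symmetric] on_circle_integrable g assms)
      also have "cmod \<dots> \<le> (\<integral>\<zeta>. \<epsilon> / 2 \<partial>mT)"
        using elim \<epsilon> by (intro norm_integral_le Bochner_Integration.integrable_diff on_circle_integrable g assms)
          (auto simp: on_circle_def dist_norm less_imp_le)
      also have "\<dots> < \<epsilon>" using \<epsilon> by (simp add: measure_mT_UNIV)
      finally show ?case by (simp add: dist_norm)
    qed
  qed
qed

lemma taylor_uniform_limit:
  assumes g: "g holomorphic_on ball 0 1" and r: "0 \<le> r" "r < 1"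
  shows "uniform_limit (sphere 0 1) (\<lambda>n \<zeta>. \<Sum>i<n. ((deriv ^^ i) g 0 / fact i * of_real r ^ i) * \<zeta> ^ i) (\<lambda>\<zeta>. g (of_real r * \<zeta>)) sequentially"
proof -
  define c where "c i = (deriv ^^ i) g 0 / fact i" for i
  define \<rho> where "\<rho> = (1 + r) / 2"
  have \<rho>: "r < \<rho>" "\<rho> < 1" "0 < \<rho>" using r by (auto simp: \<rho>_def)
  have sums: "(\<lambda>i. c i * z ^ i) sums g z" if "z \<in> ball 0 1" for z
    using holomorphic_power_series[OF g that] by (simp add: c_def)
  have "summable (\<lambda>i. c i * of_real \<rho> ^ i)" using sums[of "of_real \<rho>"] \<rho> by (auto simp: sums_iff)
  hence sm: "summable (\<lambda>i. cmod (c i * of_real r ^ i))"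
    by (rule powser_insidea) (use r \<rho> in auto)
  have lim: "uniform_limit (sphere 0 1) (\<lambda>n \<zeta>. \<Sum>i<n. (c i * of_real r ^ i) * \<zeta> ^ i) (\<lambda>\<zeta>. \<Sum>i. (c i * of_real r ^ i) * \<zeta> ^ i) sequentially"
    by (rule Weierstrass_m_test[OF _ sm]) (auto simp: norm_mult norm_power)
  have eq: "(\<Sum>i. (c i * of_real r ^ i) * \<zeta> ^ i) = g (of_real r * \<zeta>)" if "\<zeta> \<in> sphere 0 1" for \<zeta>
  proof -
    have "(\<lambda>i. c i * (of_real r * \<zeta>) ^ i) sums g (of_real r * \<zeta>)"
      using that r by (intro sums) (simp add: norm_mult)
    thus ?thesis by (simp add: power_mult_distrib mult.assoc sums_iff)
  qed
  show ?thesis unfolding c_def[symmetric] by (rule iffD1[OF uniform_limit_cong'[OF refl eq] lim])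
qed

lemma integral_on_circle:
  assumes "f \<in> borel_measurable borel" "continuous_on (sphere 0 1) f"
  shows "(\<integral>\<zeta>. on_circle f \<zeta> \<partial>mT) = (\<integral>\<zeta>. f \<zeta> \<partial>mT)"
  by (rule integral_cong_AE)
     (use AE_mT_circle assms(1) on_circle_measurable[OF assms(2)] in
       \<open>auto simp: on_circle_def measurable_cong_sets[OF sets_mT refl] elim: eventually_mono\<close>)

lemma taylor_continuous:
  assumes "g holomorphic_on ball 0 1" "0 \<le> r" "r < 1"
  shows "continuous_on (sphere 0 1) (\<lambda>\<zeta>. g (of_real r * \<zeta>))"
proof (rule continuous_on_compose2[OF holomorphic_on_imp_continuous_on[OF assms(1)]])
  show "(\<lambda>\<zeta>. of_real r * \<zeta>) ` sphere (0::complex) 1 \<subseteq> ball 0 1" using assms by (auto simp: norm_mult)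
qed (intro continuous_intros)

text \<open>Termwise integration of a uniformly convergent Taylor series against a bounded function
  h. Coefficients, Parseval's identity and the Poisson formula are its instances.\<close>

lemma circle_taylor_sums:
  assumes g: "g holomorphic_on ball 0 1" and r: "0 \<le> r" "r < 1" and h: "continuous_on (sphere 0 1) h"
  shows "(\<lambda>i. ((deriv ^^ i) g 0 / fact i * of_real r ^ i) * (\<integral>\<zeta>. on_circle (\<lambda>\<zeta>. \<zeta> ^ i * h \<zeta>) \<zeta> \<partial>mT))
     sums (\<integral>\<zeta>. on_circle (\<lambda>\<zeta>. g (of_real r * \<zeta>) * h \<zeta>) \<zeta> \<partial>mT)"
proof -
  define c where "c i = (deriv ^^ i) g 0 / fact i * of_real r ^ i" for i
  have "bounded (h ` sphere 0 1)" by (intro compact_imp_bounded compact_continuous_image h compact_sphere)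
  hence "uniform_limit (sphere 0 1) (\<lambda>n \<zeta>. (\<Sum>i<n. c i * \<zeta> ^ i) * h \<zeta>) (\<lambda>\<zeta>. g (of_real r * \<zeta>) * h \<zeta>) sequentially"
    unfolding c_def using r
    by (intro uniform_lim_mult taylor_uniform_limit g uniform_limit_const)
       (auto intro!: compact_imp_bounded compact_continuous_image compact_sphere taylor_continuous[OF g r])
  hence "(\<lambda>n. \<integral>\<zeta>. on_circle (\<lambda>\<zeta>. (\<Sum>i<n. c i * \<zeta> ^ i) * h \<zeta>) \<zeta> \<partial>mT) \<longlonglongrightarrow> (\<integral>\<zeta>. on_circle (\<lambda>\<zeta>. g (of_real r * \<zeta>) * h \<zeta>) \<zeta> \<partial>mT)"
    by (intro uniform_limit_circle_integral continuous_intros h)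
  moreover have "(\<integral>\<zeta>. on_circle (\<lambda>\<zeta>. (\<Sum>i<n. c i * \<zeta> ^ i) * h \<zeta>) \<zeta> \<partial>mT)
     = (\<Sum>i<n. c i * (\<integral>\<zeta>. on_circle (\<lambda>\<zeta>. \<zeta> ^ i * h \<zeta>) \<zeta> \<partial>mT))" for n
  proof -
    have "(\<integral>\<zeta>. on_circle (\<lambda>\<zeta>. (\<Sum>i<n. c i * \<zeta> ^ i) * h \<zeta>) \<zeta> \<partial>mT)
      = (\<integral>\<zeta>. (\<Sum>i<n. c i * on_circle (\<lambda>\<zeta>. \<zeta> ^ i * h \<zeta>) \<zeta>) \<partial>mT)"
      by (intro Bochner_Integration.integral_cong refl) (auto simp: on_circle_def sum_distrib_right mult.assoc)
    also have "\<dots> = (\<Sum>i<n. (\<integral>\<zeta>. c i * on_circle (\<lambda>\<zeta>. \<zeta> ^ i * h \<zeta>) \<zeta> \<partial>mT))"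
      by (intro Bochner_Integration.integral_sum integrable_mult_right on_circle_integrable continuous_intros h)
    finally show ?thesis by simp
  qed
  ultimately show ?thesis unfolding sums_def c_def by simp
qed

lemma circle_power_integral: "(\<integral>\<zeta>. on_circle (\<lambda>\<zeta>. \<zeta> ^ i * cnj (\<zeta> ^ k)) \<zeta> \<partial>mT) = (if i = k then 1 else 0)"
  by (subst integral_on_circle)
     (auto intro!: borel_measurable_continuous_onI continuous_intros simp: circle_orthogonality simp del: complex_cnj_power)

lemma circle_coefficient:
  assumes g: "g holomorphic_on ball 0 1" and r: "0 \<le> r" "r < 1"
  shows "(\<integral>\<zeta>. on_circle (\<lambda>\<zeta>. g (of_real r * \<zeta>) * cnj (\<zeta> ^ k)) \<zeta> \<partial>mT) = (deriv ^^ k) g 0 / fact k * of_real r ^ k"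
proof -
  let ?c = "\<lambda>i. (deriv ^^ i) g 0 / fact i * of_real r ^ i"
  have s: "(\<lambda>i. ?c i * (if i = k then 1 else 0)) sums (\<integral>\<zeta>. on_circle (\<lambda>\<zeta>. g (of_real r * \<zeta>) * cnj (\<zeta> ^ k)) \<zeta> \<partial>mT)"
  proof -
    have "continuous_on (sphere 0 1) (\<lambda>\<zeta>::complex. cnj (\<zeta> ^ k))" by (intro continuous_intros)
    from circle_taylor_sums[OF g r this] show ?thesis unfolding circle_power_integral .
  qed
  have eq: "(\<lambda>i. ?c i * (if i = k then 1 else 0)) = (\<lambda>i. if i = k then ?c i else 0)" by auto
  show ?thesis by (rule sums_unique2[OF s[unfolded eq] sums_single])
qed

lemma circle_mean:
  assumes "g holomorphic_on ball 0 1" "0 \<le> r" "r < 1"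
  shows "(\<integral>\<zeta>. on_circle (\<lambda>\<zeta>. g (of_real r * \<zeta>)) \<zeta> \<partial>mT) = g 0"
  using circle_coefficient[OF assms, of 0] by simp

lemma on_circle_cnj: "on_circle (\<lambda>\<zeta>. cnj (f \<zeta>)) \<zeta> = cnj (on_circle f \<zeta>)"
  by (simp add: on_circle_def)

text \<open>Parseval's identity for two different radii; the mixed products are needed to compare
  dilates.\<close>

lemma circle_L2:
  assumes g: "g holomorphic_on ball 0 1" and r: "0 \<le> r" "r < 1" and s: "0 \<le> s" "s < 1"
  shows "(\<lambda>i. of_real ((cmod ((deriv ^^ i) g 0 / fact i))\<^sup>2 * (r * s) ^ i)) sums
    (\<integral>\<zeta>. on_circle (\<lambda>\<zeta>. g (of_real r * \<zeta>) * cnj (g (of_real s * \<zeta>))) \<zeta> \<partial>mT)"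
proof -
  let ?c = "\<lambda>i. (deriv ^^ i) g 0 / fact i"
  have "(\<integral>\<zeta>. on_circle (\<lambda>\<zeta>. \<zeta> ^ i * cnj (g (of_real s * \<zeta>))) \<zeta> \<partial>mT) = cnj (?c i * of_real s ^ i)" for i
  proof -
    have "(\<lambda>\<zeta>. \<zeta> ^ i * cnj (g (of_real s * \<zeta>))) = (\<lambda>\<zeta>. cnj (g (of_real s * \<zeta>) * cnj (\<zeta> ^ i)))" by (auto simp: mult.commute)
    thus ?thesis unfolding circle_coefficient[OF g s, symmetric]
      by (simp only: on_circle_cnj Bochner_Integration.integral_cnj)
  qed
  moreover have "?c i * of_real r ^ i * cnj (?c i * of_real s ^ i) = of_real ((cmod (?c i))\<^sup>2 * (r * s) ^ i)" for i
    unfolding of_real_mult complex_norm_square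
    by (simp only: of_real_power of_real_mult complex_cnj_mult complex_cnj_power complex_cnj_complex_of_real power_mult_distrib mult_ac)
  moreover have "continuous_on (sphere 0 1) (\<lambda>\<zeta>. cnj (g (of_real s * \<zeta>)))"
    by (intro continuous_on_cnj taylor_continuous g s)
  ultimately show ?thesis using circle_taylor_sums[OF g r, of "\<lambda>\<zeta>. cnj (g (of_real s * \<zeta>))"] by simp
qed

definition poisson :: "complex \<Rightarrow> complex \<Rightarrow> real" where
  "poisson z \<zeta> = (1 - (cmod z)\<^sup>2) / (cmod (1 - cnj \<zeta> * z))\<^sup>2"

text \<open>A conjugate-analytic part plus an analytic part vanishing at \<open>\<zeta> = 0\<close>,
  the form in which Taylor coefficients can be read off.\<close>

lemma poisson_split:
  assumes "cmod \<zeta> = 1" "cmod z < 1"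
  shows "of_real (poisson z \<zeta>) = cnj (1 / (1 - cnj z * \<zeta>)) + cnj z * \<zeta> / (1 - cnj z * \<zeta>)"
proof -
  have \<zeta>: "\<zeta> * cnj \<zeta> = 1" using assms(1) complex_norm_square[of \<zeta>] by simp
  have "cmod (cnj \<zeta> * z) < 1" using assms by (simp add: norm_mult)
  hence nz: "1 - cnj \<zeta> * z \<noteq> 0" by auto
  hence nz': "1 - cnj z * \<zeta> \<noteq> 0"
    by (metis complex_cnj_cancel_iff complex_cnj_cnj complex_cnj_diff complex_cnj_mult complex_cnj_one complex_cnj_zero mult.commute)
  have "of_real (poisson z \<zeta>) = (1 - z * cnj z) / ((1 - cnj \<zeta> * z) * cnj (1 - cnj \<zeta> * z))"
    unfolding poisson_def of_real_divide of_real_diff complex_norm_square by simp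
  also have "cnj (1 - cnj \<zeta> * z) = 1 - cnj z * \<zeta>" by (simp add: mult.commute)
  also have "1 - z * cnj z = (1 - cnj z * \<zeta>) + cnj z * \<zeta> * (1 - cnj \<zeta> * z)"
  proof -
    have "cnj z * \<zeta> * (1 - cnj \<zeta> * z) = cnj z * \<zeta> - z * cnj z * (\<zeta> * cnj \<zeta>)" by (simp add: algebra_simps)
    thus ?thesis unfolding \<zeta> by simp
  qed
  also have "((1 - cnj z * \<zeta>) + cnj z * \<zeta> * (1 - cnj \<zeta> * z)) / ((1 - cnj \<zeta> * z) * (1 - cnj z * \<zeta>))
    = 1 / (1 - cnj \<zeta> * z) + cnj z * \<zeta> / (1 - cnj z * \<zeta>)"
    using nz nz' by (simp add: add_divide_distrib)
  finally show ?thesis by (simp add: mult.commute)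
qed

text \<open>Against \<open>\<zeta> ^ i\<close> the analytic part of the Poisson kernel has mean 0,
  and the conjugate-analytic part picks out its i-th Taylor coefficient, the power
  \<open>z ^ i\<close>.\<close>

lemma circle_cauchy_kernel:
  assumes z: "cmod z < 1"
  shows "(\<integral>\<zeta>. on_circle (\<lambda>\<zeta>. \<zeta> ^ i * of_real (poisson z \<zeta>)) \<zeta> \<partial>mT) = z ^ i"
    and "continuous_on (sphere 0 1) (\<lambda>\<zeta>. complex_of_real (poisson z \<zeta>))"
proof -
  define r where "r = (1 + cmod z) / 2"
  have r: "0 \<le> r" "r < 1" "cmod z < r" "r > 0" using z by (auto simp: r_def add_pos_nonneg)
  \<comment> \<open>The kernel at z extends analytically past the circle. Rescaling by r presents it
    as the dilate of a function holomorphic in the unit disc, to which the coefficient formula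
    applies.\<close>
  define w where "w = cnj z / of_real r"
  have w: "cmod w < 1" using r z by (simp add: w_def norm_divide)
  have nz: "1 + (- w) * v \<noteq> 0" if "v \<in> ball 0 1" for v
  proof -
    have "cmod (w * v) < 1" using w that norm_mult_less[of w 1 v 1] by simp
    thus ?thesis by auto
  qed
  have wr: "w * (of_real r * \<zeta>) = cnj z * \<zeta>" for \<zeta> using r by (simp add: w_def)
  define g1 where "g1 v = 1 / (1 + (- w) * v)" for v
  define g2 where "g2 v = (v / of_real r) ^ i * (w * v) * (1 / (1 + (- w) * v))" for v
  have g1: "g1 holomorphic_on ball 0 1" unfolding g1_def[abs_def] using nz by (intro holomorphic_intros) auto
  have g2: "g2 holomorphic_on ball 0 1" unfolding g2_def[abs_def] using nz r by (intro holomorphic_intros) auto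
  have eq1: "g1 (of_real r * \<zeta>) = 1 / (1 - cnj z * \<zeta>)" for \<zeta> by (simp add: g1_def wr[symmetric])
  have eq2: "g2 (of_real r * \<zeta>) = \<zeta> ^ i * (cnj z * \<zeta> / (1 - cnj z * \<zeta>))" for \<zeta> using r by (simp add: g2_def wr[symmetric])
  have c1: "continuous_on (sphere 0 1) (\<lambda>\<zeta>. g1 (of_real r * \<zeta>))" by (rule taylor_continuous[OF g1 r(1,2)])
  have c2: "continuous_on (sphere 0 1) (\<lambda>\<zeta>. g2 (of_real r * \<zeta>))" by (rule taylor_continuous[OF g2 r(1,2)])
  have "continuous_on (sphere 0 1) (\<lambda>\<zeta>. cnj (g1 (of_real r * \<zeta>)) + cnj z * \<zeta> * g1 (of_real r * \<zeta>))"
    by (intro continuous_intros c1)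
  thus "continuous_on (sphere 0 1) (\<lambda>\<zeta>. complex_of_real (poisson z \<zeta>))"
    by (rule continuous_on_eq) (use z in \<open>simp add: poisson_split eq1\<close>)
  have "(\<integral>\<zeta>. on_circle (\<lambda>\<zeta>. \<zeta> ^ i * of_real (poisson z \<zeta>)) \<zeta> \<partial>mT)
     = (\<integral>\<zeta>. on_circle (\<lambda>\<zeta>. cnj (g1 (of_real r * \<zeta>) * cnj (\<zeta> ^ i))) \<zeta> + on_circle (\<lambda>\<zeta>. g2 (of_real r * \<zeta>)) \<zeta> \<partial>mT)"
  proof (rule Bochner_Integration.integral_cong[OF refl])
    fix \<zeta>
    have "\<zeta> ^ i * of_real (poisson z \<zeta>) = cnj (g1 (of_real r * \<zeta>) * cnj (\<zeta> ^ i)) + g2 (of_real r * \<zeta>)" if "cmod \<zeta> = 1"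
      unfolding poisson_split[OF that z] eq1 eq2
      by (simp only: distrib_left complex_cnj_mult complex_cnj_cnj mult.commute)
    thus "on_circle (\<lambda>\<zeta>. \<zeta> ^ i * of_real (poisson z \<zeta>)) \<zeta>
      = on_circle (\<lambda>\<zeta>. cnj (g1 (of_real r * \<zeta>) * cnj (\<zeta> ^ i))) \<zeta> + on_circle (\<lambda>\<zeta>. g2 (of_real r * \<zeta>)) \<zeta>"
      unfolding on_circle_def by simp
  qed
  also have "\<dots> = (\<integral>\<zeta>. on_circle (\<lambda>\<zeta>. cnj (g1 (of_real r * \<zeta>) * cnj (\<zeta> ^ i))) \<zeta> \<partial>mT) + (\<integral>\<zeta>. on_circle (\<lambda>\<zeta>. g2 (of_real r * \<zeta>)) \<zeta> \<partial>mT)"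
    by (intro Bochner_Integration.integral_add on_circle_integrable continuous_intros c1 c2)
  also have "(\<integral>\<zeta>. on_circle (\<lambda>\<zeta>. g2 (of_real r * \<zeta>)) \<zeta> \<partial>mT) = 0"
    unfolding circle_mean[OF g2 r(1,2)] by (simp add: g2_def)
  also have "(\<integral>\<zeta>. on_circle (\<lambda>\<zeta>. cnj (g1 (of_real r * \<zeta>) * cnj (\<zeta> ^ i))) \<zeta> \<partial>mT) = cnj ((deriv ^^ i) g1 0 / fact i * of_real r ^ i)"
    unfolding circle_coefficient[OF g1 r(1,2), symmetric] by (simp only: on_circle_cnj Bochner_Integration.integral_cnj)
  also have "(deriv ^^ i) g1 0 / fact i * of_real r ^ i = cnj z ^ i"
    unfolding g1_def[abs_def] using higher_deriv_inverse_linear[of 1 "- w" 0 i] r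
    by (simp add: w_def power_divide)
  finally show "(\<integral>\<zeta>. on_circle (\<lambda>\<zeta>. \<zeta> ^ i * of_real (poisson z \<zeta>)) \<zeta> \<partial>mT) = z ^ i" by simp
qed

lemma poisson_formula:
  assumes g: "g holomorphic_on ball 0 1" and r: "0 \<le> r" "r < 1" and z: "cmod z < 1"
  shows "(\<integral>\<zeta>. on_circle (\<lambda>\<zeta>. g (of_real r * \<zeta>) * of_real (poisson z \<zeta>)) \<zeta> \<partial>mT) = g (of_real r * z)"
proof -
  have "(\<lambda>i. (deriv ^^ i) g 0 / fact i * (of_real r * z - 0) ^ i) sums g (of_real r * z)"
  proof (rule holomorphic_power_series[OF g])
    have "r * cmod z < 1" using r z mult_strict_mono[of r 1 "cmod z" 1] by (cases "cmod z = 0") auto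
    thus "of_real r * z \<in> ball 0 1" using r by (simp add: norm_mult)
  qed
  hence "(\<lambda>i. (deriv ^^ i) g 0 / fact i * of_real r ^ i * z ^ i) sums g (of_real r * z)"
    by (simp add: power_mult_distrib mult.assoc)
  moreover have "(\<lambda>i. (deriv ^^ i) g 0 / fact i * of_real r ^ i * z ^ i) sums
      (\<integral>\<zeta>. on_circle (\<lambda>\<zeta>. g (of_real r * \<zeta>) * of_real (poisson z \<zeta>)) \<zeta> \<partial>mT)"
    using circle_taylor_sums[OF g r circle_cauchy_kernel(2)[OF z]] unfolding circle_cauchy_kernel(1)[OF z] .
  ultimately show ?thesis using sums_unique2 by blast
qed

section \<open>Boundary values along a sequence of radii\<close>

locale schur_function =
  fixes g :: "complex \<Rightarrow> complex"
  assumes g_holomorphic: "g holomorphic_on ball 0 1"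
    and g_le_1: "z \<in> ball 0 1 \<Longrightarrow> cmod (g z) \<le> 1"
begin

definition sqc :: "nat \<Rightarrow> real" where
  "sqc i = (cmod ((deriv ^^ i) g 0 / fact i))\<^sup>2"

definition dil :: "real \<Rightarrow> complex \<Rightarrow> complex" where
  "dil r = on_circle (\<lambda>\<zeta>. g (of_real r * \<zeta>))"

lemma sqc_nonneg: "sqc i \<ge> 0"
  by (simp add: sqc_def)

lemma dil_measurable: "0 \<le> r \<Longrightarrow> r < 1 \<Longrightarrow> dil r \<in> borel_measurable borel"
  unfolding dil_def by (intro on_circle_measurable taylor_continuous g_holomorphic)

lemma dil_le_1: "0 \<le> r \<Longrightarrow> r < 1 \<Longrightarrow> cmod (dil r \<zeta>) \<le> 1"
  unfolding dil_def on_circle_def by (auto intro!: g_le_1 simp: norm_mult)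

lemma dil_product_sums:
  assumes "0 \<le> r" "r < 1" "0 \<le> s" "s < 1"
  shows "(\<lambda>i. complex_of_real (sqc i * (r * s) ^ i)) sums (\<integral>\<zeta>. dil r \<zeta> * cnj (dil s \<zeta>) \<partial>mT)"
proof -
  have "on_circle (\<lambda>\<zeta>. g (of_real r * \<zeta>) * cnj (g (of_real s * \<zeta>))) = (\<lambda>\<zeta>. dil r \<zeta> * cnj (dil s \<zeta>))"
    by (auto simp: dil_def on_circle_def)
  thus ?thesis using circle_L2[OF g_holomorphic assms] by (simp only: sqc_def)
qed

lemma dil_product_integrable:
  assumes "0 \<le> r" "r < 1" "0 \<le> s" "s < 1"
  shows "integrable mT (\<lambda>\<zeta>. dil r \<zeta> * cnj (dil s \<zeta>))"
proof (rule mT.integrable_const_bound)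
  show "AE \<zeta> in mT. cmod (dil r \<zeta> * cnj (dil s \<zeta>)) \<le> 1"
    using assms dil_le_1 by (auto simp: norm_mult intro!: mult_le_one)
  show "(\<lambda>\<zeta>. dil r \<zeta> * cnj (dil s \<zeta>)) \<in> borel_measurable mT"
    using dil_measurable assms
    by (auto simp: measurable_cong_sets[OF sets_mT refl] intro!: borel_measurable_times borel_measurable_cnj)
qed

lemma dil_diff_sums:
  assumes r: "0 \<le> r" "r < 1" and s: "0 \<le> s" "s < 1"
  shows "(\<lambda>i. sqc i * (r ^ i - s ^ i)\<^sup>2) sums (\<integral>\<zeta>. (cmod (dil r \<zeta> - dil s \<zeta>))\<^sup>2 \<partial>mT)"
proof -
  let ?I = "\<lambda>r s. \<integral>\<zeta>. dil r \<zeta> * cnj (dil s \<zeta>) \<partial>mT"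
  note int = dil_product_integrable
  have "(\<lambda>i. complex_of_real (sqc i * (r * r) ^ i) - complex_of_real (sqc i * (r * s) ^ i)
      - (complex_of_real (sqc i * (s * r) ^ i) - complex_of_real (sqc i * (s * s) ^ i))) sums (?I r r - ?I r s - (?I s r - ?I s s))"
    by (intro sums_diff dil_product_sums r s)
  also have "(\<lambda>i. complex_of_real (sqc i * (r * r) ^ i) - complex_of_real (sqc i * (r * s) ^ i)
      - (complex_of_real (sqc i * (s * r) ^ i) - complex_of_real (sqc i * (s * s) ^ i))) = (\<lambda>i. complex_of_real (sqc i * (r ^ i - s ^ i)\<^sup>2))"
    by (simp add: power_mult_distrib power2_eq_square algebra_simps)
  also have "?I r r - ?I r s - (?I s r - ?I s s) = (\<integral>\<zeta>. dil r \<zeta> * cnj (dil r \<zeta>) - dil r \<zeta> * cnj (dil s \<zeta>)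
      - (dil s \<zeta> * cnj (dil r \<zeta>) - dil s \<zeta> * cnj (dil s \<zeta>)) \<partial>mT)"
    using int[OF r r] int[OF r s] int[OF s r] int[OF s s] by simp
  also have "\<dots> = (\<integral>\<zeta>. complex_of_real ((cmod (dil r \<zeta> - dil s \<zeta>))\<^sup>2) \<partial>mT)"
    by (intro Bochner_Integration.integral_cong refl) (simp only: complex_norm_square, simp add: algebra_simps)
  also have "\<dots> = complex_of_real (\<integral>\<zeta>. (cmod (dil r \<zeta> - dil s \<zeta>))\<^sup>2 \<partial>mT)" by (rule integral_complex_of_real)
  finally show ?thesis by (simp only: sums_of_real_iff)
qed

lemma sqc_partial_sum_le: "(\<Sum>i<n. sqc i) \<le> 1"
proof -
  have le: "(\<Sum>i<n. sqc i * (r * r) ^ i) \<le> 1" if r: "0 \<le> r" "r < 1" for r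
  proof -
    have "complex_of_real (\<integral>\<zeta>. (cmod (dil r \<zeta>))\<^sup>2 \<partial>mT) = (\<integral>\<zeta>. dil r \<zeta> * cnj (dil r \<zeta>) \<partial>mT)"
      unfolding complex_norm_square[symmetric] by (rule integral_complex_of_real[symmetric])
    hence s: "(\<lambda>i. sqc i * (r * r) ^ i) sums (\<integral>\<zeta>. (cmod (dil r \<zeta>))\<^sup>2 \<partial>mT)"
      using dil_product_sums[OF r r] by (simp only: sums_of_real_iff flip: \<open>complex_of_real _ = _\<close>)
    have "(\<Sum>i<n. sqc i * (r * r) ^ i) \<le> (\<integral>\<zeta>. (cmod (dil r \<zeta>))\<^sup>2 \<partial>mT)"
      using s sqc_nonneg r by (subst sums_unique[OF s]) (intro sum_le_suminf, auto simp: sums_iff)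
    also have "\<dots> \<le> (\<integral>\<zeta>. 1 \<partial>mT)"
    proof (rule integral_mono')
      show "(cmod (dil r \<zeta>))\<^sup>2 \<le> 1" for \<zeta> using dil_le_1[OF r, of \<zeta>] by (simp add: power_le_one)
    qed auto
    finally show ?thesis by (simp add: measure_mT_UNIV)
  qed
  have "((\<lambda>r::real. \<Sum>i<n. sqc i * (r * r) ^ i) \<longlongrightarrow> (\<Sum>i<n. sqc i * (1 * 1) ^ i)) (at_left 1)"
    by (intro tendsto_intros)
  moreover have "\<forall>\<^sub>F r in at_left (1::real). (\<Sum>i<n. sqc i * (r * r) ^ i) \<le> 1"
    unfolding eventually_at_left_field using le by (intro exI[of _ 0]) auto
  ultimately have "(\<Sum>i<n. sqc i * (1 * 1) ^ i) \<le> 1" by (rule tendsto_upperbound) simp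
  thus ?thesis by simp
qed

lemma sqc_summable: "summable sqc"
  by (rule summableI_nonneg_bounded[OF sqc_nonneg sqc_partial_sum_le])

text \<open>A measure of the L2 mass lost on the circle of radius r. It tends to 0 as r tends to 1
  because the squared coefficients are summable.\<close>

definition defect :: "real \<Rightarrow> real" where
  "defect r = (\<Sum>i. sqc i * (1 - r ^ i))"

lemma defect_summable: "0 \<le> r \<Longrightarrow> r < 1 \<Longrightarrow> summable (\<lambda>i. sqc i * (1 - r ^ i))"
  by (rule summable_comparison_test'[OF sqc_summable, of 0])
     (auto simp: abs_mult sqc_nonneg power_le_one intro!: mult_left_le)

lemma defect_small:
  assumes "\<epsilon> > 0"
  shows "\<exists>r. 1 - \<epsilon> < r \<and> 0 \<le> r \<and> r < 1 \<and> defect r \<le> \<epsilon>"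
proof -
  obtain n where "\<forall>k\<ge>n. norm (\<Sum>i. sqc (i + k)) < \<epsilon> / 2"
    using suminf_exist_split[OF half_gt_zero[OF assms] sqc_summable] by blast
  hence "norm (\<Sum>i. sqc (i + n)) < \<epsilon> / 2" by blast
  hence n: "(\<Sum>i. sqc (i + n)) \<le> \<epsilon> / 2" by simp
  have "((\<lambda>r::real. \<Sum>i<n. sqc i * (1 - r ^ i)) \<longlongrightarrow> (\<Sum>i<n. sqc i * (1 - 1 ^ i))) (at_left 1)"
    by (intro tendsto_intros)
  hence "\<forall>\<^sub>F r in at_left (1::real). (\<Sum>i<n. sqc i * (1 - r ^ i)) < \<epsilon> / 2"
    using assms by (intro order_tendstoD) auto
  moreover have "\<forall>\<^sub>F r in at_left (1::real). r \<in> {max 0 (1 - \<epsilon>)<..<1}"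
    by (rule eventually_at_left_real) (use assms in auto)
  ultimately have "\<forall>\<^sub>F r in at_left (1::real). (\<Sum>i<n. sqc i * (1 - r ^ i)) < \<epsilon> / 2 \<and> r \<in> {max 0 (1 - \<epsilon>)<..<1}"
    by (rule eventually_conj)
  then obtain r where r: "(\<Sum>i<n. sqc i * (1 - r ^ i)) < \<epsilon> / 2" "r \<in> {max 0 (1 - \<epsilon>)<..<1}"
    using eventually_happens'[OF trivial_limit_at_left_real] by blast
  have "defect r = (\<Sum>i. sqc (i + n) * (1 - r ^ (i + n))) + (\<Sum>i<n. sqc i * (1 - r ^ i))"
    unfolding defect_def using r by (intro suminf_split_initial_segment defect_summable) auto
  also have "(\<Sum>i. sqc (i + n) * (1 - r ^ (i + n))) \<le> (\<Sum>i. sqc (i + n))"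
  proof (rule suminf_le)
    show "sqc (i + n) * (1 - r ^ (i + n)) \<le> sqc (i + n)" for i
      using r sqc_nonneg[of "i + n"] by (intro mult_left_le) auto
    show "summable (\<lambda>i. sqc (i + n) * (1 - r ^ (i + n)))"
      using r by (intro summable_ignore_initial_segment[of "\<lambda>i. sqc i * (1 - r ^ i)"] defect_summable) auto
    show "summable (\<lambda>i. sqc (i + n))" by (rule summable_ignore_initial_segment[OF sqc_summable])
  qed
  finally show ?thesis using r n by (intro exI[of _ r]) auto
qed

text \<open>For numbers in the unit interval
  \<open>(p - q)^2 <= |p - q| <= (1 - p) + (1 - q)\<close>, applied to the powers of r and
  s.\<close>

lemma dil_diff_le_defect:
  assumes r: "0 \<le> r" "r < 1" and s: "0 \<le> s" "s < 1"
  shows "(\<integral>\<zeta>. (cmod (dil r \<zeta> - dil s \<zeta>))\<^sup>2 \<partial>mT) \<le> defect r + defect s"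
proof -
  have "(\<integral>\<zeta>. (cmod (dil r \<zeta> - dil s \<zeta>))\<^sup>2 \<partial>mT) = (\<Sum>i. sqc i * (r ^ i - s ^ i)\<^sup>2)"
    by (rule sums_unique[OF dil_diff_sums[OF r s]])
  also have "\<dots> \<le> (\<Sum>i. sqc i * (1 - r ^ i) + sqc i * (1 - s ^ i))"
  proof (rule suminf_le)
    fix i
    have x: "0 \<le> r ^ i" "r ^ i \<le> 1" "0 \<le> s ^ i" "s ^ i \<le> 1" using r s by (auto simp: power_le_one)
    have "(r ^ i - s ^ i)\<^sup>2 = \<bar>r ^ i - s ^ i\<bar> * \<bar>r ^ i - s ^ i\<bar>" by (simp add: power2_eq_square)
    also have "\<dots> \<le> \<bar>r ^ i - s ^ i\<bar> * 1" using x by (intro mult_left_mono) auto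
    also have "\<dots> \<le> (1 - r ^ i) + (1 - s ^ i)" using x by auto
    finally show "sqc i * (r ^ i - s ^ i)\<^sup>2 \<le> sqc i * (1 - r ^ i) + sqc i * (1 - s ^ i)"
      unfolding distrib_left[symmetric] by (intro mult_left_mono sqc_nonneg)
  qed (use dil_diff_sums[OF r s] defect_summable r s in \<open>auto simp: sums_iff intro!: summable_add\<close>)
  also have "\<dots> = defect r + defect s"
    unfolding defect_def using defect_summable r s by (intro suminf_add[symmetric]) auto
  finally show ?thesis .
qed

text \<open>Radii are chosen with defect at most \<open>(1/4)^k\<close>, fast enough that
  consecutive dilates differ by a geometric sequence almost everywhere. Convergence along one
  sequence already yields the boundary function; full radial convergence comes later from the
  Poisson integral.\<close>

lemma boundary_sequence:
  obtains rho \<beta> where "\<And>k. 0 \<le> rho k" "\<And>k. rho k < (1::real)" "rho \<longlonglongrightarrow> 1"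
    "\<beta> \<in> borel_measurable borel" "\<And>\<zeta>. cmod (\<beta> \<zeta>) \<le> 1" "AE \<zeta> in mT. (\<lambda>k. dil (rho k) \<zeta>) \<longlonglongrightarrow> \<beta> \<zeta>"
proof -
  have "\<forall>k. \<exists>r. 1 - (1/4) ^ k < r \<and> 0 \<le> r \<and> r < 1 \<and> defect r \<le> (1/4) ^ k"
    using defect_small by simp
  then obtain rho :: "nat \<Rightarrow> real" where rho: "\<And>k. 1 - (1/4) ^ k < rho k" "\<And>k. 0 \<le> rho k" "\<And>k. rho k < 1"
    "\<And>k. defect (rho k) \<le> (1/4) ^ k" by metis
  have rho_lim: "rho \<longlonglongrightarrow> 1"
  proof (rule tendsto_sandwich)
    show "\<forall>\<^sub>F k in sequentially. 1 - (1/4) ^ k \<le> rho k" using rho(1) by (intro always_eventually allI less_imp_le)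
    show "\<forall>\<^sub>F k in sequentially. rho k \<le> 1" using rho(3) by (intro always_eventually allI less_imp_le)
    have "(\<lambda>k. 1 - (1/4) ^ k) \<longlonglongrightarrow> 1 - (0::real)" by (intro tendsto_intros) auto
    thus "(\<lambda>k. 1 - (1/4) ^ k) \<longlonglongrightarrow> (1::real)" by simp
  qed simp
  define d where "d k \<zeta> = cmod (dil (rho k) \<zeta> - dil (rho (Suc k)) \<zeta>)" for k \<zeta>
  have dm [measurable]: "dil (rho k) \<in> borel_measurable borel" for k by (intro dil_measurable rho)
  have d_meas [measurable]: "d k \<in> borel_measurable mT" for k unfolding d_def by measurable
  \<comment> \<open>The weight \<open>2 ^ k\<close> still leaves a summable series of means, and its
    finiteness at a point forces geometric decay of the differences there.\<close>
  have d_int: "(\<integral>\<^sup>+\<zeta>. ennreal (2 ^ k * (d k \<zeta>)\<^sup>2) \<partial>mT) \<le> ennreal (2 * (1/2) ^ k)" for k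
  proof -
    have int: "integrable mT (\<lambda>\<zeta>. (d k \<zeta>)\<^sup>2)"
    proof (rule mT.integrable_const_bound)
      have "d k \<zeta> \<le> 2" for \<zeta>
        unfolding d_def using norm_triangle_ineq4[of "dil (rho k) \<zeta>" "dil (rho (Suc k)) \<zeta>"]
          dil_le_1[OF rho(2,3), of k \<zeta>] dil_le_1[OF rho(2,3), of "Suc k" \<zeta>] by linarith
      hence "(d k \<zeta>)\<^sup>2 \<le> 2\<^sup>2" for \<zeta> by (intro power_mono) (auto simp: d_def)
      thus "AE \<zeta> in mT. norm ((d k \<zeta>)\<^sup>2) \<le> 2\<^sup>2" by (intro AE_I2) simp
    qed measurable
    have "(\<integral>\<^sup>+\<zeta>. ennreal (2 ^ k * (d k \<zeta>)\<^sup>2) \<partial>mT) = ennreal (\<integral>\<zeta>. 2 ^ k * (d k \<zeta>)\<^sup>2 \<partial>mT)"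
      using int by (intro nn_integral_eq_integral) auto
    also have "(\<integral>\<zeta>. 2 ^ k * (d k \<zeta>)\<^sup>2 \<partial>mT) = 2 ^ k * (\<integral>\<zeta>. (d k \<zeta>)\<^sup>2 \<partial>mT)" by simp
    also have "\<dots> \<le> 2 ^ k * ((1/4) ^ k + (1/4) ^ Suc k)"
      unfolding d_def using dil_diff_le_defect[OF rho(2,3) rho(2,3), of k "Suc k"] rho(4)[of k] rho(4)[of "Suc k"]
      by (intro mult_left_mono) auto
    also have "\<dots> \<le> 2 ^ k * (2 * (1/4) ^ k)" by simp
    also have "\<dots> = 2 * (1/2) ^ k"
    proof -
      have "(2::real) ^ k * (1/4) ^ k = (1/2) ^ k" by (simp add: power_mult_distrib[symmetric])
      thus ?thesis by simp
    qed
    finally show ?thesis by (simp add: ennreal_leI)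
  qed
  have "(\<integral>\<^sup>+\<zeta>. (\<Sum>k. ennreal (2 ^ k * (d k \<zeta>)\<^sup>2)) \<partial>mT) = (\<Sum>k. \<integral>\<^sup>+\<zeta>. ennreal (2 ^ k * (d k \<zeta>)\<^sup>2) \<partial>mT)"
    by (rule nn_integral_suminf) measurable
  also have "\<dots> \<le> (\<Sum>k. ennreal (2 * (1/2) ^ k))" by (intro suminf_le d_int) auto
  also have "\<dots> < top"
  proof -
    have "summable (\<lambda>k. 2 * (1/2) ^ k :: real)" by (intro summable_mult summable_geometric) simp
    hence "(\<Sum>k. ennreal (2 * (1/2) ^ k)) \<noteq> top" by (rule ennreal_suminf_neq_top) simp
    thus ?thesis by (simp only: less_top)
  qed
  finally have fin: "(\<integral>\<^sup>+\<zeta>. (\<Sum>k. ennreal (2 ^ k * (d k \<zeta>)\<^sup>2)) \<partial>mT) \<noteq> \<infinity>" by auto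
  have "AE \<zeta> in mT. (\<Sum>k. ennreal (2 ^ k * (d k \<zeta>)\<^sup>2)) \<noteq> \<infinity>"
    by (rule nn_integral_PInf_AE[OF _ fin]) measurable
  hence conv: "AE \<zeta> in mT. convergent (\<lambda>k. dil (rho k) \<zeta>)"
  proof eventually_elim
    case (elim \<zeta>)
    define C where "C = (\<Sum>k. ennreal (2 ^ k * (d k \<zeta>)\<^sup>2))"
    have "C \<noteq> top" using elim unfolding C_def by simp
    then obtain c where c: "c \<ge> 0" "C = ennreal c" by (cases C rule: ennreal_cases) auto
    have dk: "d k \<zeta> \<le> sqrt c * (sqrt (1/2)) ^ k" for k
    proof -
      have "ennreal (2 ^ k * (d k \<zeta>)\<^sup>2) \<le> C"
      proof -
        have "(\<Sum>i\<in>{k}. ennreal (2 ^ i * (d i \<zeta>)\<^sup>2)) \<le> C" unfolding C_def by (intro sum_le_suminf) auto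
        thus ?thesis by (simp only: sum.insert sum.empty finite.emptyI empty_iff not_False_eq_True add_0_right)
      qed
      hence "2 ^ k * (d k \<zeta>)\<^sup>2 \<le> c" unfolding c(2) using c(1) by (subst (asm) ennreal_le_iff) auto
      hence "(d k \<zeta>)\<^sup>2 \<le> c * (1/2) ^ k" by (simp add: field_simps power_one_over)
      also have "c * (1/2) ^ k = (sqrt c * sqrt (1/2) ^ k)\<^sup>2"
      proof -
        have "(sqrt (1/2) ^ k)\<^sup>2 = ((sqrt (1/2))\<^sup>2) ^ k" by (simp only: power_mult[symmetric] mult.commute)
        also have "(sqrt (1/2))\<^sup>2 = (1/2::real)" by (rule real_sqrt_pow2) simp
        finally show ?thesis using c(1) by (simp only: power_mult_distrib real_sqrt_pow2)
      qed
      finally show ?thesis by (rule power2_le_imp_le) (use c(1) in simp)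
    qed
    have sm: "summable (\<lambda>k. sqrt c * (sqrt (1/2)) ^ k)"
    proof (intro summable_mult summable_geometric)
      have "sqrt (1/2) < sqrt 1" by (rule real_sqrt_less_mono) simp
      thus "norm (sqrt (1/2)) < 1" by simp
    qed
    have nd: "norm (dil (rho (Suc k)) \<zeta> - dil (rho k) \<zeta>) = d k \<zeta>" for k
      unfolding d_def by (rule norm_minus_commute)
    have "summable (\<lambda>k. dil (rho (Suc k)) \<zeta> - dil (rho k) \<zeta>)"
      by (rule summable_comparison_test'[OF sm, of 0]) (simp only: nd dk)
    hence "convergent (\<lambda>n. \<Sum>k<n. dil (rho (Suc k)) \<zeta> - dil (rho k) \<zeta>)" by (simp add: summable_iff_convergent)
    hence "convergent (\<lambda>n. dil (rho n) \<zeta> - dil (rho 0) \<zeta>)"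
      by (simp only: sum_lessThan_telescope[of "\<lambda>k. dil (rho k) \<zeta>"])
    hence "convergent (\<lambda>n. dil (rho n) \<zeta> - dil (rho 0) \<zeta> + dil (rho 0) \<zeta>)"
      by (intro convergent_add convergent_const)
    thus ?case by simp
  qed
  define L where "L \<zeta> = lim (\<lambda>k. dil (rho k) \<zeta>)" for \<zeta>
  \<comment> \<open>The limit has modulus at most 1 wherever the dilates converge; truncation
    enforces this bound at the exceptional points too.\<close>
  define \<beta> where "\<beta> \<zeta> = (if cmod (L \<zeta>) \<le> 1 then L \<zeta> else 0)" for \<zeta>
  have [measurable]: "L \<in> borel_measurable borel"
    unfolding L_def by (rule borel_measurable_lim_metric) measurable
  show ?thesis
  proof (rule that[of rho \<beta>])
    show "\<beta> \<in> borel_measurable borel" unfolding \<beta>_def by measurable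
    show "cmod (\<beta> \<zeta>) \<le> 1" for \<zeta> by (simp add: \<beta>_def)
    show "AE \<zeta> in mT. (\<lambda>k. dil (rho k) \<zeta>) \<longlonglongrightarrow> \<beta> \<zeta>"
      using conv
    proof eventually_elim
      case (elim \<zeta>)
      hence l: "(\<lambda>k. dil (rho k) \<zeta>) \<longlonglongrightarrow> L \<zeta>" unfolding L_def by (simp add: convergent_LIMSEQ_iff)
      have "cmod (L \<zeta>) \<le> 1" by (rule LIMSEQ_le_const2[OF tendsto_norm[OF l]]) (use dil_le_1 rho in blast)
      thus ?case using l by (simp add: \<beta>_def)
    qed
  qed (use rho rho_lim in auto)
qed

end

section \<open>Lebesgue points and decreasing kernels\<close>

lemma integrable_bounded_interval:
  fixes f :: "real \<Rightarrow> 'b::{banach, second_countable_topology}"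
  assumes "f \<in> borel_measurable borel" "\<And>t. norm (f t) \<le> B * indicator {a..b} t"
  shows "integrable lborel f"
proof (rule Bochner_Integration.integrable_bound)
  show "integrable lborel (\<lambda>t. B * indicator {a..b} t :: real)"
    by (intro integrable_mult_right integrable_real_indicator) (auto simp: emeasure_lborel_Icc_eq)
  show "AE t in lborel. norm (f t) \<le> norm (B * indicator {a..b} t :: real)"
    using assms(2) by (intro AE_I2) (smt (verit) real_norm_def)
qed (use assms in simp)

text \<open>Layer cake: a decreasing kernel is a superposition of indicators of intervals starting at 0.\<close>

lemma monotone_kernel_bound:
  fixes K :: "real \<Rightarrow> real" and h :: "real \<Rightarrow> complex"
  assumes d: "d \<ge> 0" and K [measurable]: "K \<in> borel_measurable borel" and K0: "\<And>t. 0 \<le> t \<Longrightarrow> t \<le> d \<Longrightarrow> 0 \<le> K t"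
    and mono: "\<And>s t. 0 \<le> s \<Longrightarrow> s \<le> t \<Longrightarrow> t \<le> d \<Longrightarrow> K t \<le> K s"
    and h [measurable]: "h \<in> borel_measurable borel" and H: "\<And>t. cmod (h t) \<le> H"
    and avg: "\<And>s. 0 \<le> s \<Longrightarrow> s \<le> d \<Longrightarrow> cmod (\<integral>t. indicator {0..s} t *\<^sub>R h t \<partial>lborel) \<le> \<epsilon> * s"
  shows "cmod (\<integral>t. (indicator {0..d} t * K t) *\<^sub>R h t \<partial>lborel) \<le> \<epsilon> * (\<integral>t. indicator {0..d} t * K t \<partial>lborel)"
proof -
  \<comment> \<open>Indicator of the region under the graph of K over [0, d]; integrating first in y
    gives K, first in t gives the superlevel sets.\<close>
  define lev where "lev t y = (indicator {0..d} t * indicator {0<..<K t} y :: real)" for t y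
  have lev_meas [measurable]: "(\<lambda>x. lev (fst x) (snd x)) \<in> borel_measurable (lborel \<Otimes>\<^sub>M lborel)"
  proof -
    have eq: "lev (fst x) (snd x) = indicator {x. fst x \<in> {0..d} \<and> 0 < snd x \<and> snd x < K (fst x)} x" for x
      by (auto simp: lev_def indicator_def)
    show ?thesis unfolding eq by measurable
  qed
  have int: "integrable (lborel \<Otimes>\<^sub>M lborel) (\<lambda>x. lev (fst x) (snd x) *\<^sub>R k (fst x))"
    if [measurable]: "k \<in> borel_measurable borel" and k: "\<And>t. cmod (k t) \<le> B" for k :: "real \<Rightarrow> complex" and B
  proof (rule Bochner_Integration.integrable_bound)
    have B: "B \<ge> 0" using k[of 0] norm_ge_zero order_trans by blast
    have "emeasure (lborel \<Otimes>\<^sub>M lborel) ({0..d} \<times> {0..K 0}) = ennreal d * ennreal (K 0)"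
      using d K0[of 0] by (subst lborel.emeasure_pair_measure_Times) auto
    thus "integrable (lborel \<Otimes>\<^sub>M lborel) (\<lambda>x. B * indicator ({0..d} \<times> {0..K 0}) x :: real)"
      by (intro integrable_mult_right integrable_real_indicator) (auto simp: ennreal_mult_less_top)
    show "AE x in lborel \<Otimes>\<^sub>M lborel. norm (lev (fst x) (snd x) *\<^sub>R k (fst x)) \<le> norm (B * indicator ({0..d} \<times> {0..K 0}) x :: real)"
    proof (rule AE_I2)
      fix x :: "real \<times> real"
      have "lev (fst x) (snd x) = 0 \<or> (x \<in> {0..d} \<times> {0..K 0} \<and> lev (fst x) (snd x) = 1)"
        using mono[of 0 "fst x"] by (cases x) (auto simp: lev_def indicator_def)
      thus "norm (lev (fst x) (snd x) *\<^sub>R k (fst x)) \<le> norm (B * indicator ({0..d} \<times> {0..K 0}) x :: real)"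
        using k[of "fst x"] B by auto
    qed
  qed measurable
  have inner: "(\<integral>y. lev t y *\<^sub>R v \<partial>lborel) = (indicator {0..d} t * K t) *\<^sub>R v" for t and v :: complex
  proof (cases "t \<in> {0..d}")
    case True
    have "(\<integral>y. lev t y *\<^sub>R v \<partial>lborel) = (\<integral>y. indicator {0<..<K t} y *\<^sub>R v \<partial>lborel)"
      using True by (simp add: lev_def)
    also have "\<dots> = K t *\<^sub>R v" using True K0[of t] by simp
    finally show ?thesis using True by simp
  qed (simp add: lev_def)
  have fubini: "(\<integral>t. (indicator {0..d} t * K t) *\<^sub>R k t \<partial>lborel) = (\<integral>y. (\<integral>t. lev t y *\<^sub>R k t \<partial>lborel) \<partial>lborel)"
    and fub_int: "integrable lborel (\<lambda>y. \<integral>t. lev t y *\<^sub>R k t \<partial>lborel)"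
    if "k \<in> borel_measurable borel" "\<And>t. cmod (k t) \<le> B" for k :: "real \<Rightarrow> complex" and B
  proof -
    have i: "integrable (lborel \<Otimes>\<^sub>M lborel) (\<lambda>(t, y). lev t y *\<^sub>R k t)" unfolding case_prod_unfold by (rule int[OF that])
    show "(\<integral>t. (indicator {0..d} t * K t) *\<^sub>R k t \<partial>lborel) = (\<integral>y. (\<integral>t. lev t y *\<^sub>R k t \<partial>lborel) \<partial>lborel)"
      using lborel_pair.Fubini_integral[OF i] by (simp add: inner)
    show "integrable lborel (\<lambda>y. \<integral>t. lev t y *\<^sub>R k t \<partial>lborel)" by (rule lborel_pair.integrable_snd[OF i])
  qed
  have layer: "cmod (\<integral>t. lev t y *\<^sub>R h t \<partial>lborel) \<le> \<epsilon> * (\<integral>t. lev t y \<partial>lborel)" for y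
  proof -
    define A where "A = {t \<in> {0..d}. 0 < y \<and> y < K t}"
    show ?thesis
    proof (cases "A = {}")
      case True
      hence "lev t y = 0" for t by (auto simp: A_def lev_def indicator_def)
      thus ?thesis by simp
    next
      case False
      define s where "s = Sup A"
      have bdd: "bdd_above A" by (rule bdd_aboveI[of _ d]) (auto simp: A_def)
      have s: "0 \<le> s" "s \<le> d"
        using False cSup_upper[OF _ bdd] unfolding s_def by (force simp: A_def, intro cSup_least) (auto simp: A_def)
      \<comment> \<open>K is decreasing, so its superlevel set is an interval from 0 to s. Whether
        it contains s is unknown, but a single point is null.\<close>
      have lev_eq: "lev t y = indicator {0..s} t" if "t \<noteq> s" for t
      proof (cases "t \<in> {0..<s}")
        case True
        then obtain a where "a \<in> A" "t < a" using less_cSup_iff[OF False bdd] unfolding s_def by auto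
        thus ?thesis using True mono[of t a] by (auto simp: A_def lev_def indicator_def)
      next
        case False
        hence "t \<notin> A" using cSup_upper[OF _ bdd, of t] that unfolding s_def[symmetric] by (auto simp: A_def)
        thus ?thesis using False that by (auto simp: A_def lev_def indicator_def)
      qed
      have [measurable]: "(\<lambda>t. lev t y) \<in> borel_measurable lborel"
      proof -
        have "(\<lambda>t. lev t y) = indicator A" by (auto simp: A_def lev_def indicator_def)
        moreover have "A \<in> sets borel" unfolding A_def by measurable
        ultimately show ?thesis by simp
      qed
      have ae: "AE t in lborel. lev t y = indicator {0..s} t"
        using AE_lborel_singleton[of s] by eventually_elim (rule lev_eq)
      have "(\<integral>t. lev t y *\<^sub>R h t \<partial>lborel) = (\<integral>t. indicator {0..s} t *\<^sub>R h t \<partial>lborel)"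
        by (rule integral_cong_AE, measurable) (use ae in \<open>auto elim: eventually_mono\<close>)
      moreover have "(\<integral>t. lev t y \<partial>lborel) = (\<integral>t. indicator {0..s} t \<partial>lborel)"
        by (rule integral_cong_AE, measurable) (use ae in auto)
      ultimately show ?thesis using avg[OF s] s by simp
    qed
  qed
  have real_int: "(\<integral>t. lev t y *\<^sub>R (1::complex) \<partial>lborel) = of_real (\<integral>t. lev t y \<partial>lborel)" for y
    by (simp add: scaleR_conv_of_real)
  have one: "integrable lborel (\<lambda>y. \<integral>t. lev t y \<partial>lborel)"
    using fub_int[of "\<lambda>_. 1" 1] unfolding real_int by (simp add: complex_of_real_integrable_eq)
  have "cmod (\<integral>t. (indicator {0..d} t * K t) *\<^sub>R h t \<partial>lborel) \<le> (\<integral>y. \<epsilon> * (\<integral>t. lev t y \<partial>lborel) \<partial>lborel)"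
    unfolding fubini[OF h H]
    by (rule norm_integral_le[OF fub_int[OF h H]]) (use one layer in auto)
  also have "\<dots> = \<epsilon> * (\<integral>y. (\<integral>t. lev t y \<partial>lborel) \<partial>lborel)" by (rule integral_mult_right_zero)
  also have "(\<integral>y. (\<integral>t. lev t y \<partial>lborel) \<partial>lborel) = (\<integral>t. indicator {0..d} t * K t \<partial>lborel)"
    using fubini[of "\<lambda>_. 1" 1] unfolding real_int by (simp add: scaleR_conv_of_real flip: of_real_mult)
  finally show ?thesis .
qed

text \<open>One-sided averages of \<open>f (x + t) - f x\<close>, from Lebesgue's differentiation
  theorem. The averages to the left of a point are obtained later by reflecting f.\<close>

lemma lebesgue_points:
  fixes f :: "real \<Rightarrow> complex"
  assumes f: "f \<in> borel_measurable borel" and B: "\<And>t. cmod (f t) \<le> B"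
  obtains N where "negligible N"
    "\<And>x \<epsilon>. x \<notin> N \<Longrightarrow> \<epsilon> > 0 \<Longrightarrow> \<exists>d>0. \<forall>s. 0 \<le> s \<longrightarrow> s < d \<longrightarrow>
        cmod (\<integral>t. indicator {0..s} t *\<^sub>R (f (x + t) - f x) \<partial>lborel) \<le> \<epsilon> * s"
proof -
  have B0: "B \<ge> 0" using B[of 0] norm_ge_zero order_trans by blast
  have int: "integrable lborel (\<lambda>t. indicator {a..b} t *\<^sub>R f (x + t))" for a b x
    using f B B0 by (intro integrable_bounded_interval[where B = B and a = a and b = b]) (auto simp: indicator_def)
  have set_int: "set_integrable lborel {a..b} f" for a b
    using int[of a b 0] by (simp add: set_integrable_def)
  obtain N where N: "negligible N" "\<And>x e. x \<notin> N \<Longrightarrow> 0 < e \<Longrightarrow>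
      \<exists>d>0. \<forall>h. 0 < h \<and> h < d \<longrightarrow> norm (integral (cbox x (x + h *\<^sub>R One)) f /\<^sub>R h ^ DIM(real) - f x) < e"
    using integrable_ccontinuous_explicit[of f] set_borel_integral_eq_integral(1)[OF set_int] by auto
  show ?thesis
  proof (rule that[OF N(1)])
    fix x \<epsilon> :: real assume x: "x \<notin> N" and \<epsilon>: "\<epsilon> > 0"
    obtain d where d: "d > 0" "\<And>h. 0 < h \<Longrightarrow> h < d \<Longrightarrow> norm (integral {x..x + h} f /\<^sub>R h - f x) < \<epsilon>"
      using N(2)[OF x \<epsilon>] by auto
    have "cmod (\<integral>t. indicator {0..s} t *\<^sub>R (f (x + t) - f x) \<partial>lborel) \<le> \<epsilon> * s" if s: "0 < s" "s < d" for s
    proof -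
      have "(\<integral>t. indicator {0..s} t *\<^sub>R (f (x + t) - f x) \<partial>lborel)
        = (\<integral>t. indicator {0..s} t *\<^sub>R f (x + t) \<partial>lborel) - (\<integral>t. indicator {0..s} t *\<^sub>R f x \<partial>lborel)"
        unfolding scaleR_diff_right 
          by (rule Bochner_Integration.integral_diff[OF int])
             (rule integrable_bounded_interval[of _ "cmod (f x)" 0 s], auto simp: indicator_def)
      also have "(\<integral>t. indicator {0..s} t *\<^sub>R f (x + t) \<partial>lborel) = (\<integral>t. indicator {x..x + s} t *\<^sub>R f t \<partial>lborel)"
        by (subst lborel_integral_real_affine[of 1 "\<lambda>t. indicator {x..x + s} t *\<^sub>R f t" x])
           (auto intro!: Bochner_Integration.integral_cong simp: indicator_def)
      also have "\<dots> = integral {x..x + s} f"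
        using set_borel_integral_eq_integral(2)[OF set_int] by (simp add: set_lebesgue_integral_def)
      also have "(\<integral>t. indicator {0..s} t *\<^sub>R f x \<partial>lborel) = s *\<^sub>R f x" using s by simp
      also have "integral {x..x + s} f - s *\<^sub>R f x = s *\<^sub>R (integral {x..x + s} f /\<^sub>R s - f x)"
        using s by (simp add: scaleR_diff_right)
      also have "cmod \<dots> \<le> s * \<epsilon>" using d(2)[OF s] s by (simp add: mult_left_mono)
      finally show ?thesis by (simp add: mult.commute)
    qed
    moreover have "(\<integral>t. indicator {0..0} t *\<^sub>R (f (x + t) - f x) \<partial>lborel) = (\<integral>t. 0 \<partial>(lborel::real measure))"
      using f by (intro integral_cong_AE) (use AE_lborel_singleton[of "0::real"] in \<open>auto elim: eventually_mono\<close>)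
    ultimately have "cmod (\<integral>t. indicator {0..s} t *\<^sub>R (f (x + t) - f x) \<partial>lborel) \<le> \<epsilon> * s" if "0 \<le> s" "s < d" for s
      using that by (cases "s = 0") auto
    thus "\<exists>d>0. \<forall>s. 0 \<le> s \<longrightarrow> s < d \<longrightarrow> cmod (\<integral>t. indicator {0..s} t *\<^sub>R (f (x + t) - f x) \<partial>lborel) \<le> \<epsilon> * s"
      using d(1) by blast
  qed
qed

section \<open>The Poisson kernel as an approximate identity\<close>

definition poisson_angle :: "real \<Rightarrow> real \<Rightarrow> real" where
  "poisson_angle r s = (1 - r\<^sup>2) / (1 - 2 * r * cos s + r\<^sup>2)"

lemma cmod_one_minus_rcis: "(cmod (1 - of_real r * cis s))\<^sup>2 = 1 - 2 * r * cos s + r\<^sup>2"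
proof -
  have "(cmod (1 - of_real r * cis s))\<^sup>2 = (1 - r * cos s)\<^sup>2 + (r * sin s)\<^sup>2" by (simp add: cmod_power2)
  also have "\<dots> = 1 - 2 * r * cos s + r\<^sup>2 * ((sin s)\<^sup>2 + (cos s)\<^sup>2)"
    by algebra
  finally show ?thesis by simp
qed

lemma poisson_cis:
  assumes "0 \<le> r" shows "poisson (of_real r * cis \<theta>) (cis t) = poisson_angle r (t - \<theta>)"
proof -
  have "cnj (cis t) * (of_real r * cis \<theta>) = of_real r * cis (- (t - \<theta>))"
    by (simp add: cis_cnj cis_mult mult.left_commute)
  thus ?thesis using assms cmod_one_minus_rcis[of r "- (t - \<theta>)"]
    by (simp only: poisson_def poisson_angle_def norm_mult norm_of_real norm_cis cos_minus) simp
qed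

lemma poisson_angle_denominator: "(1 - r)\<^sup>2 \<le> 1 - 2 * r * cos s + r\<^sup>2" if "0 \<le> r" for r :: real
proof -
  have "r * cos s \<le> r * 1" using that by (intro mult_left_mono) auto
  thus ?thesis by (simp add: power2_eq_square algebra_simps)
qed

lemma poisson_angle_nonneg: "0 \<le> r \<Longrightarrow> r < 1 \<Longrightarrow> 0 \<le> poisson_angle r s"
  using poisson_angle_denominator[of r s] unfolding poisson_angle_def
  by (intro divide_nonneg_nonneg) (auto simp: power_le_one intro: order_trans[OF zero_le_power2])

lemma poisson_angle_antimono:
  assumes r: "0 \<le> r" "r < 1" and c: "cos t \<le> cos s"
  shows "poisson_angle r t \<le> poisson_angle r s"
proof -
  have pos: "0 < 1 - 2 * r * cos s + r\<^sup>2"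
    using poisson_angle_denominator[of r s] r zero_less_power[of "1 - r" 2] by linarith
  have "2 * r * cos t \<le> 2 * r * cos s" using r c by (intro mult_left_mono) auto
  thus ?thesis unfolding poisson_angle_def using pos r
    by (intro divide_left_mono mult_pos_pos) (auto simp: power_le_one)
qed

lemma poisson_angle_measurable [measurable]: "poisson_angle r \<in> borel_measurable borel"
  unfolding poisson_angle_def[abs_def] by measurable

lemma poisson_angle_bound:
  assumes r: "0 \<le> r" "r < 1" shows "poisson_angle r s \<le> poisson_angle r 0"
  by (rule poisson_angle_antimono[OF r]) simp

lemma poisson_angle_tendsto_0:
  assumes "0 < d" "d < pi" shows "((\<lambda>r. poisson_angle r d) \<longlongrightarrow> 0) (at_left 1)"
proof -
  have "cos d < cos 0" using assms by (intro cos_monotone_0_pi) auto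
  hence "((\<lambda>r. poisson_angle r d) \<longlongrightarrow> (1 - 1\<^sup>2) / (1 - 2 * 1 * cos d + 1\<^sup>2)) (at_left 1)"
    unfolding poisson_angle_def by (intro tendsto_intros) auto
  thus ?thesis by simp
qed

lemma poisson_measurable: "poisson z \<in> borel_measurable borel"
proof -
  have "(\<lambda>\<zeta>. cnj \<zeta> * z) \<in> borel_measurable borel"
    by (intro borel_measurable_continuous_onI continuous_intros)
  thus ?thesis unfolding poisson_def[abs_def] by measurable
qed

lemma poisson_bound:
  assumes "cmod \<zeta> = 1" "cmod z < 1"
  shows "0 \<le> poisson z \<zeta>" "poisson z \<zeta> \<le> 1 / (1 - cmod z)\<^sup>2"
proof -
  have "1 - cmod z \<le> cmod (1 - cnj \<zeta> * z)"
    using norm_triangle_ineq2[of 1 "cnj \<zeta> * z"] assms(1) by (simp add: norm_mult)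
  moreover have z1: "(cmod z)\<^sup>2 \<le> 1" using assms(2) by (simp add: power_le_one)
  ultimately show "poisson z \<zeta> \<le> 1 / (1 - cmod z)\<^sup>2"
    unfolding poisson_def using assms(2) by (intro frac_le power_mono) auto
  show "0 \<le> poisson z \<zeta>" unfolding poisson_def using z1 by simp
qed

lemma integral_poisson_angle:
  assumes r: "0 \<le> r" "r < 1"
  shows "(\<integral>t. circle_weight t * poisson_angle r (t - \<theta>) \<partial>lborel) = 1"
proof -
  let ?z = "of_real r * cis \<theta>"
  have z: "cmod ?z < 1" using r by (simp add: norm_mult)
  have [measurable]: "poisson ?z \<in> borel_measurable borel" by (rule poisson_measurable)
  have "complex_of_real (\<integral>\<zeta>. poisson ?z \<zeta> \<partial>mT) = (\<integral>\<zeta>. complex_of_real (poisson ?z \<zeta>) \<partial>mT)"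
    by (rule integral_complex_of_real[symmetric])
  also have "\<dots> = (\<integral>\<zeta>. on_circle (\<lambda>\<zeta>. of_real (poisson ?z \<zeta>)) \<zeta> \<partial>mT)"
    by (rule integral_on_circle[symmetric, OF _ circle_cauchy_kernel(2)[OF z]]) measurable
  also have "\<dots> = 1" using circle_cauchy_kernel(1)[OF z, of 0] by simp
  finally have "(\<integral>\<zeta>. poisson ?z \<zeta> \<partial>mT) = 1" by (simp only: of_real_eq_1_iff)
  thus ?thesis by (subst (asm) integral_mT) (simp_all add: poisson_cis[OF r(1)])
qed

context schur_function
begin

text \<open>The Poisson formula on the circles of radius \<open>rho k\<close>, passed to the limit
  by dominated convergence. It makes g the Poisson integral of its boundary function
  \<beta>.\<close>

lemma poisson_representation:
  assumes rho: "\<And>k. 0 \<le> rho k" "\<And>k. rho k < (1::real)" "rho \<longlonglongrightarrow> 1"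
    and \<beta>: "\<beta> \<in> borel_measurable borel" "AE \<zeta> in mT. (\<lambda>k. dil (rho k) \<zeta>) \<longlonglongrightarrow> \<beta> \<zeta>" and z: "cmod z < 1"
  shows "(\<integral>\<zeta>. \<beta> \<zeta> * of_real (poisson z \<zeta>) \<partial>mT) = g z"
proof -
  have [measurable]: "poisson z \<in> borel_measurable borel" by (rule poisson_measurable)
  have "(\<lambda>k. \<integral>\<zeta>. dil (rho k) \<zeta> * of_real (poisson z \<zeta>) \<partial>mT) \<longlonglongrightarrow> (\<integral>\<zeta>. \<beta> \<zeta> * of_real (poisson z \<zeta>) \<partial>mT)"
  proof (rule integral_dominated_convergence[where w = "\<lambda>_. 1 / (1 - cmod z)\<^sup>2"])
    show "(\<lambda>\<zeta>. \<beta> \<zeta> * of_real (poisson z \<zeta>)) \<in> borel_measurable mT" using \<beta>(1) by measurable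
    show "(\<lambda>\<zeta>. dil (rho k) \<zeta> * of_real (poisson z \<zeta>)) \<in> borel_measurable mT" for k
      using dil_measurable[OF rho(1,2)] by measurable
    show "AE \<zeta> in mT. (\<lambda>k. dil (rho k) \<zeta> * of_real (poisson z \<zeta>)) \<longlonglongrightarrow> \<beta> \<zeta> * of_real (poisson z \<zeta>)"
      using \<beta>(2) by eventually_elim (intro tendsto_intros)
    show "AE \<zeta> in mT. cmod (dil (rho k) \<zeta> * of_real (poisson z \<zeta>)) \<le> 1 / (1 - cmod z)\<^sup>2" for k
      using AE_mT_circle
    proof eventually_elim
      case (elim \<zeta>)
      have "cmod (dil (rho k) \<zeta>) * poisson z \<zeta> \<le> 1 * (1 / (1 - cmod z)\<^sup>2)"
        using poisson_bound[OF elim z] dil_le_1[OF rho(1,2)] by (intro mult_mono) auto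
      thus ?case using poisson_bound(1)[OF elim z] by (simp add: norm_mult)
    qed
  qed simp
  moreover have "(\<integral>\<zeta>. dil (rho k) \<zeta> * of_real (poisson z \<zeta>) \<partial>mT) = g (of_real (rho k) * z)" for k
  proof -
    have "(\<lambda>\<zeta>. dil (rho k) \<zeta> * of_real (poisson z \<zeta>)) = on_circle (\<lambda>\<zeta>. g (of_real (rho k) * \<zeta>) * of_real (poisson z \<zeta>))"
      by (auto simp: dil_def on_circle_def)
    thus ?thesis using poisson_formula[OF g_holomorphic rho(1,2) z] by simp
  qed
  moreover have "(\<lambda>k. g (of_real (rho k) * z)) \<longlonglongrightarrow> g z"
  proof (rule isCont_tendsto_compose[of z g "\<lambda>k. of_real (rho k) * z"])
    show "isCont g z"
      using holomorphic_on_imp_continuous_on[OF g_holomorphic] z by (simp add: continuous_on_eq_continuous_at)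
    have "(\<lambda>k. of_real (rho k) * z) \<longlonglongrightarrow> of_real 1 * z" by (intro tendsto_intros rho)
    thus "(\<lambda>k. of_real (rho k) * z) \<longlonglongrightarrow> z" by simp
  qed
  ultimately show ?thesis using LIMSEQ_unique by simp
qed

text \<open>The window of half-width d is handled by the monotone kernel bound on each side, the
  rest by the value of the kernel at angle d, which tends to 0. The condition
  \<open>d <= pi - |\<theta>|\<close> keeps the window in the interval where the circle weight is
  constant.\<close>

lemma radial_limit_at_lebesgue_point:
  fixes f :: "real \<Rightarrow> complex"
  assumes f [measurable]: "f \<in> borel_measurable borel" and f1: "\<And>t. cmod (f t) \<le> 1"
    and rep: "\<And>r. 0 \<le> r \<Longrightarrow> r < 1 \<Longrightarrow>
      (\<integral>t. circle_weight t *\<^sub>R (f t * of_real (poisson_angle r (t - \<theta>))) \<partial>lborel) = g (of_real r * cis \<theta>)"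
    and \<theta>: "\<bar>\<theta>\<bar> < pi"
    and right: "\<And>\<epsilon>. \<epsilon> > 0 \<Longrightarrow> \<exists>d>0. \<forall>s. 0 \<le> s \<longrightarrow> s < d \<longrightarrow>
        cmod (\<integral>t. indicator {0..s} t *\<^sub>R (f (\<theta> + t) - f \<theta>) \<partial>lborel) \<le> \<epsilon> * s"
    and left: "\<And>\<epsilon>. \<epsilon> > 0 \<Longrightarrow> \<exists>d>0. \<forall>s. 0 \<le> s \<longrightarrow> s < d \<longrightarrow>
        cmod (\<integral>t. indicator {0..s} t *\<^sub>R (f (\<theta> - t) - f \<theta>) \<partial>lborel) \<le> \<epsilon> * s"
  shows "((\<lambda>r. g (of_real r * cis \<theta>)) \<longlongrightarrow> f \<theta>) (at_left 1)"
proof -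
  let ?K = poisson_angle
  define hh where "hh t = f t - f \<theta>" for t
  have hh_meas [measurable]: "hh \<in> borel_measurable borel" unfolding hh_def[abs_def] by measurable
  have hh2: "cmod (hh t) \<le> 2" for t
    unfolding hh_def using norm_triangle_ineq4[of "f t" "f \<theta>"] f1[of t] f1[of \<theta>] by linarith
  have key: "cmod (g (of_real r * cis \<theta>) - f \<theta>) \<le> 2 * \<epsilon> + 2 * ?K r d"
    if r: "0 \<le> r" "r < 1" and d: "0 < d" "d \<le> pi - \<bar>\<theta>\<bar>" and \<epsilon>: "\<epsilon> > 0"
      and R: "\<And>s. 0 \<le> s \<Longrightarrow> s \<le> d \<Longrightarrow> cmod (\<integral>t. indicator {0..s} t *\<^sub>R hh (\<theta> + t) \<partial>lborel) \<le> \<epsilon> * s"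
      and L: "\<And>s. 0 \<le> s \<Longrightarrow> s \<le> d \<Longrightarrow> cmod (\<integral>t. indicator {0..s} t *\<^sub>R hh (\<theta> - t) \<partial>lborel) \<le> \<epsilon> * s" for r d \<epsilon>
  proof -
    define M where "M = ?K r 0"
    have K: "0 \<le> ?K r s" "?K r s \<le> M" for s
      using poisson_angle_nonneg[OF r] poisson_angle_bound[OF r] by (auto simp: M_def)
    have M0: "M \<ge> 0" using K(1)[of 0] by (simp add: M_def)
    have int: "integrable lborel (\<lambda>t. c t *\<^sub>R k t)"
      if "c \<in> borel_measurable borel" "k \<in> borel_measurable borel" "\<And>t. \<bar>c t\<bar> \<le> C * indicator {x..y} t" "\<And>t. norm (k t) \<le> B"
      for c :: "real \<Rightarrow> real" and k :: "real \<Rightarrow> 'c::{banach, second_countable_topology}" and C B x y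
    proof (rule integrable_bounded_interval[where B = "C * B" and a = x and b = y])
      show "norm (c t *\<^sub>R k t) \<le> C * B * indicator {x..y} t" for t
        using mult_mono[OF that(3)[of t] that(4)[of t]] order_trans[OF abs_ge_zero that(3)[of t]] by (simp add: mult_ac)
    qed (use that in measurable)
    have w: "\<bar>circle_weight t\<bar> \<le> 1 / (2 * pi) * indicator {-pi..pi} t" for t
      by (simp add: circle_weight_def indicator_def)
    have Kt [measurable]: "(\<lambda>t. ?K r (t - \<theta>)) \<in> borel_measurable borel"
      by (rule measurable_compose[OF _ poisson_angle_measurable]) measurable
    have int1: "integrable lborel (\<lambda>t. circle_weight t *\<^sub>R (k t * of_real (?K r (t - \<theta>))))"
      if "k \<in> borel_measurable borel" "\<And>t. cmod (k t) \<le> B" for k :: "real \<Rightarrow> complex" and B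
    proof (rule int[OF _ _ w])
      show "cmod (k t * of_real (?K r (t - \<theta>))) \<le> B * M" for t
        unfolding norm_mult norm_of_real using K[of "t - \<theta>"] that(2)[of t] order_trans[OF norm_ge_zero that(2)[of t]]
        by (intro mult_mono) auto
    qed (use that(1) in measurable)
    have one: "(\<integral>t. circle_weight t *\<^sub>R (1 * of_real (?K r (t - \<theta>))) \<partial>lborel) = (1::complex)"
    proof -
      have "(\<integral>t. circle_weight t *\<^sub>R (1 * complex_of_real (?K r (t - \<theta>))) \<partial>lborel)
        = (\<integral>t. complex_of_real (circle_weight t * ?K r (t - \<theta>)) \<partial>lborel)"
        by (intro Bochner_Integration.integral_cong refl) (simp add: scaleR_conv_of_real)
      thus ?thesis unfolding integral_complex_of_real integral_poisson_angle[OF r] by simp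
    qed
    have "g (of_real r * cis \<theta>) - f \<theta> = (\<integral>t. circle_weight t *\<^sub>R (f t * of_real (?K r (t - \<theta>))) \<partial>lborel)
        - (\<integral>t. circle_weight t *\<^sub>R (1 * of_real (?K r (t - \<theta>))) \<partial>lborel) * f \<theta>"
      unfolding rep[OF r] one by simp
    also have "\<dots> = (\<integral>t. circle_weight t *\<^sub>R (f t * of_real (?K r (t - \<theta>))) - circle_weight t *\<^sub>R (1 * of_real (?K r (t - \<theta>))) * f \<theta> \<partial>lborel)"
      unfolding integral_mult_left_zero[symmetric]
      by (rule Bochner_Integration.integral_diff[OF int1[OF f f1], symmetric])
         (intro integrable_mult_left int1[of "\<lambda>_. 1" 1], auto)
    also have "\<dots> = (\<integral>t. circle_weight t *\<^sub>R (hh t * of_real (?K r (t - \<theta>))) \<partial>lborel)"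
      by (intro Bochner_Integration.integral_cong refl) (simp add: hh_def scaleR_conv_of_real algebra_simps)
    finally have main: "g (of_real r * cis \<theta>) - f \<theta> = (\<integral>t. circle_weight t *\<^sub>R (hh t * of_real (?K r (t - \<theta>))) \<partial>lborel)" .
    \<comment> \<open>The two closed halves of the window overlap in \<theta>, a null set.\<close>
    define near where "near t = indicator {\<theta>..\<theta> + d} t + indicator {\<theta> - d..\<theta>} (t::real) / (1::real)" for t
    have near_meas [measurable]: "near \<in> borel_measurable borel" unfolding near_def[abs_def] by measurable
    define far where "far t = circle_weight t - near t / (2 * pi)" for t
    have far_meas [measurable]: "far \<in> borel_measurable borel" unfolding far_def[abs_def] by measurable
    have I_int: "integrable lborel (\<lambda>t. indicator {x..y} t *\<^sub>R (hh t * of_real (?K r (t - \<theta>))))" for x y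
      by (rule int[of "indicator {x..y}" _ 1 x y "2 * M"])
         (use K hh2 M0 in \<open>auto simp: norm_mult intro!: mult_mono\<close>)
    have far_AE: "AE t in lborel. cmod (far t *\<^sub>R (hh t * of_real (?K r (t - \<theta>)))) \<le> circle_weight t * (2 * ?K r d)"
      using AE_lborel_singleton[of \<theta>] AE_lborel_singleton[of "\<theta> - d"]
    proof eventually_elim
      case (elim t)
      show ?case
      proof (cases "t \<in> {\<theta> - d..\<theta> + d}")
        case True
        hence "far t = 0" using elim \<theta> d by (auto simp: far_def near_def circle_weight_def indicator_def)
        thus ?thesis using K(1) by simp
      next
        case False
        hence "near t = 0" using d by (auto simp: near_def indicator_def)
        hence far: "far t = circle_weight t" by (simp add: far_def)
        show ?thesis
        proof (cases "-pi < t \<and> t \<le> pi")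
          case True
          have "cos \<bar>t - \<theta>\<bar> \<le> cos d"
          proof (cases "\<bar>t - \<theta>\<bar> \<le> pi")
            case True
            thus ?thesis using False d by (intro cos_monotone_0_pi_le) auto
          next
            case False
            \<comment> \<open>Beyond pi the angle is measured the other way round the circle; it is
              still at least d because
              \<open>2 * pi - |t - \<theta>| >= pi - |\<theta>|\<close>.\<close>
            have "cos \<bar>t - \<theta>\<bar> = cos (2 * pi - \<bar>t - \<theta>\<bar>)" by (simp add: cos_diff)
            also have "\<dots> \<le> cos d" using False True d \<theta> by (intro cos_monotone_0_pi_le) auto
            finally show ?thesis .
          qed
          hence "?K r (t - \<theta>) \<le> ?K r d" by (intro poisson_angle_antimono[OF r]) simp
          hence "cmod (hh t) * ?K r (t - \<theta>) \<le> 2 * ?K r d" using hh2[of t] K(1) by (intro mult_mono) auto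
          thus ?thesis unfolding far using K(1)[of "t - \<theta>"] by (simp add: norm_mult mult_left_mono)
        qed (simp add: far circle_weight_def)
      qed
    qed
    have split: "(\<integral>t. circle_weight t *\<^sub>R (hh t * of_real (?K r (t - \<theta>))) \<partial>lborel)
      = (\<integral>t. far t *\<^sub>R (hh t * of_real (?K r (t - \<theta>))) \<partial>lborel)
        + (1 / (2 * pi)) *\<^sub>R ((\<integral>t. indicator {\<theta>..\<theta> + d} t *\<^sub>R (hh t * of_real (?K r (t - \<theta>))) \<partial>lborel)
        + (\<integral>t. indicator {\<theta> - d..\<theta>} t *\<^sub>R (hh t * of_real (?K r (t - \<theta>))) \<partial>lborel))" (is "?T = ?F + _ *\<^sub>R (?R + ?L)")
      and far_int: "integrable lborel (\<lambda>t. far t *\<^sub>R (hh t * of_real (?K r (t - \<theta>))))"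
    proof -
      have e: "far t *\<^sub>R v = circle_weight t *\<^sub>R v - (1 / (2 * pi)) *\<^sub>R (indicator {\<theta>..\<theta> + d} t *\<^sub>R v + indicator {\<theta> - d..\<theta>} t *\<^sub>R v)" for t and v :: complex
        by (simp add: far_def near_def scaleR_conv_of_real algebra_simps add_divide_distrib)
      have i: "integrable lborel (\<lambda>t. (1 / (2 * pi)) *\<^sub>R (indicator {\<theta>..\<theta> + d} t *\<^sub>R (hh t * of_real (?K r (t - \<theta>)))
          + indicator {\<theta> - d..\<theta>} t *\<^sub>R (hh t * of_real (?K r (t - \<theta>)))))"
        by (intro integrable_scaleR_right Bochner_Integration.integrable_add I_int)
      note i0 = int1[OF hh_meas hh2]
      show "integrable lborel (\<lambda>t. far t *\<^sub>R (hh t * of_real (?K r (t - \<theta>))))"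
        unfolding e by (rule Bochner_Integration.integrable_diff[OF i0 i])
      have "?F = ?T - (1 / (2 * pi)) *\<^sub>R (?R + ?L)"
        unfolding e Bochner_Integration.integral_diff[OF i0 i] integral_scaleR_right
        by (subst Bochner_Integration.integral_add[OF I_int I_int]) simp
      thus "?T = ?F + (1 / (2 * pi)) *\<^sub>R (?R + ?L)" by simp
    qed
    have wK: "integrable lborel (\<lambda>t. circle_weight t * k)" for k :: real
      using int[OF circle_weight_measurable _ w, of "\<lambda>_. k" "\<bar>k\<bar>"] by simp
    have "cmod ?F \<le> (\<integral>t. circle_weight t * (2 * ?K r d) \<partial>lborel)"
      by (rule norm_integral_le[OF far_int wK far_AE])
    also have "\<dots> = 2 * ?K r d"
    proof -
      have "(\<integral>t. circle_weight t *\<^sub>R (2 * ?K r d) \<partial>lborel) = (\<integral>\<zeta>. 2 * ?K r d \<partial>mT)" by (subst integral_mT) auto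
      thus ?thesis by (simp add: measure_mT_UNIV)
    qed
    finally have F: "cmod ?F \<le> 2 * ?K r d" .
    define J where "J = (\<integral>t. indicator {0..d} t * ?K r t \<partial>lborel)"
    have mono: "?K r t \<le> ?K r s" if "0 \<le> s" "s \<le> t" "t \<le> d" for s t
      using that d \<theta> by (intro poisson_angle_antimono[OF r] cos_monotone_0_pi_le) auto
    have "?R = (\<integral>t. (indicator {0..d} t * ?K r t) *\<^sub>R hh (\<theta> + t) \<partial>lborel)"
      by (subst lborel_integral_real_affine[of 1 _ \<theta>])
         (auto intro!: Bochner_Integration.integral_cong simp: indicator_def scaleR_conv_of_real)
    also have "cmod \<dots> \<le> \<epsilon> * J" unfolding J_def
      by (rule monotone_kernel_bound[where H = 2]) (use d K mono hh2 R in auto)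
    finally have Rb: "cmod ?R \<le> \<epsilon> * J" .
    have "?L = (\<integral>t. (indicator {0..d} t * ?K r t) *\<^sub>R hh (\<theta> - t) \<partial>lborel)"
    proof -
      have "?K r (- t) = ?K r t" for t by (simp add: poisson_angle_def)
      thus ?thesis
        by (subst lborel_integral_real_affine[of "-1" _ \<theta>])
           (auto intro!: Bochner_Integration.integral_cong simp: indicator_def scaleR_conv_of_real)
    qed
    also have "cmod \<dots> \<le> \<epsilon> * J" unfolding J_def
      by (rule monotone_kernel_bound[where H = 2]) (use d K mono hh2 L in auto)
    finally have Lb: "cmod ?L \<le> \<epsilon> * J" .
    have "J = (\<integral>t. indicator {\<theta>..\<theta> + d} t * ?K r (t - \<theta>) \<partial>lborel)"
      unfolding J_def by (subst (2) lborel_integral_real_affine[of 1 _ \<theta>])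
         (auto intro!: Bochner_Integration.integral_cong simp: indicator_def)
    also have "\<dots> \<le> (\<integral>t. 2 * pi * (circle_weight t * ?K r (t - \<theta>)) \<partial>lborel)"
    proof (rule integral_mono)
      show "integrable lborel (\<lambda>t. indicator {\<theta>..\<theta> + d} t * ?K r (t - \<theta>))"
        using int[of "indicator {\<theta>..\<theta> + d}" "\<lambda>t. ?K r (t - \<theta>)" 1 \<theta> "\<theta> + d" M] K by auto
      show "integrable lborel (\<lambda>t. 2 * pi * (circle_weight t * ?K r (t - \<theta>)))"
        using int[OF circle_weight_measurable Kt w, of M] K by auto
      show "indicator {\<theta>..\<theta> + d} t * ?K r (t - \<theta>) \<le> 2 * pi * (circle_weight t * ?K r (t - \<theta>))" for t
        using d \<theta> K(1)[of "t - \<theta>"] by (auto simp: indicator_def circle_weight_def)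
    qed
    also have "\<dots> = 2 * pi" using integral_poisson_angle[OF r, of \<theta>] by simp
    \<comment> \<open>The factor \<open>2 * pi\<close> from the missing normalization of
      \<open>near\<close> is cancelled by the prefactor in \<open>split\<close>.\<close>
    finally have J: "J \<le> 2 * pi" .
    have "cmod (?R + ?L) \<le> 2 * \<epsilon> * (2 * pi)"
      using norm_triangle_ineq[of ?R ?L] Rb Lb mult_left_mono[OF J, of \<epsilon>] \<epsilon> by linarith
    hence "\<bar>1 / (2 * pi)\<bar> * cmod (?R + ?L) \<le> \<bar>1 / (2 * pi)\<bar> * (2 * \<epsilon> * (2 * pi))" by (intro mult_left_mono) auto
    also have "\<dots> = 2 * \<epsilon>" by simp
    finally have "cmod ((1 / (2 * pi)) *\<^sub>R (?R + ?L)) \<le> 2 * \<epsilon>" by (simp only: norm_scaleR)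
    thus ?thesis unfolding main split using F norm_triangle_ineq[of ?F "(1 / (2 * pi)) *\<^sub>R (?R + ?L)"] by linarith
  qed
  show ?thesis
  proof (rule tendstoI)
    fix \<epsilon> :: real assume \<epsilon>: "\<epsilon> > 0"
    obtain d1 where d1: "d1 > 0" "\<And>s. 0 \<le> s \<Longrightarrow> s < d1 \<Longrightarrow> cmod (\<integral>t. indicator {0..s} t *\<^sub>R hh (\<theta> + t) \<partial>lborel) \<le> \<epsilon> / 8 * s"
      using right[of "\<epsilon> / 8"] \<epsilon> unfolding hh_def by auto
    obtain d2 where d2: "d2 > 0" "\<And>s. 0 \<le> s \<Longrightarrow> s < d2 \<Longrightarrow> cmod (\<integral>t. indicator {0..s} t *\<^sub>R hh (\<theta> - t) \<partial>lborel) \<le> \<epsilon> / 8 * s"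
      using left[of "\<epsilon> / 8"] \<epsilon> unfolding hh_def by auto
    define d where "d = min (min d1 d2) (pi - \<bar>\<theta>\<bar>) / 2"
    have d: "0 < d" "d \<le> pi - \<bar>\<theta>\<bar>" "d < d1" "d < d2" "d < pi" using d1 d2 \<theta> by (auto simp: d_def)
    have "\<forall>\<^sub>F r in at_left 1. ?K r d < \<epsilon> / 8"
      using order_tendstoD(2)[OF poisson_angle_tendsto_0[OF d(1,5)], of "\<epsilon> / 8"] \<epsilon> by simp
    moreover have "\<forall>\<^sub>F r in at_left (1::real). r \<in> {0<..<1}" by (rule eventually_at_left_real) simp
    ultimately show "\<forall>\<^sub>F r in at_left 1. dist (g (of_real r * cis \<theta>)) (f \<theta>) < \<epsilon>"
    proof eventually_elim
      case (elim r)
      have "cmod (g (of_real r * cis \<theta>) - f \<theta>) \<le> 2 * (\<epsilon> / 8) + 2 * ?K r d"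
        using elim d d1 d2 \<epsilon> by (intro key) auto
      thus ?case using elim \<epsilon> by (simp add: dist_norm)
    qed
  qed
qed

end

context schur_function
begin

text \<open>g is continuous along each radius, so the limit can be tested on rational radii, and the
  set becomes a countable combination of Borel sets.\<close>

lemma radial_limit_measurable:
  assumes [measurable]: "\<beta> \<in> borel_measurable borel"
  shows "{\<zeta>. cmod \<zeta> = 1 \<longrightarrow> ((\<lambda>r. g (of_real r * \<zeta>)) \<longlongrightarrow> \<beta> \<zeta>) (at_left (1::real))} \<in> sets borel"
proof -
  define D where "D q \<zeta> = on_circle (\<lambda>\<zeta>. g (of_real (of_rat q) * \<zeta>)) \<zeta>" for q :: rat and \<zeta>
  define U where "U \<zeta> \<longleftrightarrow> (\<forall>k::nat. \<exists>n::nat. \<forall>q::rat. real_of_rat q \<in> {1 - 1 / (real n + 1)<..<1} \<longrightarrow>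
      cmod (D q \<zeta> - \<beta> \<zeta>) \<le> 1 / (real k + 1))" for \<zeta>
  have D_meas [measurable]: "D q \<in> borel_measurable borel" if "0 \<le> real_of_rat q" "real_of_rat q < 1" for q
    using dil_measurable[OF that] by (simp add: D_def[abs_def] dil_def)
  have "{\<zeta>. real_of_rat q \<in> {1 - 1 / (real n + 1)<..<1} \<longrightarrow> cmod (D q \<zeta> - \<beta> \<zeta>) \<le> 1 / (real k + 1)} \<in> sets borel" for n k q
  proof (cases "real_of_rat q \<in> {1 - 1 / (real n + 1)<..<1}")
    case True
    have "1 / (real n + 1) \<le> 1" by simp
    moreover have "1 - 1 / (real n + 1) < real_of_rat q" "real_of_rat q < 1"
      using True by (simp_all only: greaterThanLessThan_iff)
    ultimately have q: "0 \<le> real_of_rat q" "real_of_rat q < 1" by linarith+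
    have [measurable]: "D q \<in> borel_measurable borel" by (rule D_meas[OF q])
    have "{\<zeta>. cmod (D q \<zeta> - \<beta> \<zeta>) \<le> 1 / (real k + 1)} \<in> sets borel" by measurable
    thus ?thesis using True by (simp only: simp_thms)
  next
    case False
    hence "{\<zeta>. real_of_rat q \<in> {1 - 1 / (real n + 1)<..<1} \<longrightarrow> cmod (D q \<zeta> - \<beta> \<zeta>) \<le> 1 / (real k + 1)} = UNIV"
      by (simp only: simp_thms UNIV_def)
    thus ?thesis using sets.top[of "borel :: complex measure"] by (simp only: space_borel)
  qed
  note X = this
  define Y where "Y k n q = {\<zeta>. real_of_rat q \<in> {1 - 1 / (real n + 1)<..<1} \<longrightarrow> cmod (D q \<zeta> - \<beta> \<zeta>) \<le> 1 / (real k + 1)}" for k n :: nat and q :: rat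
  have Y: "Y k n q \<in> sets borel" for k n q unfolding Y_def by (rule X)
  have "(\<Inter>q. Y k n q) \<in> sets borel" for k n by (intro sets.countable_INT'' Y) simp_all
  hence "(\<Union>n. \<Inter>q. Y k n q) \<in> sets borel" for k by (intro sets.countable_UN'') simp_all
  hence "(\<Inter>k. \<Union>n. \<Inter>q. Y k n q) \<in> sets borel" by (intro sets.countable_INT'') simp_all
  moreover have "(\<Inter>k. \<Union>n. \<Inter>q. Y k n q) = {\<zeta>. U \<zeta>}"
    unfolding U_def Y_def by (rule set_eqI) (simp only: INT_iff UN_iff mem_Collect_eq ball_UNIV bex_UNIV UNIV_I)
  ultimately have U_meas: "{\<zeta>. U \<zeta>} \<in> sets borel" by simp
  have iff: "((\<lambda>r. g (of_real r * \<zeta>)) \<longlongrightarrow> \<beta> \<zeta>) (at_left (1::real)) \<longleftrightarrow> U \<zeta>" if \<zeta>: "cmod \<zeta> = 1" for \<zeta>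
  proof
    assume lim: "((\<lambda>r. g (of_real r * \<zeta>)) \<longlongrightarrow> \<beta> \<zeta>) (at_left (1::real))"
    show "U \<zeta>" unfolding U_def
    proof
      fix k :: nat
      have "\<forall>\<^sub>F r in at_left (1::real). dist (g (of_real r * \<zeta>)) (\<beta> \<zeta>) < 1 / (real k + 1)"
        by (rule tendstoD[OF lim]) simp
      then obtain a where a: "a < 1" "\<And>r. a < r \<Longrightarrow> r < 1 \<Longrightarrow> dist (g (of_real r * \<zeta>)) (\<beta> \<zeta>) < 1 / (real k + 1)"
        unfolding eventually_at_left_field by blast
      obtain n :: nat where n: "1 / (real n + 1) < 1 - a"
        using reals_Archimedean[of "1 - a"] a(1) by (auto simp: inverse_eq_divide add.commute)
      have "cmod (D q \<zeta> - \<beta> \<zeta>) \<le> 1 / (real k + 1)" if "real_of_rat q \<in> {1 - 1 / (real n + 1)<..<1}" for q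
        using a(2)[of "real_of_rat q"] that n \<zeta> by (simp add: D_def on_circle_def dist_norm less_imp_le)
      thus "\<exists>n::nat. \<forall>q::rat. real_of_rat q \<in> {1 - 1 / (real n + 1)<..<1} \<longrightarrow> cmod (D q \<zeta> - \<beta> \<zeta>) \<le> 1 / (real k + 1)" by blast
    qed
  next
    assume U: "U \<zeta>"
    show "((\<lambda>r. g (of_real r * \<zeta>)) \<longlongrightarrow> \<beta> \<zeta>) (at_left (1::real))"
    proof (rule tendstoI)
      fix \<epsilon> :: real assume \<epsilon>: "\<epsilon> > 0"
      obtain k :: nat where k: "1 / (real k + 1) < \<epsilon>"
        using reals_Archimedean[OF \<epsilon>] by (auto simp: inverse_eq_divide add.commute)
      obtain n :: nat where n: "\<And>q. real_of_rat q \<in> {1 - 1 / (real n + 1)<..<1} \<Longrightarrow> cmod (D q \<zeta> - \<beta> \<zeta>) \<le> 1 / (real k + 1)"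
        using U unfolding U_def by meson
      have "cmod (g (of_real r * \<zeta>) - \<beta> \<zeta>) \<le> 1 / (real k + 1)" if r: "1 - 1 / (real n + 1) < r" "r < 1" for r
      proof -
        have "1 / (real n + 1) \<le> 1" by simp
        hence "0 < r" using r by linarith
        hence cont: "isCont g (of_real r * \<zeta>)"
          using holomorphic_on_imp_continuous_on[OF g_holomorphic] \<zeta> r by (auto simp: continuous_on_eq_continuous_at norm_mult)
        \<comment> \<open>Rational radii approaching r from above stay in the window near 1, and
          continuity of g carries their estimate to r.\<close>
        have "\<exists>q. r < real_of_rat q \<and> real_of_rat q < min 1 (r + 1 / (real i + 1))" for i :: nat
          by (rule of_rat_dense) (use r in auto)
        then obtain q where q: "\<And>i. r < real_of_rat (q i)" "\<And>i. real_of_rat (q i) < min 1 (r + 1 / (real i + 1))" by metis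
        have q_lim: "(\<lambda>i. real_of_rat (q i)) \<longlonglongrightarrow> r"
        proof (rule tendsto_sandwich)
          show "\<forall>\<^sub>F i in sequentially. r \<le> real_of_rat (q i)" using q(1) by (intro always_eventually allI less_imp_le)
          show "\<forall>\<^sub>F i in sequentially. real_of_rat (q i) \<le> r + 1 / (real i + 1)"
            using q(2) by (intro always_eventually allI less_imp_le) auto
          have "(\<lambda>i. r + inverse (real (Suc i))) \<longlonglongrightarrow> r + 0" by (intro tendsto_intros LIMSEQ_inverse_real_of_nat)
          thus "(\<lambda>i. r + 1 / (real i + 1)) \<longlonglongrightarrow> r" by (simp add: inverse_eq_divide add.commute)
        qed simp
        have "(\<lambda>i. g (of_real (real_of_rat (q i)) * \<zeta>)) \<longlonglongrightarrow> g (of_real r * \<zeta>)"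
          by (rule isCont_tendsto_compose[OF cont]) (intro tendsto_intros q_lim)
        hence "(\<lambda>i. cmod (g (of_real (real_of_rat (q i)) * \<zeta>) - \<beta> \<zeta>)) \<longlonglongrightarrow> cmod (g (of_real r * \<zeta>) - \<beta> \<zeta>)"
          by (intro tendsto_intros)
        moreover have "cmod (g (of_real (real_of_rat (q i)) * \<zeta>) - \<beta> \<zeta>) \<le> 1 / (real k + 1)" for i
          using n[of "q i"] q[of i] r \<zeta> by (simp add: D_def on_circle_def)
        ultimately show ?thesis by (intro LIMSEQ_le_const2) auto
      qed
      thus "\<forall>\<^sub>F r in at_left (1::real). dist (g (of_real r * \<zeta>)) (\<beta> \<zeta>) < \<epsilon>"
        unfolding eventually_at_left_field dist_norm
        by (intro exI[of _ "1 - 1 / (real n + 1)"]) (use k in \<open>auto intro: le_less_trans\<close>)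
    qed
  qed
  have "{\<zeta>. cmod \<zeta> = 1 \<longrightarrow> ((\<lambda>r. g (of_real r * \<zeta>)) \<longlongrightarrow> \<beta> \<zeta>) (at_left (1::real))}
     = {\<zeta>. cmod \<zeta> = 1 \<longrightarrow> \<zeta> \<in> {\<zeta>. U \<zeta>}}" using iff by auto
  also have "\<dots> \<in> sets borel" using U_meas by measurable
  finally show ?thesis .
qed

text \<open>Almost every angle is a Lebesgue point of the boundary function from both sides, and
  there the Poisson integral has the radial limit \<beta>.\<close>

theorem fatou:
  obtains \<beta> where "\<beta> \<in> borel_measurable borel" "\<And>\<zeta>. cmod (\<beta> \<zeta>) \<le> 1"
    "AE \<zeta> in mT. cmod \<zeta> = 1 \<longrightarrow> ((\<lambda>r. g (of_real r * \<zeta>)) \<longlongrightarrow> \<beta> \<zeta>) (at_left (1::real))"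
proof -
  obtain rho \<beta> where rho: "\<And>k. 0 \<le> rho k" "\<And>k. rho k < (1::real)" "rho \<longlonglongrightarrow> 1"
    and \<beta>: "\<beta> \<in> borel_measurable borel" "\<And>\<zeta>. cmod (\<beta> \<zeta>) \<le> 1" "AE \<zeta> in mT. (\<lambda>k. dil (rho k) \<zeta>) \<longlonglongrightarrow> \<beta> \<zeta>"
    using boundary_sequence by blast
  note [measurable] = \<beta>(1)
  define f where "f t = \<beta> (cis t)" for t
  have f: "f \<in> borel_measurable borel" unfolding f_def[abs_def] by measurable
  have f': "(\<lambda>t. f (- t)) \<in> borel_measurable borel" using f by measurable
  have f1: "cmod (f t) \<le> 1" for t by (simp add: f_def \<beta>)
  obtain N where N: "negligible N" "\<And>x \<epsilon>. x \<notin> N \<Longrightarrow> \<epsilon> > 0 \<Longrightarrow> \<exists>d>0. \<forall>s. 0 \<le> s \<longrightarrow> s < d \<longrightarrow>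
        cmod (\<integral>t. indicator {0..s} t *\<^sub>R (f (x + t) - f x) \<partial>lborel) \<le> \<epsilon> * s"
    by (rule lebesgue_points[OF f f1]) (rule that; assumption)
  \<comment> \<open>Lebesgue points of the reflected function supply the averages to the
    left.\<close>
  obtain N' where N': "negligible N'" "\<And>x \<epsilon>. x \<notin> N' \<Longrightarrow> \<epsilon> > 0 \<Longrightarrow> \<exists>d>0. \<forall>s. 0 \<le> s \<longrightarrow> s < d \<longrightarrow>
        cmod (\<integral>t. indicator {0..s} t *\<^sub>R (f (- (x + t)) - f (- x)) \<partial>lborel) \<le> \<epsilon> * s"
    by (rule lebesgue_points[OF f' f1]) (rule that; assumption)
  have "negligible (uminus ` N')"
    by (rule negligible_differentiable_image_negligible[OF order_refl N'(1)]) simp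
  \<comment> \<open>At the angle pi no two-sided window fits into the parameter interval.\<close>
  hence neg: "negligible (N \<union> uminus ` N' \<union> {pi})" using N(1) by (simp add: negligible_Un)
  have rep: "(\<integral>t. circle_weight t *\<^sub>R (f t * of_real (poisson_angle r (t - \<theta>))) \<partial>lborel) = g (of_real r * cis \<theta>)"
    if r: "0 \<le> r" "r < 1" for r \<theta>
  proof -
    have [measurable]: "poisson (of_real r * cis \<theta>) \<in> borel_measurable borel" by (rule poisson_measurable)
    have "g (of_real r * cis \<theta>) = (\<integral>\<zeta>. \<beta> \<zeta> * of_real (poisson (of_real r * cis \<theta>) \<zeta>) \<partial>mT)"
      using r by (intro poisson_representation[OF rho \<beta>(1,3), symmetric]) (simp add: norm_mult)
    thus ?thesis by (subst (asm) integral_mT) (simp_all add: poisson_cis[OF r(1)] f_def)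
  qed
  have lim: "((\<lambda>r. g (of_real r * cis \<theta>)) \<longlongrightarrow> f \<theta>) (at_left 1)"
    if \<theta>: "-pi < \<theta>" "\<theta> \<le> pi" "\<theta> \<notin> N \<union> uminus ` N' \<union> {pi}" for \<theta>
  proof (rule radial_limit_at_lebesgue_point[OF f f1 rep])
    show "\<bar>\<theta>\<bar> < pi" using \<theta> by auto
    show "\<exists>d>0. \<forall>s. 0 \<le> s \<longrightarrow> s < d \<longrightarrow> cmod (\<integral>t. indicator {0..s} t *\<^sub>R (f (\<theta> + t) - f \<theta>) \<partial>lborel) \<le> \<epsilon> * s"
      if "\<epsilon> > 0" for \<epsilon> using N(2)[of \<theta>] \<theta> that by auto
    have "- \<theta> \<notin> N'" using \<theta>(3) by force
    thus "\<exists>d>0. \<forall>s. 0 \<le> s \<longrightarrow> s < d \<longrightarrow> cmod (\<integral>t. indicator {0..s} t *\<^sub>R (f (\<theta> - t) - f \<theta>) \<partial>lborel) \<le> \<epsilon> * s"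
      if "\<epsilon> > 0" for \<epsilon> using N'(2)[of "-\<theta>"] that by auto
  qed
  have "AE \<theta> in lebesgue. \<theta> \<notin> N \<union> uminus ` N' \<union> {pi}"
    using neg by (simp only: negligible_iff_null_sets AE_not_in)
  hence ae: "AE \<theta> in lborel. \<theta> \<notin> N \<union> uminus ` N' \<union> {pi}" by (simp only: AE_completion_iff)
  show ?thesis
  proof (rule that[OF \<beta>(1,2)])
    show "AE \<zeta> in mT. cmod \<zeta> = 1 \<longrightarrow> ((\<lambda>r. g (of_real r * \<zeta>)) \<longlongrightarrow> \<beta> \<zeta>) (at_left (1::real))"
      unfolding AE_mT_iff[OF radial_limit_measurable[OF \<beta>(1)]]
      using ae by eventually_elim (use lim in \<open>auto simp: f_def\<close>)
  qed
qed

end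

section \<open>Recovering the canonical factorization\<close>

text \<open>Near z0 the quotient is holomorphic of constant modulus 1, hence constant by the maximum
  principle; analytic continuation removes the restriction to points where f does not
  vanish.\<close>

lemma holomorphic_eq_unimodular_mult:
  assumes f: "f holomorphic_on ball 0 1" and h: "h holomorphic_on ball 0 1"
    and z0: "z0 \<in> ball 0 1" "f z0 \<noteq> 0"
    and eq: "\<And>z. z \<in> ball 0 1 \<Longrightarrow> f z \<noteq> 0 \<Longrightarrow> cmod (f z) = cmod (h z)"
  obtains \<gamma> where "cmod \<gamma> = 1" "\<And>z. z \<in> ball 0 1 \<Longrightarrow> f z = \<gamma> * h z"
proof -
  have "open (ball 0 1 \<inter> f -` (- {0}))"
    by (rule continuous_open_preimage[OF holomorphic_on_imp_continuous_on[OF f]]) auto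
  then obtain e where e: "e > 0" "ball z0 e \<subseteq> ball 0 1 \<inter> f -` (- {0})"
    using z0 by (metis (no_types, lifting) ComplI IntI openE singletonD vimageI)
  have nz: "z \<in> ball 0 1" "f z \<noteq> 0" if "z \<in> ball z0 e" for z using that e(2) by auto
  have hnz: "h z \<noteq> 0" if "z \<in> ball z0 e" for z using eq[OF nz[OF that]] nz(2)[OF that] by auto
  have sub: "ball z0 e \<subseteq> ball 0 1" using e(2) by auto
  have q1: "cmod (f z / h z) = 1" if "z \<in> ball z0 e" for z
    using eq[OF nz[OF that]] hnz[OF that] by (simp add: norm_divide)
  have hol: "(\<lambda>z. f z / h z) holomorphic_on ball z0 e"
    by (intro holomorphic_on_divide holomorphic_on_subset[OF f sub] holomorphic_on_subset[OF h sub] hnz)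
  have z0e: "z0 \<in> ball z0 e" using e by simp
  have "(\<lambda>z. f z / h z) constant_on ball z0 e"
    by (rule maximum_modulus_principle[OF hol _ _ _ order_refl z0e])
       (use q1 q1[OF z0e] in auto)
  then obtain \<gamma> where \<gamma>: "\<And>z. z \<in> ball z0 e \<Longrightarrow> f z / h z = \<gamma>" unfolding constant_on_def by blast
  show ?thesis
  proof (rule that)
    show "cmod \<gamma> = 1" using q1[OF z0e] \<gamma>[OF z0e] by simp
    fix z :: complex assume z: "z \<in> ball 0 1"
    show "f z = \<gamma> * h z"
    proof (rule analytic_continuation_open[OF open_ball open_ball _ connected_ball sub f _ _ z])
      show "ball z0 e \<noteq> {}" using e by simp
      show "(\<lambda>z. \<gamma> * h z) holomorphic_on ball 0 1" by (intro holomorphic_intros h)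
      fix w assume w: "w \<in> ball z0 e"
      show "f w = \<gamma> * h w" using \<gamma>[OF w] hnz[OF w] by (simp add: field_simps)
    qed
  qed
qed

text \<open>Listing a point n w times amounts to weighting it by n w, which links zero sequences
  with multiplicity to sums weighted by \<open>zorder\<close>.\<close>

lemma nn_integral_count_space_Sigma_const:
  fixes H :: "'a \<Rightarrow> ennreal" and n :: "'a \<Rightarrow> nat"
  shows "(\<integral>\<^sup>+p. H (fst p) \<partial>count_space (Sigma Z (\<lambda>w. {..<n w}))) = (\<integral>\<^sup>+w. of_nat (n w) * H w \<partial>count_space Z)"
proof -
  define S where "S = Sigma Z (\<lambda>w. {..<n w})"
  have "(\<integral>\<^sup>+p. H (fst p) \<partial>count_space S) = (\<integral>\<^sup>+p. H (fst p) * indicator S p \<partial>count_space UNIV)"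
    by (rule nn_integral_count_space_indicator) simp
  also have "\<dots> = (\<integral>\<^sup>+w. \<integral>\<^sup>+k. H (fst (w, k)) * indicator S (w, k) \<partial>count_space UNIV \<partial>count_space UNIV)"
    by (rule nn_integral_fst_count_space[symmetric])
  also have "\<dots> = (\<integral>\<^sup>+w. (of_nat (n w) * H w) * indicator Z w \<partial>count_space UNIV)"
  proof (rule nn_integral_cong)
    fix w
    have "(\<integral>\<^sup>+k. H (fst (w, k)) * indicator S (w, k) \<partial>count_space UNIV)
        = (\<integral>\<^sup>+k. (H w * indicator Z w) * indicator {..<n w} k \<partial>count_space UNIV)"
      by (intro nn_integral_cong) (simp add: S_def indicator_def)
    also have "\<dots> = (H w * indicator Z w) * of_nat (n w)"
      by (subst nn_integral_cmult_indicator) (simp_all add: emeasure_count_space_finite)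
    finally show "(\<integral>\<^sup>+k. H (fst (w, k)) * indicator S (w, k) \<partial>count_space UNIV) = (of_nat (n w) * H w) * indicator Z w"
      by (simp only: ac_simps)
  qed
  also have "\<dots> = (\<integral>\<^sup>+w. of_nat (n w) * H w \<partial>count_space Z)"
    by (rule nn_integral_count_space_indicator[symmetric]) simp
  finally show ?thesis by (simp only: S_def)
qed

text \<open>Indices that carry no zero are filled up with the value 1, whose Blaschke factor is trivial.\<close>

lemma zero_enumeration:
  assumes b: "b holomorphic_on ball 0 1" and nz: "z0 \<in> ball 0 1" "b z0 \<noteq> 0"
  obtains a where "\<And>n. cmod (a n) \<le> 1"
    "\<And>F. (\<Sum>n. ennreal (1 - (cmod (a n))\<^sup>2) * F (a n))
        = (\<integral>\<^sup>+w. ennreal (real (nat (zorder b w)) * (1 - (cmod w)\<^sup>2)) * F w \<partial>count_space (zeros_of b))"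
    "\<And>z. summable (\<lambda>n. 1 - cmod (a n)) \<Longrightarrow> z \<in> ball 0 1 \<Longrightarrow> b z \<noteq> 0 \<Longrightarrow> blaschke_abs b z = cmod (blaschke a z)"
proof -
  define N where "N w = nat (zorder b w)" for w
  define Z where "Z = Sigma (zeros_of b) (\<lambda>w. {..<N w})"
  \<comment> \<open>Countability of the zero set requires a nonconstant function; without zeros
    there is nothing to enumerate.\<close>
  have nc: "\<not> b constant_on ball 0 1" if zne: "zeros_of b \<noteq> {}"
  proof
    assume "b constant_on ball 0 1"
    then obtain y where y: "\<And>x. x \<in> ball 0 1 \<Longrightarrow> b x = y" unfolding constant_on_def by blast
    obtain w where "w \<in> ball 0 1" "b w = 0" using zne unfolding zeros_of_def by blast
    with y[of w] y[OF nz(1)] nz(2) show False by simp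
  qed
  have "ball 0 1 = (\<Union>n. cball (0::complex) (1 - inverse (real (Suc n))))"
  proof (intro equalityI subsetI)
    fix x :: complex assume "x \<in> ball 0 1"
    then obtain n where "inverse (real (Suc n)) < 1 - cmod x" using reals_Archimedean[of "1 - cmod x"] by auto
    thus "x \<in> (\<Union>n. cball 0 (1 - inverse (real (Suc n))))" by (intro UN_I[of n]) auto
  next
    fix x :: complex assume "x \<in> (\<Union>n. cball 0 (1 - inverse (real (Suc n))))"
    then obtain n where "cmod x \<le> 1 - inverse (real (Suc n))" by auto
    moreover have "0 < inverse (real (Suc n))" by simp
    ultimately have "cmod x < 1" by linarith
    thus "x \<in> ball 0 1" by simp
  qed
  hence fs: "fsigma (ball (0::complex) 1)"
    using fsigma.intros[of "\<lambda>n. cball (0::complex) (1 - inverse (real (Suc n)))"] by simp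
  have "countable (zeros_of b)"
  proof (cases "zeros_of b = {}")
    case False
    show ?thesis unfolding zeros_of_def
      by (rule holomorphic_countable_zeros[OF b open_ball connected_ball fs nc[OF False]])
  qed simp
  hence "countable Z" unfolding Z_def by (intro countable_SIGMA) auto
  define e where "e = to_nat_on Z"
  have inj: "inj_on e Z" unfolding e_def by (rule inj_on_to_nat_on) fact
  define d where "d = inv_into Z e"
  have bij: "bij_betw d (e ` Z) Z" unfolding d_def by (rule bij_betw_inv_into) (rule inj_on_imp_bij_betw[OF inj])
  define a where "a n = (if n \<in> e ` Z then fst (d n) else 1)" for n
  have dZ: "d n \<in> Z" if "n \<in> e ` Z" for n using bij that by (auto simp: bij_betw_def)
  have a_zero: "a n \<in> zeros_of b" if "n \<in> e ` Z" for n using dZ[OF that] that by (auto simp: a_def Z_def)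
  have a1: "cmod (a n) \<le> 1" for n
    using a_zero[of n] by (cases "n \<in> e ` Z") (auto simp: a_def zeros_of_def less_imp_le)
  have sumF: "(\<Sum>n. ennreal (1 - (cmod (a n))\<^sup>2) * F (a n))
        = (\<integral>\<^sup>+w. ennreal (real (nat (zorder b w)) * (1 - (cmod w)\<^sup>2)) * F w \<partial>count_space (zeros_of b))" for F
  proof -
    define H where "H w = ennreal (1 - (cmod w)\<^sup>2) * F w" for w
    have "(\<Sum>n. ennreal (1 - (cmod (a n))\<^sup>2) * F (a n)) = (\<integral>\<^sup>+n. H (a n) \<partial>count_space UNIV)"
      unfolding H_def by (rule nn_integral_count_space_nat[symmetric])
    also have "\<dots> = (\<integral>\<^sup>+n. H (a n) * indicator (e ` Z) n \<partial>count_space UNIV)"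
      by (rule nn_integral_cong) (simp add: H_def a_def indicator_def)
    also have "\<dots> = (\<integral>\<^sup>+n. H (a n) \<partial>count_space (e ` Z))"
      by (rule nn_integral_count_space_indicator[symmetric]) simp
    also have "\<dots> = (\<integral>\<^sup>+n. H (fst (d n)) \<partial>count_space (e ` Z))"
      by (rule nn_integral_cong) (simp add: a_def)
    also have "\<dots> = (\<integral>\<^sup>+p. H (fst p) \<partial>count_space Z)"
      by (rule nn_integral_bij_count_space[OF bij])
    also have "\<dots> = (\<integral>\<^sup>+w. of_nat (N w) * H w \<partial>count_space (zeros_of b))"
      unfolding Z_def by (rule nn_integral_count_space_Sigma_const)
    also have "\<dots> = (\<integral>\<^sup>+w. ennreal (real (nat (zorder b w)) * (1 - (cmod w)\<^sup>2)) * F w \<partial>count_space (zeros_of b))"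
      by (intro nn_integral_cong)
         (simp add: H_def N_def zeros_of_def ennreal_mult' ennreal_of_nat_eq_real_of_nat mult.assoc)
    finally show ?thesis .
  qed
  have abs: "blaschke_abs b z = cmod (blaschke a z)"
    if sm: "summable (\<lambda>n. 1 - cmod (a n))" and z: "z \<in> ball 0 1" and bz: "b z \<noteq> 0" for z
  proof -
    define \<phi> where "\<phi> n = cmod (blaschke_factor (a n) z)" for n
    define \<l> where "\<l> w = ln (cmod ((w - z) / (1 - cnj w * z)))" for w
    have z1: "cmod z < 1" using z by simp
    have \<phi>_out: "\<phi> n = 1" if "n \<notin> e ` Z" for n
    proof -
      have "z \<noteq> 1" using z1 by auto
      thus ?thesis using that by (simp add: \<phi>_def a_def cmod_blaschke_factor)
    qed
    have \<phi>_in: "\<phi> n = cmod ((fst (d n) - z) / (1 - cnj (fst (d n)) * z))" if "n \<in> e ` Z" for n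
    proof -
      have "a n = fst (d n)" using that by (simp add: a_def)
      thus ?thesis unfolding \<phi>_def cmod_blaschke_factor[OF a1] by (simp add: norm_divide)
    qed
    have \<phi>_pos: "0 < \<phi> n" for n
    proof (cases "n \<in> e ` Z")
      case True
      have "a n \<noteq> z" using a_zero[OF True] bz by (auto simp: zeros_of_def)
      moreover have "cmod (cnj (a n) * z) < 1"
        using a1[of n] z1 by (simp add: norm_mult) (meson le_less_trans mult_left_le_one_le norm_ge_zero)
      hence "cnj (a n) * z \<noteq> 1" by auto
      ultimately show ?thesis unfolding \<phi>_def cmod_blaschke_factor[OF a1] by simp
    qed (simp add: \<phi>_out)
    have \<phi>_le: "\<phi> n \<le> 1" for n unfolding \<phi>_def by (rule blaschke_factor_le_1[OF a1]) (use z1 in simp)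
    define M where "M = 2 / (1 - cmod z)"
    have \<phi>_ge: "1 - \<phi> n \<le> M * (1 - cmod (a n))" for n
    proof -
      have "1 - \<phi> n \<le> cmod (blaschke_factor (a n) z - 1)"
        unfolding \<phi>_def using norm_triangle_ineq2[of 1 "blaschke_factor (a n) z"] by (simp add: norm_minus_commute)
      also have "\<dots> \<le> M * (1 - cmod (a n))" unfolding M_def by (rule blaschke_factor_minus_1[OF a1]) (use z1 in simp)
      finally show ?thesis .
    qed
    have "(\<lambda>n. M * (1 - cmod (a n))) \<longlonglongrightarrow> 0"
      by (rule summable_LIMSEQ_zero) (rule summable_mult[OF sm])
    hence ev: "\<forall>\<^sub>F n in sequentially. M * (1 - cmod (a n)) < 1/2" by (rule order_tendstoD) simp
    have ln_summable: "summable (\<lambda>n. norm (ln (\<phi> n)))"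
    proof (rule summable_comparison_test_ev)
      show "summable (\<lambda>n. 2 * (M * (1 - cmod (a n))))" by (intro summable_mult sm)
      show "\<forall>\<^sub>F n in sequentially. norm (norm (ln (\<phi> n))) \<le> 2 * (M * (1 - cmod (a n)))"
        using ev
      proof eventually_elim
        case (elim n)
        have h: "1/2 \<le> \<phi> n" using elim \<phi>_ge[of n] by linarith
        \<comment> \<open>Once a factor has modulus at least 1/2, minus its logarithm is at most
          twice its distance to 1, so the Blaschke condition makes the logarithms absolutely
          summable.\<close>
        have "- ln (\<phi> n) = ln (1 / \<phi> n)" using \<phi>_pos[of n] by (simp add: ln_div)
        also have "\<dots> \<le> 1 / \<phi> n - 1" using \<phi>_pos[of n] by (intro ln_le_minus_one) simp
        also have "\<dots> = (1 - \<phi> n) / \<phi> n" using \<phi>_pos[of n] by (simp add: field_simps)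
        also have "\<dots> \<le> (1 - \<phi> n) / (1/2)" using h \<phi>_le[of n] by (intro divide_left_mono) auto
        also have "\<dots> \<le> 2 * (M * (1 - cmod (a n)))" using \<phi>_ge[of n] by simp
        finally show ?case using \<phi>_le[of n] \<phi>_pos[of n] by simp
      qed
    qed
    have "(\<lambda>n. exp (\<Sum>i<n. ln (\<phi> i))) \<longlonglongrightarrow> exp (\<Sum>i. ln (\<phi> i))"
      by (intro tendsto_exp summable_LIMSEQ summable_norm_cancel[OF ln_summable])
    moreover have "exp (\<Sum>i<n. ln (\<phi> i)) = cmod (blaschke_partial a n z)" for n
      using \<phi>_pos by (simp add: exp_sum blaschke_partial_def prod_norm[symmetric] \<phi>_def)
    ultimately have "(\<lambda>n. cmod (blaschke_partial a n z)) \<longlonglongrightarrow> exp (\<Sum>i. ln (\<phi> i))" by simp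
    moreover have "(\<lambda>n. cmod (blaschke_partial a n z)) \<longlonglongrightarrow> cmod (blaschke a z)"
      by (intro tendsto_norm blaschke_tendsto a1 sm) (use z1 in simp)
    ultimately have B: "cmod (blaschke a z) = exp (\<Sum>i. ln (\<phi> i))" by (rule LIMSEQ_unique[symmetric])
    \<comment> \<open>Absolute summability permits passing from the ordered series to an unordered
      sum, which can be transported to Z and grouped by zeros. Filler indices contribute ln 1 =
      0.\<close>
    have hs: "((\<lambda>i. ln (\<phi> i)) has_sum (\<Sum>i. ln (\<phi> i))) UNIV"
      by (rule norm_summable_imp_has_sum[OF ln_summable]) (rule summable_sums[OF summable_norm_cancel[OF ln_summable]])
    hence "((\<lambda>i. \<l> (fst (d i))) has_sum (\<Sum>i. ln (\<phi> i))) (e ` Z)"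
      by (rule has_sum_cong_neutral[THEN iffD1, rotated -1]) (auto simp: \<phi>_out \<phi>_in \<l>_def)
    hence hZ: "((\<lambda>p. \<l> (fst p)) has_sum (\<Sum>i. ln (\<phi> i))) Z"
      by (rule has_sum_reindex_bij_betw[OF bij, THEN iffD1])
    hence "(\<Sum>i. ln (\<phi> i)) = infsum (\<lambda>p. \<l> (fst p)) Z" by (rule infsumI[symmetric])
    also have "\<dots> = infsum (\<lambda>w. infsum (\<lambda>k. \<l> (fst (w, k))) {..<N w}) (zeros_of b)"
      unfolding Z_def by (rule infsum_Sigma_banach[symmetric]) (use hZ in \<open>simp add: Z_def has_sum_imp_summable\<close>)
    also have "\<dots> = infsum (\<lambda>w. real (nat (zorder b w)) * \<l> w) (zeros_of b)"
      by (intro infsum_cong) (simp add: N_def)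
    finally show ?thesis by (simp add: B blaschke_abs_def \<l>_def)
  qed
  show ?thesis by (rule that[OF a1 sumF abs])
qed

lemma Re_herglotz_kernel:
  "Re ((\<zeta> + z) / (\<zeta> - z)) = ((cmod \<zeta>)\<^sup>2 - (cmod z)\<^sup>2) / (cmod (\<zeta> - z))\<^sup>2"
proof -
  have "Re ((\<zeta> + z) * cnj (\<zeta> - z)) = (cmod \<zeta>)\<^sup>2 - (cmod z)\<^sup>2"
    unfolding cmod_power2 by (simp add: power2_eq_square algebra_simps)
  moreover have "(\<zeta> + z) / (\<zeta> - z) = (\<zeta> + z) * cnj (\<zeta> - z) / of_real ((cmod (\<zeta> - z))\<^sup>2)"
    by (subst complex_div_cnj) (simp only: of_real_power)
  ultimately show ?thesis by (simp only: Re_divide_of_real)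
qed

text \<open>Weierstrass's product inequality; it bounds a Blaschke product at the origin from below
  by the Blaschke sum.\<close>

lemma one_minus_sum_le_prod:
  fixes x :: "nat \<Rightarrow> real"
  assumes "\<And>i. 0 \<le> x i" "\<And>i. x i \<le> 1"
  shows "1 - (\<Sum>i<k. 1 - x i) \<le> (\<Prod>i<k. x i)"
proof (induction k)
  case (Suc k)
  have p: "0 \<le> (\<Prod>i<k. x i)" "(\<Prod>i<k. x i) \<le> 1" using assms by (auto intro: prod_nonneg prod_le_1)
  have "(1 - x k) * (1 - (\<Prod>i<k. x i)) \<ge> 0" using p assms by (intro mult_nonneg_nonneg) (simp_all add: algebra_simps)
  thus ?case using Suc.IH by (simp add: algebra_simps)
qed simp

lemma blaschke_split:
  assumes "\<And>n. cmod (a n) \<le> 1" "summable (\<lambda>n. 1 - cmod (a n))" "cmod z < 1"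
  shows "blaschke a z = blaschke_partial a n z * blaschke (\<lambda>i. a (i + n)) z"
proof (rule LIMSEQ_unique)
  show "(\<lambda>k. blaschke_partial a (k + n) z) \<longlonglongrightarrow> blaschke a z"
    by (rule LIMSEQ_ignore_initial_segment) (rule blaschke_tendsto[OF assms])
  have "blaschke_partial a (k + n) z = blaschke_partial a n z * blaschke_partial (\<lambda>i. a (i + n)) k z" for k
    by (induction k) (simp_all add: blaschke_partial_def)
  thus "(\<lambda>k. blaschke_partial a (k + n) z) \<longlonglongrightarrow> blaschke_partial a n z * blaschke (\<lambda>i. a (i + n)) z"
    using assms by (simp only:) (intro tendsto_intros blaschke_tendsto, simp_all add: summable_ignore_initial_segment[of "\<lambda>n. 1 - cmod (a n)"])
qed

lemma blaschke_at_0_ge: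
  assumes a: "\<And>n. cmod (a n) \<le> 1" and s: "summable (\<lambda>n. 1 - cmod (a n))"
  shows "1 - (\<Sum>n. 1 - cmod (a n)) \<le> cmod (blaschke a 0)"
proof (rule LIMSEQ_le)
  show "(\<lambda>k. 1 - (\<Sum>i<k. 1 - cmod (a i))) \<longlonglongrightarrow> 1 - (\<Sum>n. 1 - cmod (a n))"
    by (intro tendsto_intros summable_LIMSEQ s)
  show "(\<lambda>k. cmod (blaschke_partial a k 0)) \<longlonglongrightarrow> cmod (blaschke a 0)"
    by (intro tendsto_norm blaschke_tendsto a s) simp
  have "cmod (blaschke_partial a k 0) = (\<Prod>i<k. cmod (a i))" for k
    by (simp add: blaschke_partial_def prod_norm[symmetric] cmod_blaschke_factor[OF a])
  thus "\<exists>N. \<forall>k\<ge>N. 1 - (\<Sum>i<k. 1 - cmod (a i)) \<le> cmod (blaschke_partial a k 0)"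
    using one_minus_sum_le_prod[of "\<lambda>i. cmod (a i)"] a by auto
qed

text \<open>A finite Blaschke product is unimodular on the circle. Filler values of modulus 1 are
  treated apart: their denominator could vanish in the limit, but their factor has constant modulus
  1.\<close>

lemma blaschke_partial_radial_limit:
  assumes a: "\<And>n. cmod (a n) \<le> 1" and \<zeta>: "cmod \<zeta> = 1"
    and rho: "\<And>k. 0 \<le> rho k" "\<And>k. rho k < (1::real)" "rho \<longlonglongrightarrow> 1"
  shows "(\<lambda>k. cmod (blaschke_partial a n (of_real (rho k) * \<zeta>))) \<longlonglongrightarrow> 1"
proof -
  have eq1: "cmod (c - w) = cmod (1 - cnj c * w)" if "cmod c = 1" for c w
  proof -
    have "c - w = c * (1 - cnj c * w)"
      using unit_mult_cnj[OF that] by (metis mult.assoc mult.left_neutral mult.right_neutral right_diff_distrib)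
    thus ?thesis using that by (simp add: norm_mult)
  qed
  have eq2: "cmod (c - \<zeta>) = cmod (1 - cnj c * \<zeta>)" for c
  proof -
    have "cmod (c - \<zeta>) = cmod (\<zeta> - c)" by (rule norm_minus_commute)
    also have "\<dots> = cmod (1 - cnj \<zeta> * c)" by (rule eq1[OF \<zeta>])
    also have "\<dots> = cmod (cnj (1 - cnj \<zeta> * c))" by (rule complex_mod_cnj[symmetric])
    also have "cnj (1 - cnj \<zeta> * c) = 1 - cnj c * \<zeta>" by (simp add: mult.commute)
    finally show ?thesis .
  qed
  have fac: "(\<lambda>k. cmod (blaschke_factor (a i) (of_real (rho k) * \<zeta>))) \<longlonglongrightarrow> 1" for i
  proof (cases "cmod (a i) = 1")
    case True
    have "cmod (blaschke_factor (a i) (of_real (rho k) * \<zeta>)) = 1" for k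
    proof -
      have "a i \<noteq> of_real (rho k) * \<zeta>" using True rho(1,2)[of k] \<zeta> by (auto simp: norm_mult)
      hence "cmod (a i - of_real (rho k) * \<zeta>) \<noteq> 0" by simp
      thus ?thesis unfolding cmod_blaschke_factor[OF a] eq1[OF True] by simp
    qed
    thus ?thesis by simp
  next
    case False
    hence "cmod (cnj (a i) * \<zeta>) < 1" using a[of i] \<zeta> by (simp add: norm_mult)
    hence nz: "cmod (1 - cnj (a i) * \<zeta>) \<noteq> 0" by auto
    have "(\<lambda>k. cmod (a i - of_real (rho k) * \<zeta>) / cmod (1 - cnj (a i) * (of_real (rho k) * \<zeta>)))
      \<longlonglongrightarrow> cmod (a i - of_real 1 * \<zeta>) / cmod (1 - cnj (a i) * (of_real 1 * \<zeta>))"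
      by (intro tendsto_intros rho) (use nz in simp)
    thus ?thesis unfolding cmod_blaschke_factor[OF a] using eq2[of "a i"] nz by simp
  qed
  have "(\<lambda>k. \<Prod>i<n. cmod (blaschke_factor (a i) (of_real (rho k) * \<zeta>))) \<longlonglongrightarrow> (\<Prod>i<n. 1)"
    by (intro tendsto_prod fac)
  thus ?thesis by (simp add: blaschke_partial_def prod_norm[symmetric])
qed

context canonical_factorization
begin

lemma herglotz_kernel_integrable:
  assumes "z \<in> ball 0 1" shows "integrable \<mu> (\<lambda>\<zeta>. (\<zeta> + z) / (\<zeta> - z))"
  by (rule integrable_cong_AE_imp[OF P_integrable[OF assms]], measurable)
     (use AE_proj_circle in eventually_elim, simp add: P_def)

lemma herglotz_at_0: "herglotz \<mu> 0 = of_real (measure \<mu> UNIV)"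
proof -
  have "herglotz \<mu> 0 = (\<integral>\<zeta>. 1 \<partial>\<mu>)"
    unfolding herglotz_def by (rule integral_cong_AE, measurable) (use mu_circle in eventually_elim, auto)
  thus ?thesis using sets_eq_imp_space_eq[OF mu_borel] by (simp add: scaleR_conv_of_real)
qed

text \<open>At distance d from the carrier K the Poisson kernel is at most
  \<open>(1 - rho^2) / (d/2)^2\<close> once the radial point is within d/2 of the circle.\<close>

lemma Re_herglotz_radial_limit:
  assumes K: "compact K" "emeasure \<mu> (UNIV - K) = 0" and \<zeta>: "cmod \<zeta> = 1" "\<zeta> \<notin> K"
    and rho: "\<And>k. 0 \<le> rho k" "\<And>k. rho k < (1::real)" "rho \<longlonglongrightarrow> 1"
  shows "(\<lambda>k. Re (herglotz \<mu> (of_real (rho k) * \<zeta>))) \<longlonglongrightarrow> 0"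
proof -
  obtain d where d: "d > 0" "\<And>\<eta>. \<eta> \<in> K \<Longrightarrow> d \<le> dist \<zeta> \<eta>"
    using separate_point_closed[OF compact_imp_closed[OF K(1)] \<zeta>(2)] by blast
  have AEK: "AE \<eta> in \<mu>. \<eta> \<in> K"
  proof (rule AE_I[where N = "UNIV - K"])
    show "UNIV - K \<in> sets \<mu>" using borel_compact[OF K(1)] mu_borel by auto
  qed (use K(2) in auto)
  have "(\<lambda>k. 1 - rho k) \<longlonglongrightarrow> 1 - 1" by (intro tendsto_intros rho)
  hence "(\<lambda>k. 1 - rho k) \<longlonglongrightarrow> 0" by simp
  hence ev: "\<forall>\<^sub>F k in sequentially. 1 - rho k < d / 2" by (rule order_tendstoD) (use d in simp)
  define c where "c k = (1 - (rho k)\<^sup>2) / (d / 2)\<^sup>2" for k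
  have "(\<lambda>k. measure \<mu> UNIV * c k) \<longlonglongrightarrow> measure \<mu> UNIV * ((1 - 1\<^sup>2) / (d / 2)\<^sup>2)"
    unfolding c_def by (intro tendsto_intros rho) (use d in simp)
  hence lim: "(\<lambda>k. measure \<mu> UNIV * c k) \<longlonglongrightarrow> 0" by simp
  have zb: "of_real (rho k) * \<zeta> \<in> ball 0 1" for k using rho(1,2)[of k] \<zeta> by (simp add: norm_mult)
  show ?thesis
  proof (rule tendsto_sandwich[OF _ _ tendsto_const lim])
    show "\<forall>\<^sub>F k in sequentially. 0 \<le> Re (herglotz \<mu> (of_real (rho k) * \<zeta>))"
      using Re_herglotz_nonneg[OF zb] by simp
    show "\<forall>\<^sub>F k in sequentially. Re (herglotz \<mu> (of_real (rho k) * \<zeta>)) \<le> measure \<mu> UNIV * c k"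
      using ev
    proof eventually_elim
      case (elim k)
      define z where "z = of_real (rho k) * \<zeta>"
      have z1: "cmod z < 1" and zk: "cmod z = rho k" using rho(1,2)[of k] \<zeta> by (simp_all add: z_def norm_mult)
      have int: "integrable \<mu> (\<lambda>\<eta>. (\<eta> + z) / (\<eta> - z))" by (rule herglotz_kernel_integrable) (simp add: z1)
      have "Re (herglotz \<mu> z) = (\<integral>\<eta>. Re ((\<eta> + z) / (\<eta> - z)) \<partial>\<mu>)"
        unfolding herglotz_def by (rule integral_Re[OF int, symmetric])
      also have "\<dots> \<le> (\<integral>\<eta>. c k \<partial>\<mu>)"
      proof (rule integral_mono_AE)
        show "integrable \<mu> (\<lambda>\<eta>. Re ((\<eta> + z) / (\<eta> - z)))" using int by (rule integrable_Re)
        show "integrable \<mu> (\<lambda>\<eta>. c k)" by simp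
        show "AE \<eta> in \<mu>. Re ((\<eta> + z) / (\<eta> - z)) \<le> c k"
          using AEK mu_circle
        proof eventually_elim
          case (elim \<eta>)
          have "dist \<zeta> z = cmod ((1 - of_real (rho k)) * \<zeta>)" by (simp add: dist_norm z_def left_diff_distrib)
          also have "1 - of_real (rho k) = complex_of_real (1 - rho k)" by simp
          also have "cmod (complex_of_real (1 - rho k) * \<zeta>) = 1 - rho k"
            using rho(2)[of k] \<zeta> by (simp only: norm_mult norm_of_real mult_1_right abs_of_pos diff_gt_0_iff_gt)
          finally have "dist \<zeta> z < d / 2" using \<open>1 - rho k < d / 2\<close> by simp
          hence "d / 2 \<le> dist \<eta> z" using d(2)[OF elim(1)] dist_triangle[of \<zeta> \<eta> z] dist_commute[of \<eta> z] by linarith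
          hence low: "d / 2 \<le> cmod (\<eta> - z)" by (simp add: dist_norm)
          have "Re ((\<eta> + z) / (\<eta> - z)) = (1 - (rho k)\<^sup>2) / (cmod (\<eta> - z))\<^sup>2"
            using elim(2) zk by (simp only: Re_herglotz_kernel power_one)
          also have "\<dots> \<le> c k" unfolding c_def
            using low d rho(1,2)[of k] by (intro divide_left_mono power_mono mult_pos_pos zero_less_power) (auto simp: power_le_one)
          finally show ?case .
        qed
      qed
      also have "\<dots> = measure \<mu> UNIV * c k" using sets_eq_imp_space_eq[OF mu_borel] by simp
      finally show ?case by (simp only: z_def)
    qed
  qed
qed

end

context canonical_factorization
begin

text \<open>Splitting off a finite Blaschke product and the part of \<open>\<mu>\<close> on a compact null set \<open>K\<close> changes no
  boundary modulus off \<open>K\<close> and leaves a function whose value at the origin has modulus close to 1;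
  the mean value property then forces the boundary modulus to be 1.\<close>

theorem singular_boundary_modulus:
  assumes A: "A \<in> sets borel" "emeasure mT A = 0" "emeasure \<mu> (UNIV - A) = 0"
    and \<beta> [measurable]: "\<beta> \<in> borel_measurable borel" and \<beta>1: "\<And>\<zeta>. cmod (\<beta> \<zeta>) \<le> 1"
    and lim: "AE \<zeta> in mT. cmod \<zeta> = 1 \<longrightarrow> ((\<lambda>r. b (of_real r * \<zeta>)) \<longlongrightarrow> \<beta> \<zeta>) (at_left (1::real))"
  shows "AE \<zeta> in mT. cmod (\<beta> \<zeta>) = 1"
proof -
  note [measurable_cong] = sets_mT
  have sp: "space \<mu> = UNIV" using sets_eq_imp_space_eq[OF mu_borel] by simp
  define rho where "rho k = 1 - inverse (real (Suc k))" for k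
  have rho: "\<And>k. 0 \<le> rho k" "\<And>k. rho k < 1" "rho \<longlonglongrightarrow> 1"
  proof -
    show "0 \<le> rho k" for k using inverse_le_1_iff[of "real (Suc k)"] by (simp add: rho_def)
    show "rho k < 1" for k by (simp add: rho_def)
    have "(\<lambda>k. 1 - inverse (real (Suc k))) \<longlonglongrightarrow> 1 - 0" by (intro tendsto_intros LIMSEQ_inverse_real_of_nat)
    thus "rho \<longlonglongrightarrow> 1" by (simp add: rho_def[abs_def])
  qed
  have rho_at: "filterlim rho (at_left 1) sequentially"
    using rho(2,3) unfolding filterlim_at by (intro conjI always_eventually) (auto simp: less_imp_neq)
  have int_beta: "integrable mT (\<lambda>\<zeta>. cmod (\<beta> \<zeta>))"
    by (rule mT.integrable_const_bound[where B = 1]) (auto simp: \<beta>1)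
  have main: "(1 - \<epsilon>) * exp (- \<epsilon>) \<le> (\<integral>\<zeta>. cmod (\<beta> \<zeta>) \<partial>mT)" if \<epsilon>: "0 < \<epsilon>" "\<epsilon> < 1" for \<epsilon> :: real
  proof -
    obtain n where n: "norm (\<Sum>i. 1 - cmod (a (i + n))) < \<epsilon>"
      using suminf_exist_split[OF \<epsilon>(1) a_summable] by blast
    \<comment> \<open>Inner regularity: A may be dense in the circle, and only a compact part of it
      leaves a neighbourhood of almost every boundary point free.\<close>
    have sumK: "emeasure \<mu> A = (SUP K\<in>{K. K \<subseteq> A \<and> compact K}. emeasure \<mu> K)"
      by (rule inner_regular[OF mu_borel _ A(1)]) (simp add: mu.emeasure_finite)
    obtain K where K: "K \<subseteq> A" "compact K" "measure \<mu> (UNIV - K) \<le> \<epsilon>"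
    proof (cases "emeasure \<mu> A = 0")
      case True
      have "emeasure \<mu> UNIV \<le> emeasure \<mu> A + emeasure \<mu> (UNIV - A)"
        using emeasure_subadditive[of A \<mu> "UNIV - A"] A(1) by (simp add: mu_borel)
      hence "measure \<mu> UNIV = 0" using True A(3) by (simp add: measure_def)
      thus ?thesis using that[of "{}"] \<epsilon> by simp
    next
      case False
      have "emeasure \<mu> A - ennreal \<epsilon> < emeasure \<mu> A"
        using False \<epsilon> by (intro ennreal_between) (simp_all add: mu.emeasure_finite less_top[symmetric] zero_less_iff_neq_zero)
      then obtain K where K: "K \<subseteq> A" "compact K" "emeasure \<mu> A - ennreal \<epsilon> < emeasure \<mu> K"
        unfolding sumK less_SUP_iff by blast
      have Kb: "K \<in> sets \<mu>" using borel_compact[OF K(2)] mu_borel by simp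
      have "ennreal (measure \<mu> A) - ennreal \<epsilon> < ennreal (measure \<mu> K)"
        using K(3) by (simp only: mu.emeasure_eq_measure)
      hence "ennreal (measure \<mu> A - \<epsilon>) < ennreal (measure \<mu> K)" using \<epsilon> by (simp add: ennreal_minus)
      hence 1: "measure \<mu> A - \<epsilon> \<le> measure \<mu> K" by (meson ennreal_less_iff ennreal_leI leD le_cases not_le)
      have "measure \<mu> (UNIV - K) = measure \<mu> UNIV - measure \<mu> K" using mu.finite_measure_compl[OF Kb] sp by simp
      moreover have "measure \<mu> UNIV - measure \<mu> A = 0"
        using mu.finite_measure_compl[of A] A(1,3) sp by (simp add: measure_def mu_borel)
      ultimately show ?thesis using that[OF K(1,2)] 1 by simp
    qed
    have [measurable]: "K \<in> sets borel" by (rule borel_compact[OF K(2)])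
    \<comment> \<open>\<mu>1 carries almost all the mass but has vanishing real part at boundary
      points off K; \<mu>2 has mass at most \<epsilon>.\<close>
    define \<mu>1 where "\<mu>1 = density \<mu> (\<lambda>\<zeta>. ennreal (indicator K \<zeta>))"
    define \<mu>2 where "\<mu>2 = density \<mu> (\<lambda>\<zeta>. ennreal (indicator (UNIV - K) \<zeta>))"
    define a' where "a' = (\<lambda>i. a (i + n))"
    define T where "T z = blaschke a' z * exp (- herglotz \<mu>2 z)" for z
    have m1: "emeasure \<mu>1 X = emeasure \<mu> (K \<inter> X)" and m2: "emeasure \<mu>2 X = emeasure \<mu> ((UNIV - K) \<inter> X)"
      if "X \<in> sets borel" for X
      using that unfolding \<mu>1_def \<mu>2_def ennreal_indicator
      by (simp_all add: emeasure_density mu_borel indicator_inter_arith[symmetric])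
    interpret c1: canonical_factorization "\<lambda>_. 1" \<mu>1 "\<lambda>z. blaschke (\<lambda>_. 1) z * exp (- herglotz \<mu>1 z)" 1
    proof (rule canonical_factorization.intro)
      show "AE \<zeta> in \<mu>1. cmod \<zeta> = 1" unfolding \<mu>1_def
        by (subst AE_density, measurable) (use mu_circle in eventually_elim, simp)
      show "finite_measure \<mu>1" using m1[of UNIV] by (intro finite_measureI) (simp add: \<mu>1_def sp mu.emeasure_finite)
    qed (simp_all add: \<mu>1_def mu_borel)
    interpret c2: canonical_factorization a' \<mu>2 T 1
    proof (rule canonical_factorization.intro)
      show "AE \<zeta> in \<mu>2. cmod \<zeta> = 1" unfolding \<mu>2_def
        by (subst AE_density, measurable) (use mu_circle in eventually_elim, simp)
      show "finite_measure \<mu>2" using m2[of UNIV] by (intro finite_measureI) (simp add: \<mu>2_def sp mu.emeasure_finite)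
      show "summable (\<lambda>n. 1 - cmod (a' n))" using a_summable unfolding a'_def by (rule summable_ignore_initial_segment)
    qed (simp_all add: \<mu>2_def mu_borel a'_def a_le_1 T_def)
    have split: "herglotz \<mu> z = herglotz \<mu>1 z + herglotz \<mu>2 z" if z: "z \<in> ball 0 1" for z
    proof -
      have int: "integrable \<mu> (\<lambda>\<zeta>. (\<zeta> + z) / (\<zeta> - z))" by (rule herglotz_kernel_integrable[OF z])
      have "herglotz \<mu>1 z + herglotz \<mu>2 z = (\<integral>\<zeta>. indicator K \<zeta> *\<^sub>R ((\<zeta> + z) / (\<zeta> - z)) \<partial>\<mu>)
          + (\<integral>\<zeta>. indicator (UNIV - K) \<zeta> *\<^sub>R ((\<zeta> + z) / (\<zeta> - z)) \<partial>\<mu>)"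
        unfolding herglotz_def \<mu>1_def \<mu>2_def by (intro arg_cong2[where f = "(+)"] integral_density) auto
      also have "\<dots> = (\<integral>\<zeta>. indicator K \<zeta> *\<^sub>R ((\<zeta> + z) / (\<zeta> - z)) + indicator (UNIV - K) \<zeta> *\<^sub>R ((\<zeta> + z) / (\<zeta> - z)) \<partial>\<mu>)"
        by (intro Bochner_Integration.integral_add[symmetric] integrable_mult_indicator int) (auto simp: mu_borel)
      also have "\<dots> = herglotz \<mu> z" unfolding herglotz_def
        by (intro Bochner_Integration.integral_cong) (auto simp: indicator_def)
      finally show ?thesis ..
    qed
    have fac: "cmod (b z) = cmod (blaschke_partial a n z) * exp (- Re (herglotz \<mu>1 z)) * cmod (T z)" if z: "z \<in> ball 0 1" for z
    proof -
      have "cmod (b z) = cmod (blaschke a z) * exp (- Re (herglotz \<mu> z))"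
        by (simp add: b_eq[OF z] norm_mult gamma)
      moreover have "blaschke a z = blaschke_partial a n z * blaschke a' z" unfolding a'_def
        by (rule blaschke_split[OF a_le_1 a_summable]) (use z in simp)
      moreover have "exp (- Re (herglotz \<mu> z)) = exp (- Re (herglotz \<mu>1 z)) * exp (- Re (herglotz \<mu>2 z))"
        by (simp add: split[OF z] exp_add[symmetric])
      ultimately show ?thesis by (simp add: T_def norm_mult)
    qed
    have T_hol: "T holomorphic_on ball 0 1" unfolding T_def[abs_def]
      by (intro holomorphic_intros c2.herglotz_holomorphic blaschke_holomorphic c2.a_le_1 c2.a_summable)
    have T_le: "cmod (T z) \<le> 1" if z: "z \<in> ball 0 1" for z
    proof -
      have "cmod (T z) = cmod (blaschke a' z) * exp (- Re (herglotz \<mu>2 z))" by (simp add: T_def norm_mult)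
      also have "\<dots> \<le> 1 * 1"
        using z c2.Re_herglotz_nonneg[OF z] by (intro mult_mono blaschke_le_1 c2.a_le_1 c2.a_summable) auto
      finally show ?thesis by simp
    qed
    have T0: "(1 - \<epsilon>) * exp (- \<epsilon>) \<le> cmod (T 0)"
    proof -
      have "measure \<mu>2 UNIV \<le> \<epsilon>" using K(3) m2[of UNIV] by (simp add: measure_def)
      hence e: "exp (- \<epsilon>) \<le> exp (- Re (herglotz \<mu>2 0))" by (simp add: c2.herglotz_at_0)
      have "1 - \<epsilon> \<le> 1 - (\<Sum>i. 1 - cmod (a' i))" using n unfolding a'_def by (simp add: abs_less_iff)
      also have "\<dots> \<le> cmod (blaschke a' 0)" by (rule blaschke_at_0_ge[OF c2.a_le_1 c2.a_summable])
      finally have "(1 - \<epsilon>) * exp (- \<epsilon>) \<le> cmod (blaschke a' 0) * exp (- Re (herglotz \<mu>2 0))"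
        using e \<epsilon> by (intro mult_mono) auto
      thus ?thesis by (simp add: T_def norm_mult)
    qed
    define t where "t k = on_circle (\<lambda>\<zeta>. T (of_real (rho k) * \<zeta>))" for k
    have t_cont: "continuous_on (sphere 0 1) (\<lambda>\<zeta>. T (of_real (rho k) * \<zeta>))" for k
      by (rule taylor_continuous[OF T_hol rho(1,2)])
    have [measurable]: "t k \<in> borel_measurable borel" for k unfolding t_def by (rule on_circle_measurable[OF t_cont])
    have zb: "of_real (rho k) * \<zeta> \<in> ball 0 1" if "cmod \<zeta> = 1" for k \<zeta> using rho(1,2)[of k] that by (simp add: norm_mult)
    have t1: "cmod (t k \<zeta>) \<le> 1" for k \<zeta> unfolding t_def on_circle_def using T_le[OF zb] by simp
    have notK: "AE \<zeta> in mT. \<zeta> \<notin> K"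
      by (rule AE_I[where N = A]) (use K(1) A in \<open>auto simp: sets_mT\<close>)
    have conv: "AE \<zeta> in mT. (\<lambda>k. cmod (t k \<zeta>)) \<longlonglongrightarrow> cmod (\<beta> \<zeta>)"
      using lim notK AE_mT_circle
    proof eventually_elim
      case (elim \<zeta>)
      define p where "p k = cmod (blaschke_partial a n (of_real (rho k) * \<zeta>)) * exp (- Re (herglotz \<mu>1 (of_real (rho k) * \<zeta>)))" for k
      have "emeasure \<mu>1 (UNIV - K) = 0" by (subst m1) simp_all
      hence "(\<lambda>k. Re (herglotz \<mu>1 (of_real (rho k) * \<zeta>))) \<longlonglongrightarrow> 0"
        by (intro c1.Re_herglotz_radial_limit[OF K(2)] elim rho)
      hence "p \<longlonglongrightarrow> 1 * exp (- 0)" unfolding p_def[abs_def]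
        by (intro tendsto_intros blaschke_partial_radial_limit a_le_1 elim rho)
      hence p: "p \<longlonglongrightarrow> 1" by simp
      have "((\<lambda>r. b (of_real r * \<zeta>)) \<longlongrightarrow> \<beta> \<zeta>) (at_left (1::real))" using elim by simp
      hence "(\<lambda>k. b (of_real (rho k) * \<zeta>)) \<longlonglongrightarrow> \<beta> \<zeta>" by (rule filterlim_compose) (rule rho_at)
      hence "(\<lambda>k. cmod (b (of_real (rho k) * \<zeta>)) / p k) \<longlonglongrightarrow> cmod (\<beta> \<zeta>) / 1"
        by (intro tendsto_intros p) simp_all
      moreover have "\<forall>\<^sub>F k in sequentially. cmod (b (of_real (rho k) * \<zeta>)) / p k = cmod (t k \<zeta>)"
        using order_tendstoD(1)[OF p zero_less_one]
      proof eventually_elim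
        case (elim k)
        have "cmod (b (of_real (rho k) * \<zeta>)) = p k * cmod (t k \<zeta>)"
          using fac[OF zb[OF \<open>cmod \<zeta> = 1\<close>, of k]] \<open>cmod \<zeta> = 1\<close> by (simp add: p_def t_def on_circle_def)
        thus ?case using elim by simp
      qed
      ultimately have "(\<lambda>k. cmod (t k \<zeta>)) \<longlonglongrightarrow> cmod (\<beta> \<zeta>) / 1" by (rule Lim_transform_eventually)
      thus ?case by simp
    qed
    have "(\<lambda>k. \<integral>\<zeta>. cmod (t k \<zeta>) \<partial>mT) \<longlonglongrightarrow> (\<integral>\<zeta>. cmod (\<beta> \<zeta>) \<partial>mT)"
      by (rule integral_dominated_convergence[where w = "\<lambda>_. 1"]) (use conv t1 in auto)
    \<comment> \<open>The mean value property on the circle of radius \<open>rho k\<close>.\<close>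
    moreover have "cmod (T 0) \<le> (\<integral>\<zeta>. cmod (t k \<zeta>) \<partial>mT)" for k
      using integral_norm_bound[of mT "t k"] circle_mean[OF T_hol rho(1,2), of k] by (simp add: t_def)
    ultimately have "cmod (T 0) \<le> (\<integral>\<zeta>. cmod (\<beta> \<zeta>) \<partial>mT)" by (intro LIMSEQ_le_const) auto
    thus ?thesis using T0 by linarith
  qed
  have "((\<lambda>\<epsilon>::real. (1 - \<epsilon>) * exp (- \<epsilon>)) \<longlongrightarrow> (1 - 0) * exp (- 0)) (at_right 0)" by (intro tendsto_intros)
  hence "(1 - 0) * exp (- (0::real)) \<le> (\<integral>\<zeta>. cmod (\<beta> \<zeta>) \<partial>mT)"
  proof (rule tendsto_upperbound)
    show "\<forall>\<^sub>F \<epsilon> in at_right 0. (1 - \<epsilon>) * exp (- \<epsilon>) \<le> (\<integral>\<zeta>. cmod (\<beta> \<zeta>) \<partial>mT)"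
      unfolding eventually_at_right_field by (intro exI[of _ 1]) (use main in auto)
  qed simp
  hence ge: "1 \<le> (\<integral>\<zeta>. cmod (\<beta> \<zeta>) \<partial>mT)" by simp
  have int1: "integrable mT (\<lambda>\<zeta>. 1 - cmod (\<beta> \<zeta>))" using int_beta by simp
  have nn: "AE \<zeta> in mT. 0 \<le> 1 - cmod (\<beta> \<zeta>)" using \<beta>1 by simp
  have "(\<integral>\<zeta>. 1 - cmod (\<beta> \<zeta>) \<partial>mT) \<le> 0"
    using ge int_beta by (simp add: measure_mT_UNIV space_mT)
  moreover have "0 \<le> (\<integral>\<zeta>. 1 - cmod (\<beta> \<zeta>) \<partial>mT)" using nn by (rule integral_nonneg_AE)
  ultimately have "(\<integral>\<zeta>. 1 - cmod (\<beta> \<zeta>) \<partial>mT) = 0" by linarith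
  hence "AE \<zeta> in mT. 1 - cmod (\<beta> \<zeta>) = 0" using integral_nonneg_eq_0_iff_AE[OF int1 nn] by blast
  thus ?thesis by eventually_elim simp
qed

end

text \<open>With trivial zeros any finite measure on the circle satisfies the locale, which makes
  the facts about Herglotz integrals available for it.\<close>

lemma canonical_factorization_trivial_zeros:
  assumes "finite_measure \<mu>" "sets \<mu> = sets borel" "AE \<zeta> in \<mu>. cmod \<zeta> = 1"
  shows "canonical_factorization (\<lambda>_. 1) \<mu> (\<lambda>z. blaschke (\<lambda>_. 1) z * exp (- herglotz \<mu> z)) 1"
  by (rule canonical_factorization.intro) (use assms in simp_all)

lemma bdry_interior:
  assumes "b holomorphic_on ball 0 1" "cmod \<zeta> < 1"
  shows "bdry b \<zeta> = b \<zeta>"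
proof -
  have cont: "isCont b (of_real 1 * \<zeta>)"
    using holomorphic_on_imp_continuous_on[OF assms(1)] assms(2) by (simp add: continuous_on_eq_continuous_at)
  have "((\<lambda>r. b (of_real r * \<zeta>)) \<longlongrightarrow> b (of_real 1 * \<zeta>)) (at_left (1::real))"
    by (rule isCont_tendsto_compose[OF cont]) (intro tendsto_intros)
  thus ?thesis unfolding bdry_def by (intro tendsto_Lim trivial_limit_at_left_real) simp
qed

text \<open>\<^const>\<open>bdry\<close> takes an unspecified value wherever the radial limit does not exist, so its modulus
  need not be measurable and \<^const>\<open>outer_abs\<close> can be the junk value 1.\<close>

lemma outer_abs_not_measurable:
  assumes b: "b holomorphic_on ball 0 1" and z: "z \<in> ball 0 1"
    and nm: "(\<lambda>\<zeta>. ln (cmod (bdry b \<zeta>))) \<notin> borel_measurable borel"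
  shows "outer_abs b z = 1"
proof -
  let ?k = "\<lambda>\<zeta>. Re ((\<zeta> + z) / (\<zeta> - z))"
  have "(\<lambda>\<zeta>. ?k \<zeta> * ln (cmod (bdry b \<zeta>))) \<notin> borel_measurable borel"
  proof
    assume [measurable]: "(\<lambda>\<zeta>. ?k \<zeta> * ln (cmod (bdry b \<zeta>))) \<in> borel_measurable borel"
    have [measurable]: "(\<lambda>\<zeta>. indicator (ball 0 1) \<zeta> *\<^sub>R b \<zeta>) \<in> borel_measurable borel"
      by (rule borel_measurable_continuous_on_indicator[OF _ holomorphic_on_imp_continuous_on[OF b]]) simp
    \<comment> \<open>Dividing by the Poisson kernel recovers the logarithm except where the kernel
      vanishes. That happens only for \<open>|\<zeta>| = |z| < 1\<close>, where
      \<open>bdry b\<close> is b itself and measurable.\<close>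
    have "ln (cmod (bdry b \<zeta>)) = (if ?k \<zeta> = 0 then ln (cmod (indicator (ball 0 1) \<zeta> *\<^sub>R b \<zeta>))
        else ?k \<zeta> * ln (cmod (bdry b \<zeta>)) / ?k \<zeta>)" for \<zeta>
    proof (cases "?k \<zeta> = 0")
      case True
      hence "(cmod \<zeta>)\<^sup>2 = (cmod z)\<^sup>2 \<or> \<zeta> = z" unfolding Re_herglotz_kernel by simp
      hence "cmod \<zeta> = cmod z" by auto
      hence "cmod \<zeta> < 1" using z by simp
      thus ?thesis using True bdry_interior[OF b, of \<zeta>] by simp
    qed simp
    hence "(\<lambda>\<zeta>. ln (cmod (bdry b \<zeta>))) = (\<lambda>\<zeta>. if ?k \<zeta> = 0 then ln (cmod (indicator (ball 0 1) \<zeta> *\<^sub>R b \<zeta>))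
        else ?k \<zeta> * ln (cmod (bdry b \<zeta>)) / ?k \<zeta>)" by (rule ext)
    also have "\<dots> \<in> borel_measurable borel" by measurable
    finally show False using nm by contradiction
  qed
  hence "\<not> integrable mT (\<lambda>\<zeta>. ?k \<zeta> * ln (cmod (bdry b \<zeta>)))"
    using borel_measurable_integrable measurable_cong_sets[OF sets_mT refl] by blast
  hence "(\<integral>\<zeta>. ?k \<zeta> * ln (cmod (bdry b \<zeta>)) \<partial>mT) = 0" by (rule not_integrable_integral_eq)
  thus ?thesis by (simp only: outer_abs_def exp_zero)
qed

text \<open>Finiteness of \<open>Qsum\<close> at a single point thereby yields the Blaschke
  condition and the integrability of the logarithm of the boundary modulus.\<close>

lemma inverse_power_kernel_ge:
  assumes "cmod \<zeta> \<le> 1" "cmod z < 1"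
  shows "1 / 2 ^ n \<le> 1 / cmod (1 - cnj \<zeta> * z) ^ n"
proof -
  have "cmod (cnj \<zeta> * z) < 1" using assms by (simp add: norm_mult) (meson le_less_trans mult_left_le_one_le norm_ge_zero)
  hence "cnj \<zeta> * z \<noteq> 1" by auto
  hence "0 < cmod (1 - cnj \<zeta> * z)" by simp
  moreover have "cmod (1 - cnj \<zeta> * z) \<le> 2"
    using norm_triangle_ineq4[of 1 "cnj \<zeta> * z"] \<open>cmod (cnj \<zeta> * z) < 1\<close> by simp
  ultimately show ?thesis by (intro divide_left_mono power_mono) auto
qed

section \<open>From moduli to the canonical factorization\<close>

theorem canonical_factorization_exists:
  assumes b: "b holomorphic_on ball 0 1" and maps: "b ` ball 0 1 \<subseteq> ball 0 1"
    and z0: "z0 \<in> ball 0 1" "b z0 \<noteq> 0" and sf: "has_singular_factor b \<nu>"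
    and z1: "z1 \<in> ball 0 1" and Q: "Qsum b \<nu> m UNIV UNIV z1 < \<infinity>"
  obtains a \<mu> \<gamma> where "canonical_factorization a \<mu> b \<gamma>"
    "\<And>F. (\<Sum>n. ennreal (1 - (cmod (a n))\<^sup>2) * F (a n))
        = (\<integral>\<^sup>+w. ennreal (real (nat (zorder b w)) * (1 - (cmod w)\<^sup>2)) * F w \<partial>count_space (zeros_of b))"
    "\<And>F. F \<in> borel_measurable borel \<Longrightarrow> (\<integral>\<^sup>+\<zeta>. F \<zeta> \<partial>\<mu>) =
        (\<integral>\<^sup>+\<zeta>. F \<zeta> \<partial>\<nu>) + (\<integral>\<^sup>+\<zeta>. ennreal (- ln (cmod (bdry b \<zeta>))) * F \<zeta> \<partial>mT)"
proof -
  note [measurable_cong] = sets_mT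
  interpret schur_function b
    by standard (use b maps in \<open>auto simp: image_subset_iff less_imp_le\<close>)
  obtain \<beta> where \<beta> [measurable]: "\<beta> \<in> borel_measurable borel" and \<beta>1: "\<And>\<zeta>. cmod (\<beta> \<zeta>) \<le> 1"
    and lim: "AE \<zeta> in mT. cmod \<zeta> = 1 \<longrightarrow> ((\<lambda>r. b (of_real r * \<zeta>)) \<longlongrightarrow> \<beta> \<zeta>) (at_left (1::real))"
    using fatou by blast
  define g where "g \<zeta> = ln (cmod (\<beta> \<zeta>))" for \<zeta>
  have g [measurable]: "g \<in> borel_measurable borel" unfolding g_def[abs_def] by measurable
  \<comment> \<open>Where \<beta> vanishes, \<open>ln 0 = 0\<close> gives the bound as well.\<close>
  have g_le: "g \<zeta> \<le> 0" for \<zeta> using \<beta>1[of \<zeta>] by (cases "\<beta> \<zeta> = 0") (simp_all add: g_def)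
  have bd: "AE \<zeta> in mT. ln (cmod (bdry b \<zeta>)) = g \<zeta>"
    using lim AE_mT_circle
  proof eventually_elim
    case (elim \<zeta>)
    have "bdry b \<zeta> = \<beta> \<zeta>" unfolding bdry_def by (rule tendsto_Lim) (use elim in simp_all)
    thus ?case by (simp add: g_def)
  qed
  have \<nu>: "sets \<nu> = sets borel" "finite_measure \<nu>" "emeasure \<nu> (UNIV - sphere 0 1) = 0"
    using sf unfolding has_singular_factor_def singular_measure_on_T_def by auto
  obtain A where A: "A \<in> sets borel" "emeasure mT A = 0" "emeasure \<nu> (UNIV - A) = 0"
    using sf unfolding has_singular_factor_def singular_measure_on_T_def by auto
  have mod_b: "cmod (b z) = blaschke_abs b z * cmod (sing_inner \<nu> z) * outer_abs b z" if "z \<in> ball 0 1" "b z \<noteq> 0" for z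
    using sf that unfolding has_singular_factor_def by blast
  have sp\<nu>: "space \<nu> = UNIV" using sets_eq_imp_space_eq[OF \<nu>(1)] by simp
  have \<nu>_circle: "AE \<zeta> in \<nu>. cmod \<zeta> = 1"
    by (rule AE_I[where N = "UNIV - sphere 0 1"]) (use \<nu> in \<open>auto simp: \<nu>(1)\<close>)
  define W where "W \<zeta> = 1 / cmod (1 - cnj \<zeta> * z1) ^ (2*m+2)" for \<zeta>
  define c where "c = 1 / (2::real) ^ (2*m+2)"
  have c: "c > 0" by (simp add: c_def)
  have W_ge: "c \<le> W \<zeta>" if "cmod \<zeta> \<le> 1" for \<zeta>
    unfolding c_def W_def by (rule inverse_power_kernel_ge[OF that]) (use z1 in simp)
  have W0: "0 \<le> W \<zeta>" for \<zeta> by (simp add: W_def)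
  have Qparts: "(\<integral>\<^sup>+w. ennreal (real (nat (zorder b w)) * (1 - (cmod w)\<^sup>2)) * ennreal (W w) \<partial>count_space (zeros_of b)) < \<infinity>"
    "(\<integral>\<^sup>+\<zeta>. ennreal (- ln (cmod (bdry b \<zeta>))) * ennreal (W \<zeta>) \<partial>mT) < \<infinity>"
    using Q unfolding Qsum_def
    by (simp_all add: W_def flip: ennreal_mult'')
  have fin_g: "(\<integral>\<^sup>+\<zeta>. ennreal (- g \<zeta>) \<partial>mT) < \<infinity>"
  proof -
    have "(\<integral>\<^sup>+\<zeta>. ennreal (- g \<zeta>) \<partial>mT) * ennreal c = (\<integral>\<^sup>+\<zeta>. ennreal (- g \<zeta>) * ennreal c \<partial>mT)"
      by (rule nn_integral_multc[symmetric]) measurable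
    \<comment> \<open>Almost everywhere monotonicity of the nonnegative integral holds even though
      the integrand with \<open>bdry\<close> may fail to be measurable.\<close>
    also have "\<dots> \<le> (\<integral>\<^sup>+\<zeta>. ennreal (- ln (cmod (bdry b \<zeta>))) * ennreal (W \<zeta>) \<partial>mT)"
      by (rule nn_integral_mono_AE)
         (use bd AE_mT_circle in eventually_elim, auto intro!: mult_left_mono ennreal_leI W_ge)
    also have "\<dots> < \<infinity>" by (rule Qparts)
    finally show ?thesis using c by (auto simp: ennreal_mult_less_top)
  qed
  have int_g: "integrable mT g"
  proof -
    have "integrable mT (\<lambda>\<zeta>. - g \<zeta>)" by (rule integrableI_nonneg) (use g_le fin_g in auto)
    thus ?thesis by simp
  qed
  obtain a where a1: "\<And>n. cmod (a n) \<le> 1"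
    and a_sum: "\<And>F. (\<Sum>n. ennreal (1 - (cmod (a n))\<^sup>2) * F (a n))
        = (\<integral>\<^sup>+w. ennreal (real (nat (zorder b w)) * (1 - (cmod w)\<^sup>2)) * F w \<partial>count_space (zeros_of b))"
    and a_abs: "\<And>z. summable (\<lambda>n. 1 - cmod (a n)) \<Longrightarrow> z \<in> ball 0 1 \<Longrightarrow> b z \<noteq> 0 \<Longrightarrow> blaschke_abs b z = cmod (blaschke a z)"
    using zero_enumeration[OF b z0] by blast
  have sm: "summable (\<lambda>n. 1 - cmod (a n))"
  proof -
    have pos: "0 \<le> 1 - (cmod (a n))\<^sup>2" for n using a1[of n] by (simp add: power_le_one)
    have "(\<Sum>n. ennreal ((1 - (cmod (a n))\<^sup>2) * c)) \<le> (\<Sum>n. ennreal (1 - (cmod (a n))\<^sup>2) * ennreal (W (a n)))"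
      using c by (intro suminf_le allI summableI)
         (simp only: ennreal_mult'' less_imp_le, intro mult_left_mono ennreal_leI W_ge a1, simp)
    also have "\<dots> < \<infinity>" unfolding a_sum[of "\<lambda>w. ennreal (W w)"] by (rule Qparts)
    finally have "summable (\<lambda>n. (1 - (cmod (a n))\<^sup>2) * c)"
      using pos c by (intro summable_suminf_not_top) auto
    hence "summable (\<lambda>n. (1 - (cmod (a n))\<^sup>2) * c * (1 / c))" by (rule summable_mult2)
    moreover have "(1 - (cmod (a n))\<^sup>2) * c * (1 / c) = 1 - (cmod (a n))\<^sup>2" for n using c by simp
    ultimately have sq: "summable (\<lambda>n. 1 - (cmod (a n))\<^sup>2)" by (simp only:)
    have "norm (1 - cmod (a n)) \<le> 1 - (cmod (a n))\<^sup>2" for n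
      using a1[of n] mult_left_le[of "cmod (a n)" "cmod (a n)"] by (simp add: power2_eq_square)
    thus ?thesis by (intro summable_comparison_test'[OF sq, of 0])
  qed
  define N where "N = density mT (\<lambda>\<zeta>. ennreal (- g \<zeta>))"
  have sN [measurable_cong]: "sets N = sets borel" by (simp add: N_def sets_mT)
  have spN: "space N = UNIV" using sets_eq_imp_space_eq[OF sN] by simp
  have N_circle: "AE \<zeta> in N. cmod \<zeta> = 1" unfolding N_def
    by (subst AE_density, measurable) (use AE_mT_circle in eventually_elim, simp)
  have finN: "finite_measure N"
    by (rule finite_measureI) (use fin_g in \<open>simp add: N_def emeasure_density space_mT\<close>)
  have NA: "emeasure N A = 0"
    unfolding N_def by (subst emeasure_density) (use A nn_integral_null_set[of A mT] in \<open>auto simp: sets_mT null_sets_def\<close>)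
  interpret cN: canonical_factorization "\<lambda>_. 1" N "\<lambda>z. blaschke (\<lambda>_. 1) z * exp (- herglotz N z)" 1
    by (rule canonical_factorization_trivial_zeros[OF finN sN N_circle])
  interpret c\<nu>: canonical_factorization "\<lambda>_. 1" \<nu> "\<lambda>z. blaschke (\<lambda>_. 1) z * exp (- herglotz \<nu> z)" 1
    by (rule canonical_factorization_trivial_zeros[OF \<nu>(2,1) \<nu>_circle])
  have sing: "cmod (sing_inner \<nu> z) = cmod (exp (- herglotz \<nu> z))" for z
    by (simp only: sing_inner_def herglotz_def)
  have outer: "outer_abs b z = exp (\<integral>\<zeta>. Re ((\<zeta> + z) / (\<zeta> - z)) * g \<zeta> \<partial>mT)" if z: "z \<in> ball 0 1" for z
  proof (cases "(\<lambda>\<zeta>. ln (cmod (bdry b \<zeta>))) \<in> borel_measurable borel")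
    case True
    hence M: "(\<lambda>\<zeta>. ln (cmod (bdry b \<zeta>))) \<in> borel_measurable mT" by (simp add: measurable_cong_sets[OF sets_mT refl])
    show ?thesis unfolding outer_abs_def
    proof (rule arg_cong[where f = exp], rule integral_cong_AE)
      show "(\<lambda>\<zeta>. Re ((\<zeta> + z) / (\<zeta> - z)) * ln (cmod (bdry b \<zeta>))) \<in> borel_measurable mT"
        by (rule borel_measurable_times[OF _ M]) measurable
      show "(\<lambda>\<zeta>. Re ((\<zeta> + z) / (\<zeta> - z)) * g \<zeta>) \<in> borel_measurable mT" by measurable
      show "AE \<zeta> in mT. Re ((\<zeta> + z) / (\<zeta> - z)) * ln (cmod (bdry b \<zeta>)) = Re ((\<zeta> + z) / (\<zeta> - z)) * g \<zeta>"
        using bd by eventually_elim (simp only:)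
    qed
  next
    \<comment> \<open>Here the junk value makes the outer factor 1, so b equals a Blaschke product
      times a singular inner function up to a constant. Such a function has unimodular boundary
      values, hence g vanishes almost everywhere and the formula with g also gives 1.\<close>
    case False
    have eq: "cmod (b w) = cmod (blaschke a w * exp (- herglotz \<nu> w))" if "w \<in> ball 0 1" "b w \<noteq> 0" for w
      using mod_b[OF that] a_abs[OF sm that] outer_abs_not_measurable[OF b that(1) False] by (simp only: sing norm_mult mult_1_right)
    have hol: "(\<lambda>w. blaschke a w * exp (- herglotz \<nu> w)) holomorphic_on ball 0 1"
      by (intro holomorphic_intros blaschke_holomorphic a1 sm c\<nu>.herglotz_holomorphic)
    obtain \<gamma> where \<gamma>: "cmod \<gamma> = 1" "\<And>w. w \<in> ball 0 1 \<Longrightarrow> b w = \<gamma> * (blaschke a w * exp (- herglotz \<nu> w))"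
      by (rule holomorphic_eq_unimodular_mult[OF b hol z0 eq]) (assumption, assumption, (rule that; assumption))
    interpret cb: canonical_factorization a \<nu> b \<gamma>
      by (rule canonical_factorization.intro) (use a1 sm \<nu> \<nu>_circle \<gamma> in \<open>simp_all add: mult.assoc\<close>)
    have "AE \<zeta> in mT. cmod (\<beta> \<zeta>) = 1"
      by (rule cb.singular_boundary_modulus[OF A \<beta> \<beta>1 lim])
    hence "AE \<zeta> in mT. Re ((\<zeta> + z) / (\<zeta> - z)) * g \<zeta> = 0" by eventually_elim (simp add: g_def)
    hence "(\<integral>\<zeta>. Re ((\<zeta> + z) / (\<zeta> - z)) * g \<zeta> \<partial>mT) = 0" by (rule integral_eq_zero_AE)
    thus ?thesis using outer_abs_not_measurable[OF b z False] by simp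
  qed
  \<comment> \<open>The set A witnesses mutual singularity: \<nu> lives on it, and N, having a
    density with respect to \<open>mT\<close>, gives it mass 0.\<close>
  define \<mu> where "\<mu> = sum_measure \<nu> N"
  have sing_parts: "sets N = sets \<nu>" "A \<in> sets \<nu>" "emeasure \<nu> (space \<nu> - A) = 0" "emeasure N A = 0"
    using sN \<nu>(1) A NA sp\<nu> by simp_all
  have s\<mu>: "sets \<mu> = sets borel" and sp\<mu>: "space \<mu> = UNIV" using \<nu>(1) sp\<nu> by (simp_all add: \<mu>_def)
  have em: "emeasure \<mu> X = emeasure \<nu> X + emeasure N X" if "X \<in> sets borel" for X
    unfolding \<mu>_def by (rule emeasure_sum_measure) (use that sN \<nu>(1) in simp_all)
  have fin\<mu>: "finite_measure \<mu>"
    by (rule finite_measureI) (simp add: sp\<mu> em c\<nu>.mu.emeasure_finite cN.mu.emeasure_finite)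
  have \<mu>_circle: "AE \<zeta> in \<mu>. cmod \<zeta> = 1"
  proof (rule AE_I[where N = "UNIV - sphere 0 1"])
    have "{\<zeta>. cmod \<zeta> \<noteq> 1} = UNIV - sphere (0::complex) 1" by (auto simp: set_eq_iff)
    hence "emeasure N (UNIV - sphere 0 1) = 0"
      using AE_iff_measurable[of "UNIV - sphere 0 1" N "\<lambda>\<zeta>. cmod \<zeta> = 1"] N_circle sN spN by auto
    thus "emeasure \<mu> (UNIV - sphere 0 1) = 0" using \<nu>(3) by (subst em) auto
  qed (auto simp: s\<mu>)
  interpret c\<mu>: canonical_factorization "\<lambda>_. 1" \<mu> "\<lambda>z. blaschke (\<lambda>_. 1) z * exp (- herglotz \<mu> z)" 1
    by (rule canonical_factorization_trivial_zeros[OF fin\<mu> s\<mu> \<mu>_circle])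
  have exp_\<mu>: "cmod (exp (- herglotz \<mu> z)) = cmod (sing_inner \<nu> z) * outer_abs b z" if z: "z \<in> ball 0 1" for z
  proof -
    let ?k = "\<lambda>\<zeta>. (\<zeta> + z) / (\<zeta> - z)"
    have intN: "integrable N ?k" by (rule cN.herglotz_kernel_integrable[OF z])
    have "herglotz \<mu> z = herglotz \<nu> z + herglotz N z" unfolding herglotz_def \<mu>_def
      by (rule integral_sum_measure[OF sing_parts c\<nu>.herglotz_kernel_integrable[OF z] intN])
    hence "Re (herglotz \<mu> z) = Re (herglotz \<nu> z) + Re (herglotz N z)" by simp
    also have "Re (herglotz N z) = (\<integral>\<zeta>. Re (?k \<zeta>) \<partial>N)" unfolding herglotz_def by (rule integral_Re[OF intN, symmetric])
    also have "\<dots> = (\<integral>\<zeta>. (- g \<zeta>) *\<^sub>R Re (?k \<zeta>) \<partial>mT)" unfolding N_def by (rule integral_density) (use g_le in auto)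
    also have "\<dots> = (\<integral>\<zeta>. - (Re (?k \<zeta>) * g \<zeta>) \<partial>mT)" by (simp only: real_scaleR_def mult_minus_left mult.commute)
    also have "\<dots> = - (\<integral>\<zeta>. Re (?k \<zeta>) * g \<zeta> \<partial>mT)" by (rule Bochner_Integration.integral_minus)
    finally have "- Re (herglotz \<mu> z) = - Re (herglotz \<nu> z) + (\<integral>\<zeta>. Re (?k \<zeta>) * g \<zeta> \<partial>mT)" by simp
    hence "exp (- Re (herglotz \<mu> z)) = exp (- Re (herglotz \<nu> z)) * outer_abs b z"
      by (simp only: outer[OF z] exp_add)
    thus ?thesis by (simp add: sing)
  qed
  have eq: "cmod (b w) = cmod (blaschke a w * exp (- herglotz \<mu> w))" if "w \<in> ball 0 1" "b w \<noteq> 0" for w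
    using mod_b[OF that] a_abs[OF sm that] exp_\<mu>[OF that(1)] by (simp only: norm_mult mult.assoc)
  have hol: "(\<lambda>w. blaschke a w * exp (- herglotz \<mu> w)) holomorphic_on ball 0 1"
    by (intro holomorphic_intros blaschke_holomorphic a1 sm c\<mu>.herglotz_holomorphic)
  obtain \<gamma> where \<gamma>: "cmod \<gamma> = 1" "\<And>w. w \<in> ball 0 1 \<Longrightarrow> b w = \<gamma> * (blaschke a w * exp (- herglotz \<mu> w))"
    by (rule holomorphic_eq_unimodular_mult[OF b hol z0 eq]) (assumption, assumption, (rule that; assumption))
  have cf: "canonical_factorization a \<mu> b \<gamma>"
    by (rule canonical_factorization.intro) (use a1 sm fin\<mu> s\<mu> \<mu>_circle \<gamma> in \<open>simp_all add: mult.assoc\<close>)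
  show ?thesis
  proof (rule that[OF cf a_sum])
    fix F :: "complex \<Rightarrow> ennreal" assume F [measurable]: "F \<in> borel_measurable borel"
    have "(\<integral>\<^sup>+\<zeta>. F \<zeta> \<partial>\<mu>) = (\<integral>\<^sup>+\<zeta>. F \<zeta> \<partial>\<nu>) + (\<integral>\<^sup>+\<zeta>. F \<zeta> \<partial>N)" unfolding \<mu>_def
      by (rule nn_integral_sum_measure[OF sing_parts]) (simp add: measurable_cong_sets[OF \<nu>(1) refl] F)
    also have "(\<integral>\<^sup>+\<zeta>. F \<zeta> \<partial>N) = (\<integral>\<^sup>+\<zeta>. ennreal (- g \<zeta>) * F \<zeta> \<partial>mT)" unfolding N_def
      by (rule nn_integral_density) simp_all
    also have "\<dots> = (\<integral>\<^sup>+\<zeta>. ennreal (- ln (cmod (bdry b \<zeta>))) * F \<zeta> \<partial>mT)"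
      by (rule nn_integral_cong_AE) (use bd in eventually_elim, simp)
    finally show "(\<integral>\<^sup>+\<zeta>. F \<zeta> \<partial>\<mu>) = (\<integral>\<^sup>+\<zeta>. F \<zeta> \<partial>\<nu>) + (\<integral>\<^sup>+\<zeta>. ennreal (- ln (cmod (bdry b \<zeta>))) * F \<zeta> \<partial>mT)" .
  qed
qed

text \<open>The model measure gives the zeros weight 1 and the circle weight 2, so its tail lies
  between \<open>Qsum\<close> and twice \<open>Qsum\<close>; for convergence to 0 the factor is
  harmless.\<close>

lemma (in canonical_factorization) Qsum_node_bounds:
  fixes F G V :: "complex set" and z :: complex and m :: nat
  defines "tail \<equiv> (\<integral>\<^sup>+x. indicator V (node x) * ennreal (1 / cmod (1 - cnj (node x) * z) ^ (2*m+2)) \<partial>model_measure)"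
  assumes \<nu>: "AE \<zeta> in \<nu>. cmod \<zeta> = 1"
    and zeros: "\<And>F. (\<Sum>n. ennreal (1 - (cmod (a n))\<^sup>2) * F (a n))
        = (\<integral>\<^sup>+w. ennreal (real (nat (zorder b w)) * (1 - (cmod w)\<^sup>2)) * F w \<partial>count_space (zeros_of b))"
    and circle: "\<And>F. F \<in> borel_measurable borel \<Longrightarrow> (\<integral>\<^sup>+\<zeta>. F \<zeta> \<partial>\<mu>) =
        (\<integral>\<^sup>+\<zeta>. F \<zeta> \<partial>\<nu>) + (\<integral>\<^sup>+\<zeta>. ennreal (- ln (cmod (bdry b \<zeta>))) * F \<zeta> \<partial>mT)"
    and V: "V \<in> sets borel" "\<And>w. cmod w < 1 \<Longrightarrow> w \<in> V \<longleftrightarrow> w \<in> F" "\<And>\<zeta>. cmod \<zeta> = 1 \<Longrightarrow> \<zeta> \<in> V \<longleftrightarrow> \<zeta> \<in> G"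
  shows "Qsum b \<nu> m F G z \<le> tail" "tail \<le> 2 * Qsum b \<nu> m F G z"
proof -
  define D where "D \<zeta> = ennreal (1 / cmod (1 - cnj \<zeta> * z) ^ (2*m+2))" for \<zeta>
  have [measurable]: "(\<lambda>\<zeta>. cmod (1 - cnj \<zeta> * z)) \<in> borel_measurable borel"
    by (intro borel_measurable_continuous_onI continuous_intros)
  have [measurable]: "D \<in> borel_measurable borel" unfolding D_def[abs_def] by measurable
  define Z where "Z = (\<integral>\<^sup>+w. ennreal (real (nat (zorder b w)) * (1 - (cmod w)\<^sup>2)) * (indicator V w * D w) \<partial>count_space (zeros_of b))"
  define N where "N = (\<integral>\<^sup>+\<zeta>. indicator V \<zeta> * D \<zeta> \<partial>\<nu>) + (\<integral>\<^sup>+\<zeta>. ennreal (- ln (cmod (bdry b \<zeta>))) * (indicator V \<zeta> * D \<zeta>) \<partial>mT)"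
  have [measurable]: "(\<lambda>\<zeta>. indicator V \<zeta> * D \<zeta>) \<in> borel_measurable borel" using V(1) by measurable
  have "tail = (\<Sum>n. ennreal (1 - (cmod (a n))\<^sup>2) * (indicator V (a n) * D (a n))) + 2 * (\<integral>\<^sup>+\<zeta>. indicator V \<zeta> * D \<zeta> \<partial>\<mu>)"
    unfolding tail_def D_def[symmetric] by (rule nn_integral_node) measurable
  also have "\<dots> = Z + 2 * N" unfolding Z_def N_def
    by (subst circle, measurable) (simp only: zeros[of "\<lambda>w. indicator V w * D w"])
  finally have tail: "tail = Z + 2 * N" .
  have scale: "ennreal (x / cmod (1 - cnj \<zeta> * z) ^ (2*m+2)) = ennreal x * D \<zeta>" for x \<zeta>
    unfolding D_def by (subst ennreal_mult''[symmetric]) simp_all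
  have "Z = (\<integral>\<^sup>+w. ennreal (real (nat (zorder b w)) * (1 - (cmod w)\<^sup>2) / cmod (1 - cnj w * z) ^ (2*m+2)) * indicator F w
      \<partial>count_space (zeros_of b))" unfolding Z_def
  proof (rule nn_integral_cong)
    fix w assume "w \<in> space (count_space (zeros_of b))"
    hence "indicator V w = (indicator F w :: ennreal)" using V(2)[of w] by (simp add: zeros_of_def indicator_def)
    thus "ennreal (real (nat (zorder b w)) * (1 - (cmod w)\<^sup>2)) * (indicator V w * D w)
      = ennreal (real (nat (zorder b w)) * (1 - (cmod w)\<^sup>2) / cmod (1 - cnj w * z) ^ (2*m+2)) * indicator F w"
      by (simp only: scale mult.assoc) (simp only: mult.commute)
  qed
  also have "\<dots> = (\<integral>\<^sup>+w. ennreal (real (nat (zorder b w)) * (1 - (cmod w)\<^sup>2) / cmod (1 - cnj w * z) ^ (2*m+2)) * indicator F w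
      * indicator (zeros_of b) w \<partial>count_space UNIV)"
    by (rule nn_integral_count_space_indicator) simp
  also have "\<dots> = (\<integral>\<^sup>+w. ennreal (real (nat (zorder b w)) * (1 - (cmod w)\<^sup>2) / cmod (1 - cnj w * z) ^ (2*m+2))
      * indicator (zeros_of b \<inter> F) w \<partial>count_space UNIV)"
    by (rule nn_integral_cong) (simp only: indicator_inter_arith mult_ac)
  also have "\<dots> = (\<integral>\<^sup>+w. ennreal (real (nat (zorder b w)) * (1 - (cmod w)\<^sup>2) / cmod (1 - cnj w * z) ^ (2*m+2))
      \<partial>count_space (zeros_of b \<inter> F))"
    by (rule nn_integral_count_space_indicator[symmetric]) simp
  finally have Z: "Z = \<dots>" .
  have ind: "indicator V \<zeta> = (indicator G \<zeta> :: ennreal)" if "cmod \<zeta> = 1" for \<zeta>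
    using V(3)[OF that] by (simp add: indicator_def)
  have N1: "(\<integral>\<^sup>+\<zeta>. indicator V \<zeta> * D \<zeta> \<partial>\<nu>) = (\<integral>\<^sup>+\<zeta>. indicator G \<zeta> * D \<zeta> \<partial>\<nu>)"
    by (rule nn_integral_cong_AE) (use \<nu> in eventually_elim, simp only: ind)
  have N2: "(\<integral>\<^sup>+\<zeta>. ennreal (- ln (cmod (bdry b \<zeta>))) * (indicator V \<zeta> * D \<zeta>) \<partial>mT)
    = (\<integral>\<^sup>+\<zeta>. indicator G \<zeta> * ennreal (- ln (cmod (bdry b \<zeta>)) / cmod (1 - cnj \<zeta> * z) ^ (2*m+2)) \<partial>mT)"
    by (rule nn_integral_cong_AE) (use AE_mT_circle in eventually_elim, simp only: ind scale, rule mult.left_commute)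
  have Q: "Qsum b \<nu> m F G z = Z + N"
    unfolding Qsum_def Z N_def N1 N2 by (simp only: D_def add.assoc)
  have two: "2 * x = x + x" for x :: ennreal by (rule mult_2)
  show "Qsum b \<nu> m F G z \<le> tail" unfolding Q tail two by (intro add_left_mono add_increasing) simp_all
  show "tail \<le> 2 * Qsum b \<nu> m F G z" unfolding Q tail distrib_left by (intro add_right_mono) (simp add: two)
qed

theorem theoremB:
  fixes b :: "complex \<Rightarrow> complex" and \<nu> :: "complex measure"
    and \<Omega> :: "complex set" and m :: nat
  assumes "b holomorphic_on ball 0 1"
    and "b ` ball 0 1 \<subseteq> ball 0 1"
    and "\<exists>z \<in> ball 0 1. b z \<noteq> 0"
    and "has_singular_factor b \<nu>"
    and "approach_region \<Omega>"
    and "(SUP z\<in>\<Omega>. Qsum b \<nu> m UNIV UNIV z) < \<infinity>"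
  shows "((\<lambda>z. Hb_norm b (\<lambda>w. dkb b m z w - dkb1 b m \<Omega> w)) \<longlongrightarrow> 0) (at 1 within \<Omega>)
     \<longleftrightarrow> ((\<lambda>z. Qsum b \<nu> m (Sset z) (Eset z) z) \<longlongrightarrow> 0) (at 1 within \<Omega>)"
proof -
  have \<Omega>: "\<Omega> \<subseteq> ball 0 1" using assms(5) unfolding approach_region_def by blast
  \<comment> \<open>A point of the region is required to extract finiteness of \<open>Qsum\<close>
    at one place, from which the factorization is built.\<close>
  have "\<Omega> \<noteq> {}"
  proof
    assume "\<Omega> = {}"
    hence "frontier \<Omega> = {}" by simp
    thus False using assms(5) unfolding approach_region_def by auto
  qed
  then obtain z1 where z1: "z1 \<in> \<Omega>" by blast
  define C where "C = (SUP z\<in>\<Omega>. Qsum b \<nu> m UNIV UNIV z)"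
  have QC: "Qsum b \<nu> m UNIV UNIV z \<le> C" if "z \<in> \<Omega>" for z unfolding C_def by (rule SUP_upper[OF that])
  have C: "C < \<infinity>" using assms(6) by (simp only: C_def)
  obtain z0 where z0: "z0 \<in> ball 0 1" "b z0 \<noteq> 0" using assms(3) by blast
  obtain a \<mu> \<gamma> where cf: "canonical_factorization a \<mu> b \<gamma>"
    and zeros: "\<And>F. (\<Sum>n. ennreal (1 - (cmod (a n))\<^sup>2) * F (a n))
        = (\<integral>\<^sup>+w. ennreal (real (nat (zorder b w)) * (1 - (cmod w)\<^sup>2)) * F w \<partial>count_space (zeros_of b))"
    and circle: "\<And>F. F \<in> borel_measurable borel \<Longrightarrow> (\<integral>\<^sup>+\<zeta>. F \<zeta> \<partial>\<mu>) =
        (\<integral>\<^sup>+\<zeta>. F \<zeta> \<partial>\<nu>) + (\<integral>\<^sup>+\<zeta>. ennreal (- ln (cmod (bdry b \<zeta>))) * F \<zeta> \<partial>mT)"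
    by (rule canonical_factorization_exists[OF assms(1,2) z0 assms(4) subsetD[OF \<Omega> z1] le_less_trans[OF QC[OF z1] C]])
       (rule that; assumption)
  interpret canonical_factorization a \<mu> b \<gamma> by (rule cf)
  have \<nu>: "sets \<nu> = sets borel" "emeasure \<nu> (UNIV - sphere 0 1) = 0"
    using assms(4) unfolding has_singular_factor_def singular_measure_on_T_def by auto
  have \<nu>_circle: "AE \<zeta> in \<nu>. cmod \<zeta> = 1"
    by (rule AE_I[where N = "UNIV - sphere 0 1"]) (use \<nu> in auto)
  have all: "(\<integral>\<^sup>+x. ennreal (1 / cmod (1 - cnj (node x) * z) ^ (2*m+2)) \<partial>model_measure) \<le> ennreal (enn2real (2 * C))"
    if "z \<in> \<Omega>" for z
  proof -
    have "(\<integral>\<^sup>+x. ennreal (1 / cmod (1 - cnj (node x) * z) ^ (2*m+2)) \<partial>model_measure) \<le> 2 * Qsum b \<nu> m UNIV UNIV z"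
      using Qsum_node_bounds(2)[OF \<nu>_circle zeros circle, of UNIV UNIV UNIV z m] by simp
    also have "\<dots> \<le> 2 * C" by (intro mult_left_mono QC that) simp
    \<comment> \<open>The supremum is finite, so it can be turned into the real constant demanded by
      \<open>Hb_norm_tendsto_iff\<close>.\<close>
    also have "\<dots> = ennreal (enn2real (2 * C))" using C by (simp add: ennreal_mult_less_top)
    finally show ?thesis .
  qed
  define tail where "tail z = (\<integral>\<^sup>+x. indicator (sector z) (node x) * ennreal (1 / cmod (1 - cnj (node x) * z) ^ (2*m+2)) \<partial>model_measure)" for z
  have in_disc: "w \<in> sector z \<longleftrightarrow> w \<in> Sset z" if "cmod w < 1" for w z
    using that Eset_subset_sphere[of z] by (auto simp: sector_def)
  have on_circ: "\<zeta> \<in> sector z \<longleftrightarrow> \<zeta> \<in> Eset z" if "cmod \<zeta> = 1" for \<zeta> z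
    using sphere_notin_Sset[OF that] by (simp add: sector_def)
  have bounds: "Qsum b \<nu> m (Sset z) (Eset z) z \<le> tail z" "tail z \<le> 2 * Qsum b \<nu> m (Sset z) (Eset z) z" for z
    unfolding tail_def by (rule Qsum_node_bounds[OF \<nu>_circle zeros circle sector_borel in_disc on_circ]; assumption)+
  have "(tail \<longlongrightarrow> 0) (at 1 within \<Omega>) \<longleftrightarrow> ((\<lambda>z. Qsum b \<nu> m (Sset z) (Eset z) z) \<longlongrightarrow> 0) (at 1 within \<Omega>)"
  proof
    assume t: "(tail \<longlongrightarrow> 0) (at 1 within \<Omega>)"
    show "((\<lambda>z. Qsum b \<nu> m (Sset z) (Eset z) z) \<longlongrightarrow> 0) (at 1 within \<Omega>)"
      by (rule tendsto_sandwich[OF _ _ tendsto_const t]) (simp_all add: bounds(1))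
  next
    assume "((\<lambda>z. Qsum b \<nu> m (Sset z) (Eset z) z) \<longlongrightarrow> 0) (at 1 within \<Omega>)"
    hence "((\<lambda>z. 2 * Qsum b \<nu> m (Sset z) (Eset z) z) \<longlongrightarrow> 2 * 0) (at 1 within \<Omega>)"
      by (rule ennreal_tendsto_cmult[rotated]) simp
    hence t: "((\<lambda>z. 2 * Qsum b \<nu> m (Sset z) (Eset z) z) \<longlongrightarrow> 0) (at 1 within \<Omega>)" by simp
    show "(tail \<longlongrightarrow> 0) (at 1 within \<Omega>)"
      by (rule tendsto_sandwich[OF _ _ tendsto_const t]) (simp_all add: bounds(2))
  qed
  thus ?thesis
    using Hb_norm_tendsto_iff[OF assms(5) all enn2real_nonneg] unfolding tail_def[abs_def] by simp
qed

end
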